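(* Let $A_{\Theta_1}\xrightarrow{\varphi_1}A_{\Theta_2}\xrightarrow{\varphi_2}A_{\Theta_3}\to\cdots$ be a unital toric inductive system, where each $\Theta_n\in M_{m_n}(\mathbb R)$ is nondegenerate skew-symmetric and $\varphi_n=\varphi_{M_n,z_n}$ is a monomial toric homomorphism for some $M_n\in M_{m_{n+1}\times m_n}(\mathbb Z)$ and $z_n\in\mathbb T^{m_n}$. Let $(F_n,S_n,J_n)_{n\ge1}$ be a compatible Fourier-multiplier structure. For each $n$ put $A_n:=A_{\Theta_n}$, $H_n:=L^2(A_{\Theta_n},\tau_{\Theta_n})\otimes S_n$ and $D_n:=D_{F_n}$. Assume that, for every $n$, $\varphi_n(A_{\Theta_n}^\infty(D_n))\subseteq A_{\Theta_{n+1}}^\infty(D_{n+1})$. Let $I_n\colon H_n\to H_{n+1}$ be defined on elementary vectors by $I_n(\Lambda_n(a)\otimes\xi):=\Lambda_{n+1}(\varphi_n(a))\otimes J_n\xi$ for all $a\in A_n$ and $\xi\in S_n$. Then $\{(A_n,H_n,D_n),(\varphi_n,I_n)\}_{n\ge1}$ is an inductive system of spectral triples.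
   Context: $A_\Theta$ ($\Theta\in M_m(\mathbb R)$ skew-symmetric, $m\ge2$) is the universal unital $C^*$-algebra generated by unitaries $U_1,\dots,U_m$ with $U_kU_j=e^{2\pi i\Theta_{j,k}}U_jU_k$; $U^x:=U_1^{x_1}\cdots U_m^{x_m}$. $\Theta$ is nondegenerate if the only $x\in\mathbb Z^m$ with $\exp(2\pi i\langle x,\Theta y\rangle)=1$ for all $y\in\mathbb Z^m$ is $x=0$; then $A_\Theta$ is simple with unique tracial state $\tau_\Theta$. A monomial toric homomorphism $\varphi_{M,z}\colon A_\Theta\to A_\Psi$ ($M\in M_{n\times m}(\mathbb Z)$, $z\in\mathbb T^m$, $\Theta-M^t\Psi M\in M_m(\mathbb Z)$) is the unital $*$-homomorphism $U_j\mapsto z_jV_1^{M_{1j}}\cdots V_n^{M_{nj}}$. $L^2(A_\Theta,\tau_\Theta)\cong\ell^2(\mathbb Z^m)$ is the GNS space, $\delta_x$ the vector of $U^x$; $\Lambda_n$ denotes the GNS map $A_n\to L^2(A_n,\tau_{\Theta_n})$; $A_n$ acts on $H_n$ by left multiplication $\pi_n$. For $F\colon\mathbb Z^m\to\mathrm{End}(S)_{\mathrm{sa}}$ with $S$ a finite-dimensional Hilbert space, $D_F$ is the selfadjoint operator on $L^2(A_\Theta,\tau_\Theta)\otimes S$ with $D_F(\delta_x\otimes\xi)=\delta_x\otimes F(x)\xi$ and its maximal (diagonal) domain. A compatible Fourier-multiplier structure $(F_n,S_n,J_n)$ consists of finite-dimensional Hilbert spaces $S_n$, isometries $J_n\colon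 S_n\to S_{n+1}$, and functions $F_n\colon\mathbb Z^{m_n}\to\mathrm{End}(S_n)_{\mathrm{sa}}$ such that for each $n$: (a) for every $R>0$, $\bigoplus_{x:\ \mathrm{Spec}(F_n(x))\cap[-R,R]\ne\varnothing}S_n$ is finite-dimensional; (b) for every $a\in\mathbb Z^{m_n}$, $\sup_x\|F_n(x+a)-F_n(x)\|<\infty$; and (c) $F_{n+1}(M_nx)J_n=J_nF_n(x)$ for all $x\in\mathbb Z^{m_n}$. A spectral triple $(A,H,D)$ on a unital $C^*$-algebra $A$: a faithful unital representation $\pi\colon A\to\mathcal B(H)$ and a selfadjoint $D$ with compact resolvent such that $A^\infty(D):=\{a\in A:[D,\pi(a)]\text{ is densely defined and extends to a bounded operator}\}$ is dense in $A$. An isometric morphism $(A_1,H_1,D_1)\to(A_2,H_2,D_2)$ is a pair $(\phi,I)$ with $\phi\colon A_1\to A_2$ an injective unital $*$-homomorphism and $I\colon H_1\to H_2$ an isometry such that $\phi(A_1^\infty(D_1))\subseteq A_2^\infty(D_2)$, $I\pi_1(a)=\pi_2(\phi(a))I$ for $a\in A_1$, $I(\mathrm{Dom}(D_1))\subseteq\mathrm{Dom}(D_2)$ and $ID_1=D_2I$ on $\mathrm{Dom}(D_1)$. An inductive system of spectral triples is a sequence of spectral triples $(A_n,H_n,D_n)$ together with isometric morphisms $(\varphi_n,I_n)$ from the $n$th to the $(n+1)$st (in particular, each $I_n$ extends to an isometry on $H_n$). *)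

theory Defs
  imports
    "HOL-Analysis.Abstract_Metric_Spaces"
    "HOL-Analysis.Infinite_Sum"
    "HOL-Library.Nonpos_Ints"
    "HOL-Library.FuncSet"
    "HOL-Algebra.Ring"
    "HOL-Algebra.Module"
    "Jordan_Normal_Form.Matrix"
begin

section \<open>Complex vector spaces, Hilbert spaces, bounded operators\<close>

text \<open>The spaces and algebras of an inductive system vary with an index, so they are structures
  with explicit carriers. Maps between them are ordinary functions whose values outside the
  carrier are irrelevant.\<close>

definition complex_ring :: "complex ring" where
  "complex_ring = \<lparr>carrier = UNIV, mult = (*), one = 1, zero = 0, add = (+)\<rparr>"

definition lin_map ::
    "(complex, 'v, 'e) module_scheme \<Rightarrow> (complex, 'w, 'f) module_scheme \<Rightarrow> ('v \<Rightarrow> 'w) \<Rightarrow> bool" where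
  "lin_map V W f \<longleftrightarrow> f \<in> carrier V \<rightarrow> carrier W \<and>
     (\<forall>x\<in>carrier V. \<forall>y\<in>carrier V. f (x \<oplus>\<^bsub>V\<^esub> y) = f x \<oplus>\<^bsub>W\<^esub> f y) \<and>
     (\<forall>c. \<forall>x\<in>carrier V. f (c \<odot>\<^bsub>V\<^esub> x) = c \<odot>\<^bsub>W\<^esub> f x)"

definition lin_span :: "(complex, 'v, 'e) module_scheme \<Rightarrow> 'v set \<Rightarrow> 'v set" where
  "lin_span V X = \<Inter>{W. submodule W complex_ring V \<and> X \<subseteq> W}"

definition fin_dim :: "(complex, 'v, 'e) module_scheme \<Rightarrow> bool" where
  "fin_dim V \<longleftrightarrow> (\<exists>B\<subseteq>carrier V. finite B \<and> lin_span V B = carrier V)"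

text \<open>The algebraic direct sum of copies of \<open>S\<close> indexed by \<open>X\<close>. The fields \<open>mult\<close> and \<open>one\<close>,
  which the module record inherits from rings, carry no meaning for vector spaces.\<close>

definition direct_sum_copies ::
    "'x set \<Rightarrow> (complex, 's, 'e) module_scheme \<Rightarrow> (complex, 'x \<Rightarrow> 's) module" where
  "direct_sum_copies X S =
     \<lparr>carrier = {f \<in> X \<rightarrow>\<^sub>E carrier S. finite {x \<in> X. f x \<noteq> \<zero>\<^bsub>S\<^esub>}},
      mult = (\<lambda>_ _. undefined), one = undefined,
      zero = (\<lambda>x\<in>X. \<zero>\<^bsub>S\<^esub>),
      add = (\<lambda>f g. \<lambda>x\<in>X. f x \<oplus>\<^bsub>S\<^esub> g x),
      smult = (\<lambda>c f. \<lambda>x\<in>X. c \<odot>\<^bsub>S\<^esub> f x)\<rparr>"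

text \<open>The cut-off outside the carrier is needed because \<^locale>\<open>Metric_space\<close> demands symmetry and
  nonnegativity of the distance on the whole type.\<close>

definition norm_dist :: "(complex, 'v, 'e) module_scheme \<Rightarrow> ('v \<Rightarrow> real) \<Rightarrow> 'v \<Rightarrow> 'v \<Rightarrow> real" where
  "norm_dist V N x y = (if x \<in> carrier V \<and> y \<in> carrier V then N (x \<ominus>\<^bsub>V\<^esub> y) else 0)"

text \<open>Inner products are conjugate-linear in the first argument.\<close>

record 'v hilb = "(complex, 'v) module" +
  ip :: "'v \<Rightarrow> 'v \<Rightarrow> complex"

definition hnorm :: "('v, 'e) hilb_scheme \<Rightarrow> 'v \<Rightarrow> real" where
  "hnorm H v = sqrt (Re (ip H v v))"

definition hdist :: "('v, 'e) hilb_scheme \<Rightarrow> 'v \<Rightarrow> 'v \<Rightarrow> real" where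
  "hdist H = norm_dist H (hnorm H)"

definition hilbert_space :: "('v, 'e) hilb_scheme \<Rightarrow> bool" where
  "hilbert_space H \<longleftrightarrow> module complex_ring H \<and>
     (\<forall>u\<in>carrier H. \<forall>v\<in>carrier H. \<forall>w\<in>carrier H. ip H u (v \<oplus>\<^bsub>H\<^esub> w) = ip H u v + ip H u w) \<and>
     (\<forall>c. \<forall>u\<in>carrier H. \<forall>v\<in>carrier H. ip H u (c \<odot>\<^bsub>H\<^esub> v) = c * ip H u v) \<and>
     (\<forall>u\<in>carrier H. \<forall>v\<in>carrier H. ip H v u = cnj (ip H u v)) \<and>
     (\<forall>v\<in>carrier H. ip H v v \<in> \<real>\<^sub>\<ge>\<^sub>0) \<and>
     (\<forall>v\<in>carrier H. ip H v v = 0 \<longrightarrow> v = \<zero>\<^bsub>H\<^esub>) \<and>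
     Metric_space.mcomplete (carrier H) (hdist H)"

definition hdense :: "('v, 'e) hilb_scheme \<Rightarrow> 'v set \<Rightarrow> bool" where
  "hdense H X \<longleftrightarrow>
     Metric_space.mtopology (carrier H) (hdist H) closure_of X = carrier H"

definition bounded_op ::
    "('v, 'e) hilb_scheme \<Rightarrow> ('w, 'f) hilb_scheme \<Rightarrow> ('v \<Rightarrow> 'w) \<Rightarrow> bool" where
  "bounded_op H K T \<longleftrightarrow> lin_map H K T \<and> (\<exists>C. \<forall>v\<in>carrier H. hnorm K (T v) \<le> C * hnorm H v)"

definition isometry_op ::
    "('v, 'e) hilb_scheme \<Rightarrow> ('w, 'f) hilb_scheme \<Rightarrow> ('v \<Rightarrow> 'w) \<Rightarrow> bool" where
  "isometry_op H K T \<longleftrightarrow> lin_map H K T \<and> (\<forall>v\<in>carrier H. hnorm K (T v) = hnorm H v)"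

definition compact_op :: "('v, 'e) hilb_scheme \<Rightarrow> ('v \<Rightarrow> 'v) \<Rightarrow> bool" where
  "compact_op H T \<longleftrightarrow> lin_map H H T \<and>
     compactin (Metric_space.mtopology (carrier H) (hdist H))
       (Metric_space.mtopology (carrier H) (hdist H) closure_of
          (T ` {v \<in> carrier H. hnorm H v \<le> 1}))"

text \<open>\<open>T\<close> is the map \<open>(v, w) \<mapsto> v \<otimes> w\<close> exhibiting \<open>K\<close> as a Hilbert space tensor product of
  \<open>H\<close> and \<open>S\<close>; this determines \<open>(K, T)\<close> up to unitary isomorphism.\<close>

definition hilbert_tensor ::
    "('v, 'e) hilb_scheme \<Rightarrow> ('s, 'f) hilb_scheme \<Rightarrow> ('k, 'g) hilb_scheme \<Rightarrow>
     ('v \<Rightarrow> 's \<Rightarrow> 'k) \<Rightarrow> bool" where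
  "hilbert_tensor H S K T \<longleftrightarrow> hilbert_space H \<and> hilbert_space S \<and> hilbert_space K \<and>
     (\<forall>v\<in>carrier H. lin_map S K (T v)) \<and>
     (\<forall>w\<in>carrier S. lin_map H K (\<lambda>v. T v w)) \<and>
     (\<forall>v\<in>carrier H. \<forall>v'\<in>carrier H. \<forall>w\<in>carrier S. \<forall>w'\<in>carrier S.
        ip K (T v w) (T v' w') = ip H v v' * ip S w w') \<and>
     hdense K (lin_span K {T v w |v w. v \<in> carrier H \<and> w \<in> carrier S})"

section \<open>Unbounded operators\<close>

record 'v partial_op =
  op_dom :: "'v set"
  op_app :: "'v \<Rightarrow> 'v"

text \<open>The last conjunct says that the graphs of \<open>D\<close> and of its adjoint coincide.\<close>

definition selfadjoint :: "('v, 'e) hilb_scheme \<Rightarrow> 'v partial_op \<Rightarrow> bool" where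
  "selfadjoint H D \<longleftrightarrow> submodule (op_dom D) complex_ring H \<and> hdense H (op_dom D) \<and>
     lin_map (H\<lparr>carrier := op_dom D\<rparr>) H (op_app D) \<and>
     (\<forall>v\<in>carrier H. \<forall>w\<in>carrier H.
        (v \<in> op_dom D \<and> op_app D v = w) \<longleftrightarrow>
        (\<forall>u\<in>op_dom D. ip H (op_app D u) v = ip H u w))"

definition is_resolvent ::
    "('v, 'e) hilb_scheme \<Rightarrow> 'v partial_op \<Rightarrow> complex \<Rightarrow> ('v \<Rightarrow> 'v) \<Rightarrow> bool" where
  "is_resolvent H D c R \<longleftrightarrow> bounded_op H H R \<and>
     (\<forall>v\<in>carrier H. R v \<in> op_dom D \<and> op_app D (R v) \<ominus>\<^bsub>H\<^esub> c \<odot>\<^bsub>H\<^esub> R v = v) \<and>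
     (\<forall>v\<in>op_dom D. R (op_app D v \<ominus>\<^bsub>H\<^esub> c \<odot>\<^bsub>H\<^esub> v) = v)"

definition compact_resolvent :: "('v, 'e) hilb_scheme \<Rightarrow> 'v partial_op \<Rightarrow> bool" where
  "compact_resolvent H D \<longleftrightarrow> (\<exists>c R. is_resolvent H D c R) \<and>
     (\<forall>c R. is_resolvent H D c R \<longrightarrow> compact_op H R)"

section \<open>Unital C*-algebras\<close>

record 'a cstar = "(complex, 'a) module" +
  star :: "'a \<Rightarrow> 'a"
  nrm :: "'a \<Rightarrow> real"

definition cdist :: "('a, 'e) cstar_scheme \<Rightarrow> 'a \<Rightarrow> 'a \<Rightarrow> real" where
  "cdist A = norm_dist A (nrm A)"

definition cstar_algebra :: "('a, 'e) cstar_scheme \<Rightarrow> bool" where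
  "cstar_algebra A \<longleftrightarrow> ring A \<and> module complex_ring A \<and>
     (\<forall>c. \<forall>x\<in>carrier A. \<forall>y\<in>carrier A.
        (c \<odot>\<^bsub>A\<^esub> x) \<otimes>\<^bsub>A\<^esub> y = c \<odot>\<^bsub>A\<^esub> (x \<otimes>\<^bsub>A\<^esub> y) \<and>
        x \<otimes>\<^bsub>A\<^esub> (c \<odot>\<^bsub>A\<^esub> y) = c \<odot>\<^bsub>A\<^esub> (x \<otimes>\<^bsub>A\<^esub> y)) \<and>
     (\<forall>x\<in>carrier A. star A x \<in> carrier A \<and> star A (star A x) = x) \<and>
     (\<forall>x\<in>carrier A. \<forall>y\<in>carrier A.
        star A (x \<oplus>\<^bsub>A\<^esub> y) = star A x \<oplus>\<^bsub>A\<^esub> star A y \<and>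
        star A (x \<otimes>\<^bsub>A\<^esub> y) = star A y \<otimes>\<^bsub>A\<^esub> star A x) \<and>
     (\<forall>c. \<forall>x\<in>carrier A. star A (c \<odot>\<^bsub>A\<^esub> x) = cnj c \<odot>\<^bsub>A\<^esub> star A x) \<and>
     (\<forall>x\<in>carrier A. 0 \<le> nrm A x \<and> (nrm A x = 0 \<longleftrightarrow> x = \<zero>\<^bsub>A\<^esub>)) \<and>
     (\<forall>c. \<forall>x\<in>carrier A. nrm A (c \<odot>\<^bsub>A\<^esub> x) = cmod c * nrm A x) \<and>
     (\<forall>x\<in>carrier A. \<forall>y\<in>carrier A.
        nrm A (x \<oplus>\<^bsub>A\<^esub> y) \<le> nrm A x + nrm A y \<and>
        nrm A (x \<otimes>\<^bsub>A\<^esub> y) \<le> nrm A x * nrm A y) \<and>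
     (\<forall>x\<in>carrier A. nrm A (star A x \<otimes>\<^bsub>A\<^esub> x) = (nrm A x)\<^sup>2) \<and>
     Metric_space.mcomplete (carrier A) (cdist A)"

definition unital_star_hom ::
    "('a, 'e) cstar_scheme \<Rightarrow> ('b, 'f) cstar_scheme \<Rightarrow> ('a \<Rightarrow> 'b) \<Rightarrow> bool" where
  "unital_star_hom A B \<phi> \<longleftrightarrow> \<phi> \<in> ring_hom A B \<and> lin_map A B \<phi> \<and>
     (\<forall>x\<in>carrier A. \<phi> (star A x) = star B (\<phi> x))"

definition cstar_subalgebra :: "('a, 'e) cstar_scheme \<Rightarrow> 'a set \<Rightarrow> bool" where
  "cstar_subalgebra A B \<longleftrightarrow> submodule B complex_ring A \<and> \<one>\<^bsub>A\<^esub> \<in> B \<and>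
     (\<forall>x\<in>B. star A x \<in> B \<and> (\<forall>y\<in>B. x \<otimes>\<^bsub>A\<^esub> y \<in> B)) \<and>
     closedin (Metric_space.mtopology (carrier A) (cdist A)) B"

definition cstar_generated :: "('a, 'e) cstar_scheme \<Rightarrow> 'a set \<Rightarrow> bool" where
  "cstar_generated A X \<longleftrightarrow> X \<subseteq> carrier A \<and>
     (\<forall>B. cstar_subalgebra A B \<and> X \<subseteq> B \<longrightarrow> B = carrier A)"

definition cstar_dense :: "('a, 'e) cstar_scheme \<Rightarrow> 'a set \<Rightarrow> bool" where
  "cstar_dense A X \<longleftrightarrow>
     Metric_space.mtopology (carrier A) (cdist A) closure_of X = carrier A"

text \<open>A state is a positive functional of norm one: here \<open>\<bar>\<tau> a\<bar> \<le> \<parallel>a\<parallel>\<close>, with equality at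
  the unit.\<close>

definition tracial_state :: "('a, 'e) cstar_scheme \<Rightarrow> ('a \<Rightarrow> complex) \<Rightarrow> bool" where
  "tracial_state A \<tau> \<longleftrightarrow>
     (\<forall>x\<in>carrier A. \<forall>y\<in>carrier A. \<tau> (x \<oplus>\<^bsub>A\<^esub> y) = \<tau> x + \<tau> y) \<and>
     (\<forall>c. \<forall>x\<in>carrier A. \<tau> (c \<odot>\<^bsub>A\<^esub> x) = c * \<tau> x) \<and>
     (\<forall>x\<in>carrier A. \<tau> (star A x \<otimes>\<^bsub>A\<^esub> x) \<in> \<real>\<^sub>\<ge>\<^sub>0) \<and>
     (\<forall>x\<in>carrier A. cmod (\<tau> x) \<le> nrm A x) \<and> \<tau> \<one>\<^bsub>A\<^esub> = 1 \<and>
     (\<forall>x\<in>carrier A. \<forall>y\<in>carrier A. \<tau> (x \<otimes>\<^bsub>A\<^esub> y) = \<tau> (y \<otimes>\<^bsub>A\<^esub> x))"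

text \<open>\<open>L\<close> with \<open>\<Lambda>\<close> is the GNS space of \<open>\<tau>\<close>: the completion of \<open>A\<close>, modulo null vectors, for
  \<open>\<langle>a, b\<rangle> = \<tau>(a\<^sup>* b)\<close>; this determines \<open>(L, \<Lambda>)\<close> up to unitary isomorphism.\<close>

definition gns_space ::
    "('a, 'e) cstar_scheme \<Rightarrow> ('a \<Rightarrow> complex) \<Rightarrow> ('l, 'f) hilb_scheme \<Rightarrow> ('a \<Rightarrow> 'l) \<Rightarrow> bool" where
  "gns_space A \<tau> L \<Lambda> \<longleftrightarrow> hilbert_space L \<and> lin_map A L \<Lambda> \<and>
     (\<forall>a\<in>carrier A. \<forall>b\<in>carrier A. ip L (\<Lambda> a) (\<Lambda> b) = \<tau> (star A a \<otimes>\<^bsub>A\<^esub> b)) \<and>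
     hdense L (\<Lambda> ` carrier A)"

section \<open>Noncommutative tori and monomial toric homomorphisms\<close>

text \<open>Coordinates are numbered from \<open>0\<close>, and so are the members of the inductive sequences below.\<close>

definition skew_symmetric :: "nat \<Rightarrow> real mat \<Rightarrow> bool" where
  "skew_symmetric m \<Theta> \<longleftrightarrow> \<Theta> \<in> carrier_mat m m \<and> transpose_mat \<Theta> = - \<Theta>"

definition nondegenerate :: "nat \<Rightarrow> real mat \<Rightarrow> bool" where
  "nondegenerate m \<Theta> \<longleftrightarrow>
     (\<forall>x \<in> carrier_vec m.
        (\<forall>y \<in> carrier_vec m.
           exp (2 * complex_of_real pi * \<i> * complex_of_real
             (scalar_prod (map_vec real_of_int x)
                (mult_mat_vec \<Theta> (map_vec real_of_int y)))) = 1)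
        \<longrightarrow> x = 0\<^sub>v m)"

definition nc_torus_relations ::
    "nat \<Rightarrow> real mat \<Rightarrow> ('a, 'e) cstar_scheme \<Rightarrow> (nat \<Rightarrow> 'a) \<Rightarrow> bool" where
  "nc_torus_relations m \<Theta> A U \<longleftrightarrow>
     (\<forall>j<m. U j \<in> carrier A \<and> star A (U j) \<otimes>\<^bsub>A\<^esub> U j = \<one>\<^bsub>A\<^esub> \<and> U j \<otimes>\<^bsub>A\<^esub> star A (U j) = \<one>\<^bsub>A\<^esub>) \<and>
     (\<forall>j<m. \<forall>k<m. U k \<otimes>\<^bsub>A\<^esub> U j =
        exp (2 * complex_of_real pi * \<i> * complex_of_real (\<Theta> $$ (j, k))) \<odot>\<^bsub>A\<^esub> (U j \<otimes>\<^bsub>A\<^esub> U k))"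

text \<open>\<open>(A, U)\<close> is the universal unital C*-algebra generated by unitaries with these relations.
  HOL cannot quantify over all types inside a formula, so the test algebras \<open>B\<close> have their carriers
  in one fixed type. This loses nothing: it suffices to test against algebras generated by the
  \<open>V j\<close>; these are separable, so they have at most the cardinality of the continuum, and hence
  admit isomorphic copies with carrier in \<open>nat \<Rightarrow> complex\<close>.\<close>

definition nc_torus :: "nat \<Rightarrow> real mat \<Rightarrow> ('a, 'e) cstar_scheme \<Rightarrow> (nat \<Rightarrow> 'a) \<Rightarrow> bool" where
  "nc_torus m \<Theta> A U \<longleftrightarrow> cstar_algebra A \<and> nc_torus_relations m \<Theta> A U \<and>
     cstar_generated A (U ` {..<m}) \<and>
     (\<forall>(B :: (nat \<Rightarrow> complex) cstar) V. cstar_algebra B \<and> nc_torus_relations m \<Theta> B V \<longrightarrow>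
        (\<exists>\<phi>. unital_star_hom A B \<phi> \<and> (\<forall>j<m. \<phi> (U j) = V j)))"

text \<open>The ordered product \<open>U\<^sup>x\<close> with integer exponents; negative powers use the inverse of the
  multiplicative monoid of \<open>A\<close>.\<close>

definition nc_monomial :: "('a, 'e) cstar_scheme \<Rightarrow> (nat \<Rightarrow> 'a) \<Rightarrow> int vec \<Rightarrow> 'a" where
  "nc_monomial A U x =
     foldr (\<lambda>j y. (U j [^]\<^bsub>A\<^esub> vec_index x j) \<otimes>\<^bsub>A\<^esub> y) [0..<dim_vec x] \<one>\<^bsub>A\<^esub>"

definition toric_hom ::
    "nat \<Rightarrow> real mat \<Rightarrow> ('a, 'e) cstar_scheme \<Rightarrow> (nat \<Rightarrow> 'a) \<Rightarrow>
     nat \<Rightarrow> real mat \<Rightarrow> ('b, 'f) cstar_scheme \<Rightarrow> (nat \<Rightarrow> 'b) \<Rightarrow>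
     int mat \<Rightarrow> complex vec \<Rightarrow> ('a \<Rightarrow> 'b) \<Rightarrow> bool" where
  "toric_hom m \<Theta> A U n \<Psi> B V M z \<phi> \<longleftrightarrow>
     M \<in> carrier_mat n m \<and> z \<in> carrier_vec m \<and> (\<forall>j<m. cmod (vec_index z j) = 1) \<and>
     (\<forall>i<m. \<forall>j<m.
        (\<Theta> - transpose_mat (map_mat real_of_int M) * \<Psi> * map_mat real_of_int M) $$ (i, j) \<in> \<int>) \<and>
     unital_star_hom A B \<phi> \<and>
     (\<forall>j<m. \<phi> (U j) = vec_index z j \<odot>\<^bsub>B\<^esub> nc_monomial B V (col M j))"

section \<open>Fourier multipliers\<close>

definition selfadjoint_end :: "('s, 'e) hilb_scheme \<Rightarrow> ('s \<Rightarrow> 's) \<Rightarrow> bool" where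
  "selfadjoint_end S T \<longleftrightarrow> lin_map S S T \<and>
     (\<forall>v\<in>carrier S. \<forall>w\<in>carrier S. ip S (T v) w = ip S v (T w))"

definition spec_end :: "('s, 'e) hilb_scheme \<Rightarrow> ('s \<Rightarrow> 's) \<Rightarrow> complex set" where
  "spec_end S T =
     {c. \<not> bij_betw (\<lambda>v. T v \<ominus>\<^bsub>S\<^esub> c \<odot>\<^bsub>S\<^esub> v) (carrier S) (carrier S)}"

text \<open>In the bound on the differences, \<open>C\<close> bounds all the operator norms
  \<open>\<parallel>F n (x + a) - F n x\<parallel>\<close>.\<close>

definition compatible_multipliers ::
    "(nat \<Rightarrow> nat) \<Rightarrow> (nat \<Rightarrow> int mat) \<Rightarrow> (nat \<Rightarrow> int vec \<Rightarrow> 's \<Rightarrow> 's) \<Rightarrow>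
     (nat \<Rightarrow> ('s, 'e) hilb_scheme) \<Rightarrow> (nat \<Rightarrow> 's \<Rightarrow> 's) \<Rightarrow> bool" where
  "compatible_multipliers m M F S J \<longleftrightarrow>
     (\<forall>n. hilbert_space (S n) \<and> fin_dim (S n) \<and> carrier (S n) \<noteq> {\<zero>\<^bsub>S n\<^esub>}) \<and>
     (\<forall>n. isometry_op (S n) (S (Suc n)) (J n)) \<and>
     (\<forall>n. \<forall>x\<in>carrier_vec (m n). selfadjoint_end (S n) (F n x)) \<and>
     (\<forall>n. \<forall>R>0. fin_dim (direct_sum_copies
        {x \<in> carrier_vec (m n).
           spec_end (S n) (F n x) \<inter> complex_of_real ` {-R..R} \<noteq> {}} (S n))) \<and>
     (\<forall>n. \<forall>a\<in>carrier_vec (m n). \<exists>C. \<forall>x\<in>carrier_vec (m n). \<forall>v\<in>carrier (S n).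
        hnorm (S n) (F n (x + a) v \<ominus>\<^bsub>S n\<^esub> F n x v) \<le> C * hnorm (S n) v) \<and>
     (\<forall>n. \<forall>x\<in>carrier_vec (m n). \<forall>v\<in>carrier (S n).
        F (Suc n) (mult_mat_vec (M n) x) (J n v) = J n (F n x v))"

text \<open>Below, \<open>H\<close> with \<open>T\<close> is the tensor product of the GNS space, with GNS map \<open>\<Lambda>\<close>, and \<open>S\<close>;
  the vector \<open>\<delta>\<^sub>x\<close> is \<open>\<Lambda> (nc_monomial A U x)\<close>. The component \<open>v\<^sub>x \<in> S\<close> of
  \<open>v = \<Sum>\<^sub>x \<delta>\<^sub>x \<otimes> v\<^sub>x\<close> is determined by \<open>\<langle>\<delta>\<^sub>x \<otimes> \<xi>, v\<rangle> = \<langle>\<xi>, v\<^sub>x\<rangle>\<close>.\<close>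

definition fourier_coeff ::
    "('a, 'd) cstar_scheme \<Rightarrow> (nat \<Rightarrow> 'a) \<Rightarrow> ('a \<Rightarrow> 'l) \<Rightarrow> ('s, 'e) hilb_scheme \<Rightarrow>
     ('h, 'f) hilb_scheme \<Rightarrow> ('l \<Rightarrow> 's \<Rightarrow> 'h) \<Rightarrow> 'h \<Rightarrow> int vec \<Rightarrow> 's" where
  "fourier_coeff A U \<Lambda> S H T v x =
     (THE \<eta>. \<eta> \<in> carrier S \<and>
        (\<forall>\<xi>\<in>carrier S. ip H (T (\<Lambda> (nc_monomial A U x)) \<xi>) v = ip S \<xi> \<eta>))"

definition multiplier_op ::
    "nat \<Rightarrow> ('a, 'd) cstar_scheme \<Rightarrow> (nat \<Rightarrow> 'a) \<Rightarrow> ('a \<Rightarrow> 'l) \<Rightarrow> ('s, 'e) hilb_scheme \<Rightarrow>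
     ('h, 'f) hilb_scheme \<Rightarrow> ('l \<Rightarrow> 's \<Rightarrow> 'h) \<Rightarrow> (int vec \<Rightarrow> 's \<Rightarrow> 's) \<Rightarrow> 'h partial_op" where
  "multiplier_op m A U \<Lambda> S H T F =
     \<lparr>op_dom = {v \<in> carrier H.
        (\<lambda>x. (hnorm S (F x (fourier_coeff A U \<Lambda> S H T v x)))\<^sup>2) summable_on carrier_vec m},
      op_app = (\<lambda>v. THE w. w \<in> carrier H \<and>
        (\<forall>x\<in>carrier_vec m.
           fourier_coeff A U \<Lambda> S H T w x = F x (fourier_coeff A U \<Lambda> S H T v x)))\<rparr>"

text \<open>Two bounded operators given on elementary tensors \<open>\<Lambda>(b) \<otimes> \<xi>\<close>: left multiplication by \<open>a\<close>,
  and the map induced by \<open>\<phi>\<close> and \<open>J\<close>. Elementary tensors are total, so each is unique; its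
  existence is a matter of proof.\<close>

definition left_mult ::
    "('a, 'd) cstar_scheme \<Rightarrow> ('a \<Rightarrow> 'l) \<Rightarrow> ('s, 'e) hilb_scheme \<Rightarrow>
     ('h, 'f) hilb_scheme \<Rightarrow> ('l \<Rightarrow> 's \<Rightarrow> 'h) \<Rightarrow> 'a \<Rightarrow> 'h \<Rightarrow> 'h" where
  "left_mult A \<Lambda> S H T a =
     (THE P. P \<in> extensional (carrier H) \<and> bounded_op H H P \<and>
        (\<forall>b\<in>carrier A. \<forall>\<xi>\<in>carrier S. P (T (\<Lambda> b) \<xi>) = T (\<Lambda> (a \<otimes>\<^bsub>A\<^esub> b)) \<xi>))"

definition induced_op ::
    "('a, 'd) cstar_scheme \<Rightarrow> ('a \<Rightarrow> 'l) \<Rightarrow> ('s, 'e) hilb_scheme \<Rightarrow>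
     ('h, 'f) hilb_scheme \<Rightarrow> ('l \<Rightarrow> 's \<Rightarrow> 'h) \<Rightarrow>
     ('b \<Rightarrow> 'l2) \<Rightarrow> ('h2, 'f2) hilb_scheme \<Rightarrow> ('l2 \<Rightarrow> 's2 \<Rightarrow> 'h2) \<Rightarrow>
     ('a \<Rightarrow> 'b) \<Rightarrow> ('s \<Rightarrow> 's2) \<Rightarrow> 'h \<Rightarrow> 'h2" where
  "induced_op A \<Lambda> S H T \<Lambda>2 H2 T2 \<phi> J =
     (THE I. I \<in> extensional (carrier H) \<and> bounded_op H H2 I \<and>
        (\<forall>a\<in>carrier A. \<forall>\<xi>\<in>carrier S. I (T (\<Lambda> a) \<xi>) = T2 (\<Lambda>2 (\<phi> a)) (J \<xi>)))"

section \<open>Spectral triples and their inductive systems\<close>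

definition faithful_rep ::
    "('a, 'd) cstar_scheme \<Rightarrow> ('h, 'e) hilb_scheme \<Rightarrow> ('a \<Rightarrow> 'h \<Rightarrow> 'h) \<Rightarrow> bool" where
  "faithful_rep A H \<pi> \<longleftrightarrow>
     (\<forall>a\<in>carrier A. bounded_op H H (\<pi> a)) \<and>
     (\<forall>v\<in>carrier H. lin_map A H (\<lambda>a. \<pi> a v) \<and> \<pi> \<one>\<^bsub>A\<^esub> v = v) \<and>
     (\<forall>a\<in>carrier A. \<forall>b\<in>carrier A. \<forall>v\<in>carrier H. \<pi> (a \<otimes>\<^bsub>A\<^esub> b) v = \<pi> a (\<pi> b v)) \<and>
     (\<forall>a\<in>carrier A. \<forall>v\<in>carrier H. \<forall>w\<in>carrier H. ip H (\<pi> a v) w = ip H v (\<pi> (star A a) w)) \<and>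
     (\<forall>a\<in>carrier A. \<forall>b\<in>carrier A. (\<forall>v\<in>carrier H. \<pi> a v = \<pi> b v) \<longrightarrow> a = b)"

definition commutator_dom ::
    "('h, 'e) hilb_scheme \<Rightarrow> 'h partial_op \<Rightarrow> ('h \<Rightarrow> 'h) \<Rightarrow> 'h set" where
  "commutator_dom H D P = {v \<in> op_dom D. P v \<in> op_dom D}"

definition smooth_alg ::
    "('a, 'd) cstar_scheme \<Rightarrow> ('h, 'e) hilb_scheme \<Rightarrow> ('a \<Rightarrow> 'h \<Rightarrow> 'h) \<Rightarrow> 'h partial_op \<Rightarrow>
     'a set" where
  "smooth_alg A H \<pi> D =
     {a \<in> carrier A. hdense H (commutator_dom H D (\<pi> a)) \<and>
        (\<exists>B. bounded_op H H B \<and>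
           (\<forall>v\<in>commutator_dom H D (\<pi> a).
              B v = op_app D (\<pi> a v) \<ominus>\<^bsub>H\<^esub> \<pi> a (op_app D v)))}"

definition spectral_triple ::
    "('a, 'd) cstar_scheme \<Rightarrow> ('h, 'e) hilb_scheme \<Rightarrow> ('a \<Rightarrow> 'h \<Rightarrow> 'h) \<Rightarrow> 'h partial_op \<Rightarrow>
     bool" where
  "spectral_triple A H \<pi> D \<longleftrightarrow> cstar_algebra A \<and> hilbert_space H \<and> faithful_rep A H \<pi> \<and>
     selfadjoint H D \<and> compact_resolvent H D \<and> cstar_dense A (smooth_alg A H \<pi> D)"

definition isometric_morphism ::
    "('a, 'd) cstar_scheme \<Rightarrow> ('h, 'e) hilb_scheme \<Rightarrow> ('a \<Rightarrow> 'h \<Rightarrow> 'h) \<Rightarrow> 'h partial_op \<Rightarrow>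
     ('b, 'd2) cstar_scheme \<Rightarrow> ('k, 'e2) hilb_scheme \<Rightarrow> ('b \<Rightarrow> 'k \<Rightarrow> 'k) \<Rightarrow> 'k partial_op \<Rightarrow>
     ('a \<Rightarrow> 'b) \<Rightarrow> ('h \<Rightarrow> 'k) \<Rightarrow> bool" where
  "isometric_morphism A1 H1 \<pi>1 D1 A2 H2 \<pi>2 D2 \<phi> I \<longleftrightarrow>
     unital_star_hom A1 A2 \<phi> \<and> inj_on \<phi> (carrier A1) \<and> isometry_op H1 H2 I \<and>
     \<phi> ` smooth_alg A1 H1 \<pi>1 D1 \<subseteq> smooth_alg A2 H2 \<pi>2 D2 \<and>
     (\<forall>a\<in>carrier A1. \<forall>v\<in>carrier H1. I (\<pi>1 a v) = \<pi>2 (\<phi> a) (I v)) \<and>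
     I ` op_dom D1 \<subseteq> op_dom D2 \<and>
     (\<forall>v\<in>op_dom D1. I (op_app D1 v) = op_app D2 (I v))"

definition inductive_system ::
    "(nat \<Rightarrow> ('a, 'd) cstar_scheme) \<Rightarrow> (nat \<Rightarrow> ('h, 'e) hilb_scheme) \<Rightarrow>
     (nat \<Rightarrow> 'a \<Rightarrow> 'h \<Rightarrow> 'h) \<Rightarrow> (nat \<Rightarrow> 'h partial_op) \<Rightarrow>
     (nat \<Rightarrow> 'a \<Rightarrow> 'a) \<Rightarrow> (nat \<Rightarrow> 'h \<Rightarrow> 'h) \<Rightarrow> bool" where
  "inductive_system A H \<pi> D \<phi> I \<longleftrightarrow>
     (\<forall>n. spectral_triple (A n) (H n) (\<pi> n) (D n)) \<and>
     (\<forall>n. isometric_morphism (A n) (H n) (\<pi> n) (D n)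
        (A (Suc n)) (H (Suc n)) (\<pi> (Suc n)) (D (Suc n)) (\<phi> n) (I n))"

end

theory Submission
  imports Defs "HOL-Analysis.Urysohn" "Jordan_Normal_Form.Char_Poly"
begin

text \<open>In the orthonormal basis \<open>\<delta>\<^sub>x \<otimes> e\<close>, with \<open>e\<close> running through an eigenbasis of \<open>F x\<close>, the operator
  \<open>D\<close> is diagonal with real entries, finitely many of them in each bounded interval; hence it is
  selfadjoint with compact resolvent. Each \<open>U\<^sup>a\<close> shifts the coefficients, up to phases, so its
  commutator with \<open>D\<close> is bounded by \<open>sup\<^sub>x \<parallel>F (x + a) - F x\<parallel>\<close>, and the \<open>U\<^sup>a\<close> span a dense subspace.
  Left multiplication is faithful because \<open>\<int>\<^sup>m\<close> has polynomial growth: for a trigonometric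
  polynomial \<open>p\<close>, the C*-norm of \<open>(p\<^sup>* p)\<^sup>k\<close> exceeds its GNS norm by at most a factor polynomial in
  \<open>k\<close>, so \<open>\<parallel>p\<parallel>\<close> is the norm of left multiplication by \<open>p\<close>.

  Nondegeneracy makes the traces vanish on the nontrivial monomials and makes \<open>M\<^sub>n\<close> injective, so
  \<open>\<phi>\<^sub>n\<close> preserves the traces. Hence \<open>I\<^sub>n\<close> is isometric; it maps the coefficient at \<open>x\<close> to
  the one at \<open>M\<^sub>n x\<close>, and the relation \<open>F\<^sub>n\<^sub>+\<^sub>1 (M\<^sub>n x) J\<^sub>n = J\<^sub>n F\<^sub>n x\<close> turns into
  \<open>I\<^sub>n D\<^sub>n = D\<^sub>n\<^sub>+\<^sub>1 I\<^sub>n\<close>.\<close>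

section \<open>Normed modules over the complex numbers\<close>

text \<open>Three obstacles shape the argument. Most identities can be checked only on monomials or
  on elementary tensors, so a norm bound must come first: *-homomorphisms contract (by way of
  unitaries), and left multiplication on the GNS space is bounded by the C*-norm (by way of repeated
  squaring). After that the same step always applies: a closed subspace that contains a total set is
  everything. Products and adjoints of monomials are monomials only up to a phase. Its value matters
  just for commutation, where nondegeneracy enters; elsewhere the set \<open>mults x\<close> of
  unimodular multiples absorbs it, and what remains is a grading by the lattice. Finally,
  \<open>left_mult\<close>, \<open>induced_op\<close>, \<open>fourier_coeff\<close> and the values
  of \<open>multiplier_op\<close> are definite descriptions, so existence and uniqueness precede any
  use. Existence is extension by continuity for the two bounded operators, a finite basis of
  \<open>S\<close> for the coefficients, and Riesz-Fischer for the values of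
  \<open>D\<close>.\<close>

lemma complex_ring_simps [simp]:
  "carrier complex_ring = UNIV" "mult complex_ring = (*)" "one complex_ring = 1"
  "zero complex_ring = 0" "add complex_ring = (+)"
  by (simp_all add: complex_ring_def)

locale complex_module =
  fixes V (structure)
  assumes complex_module: "module complex_ring V"
begin

sublocale abelian_group V
  using complex_module by (rule module.axioms)

lemma smult_closed [simp, intro]: "x \<in> carrier V \<Longrightarrow> c \<odot> x \<in> carrier V"
  using module.smult_closed[OF complex_module, of c x] by simp

lemma smult_add_left: "x \<in> carrier V \<Longrightarrow> (a + b) \<odot> x = a \<odot> x \<oplus> b \<odot> x"
  using module.smult_l_distr[OF complex_module, of a b x] by simp

lemma smult_add_right:
  "x \<in> carrier V \<Longrightarrow> y \<in> carrier V \<Longrightarrow> a \<odot> (x \<oplus> y) = a \<odot> x \<oplus> a \<odot> y"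
  using module.smult_r_distr[OF complex_module, of a x y] by simp

lemma smult_smult: "x \<in> carrier V \<Longrightarrow> a \<odot> (b \<odot> x) = (a * b) \<odot> x"
  using module.smult_assoc1[OF complex_module, of a b x] by simp

lemma smult_1 [simp]: "x \<in> carrier V \<Longrightarrow> 1 \<odot> x = x"
  using module.smult_one[OF complex_module, of x] by simp

lemma smult_0_left [simp]: "x \<in> carrier V \<Longrightarrow> 0 \<odot> x = \<zero>"
  using module.smult_l_null[OF complex_module, of x] by simp

lemma smult_0_right [simp]: "c \<odot> \<zero> = \<zero>"
  using module.smult_r_null[OF complex_module, of c] by simp

lemma minus_eq_smult: "x \<in> carrier V \<Longrightarrow> \<ominus> x = (- 1) \<odot> x"
proof -
  assume x: "x \<in> carrier V"
  have "(- 1) \<odot> x \<oplus> x = \<zero>"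
    using smult_add_left[OF x, of "-1" 1] x by simp
  then show ?thesis
    using x by (intro minus_equality) auto
qed

lemma diff_eq_smult: "x \<in> carrier V \<Longrightarrow> y \<in> carrier V \<Longrightarrow> x \<ominus> y = x \<oplus> (- 1) \<odot> y"
  by (simp add: a_minus_def minus_eq_smult)

lemma diff_closed [simp, intro]: "x \<in> carrier V \<Longrightarrow> y \<in> carrier V \<Longrightarrow> x \<ominus> y \<in> carrier V"
  by (rule minus_closed)

lemma diff_add_cancel': "x \<in> carrier V \<Longrightarrow> y \<in> carrier V \<Longrightarrow> (x \<ominus> y) \<oplus> y = x"
  by (simp add: a_minus_def a_assoc l_neg)

lemma diff_self [simp]: "x \<in> carrier V \<Longrightarrow> x \<ominus> x = \<zero>"
  by (simp add: a_minus_def r_neg)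

lemma diff_eq_zeroD: "x \<in> carrier V \<Longrightarrow> y \<in> carrier V \<Longrightarrow> x \<ominus> y = \<zero> \<Longrightarrow> x = y"
  using diff_add_cancel'[of x y] by simp

lemma diff_add_diff:
  assumes "x \<in> carrier V" "y \<in> carrier V" "z \<in> carrier V"
  shows "(x \<ominus> y) \<oplus> (y \<ominus> z) = x \<ominus> z"
  using assms by (simp add: a_minus_def a_assoc r_neg1)

lemma add_diff_add:
  assumes "x \<in> carrier V" "y \<in> carrier V" "u \<in> carrier V" "v \<in> carrier V"
  shows "(x \<oplus> y) \<ominus> (u \<oplus> v) = (x \<ominus> u) \<oplus> (y \<ominus> v)"
  using assms by (simp add: a_minus_def minus_add a_ac)

lemma smult_diff:
  assumes "x \<in> carrier V" "y \<in> carrier V"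
  shows "c \<odot> (x \<ominus> y) = c \<odot> x \<ominus> c \<odot> y"
  using assms by (simp add: diff_eq_smult smult_add_right smult_smult)

lemma submoduleI:
  assumes "W \<subseteq> carrier V" "\<zero> \<in> W" "\<And>x y. x \<in> W \<Longrightarrow> y \<in> W \<Longrightarrow> x \<oplus> y \<in> W"
    and "\<And>c x. x \<in> W \<Longrightarrow> c \<odot> x \<in> W"
  shows "submodule W complex_ring V"
proof
  show "W \<subseteq> carrier (add_monoid V)" "\<one>\<^bsub>add_monoid V\<^esub> \<in> W" using assms by auto
  show "x \<otimes>\<^bsub>add_monoid V\<^esub> y \<in> W" if "x \<in> W" "y \<in> W" for x y using assms that by auto
  show "inv\<^bsub>add_monoid V\<^esub> x \<in> W" if "x \<in> W" for x
  proof -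
    have "inv\<^bsub>add_monoid V\<^esub> x = (- 1) \<odot> x"
      using minus_eq_smult[of x] that assms(1) by (auto simp: a_inv_def)
    then show ?thesis using assms(4) that by auto
  qed
  show "c \<odot> x \<in> W" if "c \<in> carrier complex_ring" "x \<in> W" for c x using assms(4) that by auto
qed

lemma submoduleD:
  assumes "submodule W complex_ring V"
  shows "W \<subseteq> carrier V" "\<zero> \<in> W" "\<And>x y. x \<in> W \<Longrightarrow> y \<in> W \<Longrightarrow> x \<oplus> y \<in> W"
    "\<And>c x. x \<in> W \<Longrightarrow> c \<odot> x \<in> W"
proof -
  interpret W: submodule W complex_ring V by fact
  show "W \<subseteq> carrier V" "\<zero> \<in> W" "\<And>x y. x \<in> W \<Longrightarrow> y \<in> W \<Longrightarrow> x \<oplus> y \<in> W"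
    "\<And>c x. x \<in> W \<Longrightarrow> c \<odot> x \<in> W"
    using W.subset W.one_closed W.m_closed W.smult_closed by auto
qed

end

lemma lin_mapD:
  assumes "lin_map V W f"
  shows "x \<in> carrier V \<Longrightarrow> f x \<in> carrier W"
    "x \<in> carrier V \<Longrightarrow> y \<in> carrier V \<Longrightarrow> f (x \<oplus>\<^bsub>V\<^esub> y) = f x \<oplus>\<^bsub>W\<^esub> f y"
    "x \<in> carrier V \<Longrightarrow> f (c \<odot>\<^bsub>V\<^esub> x) = c \<odot>\<^bsub>W\<^esub> f x"
  using assms by (auto simp: lin_map_def)

lemma lin_mapI:
  assumes "\<And>x. x \<in> carrier V \<Longrightarrow> f x \<in> carrier W"
    "\<And>x y. x \<in> carrier V \<Longrightarrow> y \<in> carrier V \<Longrightarrow> f (x \<oplus>\<^bsub>V\<^esub> y) = f x \<oplus>\<^bsub>W\<^esub> f y"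
    "\<And>c x. x \<in> carrier V \<Longrightarrow> f (c \<odot>\<^bsub>V\<^esub> x) = c \<odot>\<^bsub>W\<^esub> f x"
  shows "lin_map V W f"
  using assms by (auto simp: lin_map_def)

lemma lin_map_zero:
  assumes "complex_module V" "complex_module W" "lin_map V W f"
  shows "f \<zero>\<^bsub>V\<^esub> = \<zero>\<^bsub>W\<^esub>"
proof -
  interpret V: complex_module V by fact
  interpret W: complex_module W by fact
  have "f \<zero>\<^bsub>V\<^esub> = f (0 \<odot>\<^bsub>V\<^esub> \<zero>\<^bsub>V\<^esub>)" by simp
  also have "\<dots> = \<zero>\<^bsub>W\<^esub>" using lin_mapD(3)[OF assms(3), of "\<zero>\<^bsub>V\<^esub>" 0] lin_mapD(1)[OF assms(3), of "\<zero>\<^bsub>V\<^esub>"]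
    by simp
  finally show ?thesis .
qed

lemma lin_map_diff:
  assumes "complex_module V" "complex_module W" "lin_map V W f" "x \<in> carrier V" "y \<in> carrier V"
  shows "f (x \<ominus>\<^bsub>V\<^esub> y) = f x \<ominus>\<^bsub>W\<^esub> f y"
proof -
  interpret V: complex_module V by fact
  interpret W: complex_module W by fact
  show ?thesis
    using assms(4,5) lin_mapD[OF assms(3)] by (simp add: V.diff_eq_smult W.diff_eq_smult)
qed

lemma lin_map_finsum:
  assumes "complex_module V" "complex_module W" "lin_map V W f" "finite X"
    and "\<And>i. i \<in> X \<Longrightarrow> g i \<in> carrier V"
  shows "f (finsum V g X) = finsum W (\<lambda>i. f (g i)) X"
proof -
  interpret V: complex_module V by fact
  interpret W: complex_module W by fact
  show ?thesis
    using assms(4,5)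
  proof (induction X)
    case empty
    then show ?case using lin_map_zero[OF assms(1-3)] by simp
  next
    case (insert i X)
    then have "g \<in> X \<rightarrow> carrier V" "(\<lambda>i. f (g i)) \<in> X \<rightarrow> carrier W"
      using lin_mapD(1)[OF assms(3)] by auto
    with insert show ?case
      using lin_mapD[OF assms(3)] by (simp add: V.finsum_insert W.finsum_insert)
  qed
qed

locale normed_module = complex_module V for V (structure) +
  fixes N
  assumes norm_nonneg [simp]: "x \<in> carrier V \<Longrightarrow> 0 \<le> N x"
    and norm_eq_zero: "x \<in> carrier V \<Longrightarrow> N x = 0 \<longleftrightarrow> x = \<zero>"
    and norm_smult: "x \<in> carrier V \<Longrightarrow> N (c \<odot> x) = cmod c * N x"
    and norm_triangle: "x \<in> carrier V \<Longrightarrow> y \<in> carrier V \<Longrightarrow> N (x \<oplus> y) \<le> N x + N y"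
begin

lemma norm_zero [simp]: "N \<zero> = 0"
  by (simp add: norm_eq_zero)

lemma norm_diff_commute: "x \<in> carrier V \<Longrightarrow> y \<in> carrier V \<Longrightarrow> N (x \<ominus> y) = N (y \<ominus> x)"
proof -
  assume xy: "x \<in> carrier V" "y \<in> carrier V"
  have "x \<ominus> y = (- 1) \<odot> (y \<ominus> x)"
    using xy by (simp add: smult_diff) (simp add: diff_eq_smult smult_smult a_comm)
  then show ?thesis using xy by (simp add: norm_smult)
qed

lemma norm_triangle_diff:
  assumes "x \<in> carrier V" "y \<in> carrier V" "z \<in> carrier V"
  shows "N (x \<ominus> z) \<le> N (x \<ominus> y) + N (y \<ominus> z)"
  using norm_triangle[of "x \<ominus> y" "y \<ominus> z"] diff_add_diff[of x y z] assms by simp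

lemma norm_le_add_diff:
  assumes "x \<in> carrier V" "y \<in> carrier V"
  shows "N x \<le> N (x \<ominus> y) + N y"
  using norm_triangle[of "x \<ominus> y" y] assms by (simp add: diff_add_cancel')

lemma norm_finsum_le:
  assumes "finite X" "\<And>i. i \<in> X \<Longrightarrow> g i \<in> carrier V"
  shows "N (finsum V g X) \<le> (\<Sum>i\<in>X. N (g i))"
  using assms
proof (induction X)
  case (insert i X)
  then have "g \<in> X \<rightarrow> carrier V" by auto
  with insert have "N (finsum V g (insert i X)) \<le> N (g i) + N (finsum V g X)"
    by (simp add: finsum_insert norm_triangle)
  with insert show ?case by auto
qed simp

lemma Metric_space: "Metric_space (carrier V) (norm_dist V N)"
proof
  fix x y
  show "0 \<le> norm_dist V N x y" by (simp add: norm_dist_def)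
  show "norm_dist V N x y = norm_dist V N y x" by (simp add: norm_dist_def norm_diff_commute)
next
  fix x y assume "x \<in> carrier V" "y \<in> carrier V"
  then show "norm_dist V N x y = 0 \<longleftrightarrow> x = y"
    by (auto simp: norm_dist_def norm_eq_zero dest: diff_eq_zeroD)
next
  fix x y z assume "x \<in> carrier V" "y \<in> carrier V" "z \<in> carrier V"
  then show "norm_dist V N x z \<le> norm_dist V N x y + norm_dist V N y z"
    by (simp add: norm_dist_def norm_triangle_diff)
qed

sublocale MS: Metric_space "carrier V" "norm_dist V N"
  by (rule Metric_space)

lemma norm_dist_eq: "x \<in> carrier V \<Longrightarrow> y \<in> carrier V \<Longrightarrow> norm_dist V N x y = N (x \<ominus> y)"
  by (simp add: norm_dist_def)

lemma closure_of_eq_carrier_iff: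
  assumes "X \<subseteq> carrier V"
  shows "MS.mtopology closure_of X = carrier V \<longleftrightarrow>
    (\<forall>v\<in>carrier V. \<forall>\<epsilon>>0. \<exists>u\<in>X. N (v \<ominus> u) < \<epsilon>)"
proof -
  have "MS.mtopology closure_of X = {v \<in> carrier V. \<forall>\<epsilon>>0. \<exists>u\<in>X. N (v \<ominus> u) < \<epsilon>}"
    unfolding MS.metric_closure_of MS.in_mball using assms
    by (intro Collect_cong conj_cong refl all_cong1 imp_cong bex_cong) (auto simp: norm_dist_def)
  then show ?thesis by blast
qed

lemma limitin_iff:
  assumes "l \<in> carrier V" "\<And>n. s n \<in> carrier V"
  shows "limitin MS.mtopology s l sequentially \<longleftrightarrow> (\<lambda>n. N (s n \<ominus> l)) \<longlonglongrightarrow> 0"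
proof -
  have *: "norm_dist V N (s n) l = N (s n \<ominus> l)" for n
    using assms by (simp add: norm_dist_def)
  show ?thesis
    using assms by (simp add: MS.limitin_metric_dist_null *)
qed

lemma complete_ex_limit:
  assumes "MS.mcomplete" "\<And>n. s n \<in> carrier V"
    and "\<And>\<epsilon>. \<epsilon> > 0 \<Longrightarrow> \<exists>M. \<forall>i\<ge>M. \<forall>j\<ge>M. N (s i \<ominus> s j) < \<epsilon>"
  shows "\<exists>l\<in>carrier V. (\<lambda>n. N (s n \<ominus> l)) \<longlonglongrightarrow> 0"
proof -
  have "MS.MCauchy s"
    unfolding MS.MCauchy_def using assms(2,3) by (auto simp: norm_dist_eq)
  with assms(1) obtain l where l: "limitin MS.mtopology s l sequentially"
    by (auto simp: MS.mcomplete_def)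
  then have "l \<in> carrier V" by (rule MS.limitin_mspace)
  with l assms(2) show ?thesis by (auto simp: limitin_iff)
qed

end

section \<open>Closed subspaces and total sets\<close>

definition closed_subspace ::
    "(complex, 'v, 'e) module_scheme \<Rightarrow> ('v \<Rightarrow> real) \<Rightarrow> 'v set \<Rightarrow> bool" where
  "closed_subspace V N Q \<longleftrightarrow> Q \<subseteq> carrier V \<and> \<zero>\<^bsub>V\<^esub> \<in> Q \<and>
     (\<forall>x\<in>Q. \<forall>y\<in>Q. x \<oplus>\<^bsub>V\<^esub> y \<in> Q) \<and> (\<forall>c. \<forall>x\<in>Q. c \<odot>\<^bsub>V\<^esub> x \<in> Q) \<and>
     (\<forall>v\<in>carrier V. (\<forall>\<epsilon>>0. \<exists>u\<in>Q. N (v \<ominus>\<^bsub>V\<^esub> u) < \<epsilon>) \<longrightarrow> v \<in> Q)"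

text \<open>Equivalent to density of the linear span. In this form an argument by linearity and
  continuity becomes one inclusion of closed subspaces, and no linear combinations have to be
  written down.\<close>

definition total_set ::
    "(complex, 'v, 'e) module_scheme \<Rightarrow> ('v \<Rightarrow> real) \<Rightarrow> 'v set \<Rightarrow> bool" where
  "total_set V N X \<longleftrightarrow> X \<subseteq> carrier V \<and>
     (\<forall>Q. closed_subspace V N Q \<and> X \<subseteq> Q \<longrightarrow> Q = carrier V)"

lemma total_set_induct:
  assumes "total_set V N X" "closed_subspace V N {v \<in> carrier V. P v}" "\<And>x. x \<in> X \<Longrightarrow> P x"
    "v \<in> carrier V"
  shows "P v"
proof -
  have "X \<subseteq> {v \<in> carrier V. P v}" using assms(1,3) by (auto simp: total_set_def)
  then have "{v \<in> carrier V. P v} = carrier V" using assms(1,2) unfolding total_set_def by blast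
  then show ?thesis using assms(4) by auto
qed

lemma closed_subspaceD:
  assumes "closed_subspace V N Q"
  shows "Q \<subseteq> carrier V" "\<zero>\<^bsub>V\<^esub> \<in> Q"
    "x \<in> Q \<Longrightarrow> y \<in> Q \<Longrightarrow> x \<oplus>\<^bsub>V\<^esub> y \<in> Q" "x \<in> Q \<Longrightarrow> c \<odot>\<^bsub>V\<^esub> x \<in> Q"
    "v \<in> carrier V \<Longrightarrow> (\<And>\<epsilon>. \<epsilon> > 0 \<Longrightarrow> \<exists>u\<in>Q. N (v \<ominus>\<^bsub>V\<^esub> u) < \<epsilon>) \<Longrightarrow> v \<in> Q"
  using assms by (auto simp: closed_subspace_def)

context normed_module
begin

lemma closed_subspace_zero: "closed_subspace V N {\<zero>}"
proof -
  have "v = \<zero>" if "v \<in> carrier V" "\<forall>\<epsilon>>0. N (v \<ominus> \<zero>) < \<epsilon>" for v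
  proof -
    have "v \<ominus> \<zero> = v" using that(1) by (simp add: a_minus_def)
    with that(2) have "N v < \<epsilon>" if "\<epsilon> > 0" for \<epsilon> using that by simp
    then have "N v \<le> 0" by (meson less_irrefl not_less)
    with that(1) have "N v = 0" using norm_nonneg[of v] by linarith
    then show ?thesis using norm_eq_zero that(1) by blast
  qed
  then show ?thesis by (auto simp: closed_subspace_def)
qed

lemma closed_subspace_Inter:
  assumes "\<And>Q. Q \<in> \<Q> \<Longrightarrow> closed_subspace V N Q" "\<Q> \<noteq> {}"
  shows "closed_subspace V N (\<Inter>\<Q>)"
proof -
  have "v \<in> Q" if "v \<in> carrier V" "\<forall>\<epsilon>>0. \<exists>u\<in>\<Inter>\<Q>. N (v \<ominus> u) < \<epsilon>" "Q \<in> \<Q>" for v Q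
    using closed_subspaceD(5)[OF assms(1)[OF that(3)] that(1)] that(2,3) by blast
  moreover have "\<Inter>\<Q> \<subseteq> carrier V"
    using closed_subspaceD(1)[OF assms(1)] assms(2) by blast
  moreover have "\<zero> \<in> \<Inter>\<Q>" "\<forall>x\<in>\<Inter>\<Q>. \<forall>y\<in>\<Inter>\<Q>. x \<oplus> y \<in> \<Inter>\<Q>" "\<forall>c. \<forall>x\<in>\<Inter>\<Q>. c \<odot> x \<in> \<Inter>\<Q>"
    using closed_subspaceD(2-4)[OF assms(1)] by simp_all
  ultimately show ?thesis
    unfolding closed_subspace_def by (simp only: Inter_iff) blast
qed

lemma closed_subspace_carrier: "closed_subspace V N (carrier V)"
  by (auto simp: closed_subspace_def)

lemma closed_subspace_closure:
  assumes "submodule W complex_ring V"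
  shows "closed_subspace V N {v \<in> carrier V. \<forall>\<epsilon>>0. \<exists>u\<in>W. N (v \<ominus> u) < \<epsilon>}"
proof -
  note W = submoduleD[OF assms]
  have Wc: "u \<in> carrier V" if "u \<in> W" for u using W(1) that by auto
  show ?thesis
    unfolding closed_subspace_def mem_Collect_eq
  proof (intro conjI ballI allI impI subsetI)
    show "\<exists>u\<in>W. N (\<zero> \<ominus> u) < \<epsilon>" if "\<epsilon> > 0" for \<epsilon>
      using that W(2) by (intro bexI[of _ \<zero>]) auto
  next
    fix x y and \<epsilon> :: real
    assume "x \<in> {v \<in> carrier V. \<forall>\<epsilon>>0. \<exists>u\<in>W. N (v \<ominus> u) < \<epsilon>}"
      "y \<in> {v \<in> carrier V. \<forall>\<epsilon>>0. \<exists>u\<in>W. N (v \<ominus> u) < \<epsilon>}" and e: "\<epsilon> > 0"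
    then have xy: "x \<in> carrier V" "y \<in> carrier V"
      and "\<exists>u\<in>W. N (x \<ominus> u) < \<epsilon>/2" "\<exists>u\<in>W. N (y \<ominus> u) < \<epsilon>/2"
      using half_gt_zero[OF e] by blast+
    then obtain u v where uv: "u \<in> W" "v \<in> W" "N (x \<ominus> u) < \<epsilon>/2" "N (y \<ominus> v) < \<epsilon>/2" by blast
    have "N ((x \<oplus> y) \<ominus> (u \<oplus> v)) \<le> N (x \<ominus> u) + N (y \<ominus> v)"
      using xy uv(1,2) Wc by (simp add: add_diff_add norm_triangle)
    then show "\<exists>u\<in>W. N ((x \<oplus> y) \<ominus> u) < \<epsilon>"
      using uv W(3)[OF uv(1,2)] by (intro bexI[of _ "u \<oplus> v"]) auto
  next
    fix c x and \<epsilon> :: real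
    assume "x \<in> {v \<in> carrier V. \<forall>\<epsilon>>0. \<exists>u\<in>W. N (v \<ominus> u) < \<epsilon>}" and e: "\<epsilon> > 0"
    then have x: "x \<in> carrier V" and "\<exists>u\<in>W. N (x \<ominus> u) < \<epsilon> / (cmod c + 1)"
      by (auto simp: add_nonneg_pos)
    then obtain u where u: "u \<in> W" "N (x \<ominus> u) < \<epsilon> / (cmod c + 1)" by blast
    have "N (c \<odot> x \<ominus> c \<odot> u) = cmod c * N (x \<ominus> u)"
      using x u Wc by (simp add: norm_smult flip: smult_diff)
    also have "\<dots> \<le> (cmod c + 1) * N (x \<ominus> u)"
      using x u(1) Wc by (intro mult_right_mono) auto
    also have "\<dots> < (cmod c + 1) * (\<epsilon> / (cmod c + 1))"
      using u(2) by (intro mult_strict_left_mono) (auto simp: add_nonneg_pos)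
    also have "\<dots> = \<epsilon>"
      using add_nonneg_pos[of "cmod c" 1] by simp
    finally show "\<exists>u\<in>W. N (c \<odot> x \<ominus> u) < \<epsilon>"
      using W(4)[OF u(1)] by blast
  next
    fix v and \<epsilon> :: real
    assume v: "v \<in> carrier V"
      and *: "\<forall>\<epsilon>>0. \<exists>u\<in>{v \<in> carrier V. \<forall>\<epsilon>>0. \<exists>u\<in>W. N (v \<ominus> u) < \<epsilon>}. N (v \<ominus> u) < \<epsilon>"
      and e: "\<epsilon> > 0"
    from * e obtain u where u: "u \<in> carrier V" "\<forall>\<epsilon>>0. \<exists>w\<in>W. N (u \<ominus> w) < \<epsilon>" "N (v \<ominus> u) < \<epsilon>/2"
      using half_gt_zero[OF e] by blast
    then obtain w where w: "w \<in> W" "N (u \<ominus> w) < \<epsilon>/2" using half_gt_zero[OF e] by blast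
    have "N (v \<ominus> w) < \<epsilon>"
      using norm_triangle_diff[OF v u(1) Wc[OF w(1)]] u(3) w(2) by linarith
    then show "\<exists>u\<in>W. N (v \<ominus> u) < \<epsilon>" using w(1) by blast
  qed auto
qed

text \<open>The metric closure of a submodule is a closed subspace, so totality of a subset forces
  it to be everything. The way back, from metric density to totality, is
  \<open>hdense_total\<close>.\<close>

lemma submodule_dense:
  assumes "submodule W complex_ring V" "total_set V N X" "X \<subseteq> W"
  shows "MS.mtopology closure_of W = carrier V"
proof -
  note W = submoduleD[OF assms(1)]
  have "\<forall>\<epsilon>>0. \<exists>u\<in>W. N (v \<ominus> u) < \<epsilon>" if "v \<in> carrier V" for v
  proof (rule total_set_induct[OF assms(2) closed_subspace_closure[OF assms(1)] _ that])
    fix x assume "x \<in> X"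
    then have "x \<in> W" "x \<in> carrier V" using assms(3) W(1) by auto
    then show "\<forall>\<epsilon>>0. \<exists>u\<in>W. N (x \<ominus> u) < \<epsilon>"
      by (intro allI impI bexI[of _ x]) auto
  qed
  then show ?thesis using W(1) by (simp add: closure_of_eq_carrier_iff)
qed

lemma closed_subspace_imp_submodule: "closed_subspace V N Q \<Longrightarrow> submodule Q complex_ring V"
  by (rule submoduleI) (auto simp: closed_subspace_def)

lemma closed_subspace_imp_closedin:
  assumes "closed_subspace V N Q"
  shows "closedin MS.mtopology Q"
proof -
  note Q = closed_subspaceD[OF assms]
  have "MS.mtopology closure_of Q \<subseteq> Q"
  proof
    fix x assume "x \<in> MS.mtopology closure_of Q"
    then have "x \<in> carrier V" and "\<forall>\<epsilon>>0. \<exists>y\<in>Q. norm_dist V N x y < \<epsilon>"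
      unfolding MS.metric_closure_of MS.in_mball by blast+
    then show "x \<in> Q"
      using Q(1) by (intro Q(5)) (auto simp: norm_dist_def subset_iff)
  qed
  then show ?thesis
    using Q(1) closure_of_subset_eq[of Q MS.mtopology] by simp
qed

lemma closed_subspace_equalizer:
  fixes f g :: "_ \<Rightarrow> complex"
  assumes f: "\<And>x y. x \<in> carrier V \<Longrightarrow> y \<in> carrier V \<Longrightarrow> f (x \<oplus> y) = f x + f y"
      "\<And>c x. x \<in> carrier V \<Longrightarrow> f (c \<odot> x) = c * f x" "\<And>x. x \<in> carrier V \<Longrightarrow> cmod (f x) \<le> C * N x"
    and g: "\<And>x y. x \<in> carrier V \<Longrightarrow> y \<in> carrier V \<Longrightarrow> g (x \<oplus> y) = g x + g y"
      "\<And>c x. x \<in> carrier V \<Longrightarrow> g (c \<odot> x) = c * g x" "\<And>x. x \<in> carrier V \<Longrightarrow> cmod (g x) \<le> C' * N x"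
  shows "closed_subspace V N {x \<in> carrier V. f x = g x}"
proof -
  have zero: "f \<zero> = 0" "g \<zero> = 0" using f(2)[of \<zero> 0] g(2)[of \<zero> 0] by auto
  have closed: "f v = g v"
    if v: "v \<in> carrier V" and *: "\<forall>\<epsilon>>0. \<exists>u\<in>{x \<in> carrier V. f x = g x}. N (v \<ominus> u) < \<epsilon>" for v
  proof -
    have "cmod (f v - g v) < \<epsilon>" if e: "\<epsilon> > 0" for \<epsilon>
    proof -
      \<comment> \<open>Neither \<open>C\<close> nor \<open>C'\<close> is assumed nonnegative, hence
        the absolute values; the 1 keeps \<open>K\<close> positive for the division.\<close>
      define K where "K = \<bar>C\<bar> + \<bar>C'\<bar> + 1"
      have K: "K > 0" by (simp add: K_def)
      with e have "\<epsilon> / K > 0" by simp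
      with * obtain u where u: "u \<in> carrier V" "f u = g u" "N (v \<ominus> u) < \<epsilon> / K" by blast
      have "f v - g v = f (v \<ominus> u) - g (v \<ominus> u)"
        using v u f(1,2) g(1,2) by (simp add: diff_eq_smult)
      also have "cmod \<dots> \<le> C * N (v \<ominus> u) + C' * N (v \<ominus> u)"
        using norm_triangle_ineq4[of "f (v \<ominus> u)" "g (v \<ominus> u)"] f(3)[of "v \<ominus> u"] g(3)[of "v \<ominus> u"] v u
        by force
      also have "\<dots> \<le> K * N (v \<ominus> u)"
        using v u(1) by (simp add: K_def mult_right_mono flip: distrib_right)
      also have "\<dots> < \<epsilon>" using u(3) K by (simp add: field_simps)
      finally show ?thesis .
    qed
    from this[of "cmod (f v - g v)"] show ?thesis by fastforce
  qed
  show ?thesis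
    unfolding closed_subspace_def using closed by (auto simp: f(1,2) g(1,2) zero)
qed

end

lemma closed_subspace_vimage:
  assumes V: "normed_module V N" and W: "normed_module W N'" and f: "lin_map V W f"
    and bound: "\<And>x. x \<in> carrier V \<Longrightarrow> N' (f x) \<le> C * N x" and Q: "closed_subspace W N' Q"
  shows "closed_subspace V N {x \<in> carrier V. f x \<in> Q}"
proof -
  interpret V: normed_module V N by fact
  interpret W: normed_module W N' by fact
  note Q' = closed_subspaceD[OF Q]
  have closed: "f v \<in> Q"
    if v: "v \<in> carrier V" and *: "\<forall>\<epsilon>>0. \<exists>u\<in>{x \<in> carrier V. f x \<in> Q}. N (v \<ominus>\<^bsub>V\<^esub> u) < \<epsilon>" for v
  proof (rule Q'(5))
    show "f v \<in> carrier W" using lin_mapD(1)[OF f v] .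
    fix \<epsilon> :: real assume e: "\<epsilon> > 0"
    have K: "\<bar>C\<bar> + 1 > 0" by simp
    with e have "\<epsilon> / (\<bar>C\<bar> + 1) > 0" by simp
    with * obtain u where u: "u \<in> carrier V" "f u \<in> Q" "N (v \<ominus>\<^bsub>V\<^esub> u) < \<epsilon> / (\<bar>C\<bar> + 1)" by blast
    have "N' (f v \<ominus>\<^bsub>W\<^esub> f u) = N' (f (v \<ominus>\<^bsub>V\<^esub> u))"
      using lin_map_diff[OF V.complex_module_axioms W.complex_module_axioms f v u(1)] by simp
    also have "\<dots> \<le> C * N (v \<ominus>\<^bsub>V\<^esub> u)" using bound v u(1) by auto
    also have "\<dots> \<le> (\<bar>C\<bar> + 1) * N (v \<ominus>\<^bsub>V\<^esub> u)" using v u(1) by (intro mult_right_mono) auto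
    also have "\<dots> < \<epsilon>" using u(3) K by (simp add: field_simps)
    finally show "\<exists>w\<in>Q. N' (f v \<ominus>\<^bsub>W\<^esub> w) < \<epsilon>" using u(2) by blast
  qed
  show ?thesis
    unfolding closed_subspace_def using closed Q'(2-4)
    by (auto simp: lin_mapD[OF f] lin_map_zero[OF V.complex_module_axioms W.complex_module_axioms f])
qed

lemma closed_subspace_lin_equalizer:
  assumes V: "normed_module V N" and W: "normed_module W N'"
    and f: "lin_map V W f" "\<And>x. x \<in> carrier V \<Longrightarrow> N' (f x) \<le> C * N x"
    and g: "lin_map V W g" "\<And>x. x \<in> carrier V \<Longrightarrow> N' (g x) \<le> C' * N x"
  shows "closed_subspace V N {x \<in> carrier V. f x = g x}"
proof -
  interpret V: normed_module V N by fact
  interpret W: normed_module W N' by fact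
  note F = lin_mapD[OF f(1)] and G = lin_mapD[OF g(1)]
  have lin: "lin_map V W (\<lambda>x. f x \<ominus>\<^bsub>W\<^esub> g x)"
    using F G by (intro lin_mapI) (auto simp: W.add_diff_add W.smult_diff)
  have bd: "N' (f x \<ominus>\<^bsub>W\<^esub> g x) \<le> (C + C') * N x" if x: "x \<in> carrier V" for x
  proof -
    have "N' (f x \<ominus>\<^bsub>W\<^esub> g x) \<le> N' (f x) + N' ((- 1) \<odot>\<^bsub>W\<^esub> g x)"
      using x F(1) G(1) by (simp add: W.diff_eq_smult W.norm_triangle)
    then show ?thesis
      using f(2)[OF x] g(2)[OF x] G(1)[OF x] by (simp add: W.norm_smult algebra_simps)
  qed
  have "{x \<in> carrier V. f x = g x} = {x \<in> carrier V. f x \<ominus>\<^bsub>W\<^esub> g x \<in> {\<zero>\<^bsub>W\<^esub>}}"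
    using F(1) G(1) by (auto dest: W.diff_eq_zeroD)
  then show ?thesis
    using closed_subspace_vimage[OF V W lin bd W.closed_subspace_zero] by simp
qed

section \<open>Hilbert spaces\<close>

lemma hilbert_spaceD:
  assumes "hilbert_space H"
  shows "module complex_ring H"
    "\<And>u v w. u \<in> carrier H \<Longrightarrow> v \<in> carrier H \<Longrightarrow> w \<in> carrier H \<Longrightarrow>
      ip H u (v \<oplus>\<^bsub>H\<^esub> w) = ip H u v + ip H u w"
    "\<And>c u v. u \<in> carrier H \<Longrightarrow> v \<in> carrier H \<Longrightarrow> ip H u (c \<odot>\<^bsub>H\<^esub> v) = c * ip H u v"
    "\<And>u v. u \<in> carrier H \<Longrightarrow> v \<in> carrier H \<Longrightarrow> ip H v u = cnj (ip H u v)"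
    "\<And>v. v \<in> carrier H \<Longrightarrow> ip H v v \<in> \<real>\<^sub>\<ge>\<^sub>0"
    "\<And>v. v \<in> carrier H \<Longrightarrow> ip H v v = 0 \<Longrightarrow> v = \<zero>\<^bsub>H\<^esub>"
    "Metric_space.mcomplete (carrier H) (hdist H)"
  using assms unfolding hilbert_space_def by blast+

locale hilbert =
  fixes H (structure)
  assumes hilbert_space: "hilbert_space H"
begin

sublocale complex_module H
  by (rule complex_module.intro) (rule hilbert_spaceD(1)[OF hilbert_space])

lemma ip_add_right [simp]:
  "u \<in> carrier H \<Longrightarrow> v \<in> carrier H \<Longrightarrow> w \<in> carrier H \<Longrightarrow> ip H u (v \<oplus> w) = ip H u v + ip H u w"
  by (rule hilbert_spaceD(2)[OF hilbert_space])

lemma ip_smult_right [simp]: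
  "u \<in> carrier H \<Longrightarrow> v \<in> carrier H \<Longrightarrow> ip H u (c \<odot> v) = c * ip H u v"
  by (rule hilbert_spaceD(3)[OF hilbert_space])

lemma ip_commute: "u \<in> carrier H \<Longrightarrow> v \<in> carrier H \<Longrightarrow> ip H v u = cnj (ip H u v)"
  by (rule hilbert_spaceD(4)[OF hilbert_space])

lemma ip_add_left [simp]:
  "u \<in> carrier H \<Longrightarrow> v \<in> carrier H \<Longrightarrow> w \<in> carrier H \<Longrightarrow> ip H (u \<oplus> v) w = ip H u w + ip H v w"
  using ip_commute[of w "u \<oplus> v"] ip_commute[of w u] ip_commute[of w v] by simp

lemma ip_smult_left [simp]:
  "u \<in> carrier H \<Longrightarrow> v \<in> carrier H \<Longrightarrow> ip H (c \<odot> u) v = cnj c * ip H u v"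
  using ip_commute[of v "c \<odot> u"] ip_commute[of v u] by simp

lemma ip_zero_right [simp]: "u \<in> carrier H \<Longrightarrow> ip H u \<zero> = 0"
  using ip_smult_right[of u \<zero> 0] by simp

lemma ip_zero_left [simp]: "u \<in> carrier H \<Longrightarrow> ip H \<zero> u = 0"
  using ip_smult_left[of \<zero> u 0] by simp

lemma ip_diff_right [simp]:
  "u \<in> carrier H \<Longrightarrow> v \<in> carrier H \<Longrightarrow> w \<in> carrier H \<Longrightarrow> ip H u (v \<ominus> w) = ip H u v - ip H u w"
  by (simp add: diff_eq_smult)

lemma ip_diff_left [simp]:
  "u \<in> carrier H \<Longrightarrow> v \<in> carrier H \<Longrightarrow> w \<in> carrier H \<Longrightarrow> ip H (u \<ominus> v) w = ip H u w - ip H v w"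
  by (simp add: diff_eq_smult)

lemma ip_self: "v \<in> carrier H \<Longrightarrow> ip H v v = complex_of_real ((hnorm H v)\<^sup>2)"
proof -
  assume "v \<in> carrier H"
  then have "ip H v v \<in> \<real>\<^sub>\<ge>\<^sub>0" by (rule hilbert_spaceD(5)[OF hilbert_space])
  then show ?thesis
    by (auto simp: hnorm_def complex_nonneg_Reals_iff complex_eq_iff)
qed

lemma hnorm_nonneg [simp]: "v \<in> carrier H \<Longrightarrow> 0 \<le> hnorm H v"
proof -
  assume "v \<in> carrier H"
  then have "ip H v v \<in> \<real>\<^sub>\<ge>\<^sub>0" by (rule hilbert_spaceD(5)[OF hilbert_space])
  then show ?thesis by (auto simp: hnorm_def complex_nonneg_Reals_iff)
qed

lemma hnorm_eq_zero: "v \<in> carrier H \<Longrightarrow> hnorm H v = 0 \<longleftrightarrow> v = \<zero>"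
proof
  assume v: "v \<in> carrier H"
  { assume "hnorm H v = 0"
    with v have "ip H v v = 0" by (simp add: ip_self)
    with v show "v = \<zero>" by (intro hilbert_spaceD(6)[OF hilbert_space]) }
  { assume "v = \<zero>"
    then show "hnorm H v = 0" by (simp add: hnorm_def) }
qed

lemma hnorm_sq_add:
  assumes "u \<in> carrier H" "v \<in> carrier H"
  shows "(hnorm H (u \<oplus> v))\<^sup>2 = (hnorm H u)\<^sup>2 + (hnorm H v)\<^sup>2 + 2 * Re (ip H u v)"
proof -
  have "complex_of_real ((hnorm H (u \<oplus> v))\<^sup>2) = ip H (u \<oplus> v) (u \<oplus> v)"
    using assms by (simp add: ip_self del: ip_add_left ip_add_right)
  also have "\<dots> = ip H u u + ip H v v + (ip H u v + cnj (ip H u v))"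
    using assms ip_commute[of u v] by simp
  also have "\<dots> = complex_of_real ((hnorm H u)\<^sup>2 + (hnorm H v)\<^sup>2 + 2 * Re (ip H u v))"
    using assms by (simp add: ip_self complex_add_cnj)
  finally show ?thesis by (simp only: of_real_eq_iff)
qed

lemma hnorm_smult: "v \<in> carrier H \<Longrightarrow> hnorm H (c \<odot> v) = cmod c * hnorm H v"
proof -
  assume v: "v \<in> carrier H"
  have "complex_of_real ((hnorm H (c \<odot> v))\<^sup>2) = ip H (c \<odot> v) (c \<odot> v)"
    using v by (simp add: ip_self del: ip_smult_left ip_smult_right)
  also have "\<dots> = (c * cnj c) * ip H v v" using v by simp
  also have "\<dots> = complex_of_real ((cmod c * hnorm H v)\<^sup>2)"
    using v by (simp add: ip_self complex_norm_square[symmetric] power_mult_distrib)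
  finally have "(hnorm H (c \<odot> v))\<^sup>2 = (cmod c * hnorm H v)\<^sup>2" by (simp only: of_real_eq_iff)
  then show ?thesis using v by (simp add: power2_eq_iff_nonneg)
qed

lemma cauchy_schwarz:
  assumes "u \<in> carrier H" "v \<in> carrier H"
  shows "cmod (ip H u v) \<le> hnorm H u * hnorm H v"
proof (cases "v = \<zero>")
  case True
  then show ?thesis using assms by simp
next
  case False
  then have pos: "hnorm H v > 0"
    using assms(2) hnorm_eq_zero[of v] hnorm_nonneg[of v] by linarith
  define a where "a = ip H u v"
  define r where "r = (hnorm H v)\<^sup>2"
  have r: "r > 0" using pos by (simp add: r_def)
  \<comment> \<open>With this scalar \<open>u \<oplus> c \<odot> v\<close> is the component of
    \<open>u\<close> orthogonal to \<open>v\<close>; its squared norm being nonnegative is the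
    inequality.\<close>
  define c where "c = - cnj a / complex_of_real r"
  have "c * a = - complex_of_real ((cmod a)\<^sup>2 / r)"
    using complex_norm_square[of a] by (simp add: c_def mult.commute)
  then have re: "Re (c * a) = - ((cmod a)\<^sup>2 / r)" by simp
  have cm: "(cmod c)\<^sup>2 * r = (cmod a)\<^sup>2 / r"
    using r by (simp add: c_def norm_divide power_divide power2_eq_square)
  have "0 \<le> (hnorm H (u \<oplus> c \<odot> v))\<^sup>2" by simp
  also have "\<dots> = (hnorm H u)\<^sup>2 + (cmod c)\<^sup>2 * r + 2 * Re (c * a)"
    using assms by (simp add: hnorm_sq_add hnorm_smult power_mult_distrib a_def r_def)
  also have "\<dots> = (hnorm H u)\<^sup>2 - (cmod a)\<^sup>2 / r" unfolding re cm by simp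
  finally have "(cmod a)\<^sup>2 \<le> (hnorm H u * hnorm H v)\<^sup>2"
    using r by (simp add: field_simps power_mult_distrib r_def)
  then show ?thesis
    unfolding a_def by (rule power2_le_imp_le) (use assms in simp)
qed

lemma hnorm_triangle:
  assumes "u \<in> carrier H" "v \<in> carrier H"
  shows "hnorm H (u \<oplus> v) \<le> hnorm H u + hnorm H v"
proof (rule power2_le_imp_le)
  have "Re (ip H u v) \<le> hnorm H u * hnorm H v"
    using cauchy_schwarz[OF assms] complex_Re_le_cmod[of "ip H u v"] by linarith
  then show "(hnorm H (u \<oplus> v))\<^sup>2 \<le> (hnorm H u + hnorm H v)\<^sup>2"
    using assms by (simp add: hnorm_sq_add power2_sum)
qed (use assms in auto)

sublocale normed_module H "hnorm H"
  using hnorm_nonneg hnorm_eq_zero hnorm_smult hnorm_triangle by unfold_locales auto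

lemma complete: "MS.mcomplete"
  using hilbert_spaceD(7)[OF hilbert_space] by (simp add: hdist_def)

lemma hdense_iff:
  "X \<subseteq> carrier H \<Longrightarrow> hdense H X \<longleftrightarrow> (\<forall>v\<in>carrier H. \<forall>\<epsilon>>0. \<exists>u\<in>X. hnorm H (v \<ominus> u) < \<epsilon>)"
  unfolding hdense_def hdist_def by (rule closure_of_eq_carrier_iff)

lemma hdense_submodule:
  "submodule W complex_ring H \<Longrightarrow> total_set H (hnorm H) X \<Longrightarrow> X \<subseteq> W \<Longrightarrow> hdense H W"
  unfolding hdense_def hdist_def by (rule submodule_dense)

lemma hdense_total:
  assumes "hdense H W" "W \<subseteq> carrier H" "\<And>Q. closed_subspace H (hnorm H) Q \<Longrightarrow> X \<subseteq> Q \<Longrightarrow> W \<subseteq> Q"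
    and "X \<subseteq> carrier H"
  shows "total_set H (hnorm H) X"
  unfolding total_set_def
proof (intro conjI allI impI assms(4) subset_antisym subsetI; (elim conjE)?)
  fix Q v assume Q: "closed_subspace H (hnorm H) Q" "X \<subseteq> Q"
  show "v \<in> carrier H" if "v \<in> Q" using closed_subspaceD(1)[OF Q(1)] that by auto
  show "v \<in> Q" if v: "v \<in> carrier H"
  proof (rule closed_subspaceD(5)[OF Q(1) v])
    fix \<epsilon> :: real assume "\<epsilon> > 0"
    then show "\<exists>u\<in>Q. hnorm H (v \<ominus> u) < \<epsilon>"
      using assms(1)[unfolded hdense_iff[OF assms(2)]] v assms(3)[OF Q] by blast
  qed
qed

text \<open>Besides uniqueness claims, this settles identities between vectors: the rules for
  \<open>ip\<close> are simplification rules, so testing against \<open>w\<close> leaves scalar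
  arithmetic.\<close>

lemma eq_by_ip:
  assumes "u \<in> carrier H" "v \<in> carrier H" "\<And>w. w \<in> carrier H \<Longrightarrow> ip H w u = ip H w v"
  shows "u = v"
proof -
  have "ip H (u \<ominus> v) (u \<ominus> v) = 0" using assms(1,2) assms(3)[of "u \<ominus> v"] by simp
  then have "hnorm H (u \<ominus> v) = 0" by (simp add: hnorm_def)
  then have "u \<ominus> v = \<zero>" using assms by (simp add: hnorm_eq_zero)
  then show ?thesis by (rule diff_eq_zeroD[OF assms(1,2)])
qed

lemma closed_subspace_ip_eq:
  assumes "u \<in> carrier H" "w \<in> carrier H"
  shows "closed_subspace H (hnorm H) {v \<in> carrier H. ip H u v = ip H w v}"
  using assms cauchy_schwarz
  by (intro closed_subspace_equalizer[where C = "hnorm H u" and C' = "hnorm H w"]) auto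

lemma eq_by_total:
  assumes "total_set H (hnorm H) X" "u \<in> carrier H" "v \<in> carrier H"
    and "\<And>x. x \<in> X \<Longrightarrow> ip H x u = ip H x v"
  shows "u = v"
proof (rule eq_by_ip[OF assms(2,3)])
  fix w assume w: "w \<in> carrier H"
  have X: "X \<subseteq> carrier H" using assms(1) by (simp add: total_set_def)
  \<comment> \<open>The varying vector has to stand in the linear slot, so the claim is proved with
    the slots exchanged.\<close>
  have "ip H u w = ip H v w"
  proof (rule total_set_induct[OF assms(1) closed_subspace_ip_eq[OF assms(2,3)] _ w])
    fix x assume x: "x \<in> X"
    then have "x \<in> carrier H" using X by auto
    then show "ip H u x = ip H v x"
      using assms(4)[OF x] ip_commute[of x u] ip_commute[of x v] assms(2,3) by simp
  qed
  then show "ip H w u = ip H w v" using w assms(2,3) ip_commute[of u w] ip_commute[of v w] by simp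
qed

lemma ip_finsum_right:
  assumes "finite Y" "u \<in> carrier H" "\<And>i. i \<in> Y \<Longrightarrow> g i \<in> carrier H"
  shows "ip H u (finsum H g Y) = (\<Sum>i\<in>Y. ip H u (g i))"
  using assms(1,3)
proof (induction Y)
  case (insert i Y)
  then have "g \<in> Y \<rightarrow> carrier H" by auto
  with insert assms(2) show ?case by (simp add: finsum_insert)
qed (use assms(2) in simp)

lemma ip_finsum_left:
  assumes "finite Y" "u \<in> carrier H" "\<And>i. i \<in> Y \<Longrightarrow> g i \<in> carrier H"
  shows "ip H (finsum H g Y) u = (\<Sum>i\<in>Y. ip H (g i) u)"
proof -
  have "finsum H g Y \<in> carrier H" using assms(3) by (intro finsum_closed) auto
  then have "ip H (finsum H g Y) u = cnj (ip H u (finsum H g Y))"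
    using assms(2) by (intro ip_commute)
  also have "\<dots> = (\<Sum>i\<in>Y. ip H (g i) u)"
    using assms ip_commute[of u] by (simp add: ip_finsum_right)
  finally show ?thesis .
qed

end

subsection \<open>Orthonormal families\<close>

locale orthonormal = hilbert H for H (structure) +
  fixes X and f
  assumes f_closed [simp]: "i \<in> X \<Longrightarrow> f i \<in> carrier H"
    and f_ip: "i \<in> X \<Longrightarrow> j \<in> X \<Longrightarrow> ip H (f i) (f j) = (if i = j then 1 else 0)"
begin

definition comb where "comb c Y = finsum H (\<lambda>i. c i \<odot> f i) Y"

lemma comb_closed [simp]: "Y \<subseteq> X \<Longrightarrow> comb c Y \<in> carrier H"
  unfolding comb_def by (intro finsum_closed) auto

lemma ip_comb_right: "finite Y \<Longrightarrow> Y \<subseteq> X \<Longrightarrow> u \<in> carrier H \<Longrightarrow>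
    ip H u (comb c Y) = (\<Sum>i\<in>Y. c i * ip H u (f i))"
  unfolding comb_def by (subst ip_finsum_right) (auto intro!: sum.cong)

lemma ip_comb_left: "finite Y \<Longrightarrow> Y \<subseteq> X \<Longrightarrow> u \<in> carrier H \<Longrightarrow>
    ip H (comb c Y) u = (\<Sum>i\<in>Y. cnj (c i) * ip H (f i) u)"
  unfolding comb_def by (subst ip_finsum_left) (auto intro!: sum.cong)

lemma coeff_comb:
  assumes "finite Y" "Y \<subseteq> X" "j \<in> X"
  shows "ip H (f j) (comb c Y) = (if j \<in> Y then c j else 0)"
proof -
  have "ip H (f j) (comb c Y) = (\<Sum>i\<in>Y. if i = j then c i else 0)"
    unfolding ip_comb_right[OF assms(1,2) f_closed[OF assms(3)]]
    using assms by (intro sum.cong) (auto simp: f_ip)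
  then show ?thesis using assms(1) by simp
qed

lemma comb_Un_disjoint:
  assumes "finite Y" "finite Z" "Y \<inter> Z = {}" "Y \<subseteq> X" "Z \<subseteq> X"
  shows "comb c (Y \<union> Z) = comb c Y \<oplus> comb c Z"
  unfolding comb_def using assms by (intro finsum_Un_disjoint) auto

lemma comb_add:
  assumes "finite Y" "Y \<subseteq> X"
  shows "comb (\<lambda>i. c i + d i) Y = comb c Y \<oplus> comb d Y"
  by (rule eq_by_ip) (use assms in \<open>auto simp: ip_comb_right sum.distrib algebra_simps\<close>)

lemma comb_smult:
  assumes "finite Y" "Y \<subseteq> X"
  shows "comb (\<lambda>i. a * c i) Y = a \<odot> comb c Y"
  by (rule eq_by_ip) (use assms in \<open>auto simp: ip_comb_right sum_distrib_left algebra_simps\<close>)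

lemma hnorm_comb:
  assumes "finite Y" "Y \<subseteq> X"
  shows "(hnorm H (comb c Y))\<^sup>2 = (\<Sum>i\<in>Y. (cmod (c i))\<^sup>2)"
proof -
  have "complex_of_real ((hnorm H (comb c Y))\<^sup>2) = ip H (comb c Y) (comb c Y)"
    using assms by (simp add: ip_self)
  also have "\<dots> = (\<Sum>i\<in>Y. cnj (c i) * c i)"
    using assms by (subst ip_comb_left) (auto simp: coeff_comb subset_iff intro!: sum.cong)
  also have "\<dots> = complex_of_real (\<Sum>i\<in>Y. (cmod (c i))\<^sup>2)"
    by (simp only: of_real_sum) (intro sum.cong refl, simp only: complex_norm_square mult.commute)
  finally show ?thesis by (simp only: of_real_eq_iff)
qed

text \<open>Completing the square in each coefficient. Bessel's inequality, best approximation and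
  the estimate behind the finite nets are all read off from this identity.\<close>

lemma hnorm_diff_comb:
  assumes "finite Y" "Y \<subseteq> X" "v \<in> carrier H"
  shows "(hnorm H (v \<ominus> comb c Y))\<^sup>2 =
    (hnorm H v)\<^sup>2 - (\<Sum>i\<in>Y. (cmod (ip H (f i) v))\<^sup>2) + (\<Sum>i\<in>Y. (cmod (c i - ip H (f i) v))\<^sup>2)"
proof -
  have *: "(cmod (a - b))\<^sup>2 = (cmod a)\<^sup>2 + (cmod b)\<^sup>2 - 2 * Re (cnj a * b)" for a b
    by (simp only: cmod_power2) (simp add: power2_eq_square algebra_simps)
  have "(hnorm H (v \<ominus> comb c Y))\<^sup>2 = (hnorm H v)\<^sup>2 + (hnorm H (comb c Y))\<^sup>2 - 2 * Re (ip H v (comb c Y))"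
    using assms by (simp add: diff_eq_smult hnorm_sq_add hnorm_smult)
  moreover have "Re (ip H v (comb c Y)) = Re (ip H (comb c Y) v)"
    using assms ip_commute[of v "comb c Y"] by simp
  moreover have "Re (ip H (comb c Y) v) = (\<Sum>i\<in>Y. Re (cnj (c i) * ip H (f i) v))"
    using assms by (simp add: ip_comb_left)
  ultimately show ?thesis
    using assms by (simp add: hnorm_comb * sum.distrib sum_subtractf sum_distrib_left)
qed

abbreviation proj where "proj Y v \<equiv> comb (\<lambda>i. ip H (f i) v) Y"

lemma hnorm_diff_proj:
  assumes "finite Y" "Y \<subseteq> X" "v \<in> carrier H"
  shows "(hnorm H (v \<ominus> proj Y v))\<^sup>2 = (hnorm H v)\<^sup>2 - (\<Sum>i\<in>Y. (cmod (ip H (f i) v))\<^sup>2)"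
  using hnorm_diff_comb[OF assms, of "\<lambda>i. ip H (f i) v"] by simp

lemma bessel:
  assumes "finite Y" "Y \<subseteq> X" "v \<in> carrier H"
  shows "(\<Sum>i\<in>Y. (cmod (ip H (f i) v))\<^sup>2) \<le> (hnorm H v)\<^sup>2"
  using hnorm_diff_proj[OF assms] zero_le_power2[of "hnorm H (v \<ominus> proj Y v)"] by linarith

lemma best_approximation:
  assumes "finite Y'" "Y \<subseteq> Y'" "Y' \<subseteq> X" "v \<in> carrier H"
  shows "hnorm H (v \<ominus> proj Y' v) \<le> hnorm H (v \<ominus> comb c Y)"
proof (rule power2_le_imp_le)
  have Y: "finite Y" "Y \<subseteq> X" using assms finite_subset by auto
  have "(\<Sum>i\<in>Y. (cmod (ip H (f i) v))\<^sup>2) \<le> (\<Sum>i\<in>Y'. (cmod (ip H (f i) v))\<^sup>2)"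
    using assms by (intro sum_mono2) auto
  moreover have "0 \<le> (\<Sum>i\<in>Y. (cmod (c i - ip H (f i) v))\<^sup>2)" by (intro sum_nonneg) auto
  ultimately show "(hnorm H (v \<ominus> proj Y' v))\<^sup>2 \<le> (hnorm H (v \<ominus> comb c Y))\<^sup>2"
    unfolding hnorm_diff_comb[OF Y assms(4)] hnorm_diff_proj[OF assms(1,3,4)] by linarith
qed (use assms in auto)

end

locale orthonormal_basis = orthonormal H X f for H (structure) and X f +
  assumes total: "total_set H (hnorm H) (f ` X)"
begin

text \<open>The approximable vectors form a closed subspace containing the basis. Quantifying over
  all larger \<open>Y'\<close> gives convergence along finite subsets, as \<open>has_sum\<close>
  expects, and lets the sets found for two vectors be replaced by their union.\<close>

lemma proj_approx:
  assumes "v \<in> carrier H" "\<epsilon> > 0"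
  shows "\<exists>Y. finite Y \<and> Y \<subseteq> X \<and> (\<forall>Y'. finite Y' \<and> Y \<subseteq> Y' \<and> Y' \<subseteq> X \<longrightarrow> hnorm H (v \<ominus> proj Y' v) < \<epsilon>)"
proof -
  define P where "P v \<epsilon> \<longleftrightarrow> (\<exists>Y. finite Y \<and> Y \<subseteq> X \<and>
      (\<forall>Y'. finite Y' \<and> Y \<subseteq> Y' \<and> Y' \<subseteq> X \<longrightarrow> hnorm H (v \<ominus> proj Y' v) < \<epsilon>))" for v \<epsilon>
  \<comment> \<open>Any finite combination close to \<open>v\<close> is a witness: taking the
    optimal coefficients and adding indices can only reduce the distance.\<close>
  have PI: "P v \<epsilon>" if "finite Y" "Y \<subseteq> X" "v \<in> carrier H" "hnorm H (v \<ominus> comb c Y) < \<epsilon>" for v \<epsilon> c Y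
    unfolding P_def
  proof (intro exI[of _ Y] conjI allI impI that(1,2))
    fix Y' assume "finite Y' \<and> Y \<subseteq> Y' \<and> Y' \<subseteq> X"
    then show "hnorm H (v \<ominus> proj Y' v) < \<epsilon>"
      using best_approximation[of Y' Y v c] that by force
  qed
  have closed: "closed_subspace H (hnorm H) {v \<in> carrier H. \<forall>\<epsilon>>0. P v \<epsilon>}"
    unfolding closed_subspace_def mem_Collect_eq
  proof (intro conjI ballI allI impI)
    fix \<epsilon> :: real assume "\<epsilon> > 0"
    then show "P \<zero> \<epsilon>" by (intro PI[of "{}" _ "\<lambda>_. 0"]) (auto simp: comb_def)
  next
    fix x y and \<epsilon> :: real
    assume xy: "x \<in> {v \<in> carrier H. \<forall>\<epsilon>>0. P v \<epsilon>}" "y \<in> {v \<in> carrier H. \<forall>\<epsilon>>0. P v \<epsilon>}"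
      and e: "\<epsilon> > 0"
    then have "P x (\<epsilon>/2)" and Py: "P y (\<epsilon>/2)" using half_gt_zero[OF e] by blast+
    then obtain Y where
      Y: "finite Y \<and> Y \<subseteq> X \<and> (\<forall>Y'. finite Y' \<and> Y \<subseteq> Y' \<and> Y' \<subseteq> X \<longrightarrow> hnorm H (x \<ominus> proj Y' x) < \<epsilon>/2)"
      unfolding P_def by (elim exE)
    from Py obtain Z where
      Z: "finite Z \<and> Z \<subseteq> X \<and> (\<forall>Y'. finite Y' \<and> Z \<subseteq> Y' \<and> Y' \<subseteq> X \<longrightarrow> hnorm H (y \<ominus> proj Y' y) < \<epsilon>/2)"
      unfolding P_def by (elim exE)
    define W where "W = Y \<union> Z"
    have W: "finite W" "W \<subseteq> X" using Y Z by (auto simp: W_def)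
    have c: "x \<in> carrier H" "y \<in> carrier H" using xy by auto
    have "hnorm H ((x \<oplus> y) \<ominus> (proj W x \<oplus> proj W y)) \<le> hnorm H (x \<ominus> proj W x) + hnorm H (y \<ominus> proj W y)"
      using c W by (simp add: add_diff_add norm_triangle)
    also have "\<dots> < \<epsilon>"
      using Y[THEN conjunct2, THEN conjunct2, rule_format, of W]
        Z[THEN conjunct2, THEN conjunct2, rule_format, of W] W by (simp add: W_def)
    finally show "P (x \<oplus> y) \<epsilon>"
      using c W comb_add[of W "\<lambda>i. ip H (f i) x" "\<lambda>i. ip H (f i) y"]
      by (intro PI[of W _ "\<lambda>i. ip H (f i) x + ip H (f i) y"]) auto
  next
    fix c x and \<epsilon> :: real
    assume x: "x \<in> {v \<in> carrier H. \<forall>\<epsilon>>0. P v \<epsilon>}" and e: "\<epsilon> > 0"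
    have cp: "cmod c + 1 > 0" using norm_ge_zero[of c] by linarith
    then have "P x (\<epsilon> / (cmod c + 1))" using x e by simp
    then obtain Y where Y: "finite Y" "Y \<subseteq> X" "hnorm H (x \<ominus> proj Y x) < \<epsilon> / (cmod c + 1)"
      unfolding P_def by blast
    have xc: "x \<in> carrier H" using x by auto
    have "hnorm H (c \<odot> x \<ominus> c \<odot> proj Y x) = cmod c * hnorm H (x \<ominus> proj Y x)"
      using xc Y(2) by (simp add: norm_smult flip: smult_diff)
    also have "\<dots> \<le> (cmod c + 1) * hnorm H (x \<ominus> proj Y x)"
      using xc Y(2) by (intro mult_right_mono) auto
    also have "\<dots> < (cmod c + 1) * (\<epsilon> / (cmod c + 1))"
      using Y(3) cp by (intro mult_strict_left_mono)
    also have "\<dots> = \<epsilon>" using cp by simp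
    finally show "P (c \<odot> x) \<epsilon>"
      using xc Y comb_smult[OF Y(1,2), of c "\<lambda>i. ip H (f i) x"]
      by (intro PI[of Y _ "\<lambda>i. c * ip H (f i) x"]) auto
  next
    fix v and \<epsilon> :: real
    assume v: "v \<in> carrier H"
      and *: "\<forall>\<epsilon>>0. \<exists>u\<in>{v \<in> carrier H. \<forall>\<epsilon>>0. P v \<epsilon>}. hnorm H (v \<ominus> u) < \<epsilon>" and e: "\<epsilon> > 0"
    from * half_gt_zero[OF e] obtain u where u: "u \<in> carrier H" "\<forall>\<epsilon>>0. P u \<epsilon>" "hnorm H (v \<ominus> u) < \<epsilon>/2"
      by blast
    then obtain Y where Y: "finite Y" "Y \<subseteq> X" "hnorm H (u \<ominus> proj Y u) < \<epsilon>/2"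
      unfolding P_def using half_gt_zero[OF e] by blast
    have "hnorm H (v \<ominus> proj Y u) < \<epsilon>"
      using norm_triangle_diff[OF v u(1), of "proj Y u"] u(3) Y by simp
    then show "P v \<epsilon>" using v Y by (intro PI[of Y])
  qed auto
  have "\<forall>\<epsilon>>0. P v \<epsilon>"
  proof (rule total_set_induct[OF total closed _ assms(1)])
    fix x assume "x \<in> f ` X"
    then obtain i where i: "i \<in> X" "x = f i" by auto
    then have "comb (\<lambda>_. 1) {i} = x" by (simp add: comb_def finsum_insert)
    with i show "\<forall>\<epsilon>>0. P x \<epsilon>" by (intro allI impI PI[of "{i}" _ "\<lambda>_. 1"]) auto
  qed
  with assms(2) show ?thesis by (simp add: P_def)
qed

lemma eqI:
  assumes "u \<in> carrier H" "v \<in> carrier H" "\<And>i. i \<in> X \<Longrightarrow> ip H (f i) u = ip H (f i) v"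
  shows "u = v"
  using eq_by_total[OF total assms(1,2)] assms(3) by auto

lemma parseval_ip:
  assumes "u \<in> carrier H" "v \<in> carrier H"
  shows "((\<lambda>i. cnj (ip H (f i) u) * ip H (f i) v) has_sum ip H u v) X"
  unfolding has_sum_def tendsto_iff eventually_finite_subsets_at_top
proof (intro allI impI)
  fix \<epsilon> :: real assume e: "\<epsilon> > 0"
  \<comment> \<open>The 1 avoids a division by zero when \<open>v\<close> is the zero
    vector.\<close>
  have p: "hnorm H v + 1 > 0" using hnorm_nonneg[OF assms(2)] by linarith
  then obtain Y where Y: "finite Y" "Y \<subseteq> X"
    "\<And>Y'. finite Y' \<Longrightarrow> Y \<subseteq> Y' \<Longrightarrow> Y' \<subseteq> X \<Longrightarrow> hnorm H (u \<ominus> proj Y' u) < \<epsilon> / (hnorm H v + 1)"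
    using proj_approx[OF assms(1), of "\<epsilon> / (hnorm H v + 1)"] e by auto
  have "dist (\<Sum>i\<in>Y'. cnj (ip H (f i) u) * ip H (f i) v) (ip H u v) < \<epsilon>"
    if Y': "finite Y'" "Y \<subseteq> Y'" "Y' \<subseteq> X" for Y'
  proof -
    have "ip H (u \<ominus> proj Y' u) v = ip H u v - (\<Sum>i\<in>Y'. cnj (ip H (f i) u) * ip H (f i) v)"
      using Y' assms by (simp add: ip_comb_left)
    then have "dist (\<Sum>i\<in>Y'. cnj (ip H (f i) u) * ip H (f i) v) (ip H u v) = cmod (ip H (u \<ominus> proj Y' u) v)"
      by (simp add: dist_norm norm_minus_commute)
    also have "\<dots> \<le> hnorm H (u \<ominus> proj Y' u) * hnorm H v"
      using Y' assms by (intro cauchy_schwarz) auto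
    also have "\<dots> \<le> hnorm H (u \<ominus> proj Y' u) * (hnorm H v + 1)"
      using Y' assms by (intro mult_left_mono) auto
    also have "\<dots> < \<epsilon> / (hnorm H v + 1) * (hnorm H v + 1)"
      using Y(3)[OF Y'] p by (intro mult_strict_right_mono)
    also have "\<dots> = \<epsilon>" using p by simp
    finally show ?thesis .
  qed
  with Y(1,2) show "\<exists>Y. finite Y \<and> Y \<subseteq> X \<and> (\<forall>Y'. finite Y' \<and> Y \<subseteq> Y' \<and> Y' \<subseteq> X \<longrightarrow>
      dist (\<Sum>i\<in>Y'. cnj (ip H (f i) u) * ip H (f i) v) (ip H u v) < \<epsilon>)" by blast
qed

lemma parseval:
  assumes "v \<in> carrier H"
  shows "((\<lambda>i. (cmod (ip H (f i) v))\<^sup>2) has_sum (hnorm H v)\<^sup>2) X"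
proof -
  have "((\<lambda>i. complex_of_real ((cmod (ip H (f i) v))\<^sup>2)) has_sum complex_of_real ((hnorm H v)\<^sup>2)) X"
    using parseval_ip[OF assms assms] ip_self[OF assms]
    by (simp only: complex_norm_square mult.commute)
  then show ?thesis using has_sum_of_real_iff by blast
qed

text \<open>The index set is arbitrary, while completeness speaks of sequences. Summability supplies
  finite sets \<open>F n\<close> outside which all finite sums of squares are below
  \<open>(\<delta> n)\<^sup>2\<close>; the combinations over their increasing unions form a Cauchy
  sequence.\<close>

lemma riesz_fischer:
  assumes "(\<lambda>i. (cmod (c i))\<^sup>2) summable_on X"
  shows "\<exists>v\<in>carrier H. \<forall>i\<in>X. ip H (f i) v = c i"
proof -
  have tail: "\<exists>F. finite F \<and> F \<subseteq> X \<and> (\<forall>Z. finite Z \<and> Z \<subseteq> X - F \<longrightarrow> (\<Sum>i\<in>Z. (cmod (c i))\<^sup>2) < \<epsilon>)"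
    if e: "\<epsilon> > 0" for \<epsilon>
  proof -
    obtain s where "((\<lambda>i. (cmod (c i))\<^sup>2) has_sum s) X" using assms by (auto simp: summable_on_def)
    then have "\<forall>\<^sub>F Y in finite_subsets_at_top X. dist (\<Sum>i\<in>Y. (cmod (c i))\<^sup>2) s < \<epsilon>/2"
      unfolding has_sum_def using half_gt_zero[OF e] by (rule tendstoD)
    then obtain F where F': "finite F \<and> F \<subseteq> X \<and>
        (\<forall>Y. finite Y \<and> F \<subseteq> Y \<and> Y \<subseteq> X \<longrightarrow> dist (\<Sum>i\<in>Y. (cmod (c i))\<^sup>2) s < \<epsilon>/2)"
      unfolding eventually_finite_subsets_at_top by (elim exE)
    then have F: "finite F" "F \<subseteq> X"
      "\<And>Y. finite Y \<Longrightarrow> F \<subseteq> Y \<Longrightarrow> Y \<subseteq> X \<Longrightarrow> dist (\<Sum>i\<in>Y. (cmod (c i))\<^sup>2) s < \<epsilon>/2"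
      by simp_all
    have "(\<Sum>i\<in>Z. (cmod (c i))\<^sup>2) < \<epsilon>" if Z: "finite Z" "Z \<subseteq> X - F" for Z
    proof -
      have "(\<Sum>i\<in>F \<union> Z. (cmod (c i))\<^sup>2) = (\<Sum>i\<in>F. (cmod (c i))\<^sup>2) + (\<Sum>i\<in>Z. (cmod (c i))\<^sup>2)"
        using Z F by (intro sum.union_disjoint) auto
      moreover have "dist (\<Sum>i\<in>F \<union> Z. (cmod (c i))\<^sup>2) s < \<epsilon>/2" using Z F by (intro F(3)) auto
      moreover have "dist (\<Sum>i\<in>F. (cmod (c i))\<^sup>2) s < \<epsilon>/2" using F by (intro F(3)) auto
      ultimately show ?thesis unfolding dist_real_def by linarith
    qed
    with F show ?thesis by blast
  qed
  define \<delta> :: "nat \<Rightarrow> real" where "\<delta> n = inverse (real (Suc n))" for n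
  have \<delta>: "\<delta> n > 0" for n by (simp add: \<delta>_def)
  have "\<exists>F. finite F \<and> F \<subseteq> X \<and> (\<forall>Z. finite Z \<and> Z \<subseteq> X - F \<longrightarrow> (\<Sum>i\<in>Z. (cmod (c i))\<^sup>2) < (\<delta> n)\<^sup>2)" for n
    using \<delta>[of n] by (intro tail) auto
  then obtain F where F: "\<And>n. finite (F n)" "\<And>n. F n \<subseteq> X"
    "\<And>n Z. finite Z \<Longrightarrow> Z \<subseteq> X - F n \<Longrightarrow> (\<Sum>i\<in>Z. (cmod (c i))\<^sup>2) < (\<delta> n)\<^sup>2"
    by metis
  define G where "G n = (\<Union>k\<le>n. F k)" for n
  have G: "finite (G n)" "G n \<subseteq> X" for n using F by (auto simp: G_def)
  have G_mono: "G i \<subseteq> G j" if "i \<le> j" for i j using that by (auto simp: G_def intro: order_trans)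
  define s where "s n = comb c (G n)" for n
  have s_closed: "s n \<in> carrier H" for n using G by (simp add: s_def)
  have s_diff: "hnorm H (s j \<ominus> s i) < \<delta> i" if "i \<le> j" for i j
  proof -
    have "s j = s i \<oplus> comb c (G j - G i)"
      unfolding s_def using G[of i] G[of j] G_mono[OF that] that
      by (subst comb_Un_disjoint[symmetric]) (auto simp: Un_absorb1)
    then have "s j \<ominus> s i = comb c (G j - G i)"
      using s_closed[of i] comb_closed[OF order_trans[OF Diff_subset G(2)], of c j "G i"]
      by (intro eq_by_ip) auto
    then have "(hnorm H (s j \<ominus> s i))\<^sup>2 = (\<Sum>i\<in>G j - G i. (cmod (c i))\<^sup>2)"
      using G[of j] hnorm_comb[of "G j - G i" c] by auto
    also have "\<dots> < (\<delta> i)\<^sup>2"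
      using G[of j] by (intro F(3)) (auto simp: G_def)
    finally show ?thesis using \<delta>[of i] by (simp add: power2_less_imp_less)
  qed
  have "\<exists>l\<in>carrier H. (\<lambda>n. hnorm H (s n \<ominus> l)) \<longlonglongrightarrow> 0"
  proof (rule complete_ex_limit[OF complete s_closed])
    fix \<epsilon> :: real assume "\<epsilon> > 0"
    then obtain M where M: "\<delta> M < \<epsilon>" using reals_Archimedean \<delta>_def by metis
    have "hnorm H (s i \<ominus> s j) < \<epsilon>" if "i \<ge> M" "j \<ge> M" for i j
    proof -
      have mono: "\<delta> k \<le> \<delta> M" if "k \<ge> M" for k using that by (simp add: \<delta>_def le_imp_inverse_le)
      show ?thesis
      proof (cases "i \<le> j")
        case True
        then show ?thesis
          using s_diff[OF True] mono[OF that(1)] M s_closed by (simp add: norm_diff_commute[of "s i"])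
      next
        case False
        then show ?thesis using s_diff[of j i] mono[OF that(2)] M by simp
      qed
    qed
    then show "\<exists>M. \<forall>i\<ge>M. \<forall>j\<ge>M. hnorm H (s i \<ominus> s j) < \<epsilon>" by blast
  qed
  then obtain l where l: "l \<in> carrier H" "(\<lambda>n. hnorm H (s n \<ominus> l)) \<longlonglongrightarrow> 0" by blast
  have "ip H (f i) l = c i" if i: "i \<in> X" for i
  proof (rule LIMSEQ_unique)
    show "(\<lambda>n. ip H (f i) (s n)) \<longlonglongrightarrow> ip H (f i) l"
    proof (rule Lim_transform_bound[OF _ tendsto_mult_right_zero[OF l(2), of "hnorm H (f i)"],
          THEN LIM_zero_cancel])
      show "\<forall>\<^sub>F n in sequentially. norm (ip H (f i) (s n) - ip H (f i) l)
          \<le> norm (hnorm H (f i) * hnorm H (s n \<ominus> l))"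
        using cauchy_schwarz[of "f i"] i l(1) s_closed by (intro always_eventually allI) (simp add: abs_mult flip: ip_diff_right)
    qed
    show "(\<lambda>n. ip H (f i) (s n)) \<longlonglongrightarrow> c i"
    proof (cases "\<exists>k. i \<in> F k")
      case True
      then obtain k where "i \<in> F k" by blast
      then have "i \<in> G n" if "n \<ge> k" for n using that by (auto simp: G_def)
      then have "\<forall>\<^sub>F n in sequentially. ip H (f i) (s n) = c i"
        using i G by (intro eventually_sequentiallyI[of k]) (simp add: s_def coeff_comb)
      then show ?thesis by (rule tendsto_eventually)
    next
      \<comment> \<open>An index contained in no \<open>F n\<close> has a coefficient smaller than
        every \<open>\<delta> n\<close>, hence zero, which is also its coefficient in all the
        partial combinations.\<close>
      case False
      have "(cmod (c i))\<^sup>2 < (\<delta> n)\<^sup>2" for n using F(3)[of "{i}" n] False i by auto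
      then have *: "cmod (c i) < \<delta> n" for n using \<delta>[of n] by (meson power2_less_imp_less less_imp_le)
      have "cmod (c i) = 0"
      proof (rule ccontr)
        assume "cmod (c i) \<noteq> 0"
        then have "cmod (c i) > 0" by simp
        then obtain n where "\<delta> n < cmod (c i)" using reals_Archimedean \<delta>_def by metis
        with *[of n] show False by simp
      qed
      then have "ip H (f i) (s n) = c i" for n
        using i G False by (simp add: s_def coeff_comb G_def)
      then show ?thesis by simp
    qed
  qed
  with l(1) show ?thesis by blast
qed

text \<open>The coefficients of points of \<open>K\<close> lie in one compact disc. Discretising the
  finitely many with index in \<open>Y\<close> gives a finite net, because \<open>approx\<close>
  controls all the others uniformly on \<open>K\<close>.\<close>

lemma mtotally_boundedI:
  assumes K: "K \<subseteq> carrier H" and bd: "\<And>v. v \<in> K \<Longrightarrow> hnorm H v \<le> C"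
    and approx: "\<And>\<epsilon>. \<epsilon> > 0 \<Longrightarrow> \<exists>Y. finite Y \<and> Y \<subseteq> X \<and> (\<forall>v\<in>K. hnorm H (v \<ominus> proj Y v) \<le> \<epsilon>)"
  shows "MS.mtotally_bounded K"
proof -
  have net: "\<exists>N. finite N \<and> N \<subseteq> carrier H \<and> (\<forall>v\<in>K. \<exists>w\<in>N. hnorm H (v \<ominus> w) < \<epsilon>)" if e: "\<epsilon> > 0" for \<epsilon>
  proof -
    obtain Y where Y: "finite Y" "Y \<subseteq> X" "\<And>v. v \<in> K \<Longrightarrow> hnorm H (v \<ominus> proj Y v) \<le> \<epsilon>/2"
      using approx[of "\<epsilon>/2"] e by auto
    \<comment> \<open>Chosen so that \<open>card Y\<close> coefficient errors of size
      \<open>\<delta>\<close> add at most \<open>(\<epsilon>/2)\<^sup>2\<close> to the squared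
      distance; the 1 covers empty \<open>Y\<close>.\<close>
    define \<delta> where "\<delta> = \<epsilon> / (2 * real (card Y + 1))"
    have \<delta>: "\<delta> > 0" using e by (simp add: \<delta>_def)
    obtain B where B: "finite B" "cball (0::complex) C \<subseteq> (\<Union>x\<in>B. ball x \<delta>)"
      using seq_compact_imp_totally_bounded[of "cball (0::complex) C"] \<delta>
      by (metis compact_cball compact_imp_seq_compact)
    define N where "N = (\<lambda>c. comb c Y) ` (Y \<rightarrow>\<^sub>E B)"
    have "finite N" using Y B by (simp add: N_def finite_PiE)
    moreover have "N \<subseteq> carrier H" using Y by (auto simp: N_def)
    moreover have "\<exists>w\<in>N. hnorm H (v \<ominus> w) < \<epsilon>" if v: "v \<in> K" for v
    proof -
      have vH: "v \<in> carrier H" using K v by auto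
      have "\<exists>b\<in>B. dist b (ip H (f i) v) < \<delta>" if i: "i \<in> Y" for i
      proof -
        have "hnorm H (f i) = 1" using i Y(2) f_ip[of i i] by (auto simp: hnorm_def)
        then have "cmod (ip H (f i) v) \<le> C"
          using cauchy_schwarz[of "f i" v] bd[OF v] vH i Y(2) by fastforce
        then have "ip H (f i) v \<in> cball 0 C" by simp
        then show ?thesis using B(2) by (auto simp: ball_def)
      qed
      then obtain r where r: "\<And>i. i \<in> Y \<Longrightarrow> r i \<in> B \<and> dist (r i) (ip H (f i) v) < \<delta>" by metis
      define c where "c = restrict r Y"
      have c: "c i \<in> B" "cmod (c i - ip H (f i) v) \<le> \<delta>" if "i \<in> Y" for i
        using r[OF that] that by (auto simp: c_def dist_norm)
      have "c \<in> Y \<rightarrow>\<^sub>E B" using r by (auto simp: c_def)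
      then have "comb c Y \<in> N" by (auto simp: N_def)
      moreover have "hnorm H (v \<ominus> comb c Y) < \<epsilon>"
      proof (rule power2_less_imp_less)
        have "(\<Sum>i\<in>Y. (cmod (c i - ip H (f i) v))\<^sup>2) \<le> (\<Sum>i\<in>Y. \<delta>\<^sup>2)"
          using c(2) by (intro sum_mono power_mono) auto
        also have "\<dots> = real (card Y) * \<delta>\<^sup>2" by simp
        also have "\<dots> \<le> (real (card Y + 1))\<^sup>2 * \<delta>\<^sup>2"
          by (intro mult_right_mono) (auto simp: power2_eq_square algebra_simps)
        also have "\<dots> = (real (card Y + 1) * \<delta>)\<^sup>2" by (simp only: power_mult_distrib)
        also have "real (card Y + 1) * \<delta> = \<epsilon>/2" by (simp add: \<delta>_def field_simps)
        finally have 1: "(\<Sum>i\<in>Y. (cmod (c i - ip H (f i) v))\<^sup>2) \<le> (\<epsilon>/2)\<^sup>2" .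
        have 2: "(hnorm H (v \<ominus> proj Y v))\<^sup>2 \<le> (\<epsilon>/2)\<^sup>2"
          using Y v vH by (intro power_mono) auto
        have "(hnorm H (v \<ominus> comb c Y))\<^sup>2 \<le> (\<epsilon>/2)\<^sup>2 + (\<epsilon>/2)\<^sup>2"
          using hnorm_diff_comb[OF Y(1,2) vH, of c] hnorm_diff_proj[OF Y(1,2) vH] 1 2 by linarith
        also have "\<dots> < \<epsilon>\<^sup>2" using e by (simp add: power2_eq_square)
        finally show "(hnorm H (v \<ominus> comb c Y))\<^sup>2 < \<epsilon>\<^sup>2" .
      qed (use e in simp)
      ultimately show ?thesis by blast
    qed
    ultimately show ?thesis by blast
  qed
  show ?thesis
    unfolding MS.mtotally_bounded_def
  proof (intro allI impI)
    fix \<epsilon> :: real assume e: "\<epsilon> > 0"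
    obtain N where N: "finite N" "N \<subseteq> carrier H" "\<And>v. v \<in> K \<Longrightarrow> \<exists>w\<in>N. hnorm H (v \<ominus> w) < \<epsilon>/2"
      using net[OF half_gt_zero[OF e]] by blast
    \<comment> \<open>Total boundedness asks for centres inside \<open>K\<close>, whereas the net
      lies only in the space. Each point of the net that is close to \<open>K\<close> is traded for
      a nearby point of \<open>K\<close>, at the price of doubling the radius.\<close>
    define N' where "N' = {w \<in> N. \<exists>v\<in>K. hnorm H (v \<ominus> w) < \<epsilon>/2}"
    have "\<exists>g. \<forall>w\<in>N'. g w \<in> K \<and> hnorm H (g w \<ominus> w) < \<epsilon>/2"
      unfolding N'_def by (intro bchoice) auto
    then obtain g where g: "\<And>w. w \<in> N' \<Longrightarrow> g w \<in> K \<and> hnorm H (g w \<ominus> w) < \<epsilon>/2" by blast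
    have "K \<subseteq> (\<Union>x\<in>g ` N'. MS.mball x \<epsilon>)"
    proof
      fix v assume v: "v \<in> K"
      then obtain w where w: "w \<in> N" "hnorm H (v \<ominus> w) < \<epsilon>/2" using N(3) by blast
      then have w': "w \<in> N'" using v by (auto simp: N'_def)
      have in_H: "v \<in> carrier H" "w \<in> carrier H" "g w \<in> carrier H" using v w(1) N(2) K g[OF w'] by auto
      have "hnorm H (g w \<ominus> v) < \<epsilon>"
        using norm_triangle_diff[of "g w" w v] in_H w(2) g[OF w'] by (simp add: norm_diff_commute[of w v])
      then have "v \<in> MS.mball (g w) \<epsilon>" using in_H by (simp add: norm_dist_eq)
      with w' show "v \<in> (\<Union>x\<in>g ` N'. MS.mball x \<epsilon>)" by blast
    qed
    then show "\<exists>M. finite M \<and> M \<subseteq> K \<and> K \<subseteq> (\<Union>x\<in>M. MS.mball x \<epsilon>)"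
      using g N(1) by (intro exI[of _ "g ` N'"]) (auto simp: N'_def)
  qed
qed

end

subsection \<open>Bounded operators\<close>

text \<open>The operator is prescribed by a linear relation \<open>G\<close> rather than by a
  function: the bound makes its closure single-valued, and completeness of \<open>K\<close> makes
  the closure everywhere defined. Values may therefore be given through a representation of the
  argument whose uniqueness is left open.\<close>

lemma bounded_extension:
  assumes "hilbert H" "hilbert K" and G: "G \<subseteq> carrier H \<times> carrier K"
    and add: "\<And>v w v' w'. (v, w) \<in> G \<Longrightarrow> (v', w') \<in> G \<Longrightarrow> (v \<oplus>\<^bsub>H\<^esub> v', w \<oplus>\<^bsub>K\<^esub> w') \<in> G"
    and smult: "\<And>c v w. (v, w) \<in> G \<Longrightarrow> (c \<odot>\<^bsub>H\<^esub> v, c \<odot>\<^bsub>K\<^esub> w) \<in> G"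
    and total: "total_set H (hnorm H) X" "X \<subseteq> fst ` G" "G \<noteq> {}"
    and C: "0 \<le> C" "\<And>v w. (v, w) \<in> G \<Longrightarrow> hnorm K w \<le> C * hnorm H v"
  shows "\<exists>P. P \<in> extensional (carrier H) \<and> lin_map H K P \<and>
    (\<forall>v\<in>carrier H. hnorm K (P v) \<le> C * hnorm H v) \<and> (\<forall>v w. (v, w) \<in> G \<longrightarrow> P v = w) \<and>
    ((\<forall>v w. (v, w) \<in> G \<longrightarrow> hnorm K w = hnorm H v) \<longrightarrow> (\<forall>v\<in>carrier H. hnorm K (P v) = hnorm H v))"
proof -
  interpret H: hilbert H by fact
  interpret K: hilbert K by fact
  have Gc: "v \<in> carrier H" "w \<in> carrier K" if "(v, w) \<in> G" for v w using G that by auto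
  define R where "R v w \<longleftrightarrow> v \<in> carrier H \<and> w \<in> carrier K \<and>
    (\<forall>\<epsilon>>0. \<exists>v' w'. (v', w') \<in> G \<and> hnorm H (v \<ominus>\<^bsub>H\<^esub> v') < \<epsilon> \<and> hnorm K (w \<ominus>\<^bsub>K\<^esub> w') < \<epsilon>)" for v w
  have Rc: "v \<in> carrier H" "w \<in> carrier K" if "R v w" for v w using that by (auto simp: R_def)
  have R_G: "R v w" if "(v, w) \<in> G" for v w
    unfolding R_def using that Gc[OF that] by (intro conjI allI impI exI[of _ v] exI[of _ w]) auto
  have R_add: "R (v \<oplus>\<^bsub>H\<^esub> v') (w \<oplus>\<^bsub>K\<^esub> w')" if R: "R v w" "R v' w'" for v w v' w'
    unfolding R_def
  proof (intro conjI allI impI)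
    fix \<epsilon> :: real assume "\<epsilon> > 0"
    then have e: "\<epsilon>/2 > 0" by simp
    obtain a b where ab: "(a, b) \<in> G" "hnorm H (v \<ominus>\<^bsub>H\<^esub> a) < \<epsilon>/2" "hnorm K (w \<ominus>\<^bsub>K\<^esub> b) < \<epsilon>/2"
      using R(1) e unfolding R_def by blast
    obtain a' b' where ab': "(a', b') \<in> G" "hnorm H (v' \<ominus>\<^bsub>H\<^esub> a') < \<epsilon>/2" "hnorm K (w' \<ominus>\<^bsub>K\<^esub> b') < \<epsilon>/2"
      using R(2) e unfolding R_def by blast
    have "hnorm H ((v \<oplus>\<^bsub>H\<^esub> v') \<ominus>\<^bsub>H\<^esub> (a \<oplus>\<^bsub>H\<^esub> a')) < \<epsilon>"
      using H.norm_triangle[of "v \<ominus>\<^bsub>H\<^esub> a" "v' \<ominus>\<^bsub>H\<^esub> a'"] Rc[OF R(1)] Rc[OF R(2)] Gc[OF ab(1)] Gc[OF ab'(1)]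
        ab ab' by (simp add: H.add_diff_add)
    moreover have "hnorm K ((w \<oplus>\<^bsub>K\<^esub> w') \<ominus>\<^bsub>K\<^esub> (b \<oplus>\<^bsub>K\<^esub> b')) < \<epsilon>"
      using K.norm_triangle[of "w \<ominus>\<^bsub>K\<^esub> b" "w' \<ominus>\<^bsub>K\<^esub> b'"] Rc[OF R(1)] Rc[OF R(2)] Gc[OF ab(1)] Gc[OF ab'(1)]
        ab ab' by (simp add: K.add_diff_add)
    ultimately show "\<exists>a b. (a, b) \<in> G \<and> hnorm H ((v \<oplus>\<^bsub>H\<^esub> v') \<ominus>\<^bsub>H\<^esub> a) < \<epsilon> \<and> hnorm K ((w \<oplus>\<^bsub>K\<^esub> w') \<ominus>\<^bsub>K\<^esub> b) < \<epsilon>"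
      using add[OF ab(1) ab'(1)] by blast
  qed (use Rc[OF R(1)] Rc[OF R(2)] in auto)
  have R_smult: "R (c \<odot>\<^bsub>H\<^esub> v) (c \<odot>\<^bsub>K\<^esub> w)" if R: "R v w" for c v w
    unfolding R_def
  proof (intro conjI allI impI)
    fix \<epsilon> :: real assume e: "\<epsilon> > 0"
    have cp: "cmod c + 1 > 0" using norm_ge_zero[of c] by linarith
    then have "\<epsilon> / (cmod c + 1) > 0" using e by simp
    then obtain a b where ab: "(a, b) \<in> G" "hnorm H (v \<ominus>\<^bsub>H\<^esub> a) < \<epsilon> / (cmod c + 1)"
        "hnorm K (w \<ominus>\<^bsub>K\<^esub> b) < \<epsilon> / (cmod c + 1)"
      using R unfolding R_def by blast
    have *: "cmod c * t < \<epsilon>" if "t < \<epsilon> / (cmod c + 1)" "t \<ge> 0" for t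
    proof -
      have "cmod c * t \<le> (cmod c + 1) * t" using that by (intro mult_right_mono) auto
      also have "\<dots> < (cmod c + 1) * (\<epsilon> / (cmod c + 1))" using that cp by (intro mult_strict_left_mono)
      also have "\<dots> = \<epsilon>" using cp by simp
      finally show ?thesis .
    qed
    have "hnorm H (c \<odot>\<^bsub>H\<^esub> v \<ominus>\<^bsub>H\<^esub> c \<odot>\<^bsub>H\<^esub> a) < \<epsilon>" "hnorm K (c \<odot>\<^bsub>K\<^esub> w \<ominus>\<^bsub>K\<^esub> c \<odot>\<^bsub>K\<^esub> b) < \<epsilon>"
      using Rc[OF R] Gc[OF ab(1)] *[OF ab(2)] *[OF ab(3)]
      by (simp_all add: H.norm_smult K.norm_smult flip: H.smult_diff K.smult_diff)
    then show "\<exists>a b. (a, b) \<in> G \<and> hnorm H (c \<odot>\<^bsub>H\<^esub> v \<ominus>\<^bsub>H\<^esub> a) < \<epsilon> \<and> hnorm K (c \<odot>\<^bsub>K\<^esub> w \<ominus>\<^bsub>K\<^esub> b) < \<epsilon>"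
      using smult[OF ab(1)] by blast
  qed (use Rc[OF R] in auto)
  \<comment> \<open>The constant is a parameter because the isometric case needs the bound with 1 in
    place of \<open>C\<close>.\<close>
  have R_le: "hnorm K w \<le> C' * hnorm H v"
    if R: "R v w" and C': "0 \<le> C'" "\<And>v w. (v, w) \<in> G \<Longrightarrow> hnorm K w \<le> C' * hnorm H v" for v w C'
  proof (rule field_le_epsilon)
    fix e :: real assume e: "e > 0"
    then have "e / (C' + 1) > 0" using C'(1) by simp
    then obtain a b where ab: "(a, b) \<in> G" "hnorm H (v \<ominus>\<^bsub>H\<^esub> a) < e / (C' + 1)"
        "hnorm K (w \<ominus>\<^bsub>K\<^esub> b) < e / (C' + 1)"
      using R unfolding R_def by blast
    have "hnorm K w \<le> e / (C' + 1) + hnorm K b"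
      using K.norm_le_add_diff[of w b] Rc[OF R] Gc[OF ab(1)] ab(3) by simp
    also have "hnorm K b \<le> C' * hnorm H a" using C'(2)[OF ab(1)] .
    also have "hnorm H a \<le> hnorm H v + e / (C' + 1)"
      using H.norm_le_add_diff[of a v] Rc[OF R] Gc[OF ab(1)] ab(2) by (simp add: H.norm_diff_commute)
    finally have "hnorm K w \<le> e / (C' + 1) + C' * (hnorm H v + e / (C' + 1))"
      using C'(1) by (simp add: mult_left_mono)
    also have "\<dots> = C' * hnorm H v + (C' + 1) * (e / (C' + 1))" by (simp only: distrib_left distrib_right mult_1)
    also have "\<dots> = C' * hnorm H v + e" using C'(1) by simp
    finally show "hnorm K w \<le> C' * hnorm H v + e" .
  qed
  have R_ge: "hnorm H v \<le> hnorm K w"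
    if R: "R v w" and iso: "\<And>v w. (v, w) \<in> G \<Longrightarrow> hnorm K w = hnorm H v" for v w
  proof (rule field_le_epsilon)
    fix e :: real assume e: "e > 0"
    then have "e / 2 > 0" by simp
    then obtain a b where ab: "(a, b) \<in> G" "hnorm H (v \<ominus>\<^bsub>H\<^esub> a) < e / 2" "hnorm K (w \<ominus>\<^bsub>K\<^esub> b) < e / 2"
      using R unfolding R_def by blast
    show "hnorm H v \<le> hnorm K w + e"
      using H.norm_le_add_diff[of v a] K.norm_le_add_diff[of b w] iso[OF ab(1)] ab(2,3)
        Rc[OF R] Gc[OF ab(1)] by (simp add: K.norm_diff_commute)
  qed
  \<comment> \<open>Two values at \<open>v\<close> differ by a value at zero, which the bound forces
    to vanish.\<close>
  have R_unique: "w = w'" if R: "R v w" "R v w'" for v w w'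
  proof -
    have "R (v \<oplus>\<^bsub>H\<^esub> (- 1) \<odot>\<^bsub>H\<^esub> v) (w \<oplus>\<^bsub>K\<^esub> (- 1) \<odot>\<^bsub>K\<^esub> w')" by (intro R_add R_smult R)
    moreover have "v \<oplus>\<^bsub>H\<^esub> (- 1) \<odot>\<^bsub>H\<^esub> v = \<zero>\<^bsub>H\<^esub>" "w \<oplus>\<^bsub>K\<^esub> (- 1) \<odot>\<^bsub>K\<^esub> w' = w \<ominus>\<^bsub>K\<^esub> w'"
      using Rc[OF R(1)] Rc[OF R(2)] H.diff_eq_smult[of v v] K.diff_eq_smult[of w w'] by auto
    ultimately have "R \<zero>\<^bsub>H\<^esub> (w \<ominus>\<^bsub>K\<^esub> w')" by simp
    from R_le[OF this C] have "hnorm K (w \<ominus>\<^bsub>K\<^esub> w') = 0"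
      using Rc[OF R(1)] Rc[OF R(2)] by (intro order_antisym) auto
    then have "w \<ominus>\<^bsub>K\<^esub> w' = \<zero>\<^bsub>K\<^esub>"
      using Rc[OF R(1)] Rc[OF R(2)] K.norm_eq_zero[of "w \<ominus>\<^bsub>K\<^esub> w'"] by simp
    then show ?thesis by (rule K.diff_eq_zeroD[OF Rc(2)[OF R(1)] Rc(2)[OF R(2)]])
  qed
  have G0: "(\<zero>\<^bsub>H\<^esub>, \<zero>\<^bsub>K\<^esub>) \<in> G"
  proof -
    obtain v w where "(v, w) \<in> G" using total(3) by auto
    from smult[OF this, of 0] Gc[OF this] show ?thesis by simp
  qed
  have "submodule (fst ` G) complex_ring H"
  proof (rule H.submoduleI)
    show "fst ` G \<subseteq> carrier H" using G by auto
    show "\<zero>\<^bsub>H\<^esub> \<in> fst ` G" using G0 by force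
    show "x \<oplus>\<^bsub>H\<^esub> y \<in> fst ` G" if "x \<in> fst ` G" "y \<in> fst ` G" for x y using that add by force
    show "c \<odot>\<^bsub>H\<^esub> x \<in> fst ` G" if "x \<in> fst ` G" for c x using that smult by force
  qed
  then have "hdense H (fst ` G)" using total(1,2) by (rule H.hdense_submodule)
  moreover have "fst ` G \<subseteq> carrier H" using G by auto
  ultimately have dense: "\<exists>a b. (a, b) \<in> G \<and> hnorm H (v \<ominus>\<^bsub>H\<^esub> a) < \<epsilon>" if "v \<in> carrier H" "\<epsilon> > 0" for v \<epsilon>
    using that by (fastforce simp: H.hdense_iff)
  have R_ex: "\<exists>w. R v w" if v: "v \<in> carrier H" for v
  proof -
    define \<delta> :: "nat \<Rightarrow> real" where "\<delta> n = inverse (real (Suc n))" for n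
    have \<delta>: "\<delta> n > 0" for n by (simp add: \<delta>_def)
    have ex_\<delta>: "\<exists>M. \<forall>n\<ge>M. \<delta> n < \<epsilon>" if e: "\<epsilon> > 0" for \<epsilon>
    proof -
      obtain M where M: "\<delta> M < \<epsilon>" using reals_Archimedean[OF e] \<delta>_def by auto
      have "\<delta> n < \<epsilon>" if "n \<ge> M" for n
      proof -
        have "\<delta> n \<le> \<delta> M" using that by (simp add: \<delta>_def le_imp_inverse_le)
        then show ?thesis using M by simp
      qed
      then show ?thesis by blast
    qed
    have "\<exists>p. \<forall>n. p n \<in> G \<and> hnorm H (v \<ominus>\<^bsub>H\<^esub> fst (p n)) < \<delta> n"
      using dense[OF v \<delta>] by (intro choice allI) fastforce
    then obtain p where p: "\<And>n. p n \<in> G" "\<And>n. hnorm H (v \<ominus>\<^bsub>H\<^esub> fst (p n)) < \<delta> n" by blast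
    define a where "a n = fst (p n)" for n
    define b where "b n = snd (p n)" for n
    have ab: "(a n, b n) \<in> G" for n using p(1)[of n] by (simp add: a_def b_def)
    have a_near: "hnorm H (v \<ominus>\<^bsub>H\<^esub> a n) < \<delta> n" for n using p(2) by (simp add: a_def)
    note abc = Gc[OF ab]
    have b_diff: "hnorm K (b i \<ominus>\<^bsub>K\<^esub> b j) \<le> C * (\<delta> i + \<delta> j)" for i j
    proof -
      have "(a i \<ominus>\<^bsub>H\<^esub> a j, b i \<ominus>\<^bsub>K\<^esub> b j) \<in> G"
        using add[OF ab smult[OF ab]] abc by (simp add: H.diff_eq_smult K.diff_eq_smult)
      then have "hnorm K (b i \<ominus>\<^bsub>K\<^esub> b j) \<le> C * hnorm H (a i \<ominus>\<^bsub>H\<^esub> a j)" by (rule C(2))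
      also have "hnorm H (a i \<ominus>\<^bsub>H\<^esub> a j) \<le> \<delta> i + \<delta> j"
        using H.norm_triangle_diff[of "a i" v "a j"] a_near[of i] a_near[of j] abc v
        by (simp add: H.norm_diff_commute[of v "a i"])
      finally show ?thesis using C(1) by (simp add: mult_left_mono)
    qed
    have "\<exists>w\<in>carrier K. (\<lambda>n. hnorm K (b n \<ominus>\<^bsub>K\<^esub> w)) \<longlonglongrightarrow> 0"
    proof (rule K.complete_ex_limit[OF K.complete abc(2)])
      fix \<epsilon> :: real assume e: "\<epsilon> > 0"
      then have "\<epsilon> / (2 * (C + 1)) > 0" using C(1) by simp
      then obtain M where M: "\<And>n. n \<ge> M \<Longrightarrow> \<delta> n < \<epsilon> / (2 * (C + 1))" using ex_\<delta> by blast
      have "hnorm K (b i \<ominus>\<^bsub>K\<^esub> b j) < \<epsilon>" if "i \<ge> M" "j \<ge> M" for i j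
      proof -
        have "hnorm K (b i \<ominus>\<^bsub>K\<^esub> b j) \<le> C * (\<delta> i + \<delta> j)" by (rule b_diff)
        also have "\<dots> \<le> (C + 1) * (\<delta> i + \<delta> j)" using \<delta>[of i] \<delta>[of j] by (intro mult_right_mono) auto
        also have "\<dots> < (C + 1) * (\<epsilon> / (2 * (C + 1)) + \<epsilon> / (2 * (C + 1)))"
          using M[OF that(1)] M[OF that(2)] C(1) by (intro mult_strict_left_mono) auto
        also have "\<dots> = (C + 1) * (\<epsilon> / 2 / (C + 1)) + (C + 1) * (\<epsilon> / 2 / (C + 1))"
          by (simp only: divide_divide_eq_left distrib_left)
        also have "(C + 1) * (\<epsilon> / 2 / (C + 1)) = \<epsilon> / 2"
        proof -
          have "a * (x / a) = x" if "a \<noteq> 0" for a x :: real using that by simp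
          from this[of "C + 1" "\<epsilon> / 2"] C(1) show ?thesis by linarith
        qed
        finally have "hnorm K (b i \<ominus>\<^bsub>K\<^esub> b j) < \<epsilon> / 2 + \<epsilon> / 2" .
        also have "\<dots> = \<epsilon>" by simp
        finally show ?thesis .
      qed
      then show "\<exists>M. \<forall>i\<ge>M. \<forall>j\<ge>M. hnorm K (b i \<ominus>\<^bsub>K\<^esub> b j) < \<epsilon>" by blast
    qed
    then obtain w where w: "w \<in> carrier K" "(\<lambda>n. hnorm K (b n \<ominus>\<^bsub>K\<^esub> w)) \<longlonglongrightarrow> 0" by blast
    have "R v w"
      unfolding R_def
    proof (intro conjI allI impI v w(1))
      fix \<epsilon> :: real assume e: "\<epsilon> > 0"
      obtain M where M: "\<And>n. n \<ge> M \<Longrightarrow> \<delta> n < \<epsilon>" using ex_\<delta>[OF e] by blast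
      obtain M' where M': "\<And>n. n \<ge> M' \<Longrightarrow> hnorm K (b n \<ominus>\<^bsub>K\<^esub> w) < \<epsilon>"
        using w(2) e abc(2) w(1) unfolding LIMSEQ_iff by fastforce
      define n where "n = max M M'"
      have "hnorm H (v \<ominus>\<^bsub>H\<^esub> a n) < \<epsilon>" using a_near[of n] M[of n] by (simp add: n_def)
      moreover have "hnorm K (w \<ominus>\<^bsub>K\<^esub> b n) < \<epsilon>"
        using M'[of n] w(1) abc(2)[of n] by (simp add: n_def K.norm_diff_commute[of w])
      ultimately show "\<exists>v' w'. (v', w') \<in> G \<and> hnorm H (v \<ominus>\<^bsub>H\<^esub> v') < \<epsilon> \<and> hnorm K (w \<ominus>\<^bsub>K\<^esub> w') < \<epsilon>"
        using ab by blast
    qed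
    then show ?thesis by blast
  qed
  define P where "P = restrict (\<lambda>v. THE w. R v w) (carrier H)"
  have P: "R v (P v)" if v: "v \<in> carrier H" for v
  proof -
    have "\<exists>!w. R v w" using R_ex[OF v] R_unique by blast
    from theI'[OF this] show ?thesis using v by (simp add: P_def)
  qed
  have P_eq: "P v = w" if "R v w" for v w using P[OF Rc(1)[OF that]] that R_unique by blast
  show ?thesis
  proof (intro exI[of _ P] conjI)
    show "P \<in> extensional (carrier H)" by (simp add: P_def)
    show "lin_map H K P"
      using P by (intro lin_mapI) (auto intro: Rc intro!: P_eq R_add R_smult)
    show "\<forall>v\<in>carrier H. hnorm K (P v) \<le> C * hnorm H v" using R_le[OF P C] by blast
    show "\<forall>v w. (v, w) \<in> G \<longrightarrow> P v = w" using P_eq R_G by blast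
    show "(\<forall>v w. (v, w) \<in> G \<longrightarrow> hnorm K w = hnorm H v) \<longrightarrow> (\<forall>v\<in>carrier H. hnorm K (P v) = hnorm H v)"
    proof (intro impI ballI order_antisym)
      fix v assume iso: "\<forall>v w. (v, w) \<in> G \<longrightarrow> hnorm K w = hnorm H v" and v: "v \<in> carrier H"
      show "hnorm K (P v) \<le> hnorm H v" using R_le[OF P[OF v], of 1] iso by simp
      show "hnorm H v \<le> hnorm K (P v)" using R_ge[OF P[OF v]] iso by blast
    qed
  qed
qed

lemma bounded_op_eq_on_total:
  assumes "hilbert H" "hilbert K" "bounded_op H K P" "bounded_op H K Q"
    and "total_set H (hnorm H) X" "\<And>x. x \<in> X \<Longrightarrow> P x = Q x" "v \<in> carrier H"
  shows "P v = Q v"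
proof -
  interpret H: hilbert H by fact
  interpret K: hilbert K by fact
  obtain C where C: "lin_map H K P" "\<And>v. v \<in> carrier H \<Longrightarrow> hnorm K (P v) \<le> C * hnorm H v"
    using assms(3) by (auto simp: bounded_op_def)
  obtain C' where C': "lin_map H K Q" "\<And>v. v \<in> carrier H \<Longrightarrow> hnorm K (Q v) \<le> C' * hnorm H v"
    using assms(4) by (auto simp: bounded_op_def)
  show ?thesis
    using total_set_induct[OF assms(5) closed_subspace_lin_equalizer[OF _ _ C C']] assms(6,7)
      H.normed_module_axioms K.normed_module_axioms by blast
qed

lemma bounded_op_compose:
  assumes "hilbert K" "hilbert L" "bounded_op H K P" "bounded_op K L Q"
  shows "bounded_op H L (\<lambda>v. Q (P v))"
proof -
  interpret K: hilbert K by fact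
  interpret L: hilbert L by fact
  obtain C where C: "lin_map H K P" "\<And>v. v \<in> carrier H \<Longrightarrow> hnorm K (P v) \<le> C * hnorm H v"
    using assms(3) by (auto simp: bounded_op_def)
  obtain C' where C': "lin_map K L Q" "\<And>v. v \<in> carrier K \<Longrightarrow> hnorm L (Q v) \<le> C' * hnorm K v"
    using assms(4) by (auto simp: bounded_op_def)
  have "hnorm L (Q (P v)) \<le> (\<bar>C'\<bar> * C) * hnorm H v" if v: "v \<in> carrier H" for v
  proof -
    have Pv: "P v \<in> carrier K" using lin_mapD(1)[OF C(1) v] .
    have "hnorm L (Q (P v)) \<le> C' * hnorm K (P v)" using C'(2)[OF Pv] .
    also have "\<dots> \<le> \<bar>C'\<bar> * hnorm K (P v)" using Pv by (intro mult_right_mono) auto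
    also have "\<dots> \<le> \<bar>C'\<bar> * (C * hnorm H v)" using C(2)[OF v] by (intro mult_left_mono) auto
    finally show ?thesis by simp
  qed
  moreover have "lin_map H L (\<lambda>v. Q (P v))"
    using lin_mapD[OF C(1)] lin_mapD[OF C'(1)] by (intro lin_mapI) auto
  ultimately show ?thesis unfolding bounded_op_def by blast
qed

lemma bounded_op_add:
  assumes "hilbert K" "bounded_op H K P" "bounded_op H K Q"
  shows "bounded_op H K (\<lambda>v. P v \<oplus>\<^bsub>K\<^esub> Q v)"
proof -
  interpret K: hilbert K by fact
  obtain C where C: "lin_map H K P" "\<And>v. v \<in> carrier H \<Longrightarrow> hnorm K (P v) \<le> C * hnorm H v"
    using assms(2) by (auto simp: bounded_op_def)
  obtain C' where C': "lin_map H K Q" "\<And>v. v \<in> carrier H \<Longrightarrow> hnorm K (Q v) \<le> C' * hnorm H v"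
    using assms(3) by (auto simp: bounded_op_def)
  note P = lin_mapD[OF C(1)] and Q = lin_mapD[OF C'(1)]
  have "lin_map H K (\<lambda>v. P v \<oplus>\<^bsub>K\<^esub> Q v)"
    using P Q by (intro lin_mapI) (auto simp: K.smult_add_right K.a_ac)
  moreover have "hnorm K (P v \<oplus>\<^bsub>K\<^esub> Q v) \<le> (C + C') * hnorm H v" if v: "v \<in> carrier H" for v
    using K.norm_triangle[OF P(1)[OF v] Q(1)[OF v]] C(2)[OF v] C'(2)[OF v] by (simp add: distrib_right)
  ultimately show ?thesis unfolding bounded_op_def by blast
qed

lemma bounded_op_smult:
  assumes "hilbert K" "bounded_op H K P"
  shows "bounded_op H K (\<lambda>v. c \<odot>\<^bsub>K\<^esub> P v)"
proof -
  interpret K: hilbert K by fact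
  obtain C where C: "lin_map H K P" "\<And>v. v \<in> carrier H \<Longrightarrow> hnorm K (P v) \<le> C * hnorm H v"
    using assms(2) by (auto simp: bounded_op_def)
  note P = lin_mapD[OF C(1)]
  have "lin_map H K (\<lambda>v. c \<odot>\<^bsub>K\<^esub> P v)"
    using P by (intro lin_mapI) (auto simp: K.smult_add_right K.smult_smult mult.commute)
  moreover have "hnorm K (c \<odot>\<^bsub>K\<^esub> P v) \<le> (cmod c * C) * hnorm H v" if v: "v \<in> carrier H" for v
    using C(2)[OF v] P(1)[OF v] by (simp add: K.norm_smult mult_left_mono mult.assoc)
  ultimately show ?thesis unfolding bounded_op_def by blast
qed

lemma bounded_op_id: "bounded_op H H (\<lambda>v. v)"
  unfolding bounded_op_def by (auto intro!: lin_mapI exI[of _ 1])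

section \<open>Finite-dimensional spaces\<close>

context hilbert
begin

text \<open>Equality in Bessel's inequality. For a finite orthonormal \<open>E\<close> it expresses
  that \<open>v\<close> lies in the span of \<open>E\<close>, without mentioning linear
  combinations.\<close>

definition spanned :: "'a set \<Rightarrow> 'a \<Rightarrow> bool" where
  "spanned E v \<longleftrightarrow> (\<Sum>e\<in>E. (cmod (ip H e v))\<^sup>2) = (hnorm H v)\<^sup>2"

lemma spanned_iff_proj:
  assumes "orthonormal H E (\<lambda>e. e)" "finite E" "v \<in> carrier H"
  shows "spanned E v \<longleftrightarrow> v = orthonormal.comb H (\<lambda>e. e) (\<lambda>e. ip H e v) E"
proof -
  interpret E: orthonormal H E "\<lambda>e. e" by fact
  have "spanned E v \<longleftrightarrow> (hnorm H (v \<ominus> E.proj E v))\<^sup>2 = 0"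
    using E.hnorm_diff_proj[of E v] assms(2,3) by (auto simp: spanned_def)
  also have "\<dots> \<longleftrightarrow> v \<ominus> E.proj E v = \<zero>"
    using assms(3) by (simp add: hnorm_eq_zero)
  also have "\<dots> \<longleftrightarrow> v = E.proj E v"
    using assms(3) E.comb_closed[OF order_refl] diff_eq_zeroD diff_self by metis
  finally show ?thesis .
qed

lemma spanned_submodule:
  assumes "orthonormal H E (\<lambda>e. e)" "finite E"
  shows "submodule {v \<in> carrier H. spanned E v} complex_ring H"
proof -
  interpret E: orthonormal H E "\<lambda>e. e" by fact
  have "E.proj E (x \<oplus> y) = E.proj E x \<oplus> E.proj E y" if "x \<in> carrier H" "y \<in> carrier H" for x y
  proof -
    have "E.proj E (x \<oplus> y) = E.comb (\<lambda>e. ip H e x + ip H e y) E"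
      unfolding E.comb_def using that by (intro finsum_cong') auto
    then show ?thesis using assms(2) by (simp add: E.comb_add)
  qed
  moreover have "E.proj E (c \<odot> x) = c \<odot> E.proj E x" if "x \<in> carrier H" for c x
  proof -
    have "E.proj E (c \<odot> x) = E.comb (\<lambda>e. c * ip H e x) E"
      unfolding E.comb_def using that by (intro finsum_cong') auto
    then show ?thesis using assms(2) by (simp add: E.comb_smult)
  qed
  moreover have "spanned E \<zero>" by (simp add: spanned_def)
  ultimately show ?thesis
    using spanned_iff_proj[OF assms] by (intro submoduleI) auto
qed

lemma orthonormal_insert:
  assumes E: "orthonormal H E (\<lambda>e. e)" "finite E" and v: "v \<in> carrier H" "v \<noteq> \<zero>"
    and orth: "\<And>e. e \<in> E \<Longrightarrow> ip H e v = 0"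
  defines "u \<equiv> complex_of_real (inverse (hnorm H v)) \<odot> v"
  shows "orthonormal H (insert u E) (\<lambda>e. e)" "u \<notin> E"
proof -
  interpret E: orthonormal H E "\<lambda>e. e" by fact
  have nz: "hnorm H v \<noteq> 0" using v hnorm_eq_zero by blast
  have u: "u \<in> carrier H" using v by (simp add: u_def)
  have "hnorm H u = 1" using v nz by (simp add: u_def hnorm_smult norm_inverse)
  then have uu: "ip H u u = 1" by (simp add: ip_self[OF u])
  have eu: "ip H e u = 0" if "e \<in> E" for e
    using orth[OF that] E.f_closed[OF that] v by (simp add: u_def)
  then have ue: "ip H u e = 0" if "e \<in> E" for e
    using ip_commute[of e u] E.f_closed[OF that] that u by simp
  show "orthonormal H (insert u E) (\<lambda>e. e)"
    using u uu eu ue E.f_closed E.f_ip by unfold_locales auto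
  show "u \<notin> E" using uu eu by force
qed

text \<open>The last conjunct keeps the new vector inside every subspace that contains
  \<open>E\<close> and \<open>v\<close>; \<open>subspace_orthonormal_basis\<close> relies on
  it.\<close>

lemma gram_schmidt_step:
  assumes E: "orthonormal H E (\<lambda>e. e)" "finite E" and v: "v \<in> carrier H" "\<not> spanned E v"
  shows "\<exists>u. orthonormal H (insert u E) (\<lambda>e. e) \<and> u \<notin> E \<and> spanned (insert u E) v \<and>
    (\<exists>c. u = c \<odot> (v \<ominus> orthonormal.comb H (\<lambda>e. e) (\<lambda>e. ip H e v) E))"
proof -
  interpret E: orthonormal H E "\<lambda>e. e" by fact
  define r where "r = v \<ominus> E.proj E v"
  have r: "r \<in> carrier H" using v by (simp add: r_def)
  have rn: "(hnorm H r)\<^sup>2 = (hnorm H v)\<^sup>2 - (\<Sum>e\<in>E. (cmod (ip H e v))\<^sup>2)"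
    unfolding r_def using E v by (intro E.hnorm_diff_proj) auto
  then have nz: "r \<noteq> \<zero>" using v by (auto simp: spanned_def)
  then have nz': "hnorm H r \<noteq> 0" using r hnorm_eq_zero by blast
  have orth: "ip H e r = 0" if "e \<in> E" for e
    using that v E(2) E.coeff_comb[of E e "\<lambda>e. ip H e v"] E.f_closed[OF that] by (simp add: r_def)
  define u where "u = complex_of_real (inverse (hnorm H r)) \<odot> r"
  note ins = orthonormal_insert[OF E r nz orth, folded u_def]
  have "ip H r (E.proj E v) = 0"
    using r E(2) orth ip_commute[of _ r] E.f_closed by (subst E.ip_comb_right) (auto intro!: sum.neutral)
  moreover have "v = r \<oplus> E.proj E v" using v by (simp add: r_def diff_add_cancel')
  ultimately have "ip H r v = ip H r r"
    using r ip_add_right[of r r "E.proj E v"] by simp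
  then have "ip H u v = complex_of_real (hnorm H r)"
    using r v nz' by (simp add: u_def ip_self power2_eq_square)
  then have "(\<Sum>e\<in>insert u E. (cmod (ip H e v))\<^sup>2) = (hnorm H r)\<^sup>2 + (\<Sum>e\<in>E. (cmod (ip H e v))\<^sup>2)"
    using ins(2) E(2) by simp
  then have "spanned (insert u E) v" using rn by (simp add: spanned_def)
  then show ?thesis using ins u_def r_def by blast
qed

text \<open>A larger set can only increase the sum of squares, and Bessel's inequality caps
  it.\<close>

lemma spanned_insert:
  assumes "orthonormal H (insert u E) (\<lambda>e. e)" "finite E" "v \<in> carrier H" "spanned E v" "u \<notin> E"
  shows "spanned (insert u E) v"
proof -
  interpret E: orthonormal H "insert u E" "\<lambda>e. e" by fact
  show ?thesis
    using E.bessel[of "insert u E" v] assms(2-5) by (auto simp: spanned_def)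
qed

lemma finite_orthonormal_basis:
  assumes "fin_dim H"
  shows "\<exists>E. finite E \<and> orthonormal H E (\<lambda>e. e) \<and> (\<forall>v\<in>carrier H. spanned E v)"
proof -
  obtain B where B: "B \<subseteq> carrier H" "finite B" "lin_span H B = carrier H"
    using assms by (auto simp: fin_dim_def)
  have "\<exists>E. finite E \<and> orthonormal H E (\<lambda>e. e) \<and> (\<forall>v\<in>B. spanned E v)"
    using B(2,1)
  proof (induction B)
    case empty
    have "orthonormal H {} (\<lambda>e. e)" by unfold_locales auto
    then show ?case by auto
  next
    case (insert b B)
    then obtain E where E: "finite E" "orthonormal H E (\<lambda>e. e)" "\<forall>v\<in>B. spanned E v" by auto
    show ?case
    proof (cases "spanned E b")
      case True
      then show ?thesis using E by auto
    next
      case False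
      then obtain u where u: "orthonormal H (insert u E) (\<lambda>e. e)" "u \<notin> E" "spanned (insert u E) b"
        using gram_schmidt_step[OF E(2,1)] insert.prems by auto
      have "spanned (insert u E) v" if "v \<in> B" for v
        using spanned_insert[OF u(1) E(1) _ _ u(2)] that insert.prems E(3) by auto
      then show ?thesis using u E(1) by (intro exI[of _ "insert u E"]) auto
    qed
  qed
  then obtain E where E: "finite E" "orthonormal H E (\<lambda>e. e)" "\<forall>v\<in>B. spanned E v" by auto
  have "carrier H \<subseteq> {v \<in> carrier H. spanned E v}"
    using spanned_submodule[OF E(2,1)] E(3) B(1) unfolding B(3)[symmetric] lin_span_def by blast
  with E show ?thesis by blast
qed

section \<open>Largest orthonormal sets and the finite-dimensional spectral theorem\<close>

lemma hnorm_orthonormal: "orthonormal H E f \<Longrightarrow> e \<in> E \<Longrightarrow> hnorm H (f e) = 1"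
  using orthonormal.f_ip[of H E f e e] by (simp add: hnorm_def)

text \<open>Double counting of the squared inner products between \<open>E\<close> and
  \<open>F\<close>: summed over \<open>E\<close> first they give \<open>card F\<close>, summed over
  \<open>F\<close> first they give at most \<open>card E\<close>.\<close>

lemma card_orthonormal_le:
  assumes E: "finite E" "orthonormal H E (\<lambda>e. e)" "\<forall>v\<in>carrier H. spanned E v"
    and F: "finite F" "orthonormal H F (\<lambda>e. e)"
  shows "card F \<le> card E"
proof -
  interpret E: orthonormal H E "\<lambda>e. e" by fact
  interpret F: orthonormal H F "\<lambda>e. e" by fact
  have "real (card F) = (\<Sum>e\<in>F. (hnorm H e)\<^sup>2)"
    using hnorm_orthonormal[OF F(2)] by simp
  also have "\<dots> = (\<Sum>e\<in>F. \<Sum>e'\<in>E. (cmod (ip H e' e))\<^sup>2)"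
    using E(3) by (intro sum.cong) (auto simp: spanned_def)
  also have "\<dots> = (\<Sum>e'\<in>E. \<Sum>e\<in>F. (cmod (ip H e e'))\<^sup>2)"
    using ip_commute[OF F.f_closed E.f_closed] by (subst sum.swap) (auto intro!: sum.cong)
  also have "\<dots> \<le> (\<Sum>e'\<in>E. (hnorm H e')\<^sup>2)"
    using F by (intro sum_mono F.bessel) auto
  also have "\<dots> = real (card E)" using hnorm_orthonormal[OF E(2)] by simp
  finally show ?thesis by simp
qed

text \<open>Takes the place of induction on the dimension: cardinalities of orthonormal sets are
  bounded, so any property of them that the empty set has is attained by a largest set, which is
  then shown to span.\<close>

lemma maximal_orthonormal:
  assumes "fin_dim H" "P {}"
  shows "\<exists>E. finite E \<and> orthonormal H E (\<lambda>e. e) \<and> P E \<and>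
    (\<forall>F. finite F \<and> orthonormal H F (\<lambda>e. e) \<and> P F \<longrightarrow> card F \<le> card E)"
proof -
  obtain B where B: "finite B" "orthonormal H B (\<lambda>e. e)" "\<forall>v\<in>carrier H. spanned B v"
    using finite_orthonormal_basis[OF assms(1)] by auto
  define Q where "Q E \<longleftrightarrow> finite E \<and> orthonormal H E (\<lambda>e. e) \<and> P E" for E
  have "orthonormal H {} (\<lambda>e. e)" by unfold_locales auto
  then have "Q {}" using assms(2) by (simp add: Q_def)
  moreover have "\<forall>E. Q E \<longrightarrow> card E \<le> card B" using card_orthonormal_le[OF B] by (auto simp: Q_def)
  then have "\<forall>E. Q E \<longrightarrow> card E < Suc (card B)" by (simp add: less_Suc_eq_le)
  ultimately have "\<exists>E. Q E \<and> (\<forall>F. Q F \<longrightarrow> card F \<le> card E)"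
    by (rule Lattices_Big.ex_has_greatest_nat)
  then show ?thesis by (auto simp: Q_def)
qed

text \<open>For a largest orthonormal subset of \<open>W\<close>, a vector of \<open>W\<close>
  outside its span would yield one more orthonormal vector in \<open>W\<close> by
  Gram-Schmidt.\<close>

lemma subspace_orthonormal_basis:
  assumes "fin_dim H" and W: "submodule W complex_ring H"
  shows "\<exists>E. finite E \<and> E \<subseteq> W \<and> orthonormal H E (\<lambda>e. e) \<and> (\<forall>v\<in>W. spanned E v)"
proof -
  note W' = submoduleD[OF W]
  obtain E where E: "finite E" "orthonormal H E (\<lambda>e. e)" "E \<subseteq> W"
    and max: "\<And>F. finite F \<Longrightarrow> orthonormal H F (\<lambda>e. e) \<Longrightarrow> F \<subseteq> W \<Longrightarrow> card F \<le> card E"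
    using maximal_orthonormal[OF assms(1), of "\<lambda>E. E \<subseteq> W"] by auto
  interpret E: orthonormal H E "\<lambda>e. e" by fact
  have comb_W: "E.comb c Y \<in> W" if "finite Y" "Y \<subseteq> E" for c Y
    using that
  proof (induction Y)
    case (insert y Y)
    then have "E.comb c (insert y Y) = c y \<odot> y \<oplus> E.comb c Y"
      unfolding E.comb_def by (intro finsum_insert) auto
    then show ?case using insert W' E(3) by auto
  qed (simp add: E.comb_def W')
  have "spanned E v" if v: "v \<in> W" for v
  proof (rule ccontr)
    assume "\<not> spanned E v"
    then obtain u c where u: "orthonormal H (insert u E) (\<lambda>e. e)" "u \<notin> E" "u = c \<odot> (v \<ominus> E.proj E v)"
      using gram_schmidt_step[OF E(2,1)] v W'(1) by blast
    have "v \<ominus> E.proj E v = v \<oplus> (- 1) \<odot> E.proj E v"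
      using v W'(1) by (intro diff_eq_smult) auto
    then have "u \<in> W" using comb_W[of E] E(1) v W' u(3) by simp
    then have "card (insert u E) \<le> card E" using E u by (intro max) auto
    then show False using u(2) E(1) by simp
  qed
  with E show ?thesis by blast
qed

text \<open>In an orthonormal basis of \<open>W\<close> the restriction of \<open>T\<close> is a
  complex matrix, whose characteristic polynomial has a root. Invariant subspaces are allowed
  because the eigenvector is sought in an orthogonal complement.\<close>

lemma ex_eigenvector:
  assumes "fin_dim H" and W: "submodule W complex_ring H" and T: "lin_map H H T" "T ` W \<subseteq> W"
    and nontrivial: "w \<in> W" "w \<noteq> \<zero>"
  shows "\<exists>v\<in>W. v \<noteq> \<zero> \<and> (\<exists>k. T v = k \<odot> v)"
proof -
  note W' = submoduleD[OF W] and T' = lin_mapD[OF T(1)]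
  obtain E where E: "finite E" "E \<subseteq> W" "orthonormal H E (\<lambda>e. e)" "\<forall>v\<in>W. spanned E v"
    using subspace_orthonormal_basis[OF assms(1,2)] by blast
  obtain g where g: "bij_betw g {0..<card E} E" using ex_bij_betw_nat_finite[OF E(1)] by blast
  define d where "d = card E"
  interpret E: orthonormal H E "\<lambda>e. e" by fact
  have gE: "g i \<in> E" if "i < d" for i using g that by (auto simp: d_def bij_betw_def)
  have g_eq: "g i = g j \<longleftrightarrow> i = j" if "i < d" "j < d" for i j
    using g that by (auto simp: d_def bij_betw_def inj_on_def)
  interpret g: orthonormal H "{0..<d}" g
    using E.f_closed[OF gE] E.f_ip[OF gE gE] g_eq by unfold_locales auto
  have "d \<noteq> 0"
  proof
    assume "d = 0"
    then have "E = {}" using E(1) by (simp add: d_def)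
    moreover have "w \<in> carrier H" using nontrivial W' by auto
    ultimately have "hnorm H w = 0" using E(4) nontrivial(1) by (auto simp: spanned_def)
    then show False using nontrivial \<open>w \<in> carrier H\<close> hnorm_eq_zero by blast
  qed
  define A where "A = mat d d (\<lambda>(i, j). ip H (g i) (T (g j)))"
  have A: "A \<in> carrier_mat d d" by (simp add: A_def)
  have "\<not> constant (poly (char_poly A))"
    using degree_monic_char_poly[OF A] \<open>d \<noteq> 0\<close> by (simp add: constant_degree)
  then obtain k where "eigenvalue A k"
    using fundamental_theorem_of_algebra eigenvalue_root_char_poly[OF A] by blast
  then obtain c where c: "c \<in> carrier_vec d" "c \<noteq> 0\<^sub>v d" "A *\<^sub>v c = k \<cdot>\<^sub>v c"
    using A by (auto simp: eigenvalue_def eigenvector_def)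
  define v where "v = g.comb (\<lambda>j. vec_index c j) {0..<d}"
  have comb_W: "g.comb c Y \<in> W" if "finite Y" "Y \<subseteq> {0..<d}" for c Y
    using that
  proof (induction Y)
    case (insert y Y)
    then have "g.comb c (insert y Y) = c y \<odot> g y \<oplus> g.comb c Y"
      unfolding g.comb_def by (intro finsum_insert) auto
    moreover have "g y \<in> W" using insert.prems E(2) gE by auto
    ultimately show ?case using insert W' by auto
  qed (simp add: g.comb_def W')
  have v: "v \<in> W" "v \<in> carrier H" using comb_W by (auto simp: v_def)
  have coeff_v: "ip H (g i) v = vec_index c i" if "i < d" for i
    using that by (simp add: v_def g.coeff_comb)
  have coeff_Tv: "ip H (g i) (T v) = k * vec_index c i" if i: "i < d" for i
  proof -
    have "T v = finsum H (\<lambda>j. T (vec_index c j \<odot> g j)) {0..<d}"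
      unfolding v_def g.comb_def using T(1) complex_module_axioms by (intro lin_map_finsum) auto
    also have "ip H (g i) \<dots> = (\<Sum>j\<in>{0..<d}. ip H (g i) (T (vec_index c j \<odot> g j)))"
      using i T' by (intro ip_finsum_right) auto
    also have "\<dots> = (\<Sum>j\<in>{0..<d}. ip H (g i) (T (g j)) * vec_index c j)"
      using i T' by (intro sum.cong) (auto simp: mult.commute)
    also have "\<dots> = vec_index (A *\<^sub>v c) i"
      using i c(1) by (simp add: A_def scalar_prod_def)
    also have "\<dots> = k * vec_index c i" using i c by simp
    finally show ?thesis .
  qed
  define u where "u = T v \<ominus> k \<odot> v"
  have uc: "u \<in> carrier H" using v T' by (simp add: u_def)
  have "u = T v \<oplus> (- 1) \<odot> (k \<odot> v)" using v T' by (simp add: u_def diff_eq_smult)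
  then have uW: "u \<in> W" using W' v T(2) by auto
  have "ip H e u = 0" if e: "e \<in> E" for e
  proof -
    have "e \<in> g ` {0..<d}" using e g by (simp add: d_def bij_betw_def)
    then obtain i where "i < d" "e = g i" by auto
    then show ?thesis using coeff_v coeff_Tv v T' E.f_closed[OF e] by (simp add: u_def)
  qed
  \<comment> \<open>The defect \<open>u\<close> lies in \<open>W\<close> by invariance and is
    orthogonal to \<open>E\<close>, which spans \<open>W\<close>.\<close>
  then have "hnorm H u = 0" using E(4) uW by (auto simp: spanned_def)
  then have "u = \<zero>" by (rule hnorm_eq_zero[OF uc, THEN iffD1])
  then have "T v \<ominus> k \<odot> v = \<zero>" unfolding u_def .
  then have "T v = k \<odot> v" by (rule diff_eq_zeroD[OF T'(1)[OF v(2)] smult_closed[OF v(2)]])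
  moreover have "v \<noteq> \<zero>"
  proof
    assume "v = \<zero>"
    then have "vec_index c i = 0" if "i < d" for i using coeff_v[OF that] that by simp
    then have "c = 0\<^sub>v d" using c(1) by (intro eq_vecI) auto
    then show False using c(2) by simp
  qed
  ultimately show ?thesis using v(1) by blast
qed

text \<open>Consider a largest orthonormal set of eigenvectors with real eigenvalues. Its orthogonal
  complement is invariant by symmetry of \<open>T\<close>, and if it were nonzero, an eigenvector in
  it, again with a real eigenvalue, would enlarge the set.\<close>

lemma selfadjoint_eigenbasis:
  assumes "fin_dim H" "selfadjoint_end H T"
  shows "\<exists>E lam. finite E \<and> orthonormal_basis H E (\<lambda>e. e) \<and>
    (\<forall>e\<in>E. T e = complex_of_real (lam e) \<odot> e)"
proof -
  have T: "lin_map H H T" "\<And>v w. v \<in> carrier H \<Longrightarrow> w \<in> carrier H \<Longrightarrow> ip H (T v) w = ip H v (T w)"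
    using assms(2) by (auto simp: selfadjoint_end_def)
  note T' = lin_mapD[OF T(1)]
  define P where "P E \<longleftrightarrow> (\<forall>e\<in>E. \<exists>t. T e = complex_of_real t \<odot> e)" for E
  obtain E where E: "finite E" "orthonormal H E (\<lambda>e. e)" "P E"
    and max: "\<And>F. finite F \<Longrightarrow> orthonormal H F (\<lambda>e. e) \<Longrightarrow> P F \<Longrightarrow> card F \<le> card E"
    using maximal_orthonormal[OF assms(1), of P] by (auto simp: P_def)
  interpret E: orthonormal H E "\<lambda>e. e" by fact
  define W where "W = {w \<in> carrier H. \<forall>e\<in>E. ip H e w = 0}"
  have W: "submodule W complex_ring H" by (rule submoduleI) (auto simp: W_def)
  have TW: "T ` W \<subseteq> W"
  proof
    fix y assume "y \<in> T ` W"
    then obtain w where w: "w \<in> W" "y = T w" by auto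
    have "ip H e (T w) = 0" if e: "e \<in> E" for e
    proof -
      obtain t where t: "T e = complex_of_real t \<odot> e" using E(3) e by (auto simp: P_def)
      have "ip H e (T w) = ip H (T e) w" using T(2)[of e w] e w by (simp add: W_def)
      then show ?thesis using t e w by (simp add: W_def)
    qed
    with w show "y \<in> W" using T' by (auto simp: W_def)
  qed
  have spanned: "spanned E v" if v: "v \<in> carrier H" for v
  proof (rule ccontr)
    assume n: "\<not> spanned E v"
    define r where "r = v \<ominus> E.proj E v"
    have r: "r \<in> carrier H" using v by (simp add: r_def)
    have "r \<in> W"
      using r v E(1) E.coeff_comb[OF E(1) order_refl] by (auto simp: W_def r_def)
    moreover have "r \<noteq> \<zero>"
    proof
      assume "r = \<zero>"
      then have "v = E.proj E v" using v diff_eq_zeroD[of v "E.proj E v"] by (simp add: r_def)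
      then show False using n spanned_iff_proj[OF E(2,1) v] by simp
    qed
    ultimately obtain x k where x: "x \<in> W" "x \<noteq> \<zero>" "T x = k \<odot> x"
      using ex_eigenvector[OF assms(1) W T(1) TW] by blast
    have xc: "x \<in> carrier H" using x by (simp add: W_def)
    have "ip H x x \<noteq> 0" using x(2) xc hnorm_eq_zero by (simp add: ip_self)
    then have "cnj k = k" using T(2)[OF xc xc] x(3) xc by simp
    then obtain t where t: "k = complex_of_real t" by (metis Reals_cnj_iff Reals_cases)
    define u where "u = complex_of_real (inverse (hnorm H x)) \<odot> x"
    have u: "orthonormal H (insert u E) (\<lambda>e. e)" "u \<notin> E"
      using orthonormal_insert[OF E(2,1) xc x(2)] x(1) by (auto simp: u_def W_def)
    have "T u = complex_of_real t \<odot> u"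
      unfolding u_def T'(3)[OF xc] x(3) t using xc by (simp only: smult_smult mult.commute)
    then have "card (insert u E) \<le> card E" using u E by (intro max) (auto simp: P_def)
    then show False using u(2) E(1) by simp
  qed
  have "total_set H (hnorm H) E"
    unfolding total_set_def
  proof (intro conjI allI impI subset_antisym subsetI; (elim conjE)?)
    fix Q v assume Q: "closed_subspace H (hnorm H) Q" "E \<subseteq> Q"
    note Q' = closed_subspaceD[OF Q(1)]
    show "v \<in> carrier H" if "v \<in> Q" using Q' that by auto
    have comb_Q: "E.comb c Y \<in> Q" if "finite Y" "Y \<subseteq> E" for c Y
      using that
    proof (induction Y)
      case (insert y Y)
      then have "E.comb c (insert y Y) = c y \<odot> y \<oplus> E.comb c Y"
        unfolding E.comb_def by (intro finsum_insert) auto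
      then show ?case using insert Q' Q(2) by auto
    qed (simp add: E.comb_def Q')
    show "v \<in> Q" if "v \<in> carrier H"
      using comb_Q[OF E(1) order_refl] spanned[OF that] spanned_iff_proj[OF E(2,1) that] by metis
  qed simp
  then have "orthonormal_basis H E (\<lambda>e. e)" by unfold_locales simp
  moreover obtain lam where "\<And>e. e \<in> E \<Longrightarrow> T e = complex_of_real (lam e) \<odot> e"
    using E(3) unfolding P_def by metis
  ultimately show ?thesis using E(1) by blast
qed

lemma eigenvalue_in_spec_end:
  assumes "lin_map H H T" "e \<in> carrier H" "e \<noteq> \<zero>" "T e = c \<odot> e"
  shows "c \<in> spec_end H T"
proof -
  have "T \<zero> = \<zero>"
    using assms(1) complex_module_axioms by (intro lin_map_zero) auto
  then have eq: "T e \<ominus> c \<odot> e = T \<zero> \<ominus> c \<odot> \<zero>" using assms by simp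
  have "\<not> inj_on (\<lambda>v. T v \<ominus> c \<odot> v) (carrier H)"
    using inj_onD[OF _ eq assms(2) zero_closed] assms(3) by blast
  then show ?thesis by (auto simp: spec_end_def bij_betw_def)
qed

end

text \<open>The members of a finite spanning set have a finite joint support \<open>Z\<close>, and
  the functions vanishing off \<open>Z\<close> form a submodule, hence are all functions. A nonzero
  vector of \<open>S\<close> placed at a point then shows that the point lies in \<open>Z\<close>.
  This turns the spectral condition on \<open>F\<close> into finiteness of a set of lattice
  points.\<close>

lemma finite_if_fin_dim_direct_sum:
  assumes S: "complex_module S" "carrier S \<noteq> {\<zero>\<^bsub>S\<^esub>}" and fin: "fin_dim (direct_sum_copies Y S)"
  shows "finite Y"
proof -
  interpret S: complex_module S by fact
  let ?V = "direct_sum_copies Y S"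
  obtain B where B: "B \<subseteq> carrier ?V" "finite B" "lin_span ?V B = carrier ?V"
    using fin by (auto simp: fin_dim_def)
  define Z where "Z = (\<Union>b\<in>B. {x \<in> Y. b x \<noteq> \<zero>\<^bsub>S\<^esub>})"
  have Z: "finite Z" using B(1,2) by (auto simp: Z_def direct_sum_copies_def)
  define W where "W = {f \<in> carrier ?V. \<forall>x\<in>Y - Z. f x = \<zero>\<^bsub>S\<^esub>}"
  have W_in: "f x \<in> carrier S" "finite {x \<in> Y. f x \<noteq> \<zero>\<^bsub>S\<^esub>}" if "f \<in> W" "x \<in> Y" for f x
    using that by (auto simp: W_def direct_sum_copies_def)
  have "submodule W complex_ring ?V"
  proof
    show "W \<subseteq> carrier (add_monoid ?V)" by (auto simp: W_def)
    show "\<one>\<^bsub>add_monoid ?V\<^esub> \<in> W" by (auto simp: W_def direct_sum_copies_def)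
    show "f \<otimes>\<^bsub>add_monoid ?V\<^esub> g \<in> W" if fg: "f \<in> W" "g \<in> W" for f g
    proof -
      have "finite ({x \<in> Y. f x \<noteq> \<zero>\<^bsub>S\<^esub>} \<union> {x \<in> Y. g x \<noteq> \<zero>\<^bsub>S\<^esub>})"
        using fg by (auto simp: W_def direct_sum_copies_def)
      then have "finite {x \<in> Y. f x \<oplus>\<^bsub>S\<^esub> g x \<noteq> \<zero>\<^bsub>S\<^esub>}"
        by (rule rev_finite_subset) (auto simp: W_in[OF fg(1)])
      moreover have "f x \<in> carrier S" "g x \<in> carrier S" if "x \<in> Y" for x
        using W_in fg that by auto
      moreover have "{x \<in> Y. (if x \<in> Y then f x \<oplus>\<^bsub>S\<^esub> g x else undefined) \<noteq> \<zero>\<^bsub>S\<^esub>} = {x \<in> Y. f x \<oplus>\<^bsub>S\<^esub> g x \<noteq> \<zero>\<^bsub>S\<^esub>}"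
        by auto
      ultimately show ?thesis
        using fg by (auto simp: W_def direct_sum_copies_def restrict_def)
    qed
    show "c \<odot>\<^bsub>?V\<^esub> f \<in> W" if "f \<in> W" for c f
    proof -
      have "finite {x \<in> Y. f x \<noteq> \<zero>\<^bsub>S\<^esub>}" using that by (auto simp: W_def direct_sum_copies_def)
      then have "finite {x \<in> Y. c \<odot>\<^bsub>S\<^esub> f x \<noteq> \<zero>\<^bsub>S\<^esub>}" by (rule rev_finite_subset) auto
      moreover have "{x \<in> Y. (if x \<in> Y then c \<odot>\<^bsub>S\<^esub> f x else undefined) \<noteq> \<zero>\<^bsub>S\<^esub>} = {x \<in> Y. c \<odot>\<^bsub>S\<^esub> f x \<noteq> \<zero>\<^bsub>S\<^esub>}"
        by auto
      moreover have "f x \<in> carrier S" if "x \<in> Y" for x using W_in \<open>f \<in> W\<close> that by auto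
      ultimately show ?thesis
        using that by (auto simp: W_def direct_sum_copies_def restrict_def)
    qed
    then have smult: "(\<lambda>x\<in>Y. (- 1) \<odot>\<^bsub>S\<^esub> f x) \<in> W" if "f \<in> W" for f
      using that by (simp add: direct_sum_copies_def)
    show "inv\<^bsub>add_monoid ?V\<^esub> f \<in> W" if f: "f \<in> W" for f
    proof -
      have fS: "f x \<in> carrier S" if "x \<in> Y" for x using W_in f that by auto
      \<comment> \<open>\<open>?V\<close> has not been shown to be a module, so the additive inverse
        is identified through its definite description.\<close>
      let ?g = "\<lambda>x\<in>Y. (- 1) \<odot>\<^bsub>S\<^esub> f x"
      have "inv\<^bsub>add_monoid ?V\<^esub> f = ?g"
        unfolding m_inv_def
      proof (rule the_equality)
        have "f x \<oplus>\<^bsub>S\<^esub> (- 1) \<odot>\<^bsub>S\<^esub> f x = \<zero>\<^bsub>S\<^esub>" "(- 1) \<odot>\<^bsub>S\<^esub> f x \<oplus>\<^bsub>S\<^esub> f x = \<zero>\<^bsub>S\<^esub>" if "x \<in> Y" for x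
          using fS[OF that] by (simp_all flip: S.minus_eq_smult add: S.r_neg S.l_neg)
        then show "?g \<in> carrier (add_monoid ?V) \<and> f \<otimes>\<^bsub>add_monoid ?V\<^esub> ?g = \<one>\<^bsub>add_monoid ?V\<^esub> \<and>
            ?g \<otimes>\<^bsub>add_monoid ?V\<^esub> f = \<one>\<^bsub>add_monoid ?V\<^esub>"
          using smult[OF f] by (auto simp: direct_sum_copies_def W_def intro!: restrict_ext)
        fix h assume h: "h \<in> carrier (add_monoid ?V) \<and> f \<otimes>\<^bsub>add_monoid ?V\<^esub> h = \<one>\<^bsub>add_monoid ?V\<^esub> \<and>
            h \<otimes>\<^bsub>add_monoid ?V\<^esub> f = \<one>\<^bsub>add_monoid ?V\<^esub>"
        then have hS: "h \<in> Y \<rightarrow>\<^sub>E carrier S" by (simp add: direct_sum_copies_def)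
        have "h x = (- 1) \<odot>\<^bsub>S\<^esub> f x" if x: "x \<in> Y" for x
        proof -
          have "(\<lambda>x\<in>Y. h x \<oplus>\<^bsub>S\<^esub> f x) = (\<lambda>x\<in>Y. \<zero>\<^bsub>S\<^esub>)" using h by (simp add: direct_sum_copies_def)
          from fun_cong[OF this, of x] have "h x \<oplus>\<^bsub>S\<^esub> f x = \<zero>\<^bsub>S\<^esub>" using x by simp
          moreover have "h x \<in> carrier S" using hS x by auto
          ultimately have "\<ominus>\<^bsub>S\<^esub> f x = h x" using fS[OF x] by (intro S.minus_equality)
          then show ?thesis using S.minus_eq_smult[OF fS[OF x]] by simp
        qed
        moreover have "h \<in> extensional Y" using hS by (rule PiE_iff[THEN iffD1, THEN conjunct2])
        ultimately show "h = ?g" by (intro extensionalityI[of _ Y]) auto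
      qed
      then show ?thesis using smult[OF f] by simp
    qed
  qed
  moreover have "B \<subseteq> W" using B(1) by (auto simp: W_def Z_def)
  ultimately have all: "carrier ?V \<subseteq> W" unfolding B(3)[symmetric] lin_span_def by blast
  obtain \<xi> where \<xi>: "\<xi> \<in> carrier S" "\<xi> \<noteq> \<zero>\<^bsub>S\<^esub>" using S(2) S.zero_closed by blast
  have "Y \<subseteq> Z"
  proof
    fix x assume x: "x \<in> Y"
    let ?f = "\<lambda>y\<in>Y. if y = x then \<xi> else \<zero>\<^bsub>S\<^esub>"
    have "finite {y \<in> Y. ?f y \<noteq> \<zero>\<^bsub>S\<^esub>}" by (rule finite_subset[of _ "{x}"]) auto
    then have "?f \<in> carrier ?V" using \<xi> by (auto simp: direct_sum_copies_def)
    then have "?f \<in> W" using all by auto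
    then have f0: "\<forall>y\<in>Y - Z. ?f y = \<zero>\<^bsub>S\<^esub>" unfolding W_def by blast
    show "x \<in> Z"
    proof (rule ccontr)
      assume "x \<notin> Z"
      then show False using f0[rule_format, of x] x \<xi>(2) by simp
    qed
  qed
  then show ?thesis using Z finite_subset by blast
qed

section \<open>Diagonal operators\<close>

text \<open>\<open>graph_iff\<close> builds in the maximal domain: a vector belongs to it as soon as
  some vector of \<open>H\<close> has the multiplied coefficients.\<close>

locale diagonal_operator = orthonormal_basis H X f for H (structure) and X f +
  fixes D :: "'a partial_op" and lam :: "'c \<Rightarrow> real"
  assumes graph_iff: "v \<in> op_dom D \<and> op_app D v = w \<longleftrightarrow> v \<in> carrier H \<and> w \<in> carrier H \<and>
    (\<forall>i\<in>X. ip H (f i) w = complex_of_real (lam i) * ip H (f i) v)"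
begin

lemma dom_closed: "v \<in> op_dom D \<Longrightarrow> v \<in> carrier H" "v \<in> op_dom D \<Longrightarrow> op_app D v \<in> carrier H"
  using graph_iff by blast+

lemma coeff_app: "v \<in> op_dom D \<Longrightarrow> i \<in> X \<Longrightarrow> ip H (f i) (op_app D v) = complex_of_real (lam i) * ip H (f i) v"
  using graph_iff by blast

lemma domI:
  assumes "v \<in> carrier H" "w \<in> carrier H"
    "\<And>i. i \<in> X \<Longrightarrow> ip H (f i) w = complex_of_real (lam i) * ip H (f i) v"
  shows "v \<in> op_dom D" "op_app D v = w"
  using graph_iff[of v w] assms by blast+

lemma basis_in_dom: "i \<in> X \<Longrightarrow> f i \<in> op_dom D" "i \<in> X \<Longrightarrow> op_app D (f i) = complex_of_real (lam i) \<odot> f i"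
  using domI[of "f i" "complex_of_real (lam i) \<odot> f i"] by (auto simp: f_ip)

lemma app_add:
  assumes "u \<in> op_dom D" "v \<in> op_dom D"
  shows "u \<oplus> v \<in> op_dom D" "op_app D (u \<oplus> v) = op_app D u \<oplus> op_app D v"
proof -
  note c = dom_closed[OF assms(1)] dom_closed[OF assms(2)]
  have eq: "ip H (f i) (op_app D u \<oplus> op_app D v) = complex_of_real (lam i) * ip H (f i) (u \<oplus> v)" if "i \<in> X" for i
    using that c coeff_app assms by (simp add: distrib_left)
  then show "u \<oplus> v \<in> op_dom D" "op_app D (u \<oplus> v) = op_app D u \<oplus> op_app D v"
    using domI[OF _ _ eq] c by simp_all
qed

lemma app_smult:
  assumes "v \<in> op_dom D"
  shows "c \<odot> v \<in> op_dom D" "op_app D (c \<odot> v) = c \<odot> op_app D v"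
proof -
  note cl = dom_closed[OF assms]
  have eq: "ip H (f i) (c \<odot> op_app D v) = complex_of_real (lam i) * ip H (f i) (c \<odot> v)" if "i \<in> X" for i
    using that cl coeff_app assms by simp
  then show "c \<odot> v \<in> op_dom D" "op_app D (c \<odot> v) = c \<odot> op_app D v"
    using domI[OF _ _ eq] cl by simp_all
qed

lemma dom_submodule: "submodule (op_dom D) complex_ring H"
proof (rule submoduleI)
  show "\<zero> \<in> op_dom D" by (rule domI(1)[of _ \<zero>]) auto
qed (use dom_closed app_add app_smult in auto)

lemma dom_dense: "hdense H (op_dom D)"
  using dom_submodule total basis_in_dom by (intro hdense_submodule) auto

lemma symmetric:
  assumes "u \<in> op_dom D" "v \<in> op_dom D"
  shows "ip H (op_app D u) v = ip H u (op_app D v)"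
proof (rule has_sum_unique)
  note c = dom_closed[OF assms(1)] dom_closed[OF assms(2)]
  show "((\<lambda>i. cnj (ip H (f i) (op_app D u)) * ip H (f i) v) has_sum ip H (op_app D u) v) X"
    using c by (intro parseval_ip)
  have sum: "((\<lambda>i. cnj (ip H (f i) u) * ip H (f i) (op_app D v)) has_sum ip H u (op_app D v)) X"
    using c by (intro parseval_ip)
  have eq: "cnj (ip H (f i) u) * ip H (f i) (op_app D v) = cnj (ip H (f i) (op_app D u)) * ip H (f i) v"
    if "i \<in> X" for i
    using coeff_app[OF assms(1) that] coeff_app[OF assms(2) that] by simp
  show "((\<lambda>i. cnj (ip H (f i) (op_app D u)) * ip H (f i) v) has_sum ip H u (op_app D v)) X"
    by (rule iffD1[OF has_sum_cong[OF eq] sum])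
qed

lemma selfadjoint: "selfadjoint H D"
  unfolding selfadjoint_def
proof (intro conjI ballI dom_submodule dom_dense)
  show "lin_map (H\<lparr>carrier := op_dom D\<rparr>) H (op_app D)"
    using dom_closed app_add app_smult by (intro lin_mapI) auto
  fix v w assume vw: "v \<in> carrier H" "w \<in> carrier H"
  show "v \<in> op_dom D \<and> op_app D v = w \<longleftrightarrow> (\<forall>u\<in>op_dom D. ip H (op_app D u) v = ip H u w)"
  proof
    assume "v \<in> op_dom D \<and> op_app D v = w"
    then show "\<forall>u\<in>op_dom D. ip H (op_app D u) v = ip H u w" using symmetric by auto
  next
    assume *: "\<forall>u\<in>op_dom D. ip H (op_app D u) v = ip H u w"
    \<comment> \<open>Basis vectors lie in the domain, and testing the adjoint relation on them
      alone already gives the graph condition, because the domain is maximal.\<close>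
    have "ip H (f i) w = complex_of_real (lam i) * ip H (f i) v" if i: "i \<in> X" for i
      using *[rule_format, OF basis_in_dom(1)[OF i]] basis_in_dom(2)[OF i] vw i by simp
    then show "v \<in> op_dom D \<and> op_app D v = w" using vw graph_iff by blast
  qed
qed

text \<open>A resolvent at \<open>c\<close> divides the coefficient at \<open>i\<close> by
  \<open>lam i - c\<close>. Only finitely many \<open>lam i\<close> are bounded by a given number,
  so the coefficients outside a finite set become uniformly small on the unit ball.\<close>

lemma compact_resolvent:
  assumes fin: "\<And>R. finite {i \<in> X. \<bar>lam i\<bar> \<le> R}"
  shows "compact_resolvent H D"
  unfolding compact_resolvent_def
proof (intro conjI allI impI)
  \<comment> \<open>The \<open>lam i\<close> are real, so \<open>\<i>\<close> has distance at least
    1 from each of them and its resolvent exists as a contraction.\<close>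
  define q where "q i = inverse (complex_of_real (lam i) - \<i>)" for i
  have nz: "complex_of_real (lam i) - \<i> \<noteq> 0" for i by (auto simp: complex_eq_iff)
  have "cmod (complex_of_real (lam i) - \<i>) \<ge> 1" for i
    using abs_Im_le_cmod[of "complex_of_real (lam i) - \<i>"] by simp
  then have q: "cmod (q i) \<le> 1" for i by (simp add: q_def norm_inverse inverse_le_1_iff)
  have "\<exists>w. w \<in> carrier H \<and> (\<forall>i\<in>X. ip H (f i) w = q i * ip H (f i) v)" if v: "v \<in> carrier H" for v
  proof -
    have "(\<lambda>i. (cmod (ip H (f i) v))\<^sup>2) summable_on X" using parseval[OF v] by (rule has_sum_imp_summable)
    then have "(\<lambda>i. (cmod (q i * ip H (f i) v))\<^sup>2) summable_on X"
    proof (rule summable_on_comparison_test)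
      show "(cmod (q i * ip H (f i) v))\<^sup>2 \<le> (cmod (ip H (f i) v))\<^sup>2" for i
        using q[of i] by (intro power_mono) (auto simp: norm_mult mult_left_le_one_le)
    qed auto
    from riesz_fischer[OF this] show ?thesis by blast
  qed
  then obtain R where R: "\<And>v. v \<in> carrier H \<Longrightarrow> R v \<in> carrier H"
    "\<And>v i. v \<in> carrier H \<Longrightarrow> i \<in> X \<Longrightarrow> ip H (f i) (R v) = q i * ip H (f i) v"
    by metis
  have "lin_map H H R"
    by (rule lin_mapI; (rule eqI)?) (auto simp: R distrib_left)
  moreover have "hnorm H (R v) \<le> 1 * hnorm H v" if v: "v \<in> carrier H" for v
  proof -
    have "(hnorm H (R v))\<^sup>2 \<le> (hnorm H v)\<^sup>2"
    proof (rule has_sum_mono[OF parseval[OF R(1)[OF v]] parseval[OF v]])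
      show "(cmod (ip H (f i) (R v)))\<^sup>2 \<le> (cmod (ip H (f i) v))\<^sup>2" if "i \<in> X" for i
        unfolding R(2)[OF v that] using q[of i] by (intro power_mono) (auto simp: norm_mult mult_left_le_one_le)
    qed
    then show ?thesis using power2_le_imp_le[of "hnorm H (R v)" "hnorm H v"] v by simp
  qed
  ultimately have "bounded_op H H R" unfolding bounded_op_def by blast
  moreover have "R v \<in> op_dom D \<and> op_app D (R v) \<ominus> \<i> \<odot> R v = v" if v: "v \<in> carrier H" for v
  proof -
    have c: "ip H (f i) (v \<oplus> \<i> \<odot> R v) = complex_of_real (lam i) * ip H (f i) (R v)" if i: "i \<in> X" for i
    proof -
      have "1 + \<i> * q i = complex_of_real (lam i) * q i" using nz[of i] by (simp add: q_def field_simps)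
      then show ?thesis using i v R
        by (simp add: distrib_right[symmetric] mult.assoc[symmetric] del: distrib_right) (metis distrib_right mult_1)
    qed
    have "R v \<in> op_dom D" "op_app D (R v) = v \<oplus> \<i> \<odot> R v"
      using domI[OF _ _ c] v R(1) by simp_all
    then show ?thesis using v R(1)[OF v] by (auto intro!: eqI)
  qed
  moreover have "R (op_app D v \<ominus> \<i> \<odot> v) = v" if v: "v \<in> op_dom D" for v
  proof (rule eqI)
    note c = dom_closed[OF v]
    show "R (op_app D v \<ominus> \<i> \<odot> v) \<in> carrier H" "v \<in> carrier H" using c R by auto
    fix i assume i: "i \<in> X"
    have "ip H (f i) (R (op_app D v \<ominus> \<i> \<odot> v)) = q i * (complex_of_real (lam i) - \<i>) * ip H (f i) v"
      using c R i coeff_app[OF v i] by (simp add: algebra_simps)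
    also have "\<dots> = ip H (f i) v" using nz[of i] by (simp add: q_def)
    finally show "ip H (f i) (R (op_app D v \<ominus> \<i> \<odot> v)) = ip H (f i) v" .
  qed
  ultimately show "\<exists>c R. is_resolvent H D c R" unfolding is_resolvent_def by blast
next
  fix c R assume res: "is_resolvent H D c R"
  then obtain C where lin: "lin_map H H R" and C: "\<And>v. v \<in> carrier H \<Longrightarrow> hnorm H (R v) \<le> C * hnorm H v"
    unfolding is_resolvent_def bounded_op_def by auto
  note R = lin_mapD[OF lin]
  have coeff: "(complex_of_real (lam i) - c) * ip H (f i) (R v) = ip H (f i) v" if v: "v \<in> carrier H" and i: "i \<in> X" for v i
  proof -
    have Rv: "R v \<in> op_dom D" "op_app D (R v) \<ominus> c \<odot> R v = v"
      using res v by (auto simp: is_resolvent_def)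
    have "ip H (f i) v = ip H (f i) (op_app D (R v) \<ominus> c \<odot> R v)" using Rv by simp
    also have "\<dots> = (complex_of_real (lam i) - c) * ip H (f i) (R v)"
      using i v R(1) dom_closed[OF Rv(1)] coeff_app[OF Rv(1) i] by (simp add: algebra_simps)
    finally show ?thesis ..
  qed
  let ?K = "R ` {v \<in> carrier H. hnorm H v \<le> 1}"
  have "MS.mtotally_bounded ?K"
  proof (rule mtotally_boundedI)
    show "?K \<subseteq> carrier H" using R by auto
    show "hnorm H w \<le> \<bar>C\<bar>" if "w \<in> ?K" for w
    proof -
      obtain v where v: "v \<in> carrier H" "hnorm H v \<le> 1" "w = R v" using \<open>w \<in> ?K\<close> by auto
      have "hnorm H w \<le> \<bar>C\<bar> * hnorm H v"
        using order_trans[OF C[OF v(1)] mult_right_mono[OF abs_ge_self hnorm_nonneg[OF v(1)]]] v(3) by simp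
      also have "\<dots> \<le> \<bar>C\<bar> * 1" using v by (intro mult_left_mono) auto
      finally show ?thesis by simp
    qed
    fix \<epsilon> :: real assume e: "\<epsilon> > 0"
    \<comment> \<open>For an index outside \<open>Y\<close> the distance of \<open>lam i\<close>
      from \<open>c\<close> is at least \<open>1 / \<epsilon>\<close>, so the coefficient of
      \<open>R v\<close> is at most \<open>\<epsilon>\<close> times that of
      \<open>v\<close>.\<close>
    define Y where "Y = {i \<in> X. \<bar>lam i\<bar> \<le> cmod c + 1 / \<epsilon>}"
    have Y: "finite Y" "Y \<subseteq> X" using fin by (auto simp: Y_def)
    have tail: "(cmod (ip H (f i) (R v)))\<^sup>2 \<le> \<epsilon>\<^sup>2 * (cmod (ip H (f i) v))\<^sup>2"
      if v: "v \<in> carrier H" and i: "i \<in> X - Y" for v i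
    proof -
      have "1 / \<epsilon> \<le> cmod (complex_of_real (lam i) - c)"
        using i norm_triangle_ineq2[of "complex_of_real (lam i)" c] by (auto simp: Y_def)
      then have "1 / \<epsilon> * cmod (ip H (f i) (R v)) \<le> cmod (complex_of_real (lam i) - c) * cmod (ip H (f i) (R v))"
        by (intro mult_right_mono) auto
      also have "\<dots> = cmod (ip H (f i) v)" using coeff[OF v, of i] i by (simp flip: norm_mult)
      finally have "cmod (ip H (f i) (R v)) \<le> \<epsilon> * cmod (ip H (f i) v)" using e by (simp add: field_simps)
      then have "(cmod (ip H (f i) (R v)))\<^sup>2 \<le> (\<epsilon> * cmod (ip H (f i) v))\<^sup>2" by (intro power_mono) auto
      then show ?thesis by (simp only: power_mult_distrib)
    qed
    have "hnorm H (w \<ominus> proj Y w) \<le> \<epsilon>" if "w \<in> ?K" for w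
    proof -
      obtain v where v: "v \<in> carrier H" "hnorm H v \<le> 1" "w = R v" using \<open>w \<in> ?K\<close> by auto
      have w: "w \<in> carrier H" using v R by auto
      have "((\<lambda>i. (cmod (ip H (f i) w))\<^sup>2) has_sum ((hnorm H w)\<^sup>2 - (\<Sum>i\<in>Y. (cmod (ip H (f i) w))\<^sup>2))) (X - Y)"
        using Y by (intro has_sum_Diff parseval[OF w] has_sum_finite) auto
      moreover have "((\<lambda>i. \<epsilon>\<^sup>2 * (cmod (ip H (f i) v))\<^sup>2) has_sum \<epsilon>\<^sup>2 * (hnorm H v)\<^sup>2) X"
        by (intro has_sum_cmult_right parseval v)
      ultimately have "(hnorm H w)\<^sup>2 - (\<Sum>i\<in>Y. (cmod (ip H (f i) w))\<^sup>2) \<le> \<epsilon>\<^sup>2 * (hnorm H v)\<^sup>2"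
        by (rule has_sum_mono_neutral) (use tail[OF v(1)] v(3) in auto)
      also have "\<dots> \<le> \<epsilon>\<^sup>2 * 1" using v by (intro mult_left_mono power_le_one) auto
      finally have "(hnorm H (w \<ominus> proj Y w))\<^sup>2 \<le> \<epsilon>\<^sup>2"
        using hnorm_diff_proj[OF Y w] by simp
      then show ?thesis using e power2_le_imp_le[of "hnorm H (w \<ominus> proj Y w)" \<epsilon>] by simp
    qed
    with Y show "\<exists>Y. finite Y \<and> Y \<subseteq> X \<and> (\<forall>v\<in>?K. hnorm H (v \<ominus> proj Y v) \<le> \<epsilon>)" by blast
  qed
  then show "compact_op H R"
    using lin MS.mtotally_bounded_eq_compact_closure_of[OF complete] unfolding compact_op_def hdist_def by blast
qed

end

section \<open>C*-algebras\<close>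

lemma cstar_algebraD:
  assumes "cstar_algebra A"
  shows "ring A" "module complex_ring A"
    "\<And>c x y. x \<in> carrier A \<Longrightarrow> y \<in> carrier A \<Longrightarrow> (c \<odot>\<^bsub>A\<^esub> x) \<otimes>\<^bsub>A\<^esub> y = c \<odot>\<^bsub>A\<^esub> (x \<otimes>\<^bsub>A\<^esub> y)"
    "\<And>c x y. x \<in> carrier A \<Longrightarrow> y \<in> carrier A \<Longrightarrow> x \<otimes>\<^bsub>A\<^esub> (c \<odot>\<^bsub>A\<^esub> y) = c \<odot>\<^bsub>A\<^esub> (x \<otimes>\<^bsub>A\<^esub> y)"
    "\<And>x. x \<in> carrier A \<Longrightarrow> star A x \<in> carrier A" "\<And>x. x \<in> carrier A \<Longrightarrow> star A (star A x) = x"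
    "\<And>x y. x \<in> carrier A \<Longrightarrow> y \<in> carrier A \<Longrightarrow> star A (x \<oplus>\<^bsub>A\<^esub> y) = star A x \<oplus>\<^bsub>A\<^esub> star A y"
    "\<And>x y. x \<in> carrier A \<Longrightarrow> y \<in> carrier A \<Longrightarrow> star A (x \<otimes>\<^bsub>A\<^esub> y) = star A y \<otimes>\<^bsub>A\<^esub> star A x"
    "\<And>c x. x \<in> carrier A \<Longrightarrow> star A (c \<odot>\<^bsub>A\<^esub> x) = cnj c \<odot>\<^bsub>A\<^esub> star A x"
    "\<And>x. x \<in> carrier A \<Longrightarrow> 0 \<le> nrm A x" "\<And>x. x \<in> carrier A \<Longrightarrow> nrm A x = 0 \<longleftrightarrow> x = \<zero>\<^bsub>A\<^esub>"
    "\<And>c x. x \<in> carrier A \<Longrightarrow> nrm A (c \<odot>\<^bsub>A\<^esub> x) = cmod c * nrm A x"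
    "\<And>x y. x \<in> carrier A \<Longrightarrow> y \<in> carrier A \<Longrightarrow> nrm A (x \<oplus>\<^bsub>A\<^esub> y) \<le> nrm A x + nrm A y"
    "\<And>x y. x \<in> carrier A \<Longrightarrow> y \<in> carrier A \<Longrightarrow> nrm A (x \<otimes>\<^bsub>A\<^esub> y) \<le> nrm A x * nrm A y"
    "\<And>x. x \<in> carrier A \<Longrightarrow> nrm A (star A x \<otimes>\<^bsub>A\<^esub> x) = (nrm A x)\<^sup>2"
    "Metric_space.mcomplete (carrier A) (cdist A)"
  using assms unfolding cstar_algebra_def by blast+

locale cstar =
  fixes A (structure)
  assumes cstar_algebra: "cstar_algebra A"
begin

sublocale ring A by (rule cstar_algebraD(1)[OF cstar_algebra])

sublocale complex_module A
  by (rule complex_module.intro) (rule cstar_algebraD(2)[OF cstar_algebra])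

sublocale normed_module A "nrm A"
  by unfold_locales
    (simp_all add: cstar_algebraD(10,12,13)[OF cstar_algebra] cstar_algebraD(11)[OF cstar_algebra])

lemmas smult_mult_left [simp] = cstar_algebraD(3)[OF cstar_algebra]
  and smult_mult_right [simp] = cstar_algebraD(4)[OF cstar_algebra]
  and star_closed [simp] = cstar_algebraD(5)[OF cstar_algebra]
  and star_star [simp] = cstar_algebraD(6)[OF cstar_algebra]
  and star_add [simp] = cstar_algebraD(7)[OF cstar_algebra]
  and star_mult [simp] = cstar_algebraD(8)[OF cstar_algebra]
  and star_smult [simp] = cstar_algebraD(9)[OF cstar_algebra]
  and nrm_mult = cstar_algebraD(14)[OF cstar_algebra]
  and nrm_star_mult = cstar_algebraD(15)[OF cstar_algebra]

lemma complete: "MS.mcomplete"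
  using cstar_algebraD(16)[OF cstar_algebra] by (simp add: cdist_def)

lemma star_one [simp]: "star A \<one> = \<one>"
  using star_mult[of \<one> "star A \<one>"] by simp

lemma nrm_star [simp]:
  assumes "x \<in> carrier A"
  shows "nrm A (star A x) = nrm A x"
proof -
  have le: "nrm A y \<le> nrm A (star A y)" if y: "y \<in> carrier A" for y
  proof (cases "nrm A y = 0")
    case False
    then have "nrm A y > 0" using norm_nonneg[OF y] by linarith
    moreover have "nrm A y * nrm A y \<le> nrm A (star A y) * nrm A y"
      using nrm_mult[of "star A y" y] nrm_star_mult[OF y] y by (simp add: power2_eq_square)
    ultimately show ?thesis by simp
  qed (simp add: y)
  show ?thesis using le[OF assms] le[of "star A x"] assms by simp
qed

lemma nrm_one_le: "nrm A \<one> \<le> 1"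
proof -
  have "nrm A \<one> * nrm A \<one> = nrm A \<one>" using nrm_star_mult[of \<one>] by (simp add: power2_eq_square)
  then show ?thesis by auto
qed

lemma nrm_isometry_le:
  assumes "u \<in> carrier A" "star A u \<otimes> u = \<one>"
  shows "nrm A u \<le> 1"
proof -
  have "(nrm A u)\<^sup>2 \<le> 1\<^sup>2" using nrm_star_mult[OF assms(1)] assms(2) nrm_one_le by simp
  then show ?thesis by (rule power2_le_imp_le) simp
qed

lemma nrm_selfadjoint_sq: "h \<in> carrier A \<Longrightarrow> star A h = h \<Longrightarrow> nrm A (h \<otimes> h) = (nrm A h)\<^sup>2"
  using nrm_star_mult[of h] by simp

text \<open>The power of \<open>h\<close> with exponent \<open>2 ^ k\<close>. Along these exponents
  the C*-identity alone determines the norms of the powers of a selfadjoint \<open>h\<close>, so no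
  spectral radius is involved.\<close>

definition iter_sq where "iter_sq h k = ((\<lambda>x. x \<otimes> x) ^^ k) h"

lemma iter_sq_0 [simp]: "iter_sq h 0 = h"
  and iter_sq_Suc [simp]: "iter_sq h (Suc k) = iter_sq h k \<otimes> iter_sq h k"
  by (simp_all add: iter_sq_def)

lemma iter_sq_closed [simp]: "h \<in> carrier A \<Longrightarrow> iter_sq h k \<in> carrier A"
  by (induction k) auto

lemma iter_sq_star: "h \<in> carrier A \<Longrightarrow> star A h = h \<Longrightarrow> star A (iter_sq h k) = iter_sq h k"
  by (induction k) auto

lemma nrm_iter_sq: "h \<in> carrier A \<Longrightarrow> star A h = h \<Longrightarrow> nrm A (iter_sq h k) = nrm A h ^ 2 ^ k"
  by (induction k) (simp_all add: nrm_selfadjoint_sq iter_sq_star power_mult[symmetric] mult.commute)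

text \<open>The fixed point of \<open>y \<mapsto> (h\<^sup>2 + y\<^sup>2) / 2\<close> is \<open>1 - sqrt (1 - h\<^sup>2)\<close>.\<close>

lemma ex_selfadjoint_complement:
  assumes h: "h \<in> carrier A" "star A h = h" "nrm A h < 1"
  shows "\<exists>k\<in>carrier A. star A k = k \<and> h \<otimes> k = k \<otimes> h \<and> (h \<otimes> h) \<oplus> (k \<otimes> k) = \<one>"
proof -
  define r where "r = nrm A h"
  have r: "0 \<le> r" "r < 1" using h by (auto simp: r_def)
  define f where "f y = (1/2) \<odot> (h \<otimes> h \<oplus> y \<otimes> y)" for y
  \<comment> \<open>Commuting with \<open>h\<close> and having norm at most \<open>r\<close> are
    closed conditions that \<open>f\<close> preserves, so the fixed point inherits them. On
    \<open>M\<close> the map \<open>f\<close> contracts by \<open>r\<close>, since it halves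
    \<open>x (x - y) + (x - y) y\<close>.\<close>
  define M where "M = {y \<in> carrier A. h \<otimes> y = y \<otimes> h} \<inter> MS.mcball \<zero> r"
  have M_iff: "y \<in> M \<longleftrightarrow> y \<in> carrier A \<and> h \<otimes> y = y \<otimes> h \<and> nrm A y \<le> r" for y
    using norm_diff_commute[of \<zero> y] by (auto simp: M_def norm_dist_eq a_minus_def)
  have "closed_subspace A (nrm A) {y \<in> carrier A. h \<otimes> y = y \<otimes> h}"
  proof (rule closed_subspace_lin_equalizer[OF normed_module_axioms normed_module_axioms])
    show "lin_map A A ((\<otimes>) h)" "lin_map A A (\<lambda>y. y \<otimes> h)"
      using h by (auto intro!: lin_mapI simp: r_distr l_distr)
    show "nrm A (h \<otimes> y) \<le> nrm A h * nrm A y" "nrm A (y \<otimes> h) \<le> nrm A h * nrm A y"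
      if "y \<in> carrier A" for y
      using nrm_mult[of h y] nrm_mult[of y h] h(1) that by (simp_all add: mult.commute)
  qed
  then have "closedin MS.mtopology M"
    unfolding M_def by (intro closedin_Int[OF closed_subspace_imp_closedin MS.closedin_mcball])
  interpret S: Submetric "carrier A" "norm_dist A (nrm A)" M
    by unfold_locales (auto simp: M_iff)
  have compl: "S.sub.mcomplete"
    using S.closedin_mcomplete_imp_mcomplete \<open>closedin MS.mtopology M\<close> complete by blast
  have fM: "f y \<in> M" if y: "y \<in> M" for y
  proof -
    have y': "y \<in> carrier A" "h \<otimes> y = y \<otimes> h" "nrm A y \<le> r" using y by (auto simp: M_iff)
    have "h \<otimes> (y \<otimes> y) = (y \<otimes> y) \<otimes> h"
      using y' h(1) by (metis m_assoc)
    then have "h \<otimes> f y = f y \<otimes> h" using y' h(1) by (simp add: f_def r_distr l_distr m_assoc)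
    moreover have "nrm A (f y) \<le> r"
    proof -
      have "nrm A (h \<otimes> h \<oplus> y \<otimes> y) \<le> nrm A (h \<otimes> h) + nrm A (y \<otimes> y)"
        using y' h by (intro norm_triangle) auto
      also have "\<dots> \<le> r * r + r * r"
        using nrm_mult[of h h] nrm_mult[of y y] y' h(1) mult_mono[of "nrm A y" r "nrm A y" r] r
        by (simp add: r_def)
      also have "\<dots> \<le> 2 * r" using mult_left_le_one_le[of r r] r by simp
      finally show ?thesis using y' h by (simp add: f_def norm_smult)
    qed
    ultimately show ?thesis using y' h by (simp add: M_iff f_def)
  qed
  have contr: "nrm A (f x \<ominus> f y) \<le> r * nrm A (x \<ominus> y)" if xy: "x \<in> M" "y \<in> M" for x y
  proof -
    have xy': "x \<in> carrier A" "y \<in> carrier A" "nrm A x \<le> r" "nrm A y \<le> r" using xy by (auto simp: M_iff)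
    have "f x \<ominus> f y = (1/2) \<odot> ((h \<otimes> h \<oplus> x \<otimes> x) \<ominus> (h \<otimes> h \<oplus> y \<otimes> y))"
      using xy' h by (simp add: f_def smult_diff)
    also have "(h \<otimes> h \<oplus> x \<otimes> x) \<ominus> (h \<otimes> h \<oplus> y \<otimes> y) = x \<otimes> (x \<ominus> y) \<oplus> (x \<ominus> y) \<otimes> y"
      using xy' h(1) by algebra
    finally have "nrm A (f x \<ominus> f y) = nrm A (x \<otimes> (x \<ominus> y) \<oplus> (x \<ominus> y) \<otimes> y) / 2"
      using xy' by (simp add: norm_smult)
    also have "nrm A (x \<otimes> (x \<ominus> y) \<oplus> (x \<ominus> y) \<otimes> y) \<le> nrm A (x \<otimes> (x \<ominus> y)) + nrm A ((x \<ominus> y) \<otimes> y)"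
      using xy' by (intro norm_triangle) auto
    also have "\<dots> \<le> r * nrm A (x \<ominus> y) + nrm A (x \<ominus> y) * r"
    proof -
      have "nrm A (x \<otimes> (x \<ominus> y)) \<le> nrm A x * nrm A (x \<ominus> y)"
        "nrm A ((x \<ominus> y) \<otimes> y) \<le> nrm A (x \<ominus> y) * nrm A y" "0 \<le> nrm A (x \<ominus> y)"
        using xy' by (auto intro: nrm_mult)
      moreover note mult_right_mono[OF xy'(3) this(3)] mult_left_mono[OF xy'(4) this(3)]
      ultimately show ?thesis by linarith
    qed
    finally show ?thesis by simp
  qed
  obtain y where y: "y \<in> M" "f y = y"
  proof (rule S.sub.Banach_fixedpoint_thm[OF compl])
    have "\<zero> \<in> M" using r h by (simp add: M_iff)
    then show "M \<noteq> {}" by blast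
    show "f \<in> M \<rightarrow> M" using fM by auto
    show "r < 1" by (rule r)
    show "norm_dist A (nrm A) (f x) (f y) \<le> r * norm_dist A (nrm A) x y" if "x \<in> M" "y \<in> M" for x y
      using contr[OF that] fM[OF that(1)] fM[OF that(2)] that by (simp add: norm_dist_eq M_iff)
  qed
  have y': "y \<in> carrier A" "h \<otimes> y = y \<otimes> h" "nrm A y \<le> r" using y by (auto simp: M_iff)
  \<comment> \<open>The adjoint of the fixed point is a fixed point in \<open>M\<close> as well, and
    the contraction estimate makes the two equal.\<close>
  have sM: "star A y \<in> M"
    using y' h star_mult[of h y] star_mult[of y h] by (simp add: M_iff)
  have "f (star A y) = star A (f y)" using y' h by (simp add: f_def)
  then have "f (star A y) = star A y" using y(2) by simp
  then have "nrm A (star A y \<ominus> y) \<le> r * nrm A (star A y \<ominus> y)" using contr[OF sM y(1)] y(2) by simp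
  then have "(1 - r) * nrm A (star A y \<ominus> y) \<le> 0" by (simp add: algebra_simps)
  then have "nrm A (star A y \<ominus> y) \<le> 0" using r by (simp add: mult_le_0_iff)
  then have "nrm A (star A y \<ominus> y) = 0" using y'(1) by (intro order_antisym) auto
  then have "star A y \<ominus> y = \<zero>" using norm_eq_zero[of "star A y \<ominus> y"] y'(1) by simp
  then have sy: "star A y = y" by (rule diff_eq_zeroD[rotated 2]) (use y' in auto)
  have two: "y \<oplus> y = h \<otimes> h \<oplus> y \<otimes> y"
  proof -
    have "y \<oplus> y = 2 \<odot> f y" using y y'(1) smult_add_left[OF y'(1), of 1 1] by simp
    then show ?thesis using y'(1) h by (simp add: f_def smult_smult)
  qed
  \<comment> \<open>The fixed point equation reads \<open>2 y = h\<^sup>2 + y\<^sup>2\<close>, so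
    the square of \<open>1 - y\<close> is \<open>1 - h\<^sup>2\<close>.\<close>
  define k where "k = \<one> \<ominus> y"
  have "k \<in> carrier A" "star A k = k" "h \<otimes> k = k \<otimes> h"
    using y' h sy by (auto simp: k_def diff_eq_smult r_distr l_distr)
  moreover have "(h \<otimes> h) \<oplus> (k \<otimes> k) = \<one>"
  proof -
    have "k \<otimes> k = (\<one> \<ominus> (y \<oplus> y)) \<oplus> y \<otimes> y" unfolding k_def using y'(1)
      by (simp add: a_minus_def l_distr r_distr l_minus r_minus minus_add a_ac)
    then have "(h \<otimes> h) \<oplus> (k \<otimes> k) = (h \<otimes> h) \<oplus> ((\<one> \<ominus> (h \<otimes> h \<oplus> y \<otimes> y)) \<oplus> y \<otimes> y)"
      by (simp only: two)
    also have "\<dots> = \<one>" using h(1) y'(1) by algebra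
    finally show ?thesis .
  qed
  ultimately show ?thesis by blast
qed

end

section \<open>Contractivity of *-homomorphisms\<close>

lemma unital_star_homD:
  assumes "unital_star_hom A B \<phi>"
  shows "lin_map A B \<phi>" "x \<in> carrier A \<Longrightarrow> \<phi> x \<in> carrier B"
    "x \<in> carrier A \<Longrightarrow> y \<in> carrier A \<Longrightarrow> \<phi> (x \<oplus>\<^bsub>A\<^esub> y) = \<phi> x \<oplus>\<^bsub>B\<^esub> \<phi> y"
    "x \<in> carrier A \<Longrightarrow> \<phi> (c \<odot>\<^bsub>A\<^esub> x) = c \<odot>\<^bsub>B\<^esub> \<phi> x"
    "x \<in> carrier A \<Longrightarrow> y \<in> carrier A \<Longrightarrow> \<phi> (x \<otimes>\<^bsub>A\<^esub> y) = \<phi> x \<otimes>\<^bsub>B\<^esub> \<phi> y"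
    "\<phi> \<one>\<^bsub>A\<^esub> = \<one>\<^bsub>B\<^esub>" "x \<in> carrier A \<Longrightarrow> \<phi> (star A x) = star B (\<phi> x)"
  using assms unfolding unital_star_hom_def lin_map_def ring_hom_def by auto

text \<open>A selfadjoint contraction is the real part of a unitary, and *-homomorphisms preserve unitaries.\<close>

lemma star_hom_contractive:
  assumes "cstar_algebra A" "cstar_algebra B" "unital_star_hom A B \<phi>" and x: "x \<in> carrier A"
  shows "nrm B (\<phi> x) \<le> nrm A x"
proof -
  interpret A: cstar A by unfold_locales fact
  interpret B: cstar B by unfold_locales fact
  note \<phi> = unital_star_homD[OF assms(3)]
  have unit: "nrm B (\<phi> h) \<le> 1" if h: "h \<in> carrier A" "star A h = h" "nrm A h < 1" for h
  proof -
    obtain k where k: "k \<in> carrier A" "star A k = k" "h \<otimes>\<^bsub>A\<^esub> k = k \<otimes>\<^bsub>A\<^esub> h"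
        "(h \<otimes>\<^bsub>A\<^esub> h) \<oplus>\<^bsub>A\<^esub> (k \<otimes>\<^bsub>A\<^esub> k) = \<one>\<^bsub>A\<^esub>"
      using A.ex_selfadjoint_complement[OF h] by blast
    define a where "a = \<phi> h"
    define b where "b = \<phi> k"
    have a: "a \<in> carrier B" "star B a = a" using \<phi>(2,7) h unfolding a_def by metis+
    have b: "b \<in> carrier B" "star B b = b" using \<phi>(2,7) k unfolding b_def by metis+
    have ab: "b \<otimes>\<^bsub>B\<^esub> a = a \<otimes>\<^bsub>B\<^esub> b" using \<phi>(5) h(1) k(1,3) unfolding a_def b_def by metis
    have sq: "(a \<otimes>\<^bsub>B\<^esub> a) \<oplus>\<^bsub>B\<^esub> (b \<otimes>\<^bsub>B\<^esub> b) = \<one>\<^bsub>B\<^esub>"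
      using arg_cong[OF k(4), of \<phi>] h(1) k(1) \<phi> by (simp add: a_def b_def)
    define u where "u = a \<oplus>\<^bsub>B\<^esub> \<i> \<odot>\<^bsub>B\<^esub> b"
    have u: "u \<in> carrier B" using a b by (simp add: u_def)
    have su: "star B u = a \<oplus>\<^bsub>B\<^esub> (- \<i>) \<odot>\<^bsub>B\<^esub> b" using a b by (simp add: u_def)
    let ?c = "a \<otimes>\<^bsub>B\<^esub> b"
    have "star B u \<otimes>\<^bsub>B\<^esub> u = (a \<otimes>\<^bsub>B\<^esub> a \<oplus>\<^bsub>B\<^esub> \<i> \<odot>\<^bsub>B\<^esub> ?c) \<oplus>\<^bsub>B\<^esub> ((- \<i>) \<odot>\<^bsub>B\<^esub> ?c \<oplus>\<^bsub>B\<^esub> b \<otimes>\<^bsub>B\<^esub> b)"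
      unfolding su using a b ab by (simp add: u_def B.r_distr B.l_distr B.smult_smult B.smult_add_right B.a_ac)
    also have "\<dots> = ((a \<otimes>\<^bsub>B\<^esub> a) \<oplus>\<^bsub>B\<^esub> (b \<otimes>\<^bsub>B\<^esub> b)) \<oplus>\<^bsub>B\<^esub> (\<i> \<odot>\<^bsub>B\<^esub> ?c \<oplus>\<^bsub>B\<^esub> (- \<i>) \<odot>\<^bsub>B\<^esub> ?c)"
      using a b by (simp add: B.a_ac)
    also have "\<i> \<odot>\<^bsub>B\<^esub> ?c \<oplus>\<^bsub>B\<^esub> (- \<i>) \<odot>\<^bsub>B\<^esub> ?c = \<zero>\<^bsub>B\<^esub>"
      using a b B.smult_add_left[of ?c \<i> "- \<i>"] by simp
    finally have "star B u \<otimes>\<^bsub>B\<^esub> u = \<one>\<^bsub>B\<^esub>" using sq by simp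
    then have nu: "nrm B u \<le> 1" by (rule B.nrm_isometry_le[OF u])
    have "u \<oplus>\<^bsub>B\<^esub> star B u = (a \<oplus>\<^bsub>B\<^esub> a) \<oplus>\<^bsub>B\<^esub> (\<i> \<odot>\<^bsub>B\<^esub> b \<oplus>\<^bsub>B\<^esub> (- \<i>) \<odot>\<^bsub>B\<^esub> b)"
      unfolding su using a b by (simp add: u_def B.a_ac)
    also have "\<dots> = 2 \<odot>\<^bsub>B\<^esub> a"
      using a b B.smult_add_left[of b \<i> "- \<i>"] B.smult_add_left[of a 1 1] by simp
    finally have "2 * nrm B a = nrm B (u \<oplus>\<^bsub>B\<^esub> star B u)" using a by (simp add: B.norm_smult)
    also have "\<dots> \<le> 2" using B.norm_triangle[of u "star B u"] u nu by simp
    finally show ?thesis by (simp add: a_def)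
  qed
  have sa: "nrm B (\<phi> h) \<le> nrm A h" if h: "h \<in> carrier A" "star A h = h" for h
  proof (rule dense_ge)
    \<comment> \<open>The fact \<open>unit\<close> needs norm strictly below 1, so \<open>h\<close>
      is scaled by an arbitrary \<open>t\<close> above its norm; this also covers norm zero.\<close>
    fix t assume t: "nrm A h < t"
    then have tp: "t > 0" using A.norm_nonneg[OF h(1)] by linarith
    have "nrm A (complex_of_real (1 / t) \<odot>\<^bsub>A\<^esub> h) < 1" using h t tp by (simp add: A.norm_smult norm_divide)
    then have "nrm B (\<phi> (complex_of_real (1 / t) \<odot>\<^bsub>A\<^esub> h)) \<le> 1" using h by (intro unit) auto
    then have "nrm B (\<phi> h) / t \<le> 1" using h tp \<phi> by (simp add: B.norm_smult norm_divide)
    then show "nrm B (\<phi> h) \<le> t" using tp by simp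
  qed
  have "(nrm B (\<phi> x))\<^sup>2 = nrm B (\<phi> (star A x \<otimes>\<^bsub>A\<^esub> x))" using x \<phi> by (simp add: B.nrm_star_mult)
  also have "\<dots> \<le> nrm A (star A x \<otimes>\<^bsub>A\<^esub> x)" using x by (intro sa) auto
  also have "\<dots> = (nrm A x)\<^sup>2" using x by (rule A.nrm_star_mult)
  finally show ?thesis by (rule power2_le_imp_le) (use x in simp)
qed

section \<open>The GNS representation of a trace\<close>

text \<open>A polynomial factor in the exponent disappears after taking roots. It serves twice: with
  \<open>m = 0\<close> for a constant factor, and with the rank of the lattice for the growth of
  supports.\<close>

lemma le_if_power_le_polynomial:
  fixes x y c C :: real
  assumes "0 \<le> x" "0 \<le> y" "0 \<le> c" "0 \<le> C" "\<And>j. x ^ 2 ^ j \<le> C * (c * 2 ^ j + 1) ^ m * y ^ 2 ^ j"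
  shows "x \<le> y"
proof (rule ccontr)
  assume "\<not> x \<le> y"
  then have xy: "y < x" by simp
  have y: "y > 0" using assms(5)[of 0] assms(2) xy by (cases "y = 0") auto
  define q where "q = y / x"
  have q: "0 < q" "q < 1" using y xy by (auto simp: q_def)
  \<comment> \<open>Writing \<open>q\<close> as the power of \<open>t\<close> with exponent
    \<open>Suc m\<close> gives each of the \<open>Suc m\<close> factors \<open>real n\<close> its
    own geometric decay, so the single limit of \<open>real n * t ^ n\<close> suffices.\<close>
  define t where "t = root (Suc m) q"
  have t: "0 \<le> t" "t < 1" "t ^ Suc m = q"
    using q by (auto simp: t_def real_root_pow_pos2 simp del: power_Suc)
  define K where "K = C * (c + 1) ^ m"
  have K: "1 \<le> K * (real n * t ^ n) ^ Suc m" if n: "n = 2 ^ j" for n j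
  proof -
    have n1: "1 \<le> real n" using n by simp
    have "x ^ n \<le> C * (c * real n + 1) ^ m * y ^ n" using assms(5)[of j] n by simp
    also have "\<dots> \<le> C * ((c + 1) * real n) ^ m * y ^ n"
      using assms(2-4) n1 by (intro mult_right_mono mult_left_mono power_mono) (auto simp: algebra_simps)
    also have "\<dots> = K * real n ^ m * y ^ n" by (simp add: K_def power_mult_distrib)
    also have "\<dots> \<le> K * real n ^ Suc m * y ^ n"
      using assms(2-4) n1 by (intro mult_right_mono mult_left_mono power_increasing) (auto simp: K_def)
    finally have "1 \<le> K * real n ^ Suc m * q ^ n"
      using xy y by (simp add: q_def power_divide field_simps)
    also have "q ^ n = (t ^ n) ^ Suc m" unfolding t(3)[symmetric] by (simp only: power_mult[symmetric] mult.commute)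
    finally show ?thesis by (simp only: power_mult_distrib mult.assoc)
  qed
  have "(\<lambda>n. real n * t ^ n) \<longlonglongrightarrow> 0" using t by (intro powser_times_n_limit_0) auto
  then have "(\<lambda>n. K * (real n * t ^ n) ^ Suc m) \<longlonglongrightarrow> K * 0 ^ Suc m" by (intro tendsto_intros)
  then have lim: "(\<lambda>n. K * (real n * t ^ n) ^ Suc m) \<longlonglongrightarrow> 0" by simp
  have "strict_mono (\<lambda>j. 2 ^ j :: nat)" by (intro strict_monoI) simp
  from LIMSEQ_subseq_LIMSEQ[OF lim this]
  have "(\<lambda>j. K * (real (2 ^ j) * t ^ 2 ^ j) ^ Suc m) \<longlonglongrightarrow> 0" by (simp add: o_def)
  then have "(1::real) \<le> 0" by (rule LIMSEQ_le_const) (use K in blast)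
  then show False by simp
qed

section \<open>The GNS space of a tracial state\<close>

locale gns = cstar A for A (structure) +
  fixes \<tau> L \<Lambda>
  assumes tracial_state: "tracial_state A \<tau>" and gns_space: "gns_space A \<tau> L \<Lambda>"
begin

sublocale L: hilbert L
  using gns_space by unfold_locales (simp add: gns_space_def)

lemma \<tau>_add: "x \<in> carrier A \<Longrightarrow> y \<in> carrier A \<Longrightarrow> \<tau> (x \<oplus> y) = \<tau> x + \<tau> y"
  and \<tau>_smult: "x \<in> carrier A \<Longrightarrow> \<tau> (c \<odot> x) = c * \<tau> x"
  and \<tau>_le: "x \<in> carrier A \<Longrightarrow> cmod (\<tau> x) \<le> nrm A x"
  and \<tau>_one: "\<tau> \<one> = 1"
  and \<tau>_commute: "x \<in> carrier A \<Longrightarrow> y \<in> carrier A \<Longrightarrow> \<tau> (x \<otimes> y) = \<tau> (y \<otimes> x)"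
  using tracial_state unfolding tracial_state_def by blast+

lemma lin_\<Lambda>: "lin_map A L \<Lambda>"
  and ip_\<Lambda>: "a \<in> carrier A \<Longrightarrow> b \<in> carrier A \<Longrightarrow> ip L (\<Lambda> a) (\<Lambda> b) = \<tau> (star A a \<otimes> b)"
  and dense_\<Lambda>: "hdense L (\<Lambda> ` carrier A)"
  using gns_space unfolding gns_space_def by blast+

lemmas \<Lambda>_closed [simp] = lin_mapD(1)[OF lin_\<Lambda>]
  and \<Lambda>_add = lin_mapD(2)[OF lin_\<Lambda>] and \<Lambda>_smult = lin_mapD(3)[OF lin_\<Lambda>]

lemma hnorm_\<Lambda>_sq: "a \<in> carrier A \<Longrightarrow> complex_of_real ((hnorm L (\<Lambda> a))\<^sup>2) = \<tau> (star A a \<otimes> a)"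
  by (simp add: L.ip_self[symmetric] ip_\<Lambda> del: of_real_power)

lemma hnorm_\<Lambda>_one: "hnorm L (\<Lambda> \<one>) = 1"
  using ip_\<Lambda>[of \<one> \<one>] by (simp add: hnorm_def \<tau>_one)

lemma hnorm_\<Lambda>_le:
  assumes "a \<in> carrier A"
  shows "hnorm L (\<Lambda> a) \<le> nrm A a"
proof -
  have "(hnorm L (\<Lambda> a))\<^sup>2 = cmod (\<tau> (star A a \<otimes> a))"
    using assms by (simp flip: hnorm_\<Lambda>_sq del: of_real_power)
  also have "\<dots> \<le> (nrm A a)\<^sup>2"
    using \<tau>_le[of "star A a \<otimes> a"] assms by (simp add: nrm_star_mult)
  finally show ?thesis by (rule power2_le_imp_le) (use assms in simp)
qed

text \<open>No functional calculus is needed for this bound: with \<open>h = a\<^sup>* a\<close>, iterate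
  \<open>\<parallel>\<Lambda> (h b)\<parallel>\<^sup>2 \<le> \<parallel>\<Lambda> b\<parallel> \<parallel>\<Lambda> (h\<^sup>2 b)\<parallel>\<close> along the powers \<open>2\<^sup>k\<close> and take roots.\<close>

lemma hnorm_\<Lambda>_mult_le:
  assumes a: "a \<in> carrier A" and b: "b \<in> carrier A"
  shows "hnorm L (\<Lambda> (a \<otimes> b)) \<le> nrm A a * hnorm L (\<Lambda> b)"
proof -
  define h where "h = star A a \<otimes> a"
  have h: "h \<in> carrier A" "star A h = h" "nrm A h = (nrm A a)\<^sup>2" using a by (auto simp: h_def nrm_star_mult)
  define \<beta> where "\<beta> = hnorm L (\<Lambda> b)"
  define s where "s k = hnorm L (\<Lambda> (iter_sq h k \<otimes> b))" for k
  have \<beta>: "0 \<le> \<beta>" using b by (simp add: \<beta>_def)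
  have s: "0 \<le> s k" for k using h b by (simp add: s_def)
  have step: "(s k)\<^sup>2 \<le> \<beta> * s (Suc k)" for k
  proof -
    have "complex_of_real ((s k)\<^sup>2) = \<tau> (star A b \<otimes> (iter_sq h (Suc k) \<otimes> b))"
      using h b iter_sq_star[OF h(1,2), of k] unfolding s_def by (simp only: hnorm_\<Lambda>_sq m_closed iter_sq_closed) (simp add: m_assoc)
    also have "\<dots> = ip L (\<Lambda> b) (\<Lambda> (iter_sq h (Suc k) \<otimes> b))" using h b by (subst ip_\<Lambda>) auto
    finally have "(s k)\<^sup>2 = cmod (ip L (\<Lambda> b) (\<Lambda> (iter_sq h (Suc k) \<otimes> b)))"
      by (metis norm_of_real abs_of_nonneg zero_le_power2)
    also have "\<dots> \<le> \<beta> * s (Suc k)"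
      unfolding \<beta>_def s_def using h b by (intro L.cauchy_schwarz) auto
    finally show ?thesis .
  qed
  have pow: "(s 0) ^ 2 ^ k \<le> \<beta> ^ (2 ^ k - 1) * s k" for k
  proof (induction k)
    case (Suc k)
    have "(s 0) ^ 2 ^ Suc k = ((s 0) ^ 2 ^ k)\<^sup>2" by (simp add: power_mult[symmetric] mult.commute)
    also have "\<dots> \<le> (\<beta> ^ (2 ^ k - 1) * s k)\<^sup>2" using s by (intro power_mono Suc) auto
    also have "\<dots> \<le> (\<beta> ^ (2 ^ k - 1))\<^sup>2 * (\<beta> * s (Suc k))"
      using step[of k] \<beta> by (simp add: power_mult_distrib mult_left_mono)
    also have "\<dots> = \<beta> ^ (2 * (2 ^ k - 1) + 1) * s (Suc k)"
      by (simp add: power_mult[symmetric] mult.commute)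
    also have "2 * (2 ^ k - 1) + 1 = (2 ^ Suc k - 1 :: nat)"
    proof -
      have "(2::nat) ^ k \<ge> 1" by simp
      then show ?thesis unfolding power_Suc by arith
    qed
    finally show ?case .
  qed simp
  \<comment> \<open>The constant comes from the crude bound of \<open>s j\<close> by
    \<open>nrm A h ^ 2 ^ j * nrm A b\<close>, divided once by \<open>\<beta>\<close>. If
    \<open>\<beta>\<close> is zero, the inequality \<open>step\<close> already gives
    \<open>s 0 = 0\<close>.\<close>
  have s0: "s 0 \<le> nrm A h * \<beta>"
  proof (rule le_if_power_le_polynomial[where c = 0 and m = 0 and C = "if \<beta> = 0 then 0 else nrm A b / \<beta>"])
    fix j
    have "s j \<le> nrm A h ^ 2 ^ j * nrm A b"
    proof -
      have "s j \<le> nrm A (iter_sq h j \<otimes> b)" unfolding s_def using h b by (intro hnorm_\<Lambda>_le) auto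
      also have "\<dots> \<le> nrm A (iter_sq h j) * nrm A b" using h b by (intro nrm_mult) auto
      finally show ?thesis using h by (simp add: nrm_iter_sq)
    qed
    then have le: "(s 0) ^ 2 ^ j \<le> \<beta> ^ (2 ^ j - 1) * (nrm A h ^ 2 ^ j * nrm A b)"
      using pow[of j] \<beta> by (meson mult_left_mono order_trans zero_le_power)
    show "s 0 ^ 2 ^ j \<le> (if \<beta> = 0 then 0 else nrm A b / \<beta>) * (0 * 2 ^ j + 1) ^ 0 * (nrm A h * \<beta>) ^ 2 ^ j"
    proof (cases "\<beta> = 0")
      case True
      have "(s 0)\<^sup>2 \<le> 0" using step[of 0] True by simp
      then have "s 0 = 0" by simp
      then show ?thesis using True by (simp add: power_0_left)
    next
      case False
      have "\<beta> ^ 2 ^ j = \<beta> ^ (2 ^ j - 1) * \<beta>"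
        using power_Suc2[of \<beta> "2 ^ j - 1"] by simp
      then have "(nrm A b / \<beta>) * (nrm A h * \<beta>) ^ 2 ^ j = \<beta> ^ (2 ^ j - 1) * (nrm A h ^ 2 ^ j * nrm A b)"
        using False by (simp add: power_mult_distrib)
      then show ?thesis using le False by simp
    qed
  qed (use s \<beta> h b in auto)
  have "complex_of_real ((hnorm L (\<Lambda> (a \<otimes> b)))\<^sup>2) = ip L (\<Lambda> b) (\<Lambda> (h \<otimes> b))"
    using a b by (simp add: hnorm_\<Lambda>_sq ip_\<Lambda> h_def m_assoc del: of_real_power)
  then have "(hnorm L (\<Lambda> (a \<otimes> b)))\<^sup>2 = cmod (ip L (\<Lambda> b) (\<Lambda> (h \<otimes> b)))"
    by (metis norm_of_real abs_of_nonneg zero_le_power2)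
  also have "\<dots> \<le> \<beta> * s 0" unfolding \<beta>_def s_def iter_sq_0 using h b by (intro L.cauchy_schwarz) auto
  also have "\<dots> \<le> \<beta> * (nrm A h * \<beta>)" using s0 \<beta> by (rule mult_left_mono)
  also have "\<dots> = (nrm A a * \<beta>)\<^sup>2" using h by (simp add: power_mult_distrib power2_eq_square)
  finally show ?thesis
    unfolding \<beta>_def by (rule power2_le_imp_le) (use a b in simp)
qed

text \<open>The GNS map contracts, so closed subspaces of \<open>L\<close> pull back to closed
  subspaces of \<open>A\<close>.\<close>

lemma total_\<Lambda>:
  assumes "total_set A (nrm A) X"
  shows "total_set L (hnorm L) (\<Lambda> ` X)"
proof (rule L.hdense_total[OF dense_\<Lambda>])
  have X: "X \<subseteq> carrier A" using assms by (simp add: total_set_def)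
  then show "\<Lambda> ` X \<subseteq> carrier L" by auto
  show "\<Lambda> ` carrier A \<subseteq> carrier L" by auto
  fix Q assume Q: "closed_subspace L (hnorm L) Q" "\<Lambda> ` X \<subseteq> Q"
  have "closed_subspace A (nrm A) {a \<in> carrier A. \<Lambda> a \<in> Q}"
    using hnorm_\<Lambda>_le by (intro closed_subspace_vimage[OF normed_module_axioms L.normed_module_axioms lin_\<Lambda> _ Q(1), of 1]) auto
  then show "\<Lambda> ` carrier A \<subseteq> Q"
    using total_set_induct[OF assms, of "\<lambda>a. \<Lambda> a \<in> Q"] Q(2) by auto
qed

end

section \<open>Nondegenerate noncommutative tori\<close>

definition phase :: "real \<Rightarrow> complex" where
  "phase t = exp (2 * complex_of_real pi * \<i> * complex_of_real t)"

lemma phase_add: "phase (s + t) = phase s * phase t"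
  by (simp add: phase_def distrib_left exp_add)

lemma phase_0 [simp]: "phase 0 = 1"
  by (simp add: phase_def)

lemma norm_phase [simp]: "cmod (phase t) = 1"
  by (simp add: phase_def norm_exp_eq_Re)

lemma phase_minus_cancel: "phase t * phase (- t) = 1" "phase (- t) * phase t = 1"
  by (simp_all flip: phase_add)

section \<open>Unitaries, integer powers and commutation up to a phase\<close>

context cstar
begin

definition unitary where "unitary u \<longleftrightarrow> u \<in> carrier A \<and> star A u \<otimes> u = \<one> \<and> u \<otimes> star A u = \<one>"

lemma unitary_closed: "unitary u \<Longrightarrow> u \<in> carrier A"
  by (simp add: unitary_def)

lemma unitary_one: "unitary \<one>"
  by (simp add: unitary_def)

lemma unitary_star: "unitary u \<Longrightarrow> unitary (star A u)"
  by (simp add: unitary_def)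

lemma unitary_mult:
  assumes "unitary u" "unitary v"
  shows "unitary (u \<otimes> v)"
proof -
  have c: "u \<in> carrier A" "v \<in> carrier A" using assms by (auto simp: unitary_def)
  have "(star A v \<otimes> star A u) \<otimes> (u \<otimes> v) = star A v \<otimes> (star A u \<otimes> u) \<otimes> v" using c by (simp add: m_assoc)
  moreover have "(u \<otimes> v) \<otimes> (star A v \<otimes> star A u) = u \<otimes> (v \<otimes> star A v) \<otimes> star A u" using c by (simp add: m_assoc)
  ultimately show ?thesis using assms c by (simp add: unitary_def)
qed

lemma unitary_smult:
  assumes "unitary u" "cmod c = 1"
  shows "unitary (c \<odot> u)"
proof -
  have "cnj c * c = 1" "c * cnj c = 1"
    using complex_norm_square[of c] assms(2) by (auto simp: mult.commute)
  then show ?thesis using assms(1) by (simp add: unitary_def smult_smult)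
qed

lemma unitary_Units: "unitary u \<Longrightarrow> u \<in> Units A"
  unfolding unitary_def Units_def by (auto intro: bexI[of _ "star A u"])

lemma unitary_inv: "unitary u \<Longrightarrow> inv u = star A u"
  by (rule inv_char) (auto simp: unitary_def)

lemma Units_nat_pow: "u \<in> Units A \<Longrightarrow> u [^] (n::nat) \<in> Units A"
  by (induction n) auto

lemma int_pow_nonneg: "k \<ge> 0 \<Longrightarrow> u [^] (k::int) = u [^] nat k"
  by (simp add: pow_nat)

lemma int_pow_negative: "k < 0 \<Longrightarrow> u [^] (k::int) = inv (u [^] nat (- k))"
  by (subst int_pow_def2) simp

text \<open>Under multiplication \<open>A\<close> is only a monoid; the laws for integer exponents
  are transferred from its group of units, once the two notions of power are seen to agree.\<close>

lemma Units_int_pow: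
  fixes k l :: int
  assumes "u \<in> Units A"
  shows "u [^] k \<in> Units A" "u [^] (k + l) = u [^] k \<otimes> u [^] l" "u [^] (- k) = inv (u [^] k)"
proof -
  interpret G: group "units_of A" by (rule units_group)
  have eq: "u [^]\<^bsub>units_of A\<^esub> i = u [^] i" for i :: int
  proof (cases "i \<ge> 0")
    case True
    then show ?thesis
      using units_of_pow[OF assms, of "nat i"] by (simp only: pow_nat)
  next
    case False
    have "u [^]\<^bsub>units_of A\<^esub> i = inv\<^bsub>units_of A\<^esub> (u [^]\<^bsub>units_of A\<^esub> nat (- i))"
      using False by (subst int_pow_def2) simp
    then show ?thesis
      using False units_of_pow[OF assms, of "nat (- i)"] Units_nat_pow[OF assms, of "nat (- i)"]
      by (simp add: units_of_inv int_pow_negative)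
  qed
  have u: "u \<in> carrier (units_of A)" using assms by (simp add: units_of_carrier)
  show U: "u [^] k \<in> Units A" using G.int_pow_closed[OF u, of k] by (simp add: eq units_of_carrier)
  show "u [^] (k + l) = u [^] k \<otimes> u [^] l"
    using G.int_pow_mult[OF u, of k l] by (simp add: eq units_of_mult)
  show "u [^] (- k) = inv (u [^] k)"
    using G.int_pow_neg[OF u, of k] U by (simp add: eq units_of_inv)
qed

lemma int_pow_cases:
  fixes k :: int
  assumes "u \<in> Units A" "\<And>n::nat. P (int n) (u [^] n)" "\<And>n::nat. P (int n) (u [^] n) \<Longrightarrow> P (- int n) (inv (u [^] n))"
  shows "P k (u [^] k)"
proof (cases "k \<ge> 0")
  case True
  then show ?thesis using assms(2)[of "nat k"] unfolding int_pow_nonneg[OF True] by simp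
next
  case False
  then have "u [^] k = inv (u [^] nat (- k))" by (intro int_pow_negative) simp
  then show ?thesis using assms(3)[OF assms(2), of "nat (- k)"] False by simp
qed

lemma unitary_int_pow:
  fixes k :: int
  assumes "unitary u"
  shows "unitary (u [^] k)"
proof -
  have nat: "unitary (u [^] n)" for n :: nat
    using assms by (induction n) (auto simp: unitary_one unitary_mult)
  show ?thesis
    by (rule int_pow_cases[OF unitary_Units[OF assms], where P = "\<lambda>_. unitary"])
      (simp_all add: nat unitary_inv unitary_star)
qed

text \<open>The real exponent is recorded rather than the phase itself: exponents add under products
  and change sign under inverses, so that for monomials they assemble to a bilinear form.\<close>

definition phase_commute where
  "phase_commute a b t \<longleftrightarrow> a \<otimes> b = phase t \<odot> (b \<otimes> a)"

lemma phase_commute_sym: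
  assumes "a \<in> carrier A" "b \<in> carrier A" "phase_commute a b t"
  shows "phase_commute b a (- t)"
  using assms by (simp add: phase_commute_def smult_smult phase_minus_cancel)

lemma phase_commute_one:
  "a \<in> carrier A \<Longrightarrow> phase_commute a \<one> 0" "a \<in> carrier A \<Longrightarrow> phase_commute \<one> a 0"
  by (simp_all add: phase_commute_def)

lemma phase_commute_mult_right:
  assumes "a \<in> carrier A" "b \<in> carrier A" "c \<in> carrier A" "phase_commute a b s" "phase_commute a c t"
  shows "phase_commute a (b \<otimes> c) (s + t)"
proof -
  have "a \<otimes> (b \<otimes> c) = (a \<otimes> b) \<otimes> c" using assms by (simp add: m_assoc)
  also have "\<dots> = phase s \<odot> (b \<otimes> (a \<otimes> c))" using assms by (simp add: phase_commute_def m_assoc)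
  also have "\<dots> = phase (s + t) \<odot> ((b \<otimes> c) \<otimes> a)"
    using assms by (simp add: phase_commute_def m_assoc smult_smult phase_add)
  finally show ?thesis by (simp add: phase_commute_def)
qed

lemma phase_commute_mult_left:
  assumes "a \<in> carrier A" "b \<in> carrier A" "c \<in> carrier A" "phase_commute a c s" "phase_commute b c t"
  shows "phase_commute (a \<otimes> b) c (s + t)"
proof -
  have "phase_commute c (a \<otimes> b) (- s + - t)"
    using assms by (intro phase_commute_mult_right phase_commute_sym) auto
  from phase_commute_sym[OF _ _ this] assms show ?thesis by (simp add: add.commute)
qed

lemma phase_commute_inv_right:
  assumes "a \<in> carrier A" "b \<in> Units A" "phase_commute a b t"
  shows "phase_commute a (inv b) (- t)"
proof -
  have b: "b \<in> carrier A" "inv b \<in> carrier A" using assms(2) by auto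
  have "a = a \<otimes> (b \<otimes> inv b)" using assms by simp
  also have "\<dots> = (a \<otimes> b) \<otimes> inv b" using assms(1) b by (simp add: m_assoc)
  also have "\<dots> = phase t \<odot> (b \<otimes> (a \<otimes> inv b))"
    using assms(1,3) b unfolding phase_commute_def by (simp add: m_assoc)
  finally have a: "a = phase t \<odot> (b \<otimes> (a \<otimes> inv b))" .
  have "inv b \<otimes> a = inv b \<otimes> (phase t \<odot> (b \<otimes> (a \<otimes> inv b)))" using a by simp
  also have "\<dots> = phase t \<odot> (a \<otimes> inv b)"
    using assms b by (simp add: m_assoc[symmetric])
  finally have "phase_commute (inv b) a t" by (simp add: phase_commute_def)
  then show ?thesis using assms(1) b by (intro phase_commute_sym)
qed

lemma phase_commute_int_pow_right:
  fixes k :: int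
  assumes "a \<in> carrier A" "b \<in> Units A" "phase_commute a b t"
  shows "phase_commute a (b [^] k) (of_int k * t)"
proof -
  have b: "b \<in> carrier A" using assms(2) by auto
  have nat: "phase_commute a (b [^] n) (real n * t)" for n :: nat
  proof (induction n)
    case 0
    then show ?case using assms(1) by (simp add: phase_commute_one)
  next
    case (Suc n)
    have "phase_commute a (b [^] n \<otimes> b) (real n * t + t)"
      using assms b Suc by (intro phase_commute_mult_right) auto
    then show ?case by (simp add: algebra_simps)
  qed
  show ?thesis
  proof (rule int_pow_cases[OF assms(2), where P = "\<lambda>k c. phase_commute a c (of_int k * t)"])
    fix n
    show "phase_commute a (b [^] n) (real_of_int (int n) * t)" using nat[of n] by simp
    then show "phase_commute a (inv (b [^] n)) (real_of_int (- int n) * t)"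
      using phase_commute_inv_right[OF assms(1) Units_nat_pow[OF assms(2)]] by simp
  qed
qed

lemma phase_commute_int_pow:
  fixes k l :: int
  assumes "a \<in> Units A" "b \<in> Units A" "phase_commute a b t"
  shows "phase_commute (a [^] k) (b [^] l) (of_int k * of_int l * t)"
proof -
  have c: "a \<in> carrier A" "b \<in> carrier A" using assms by auto
  have bl: "b [^] l \<in> Units A" by (rule Units_int_pow[OF assms(2)])
  have "phase_commute a (b [^] l) (of_int l * t)"
    using c assms by (intro phase_commute_int_pow_right)
  then have "phase_commute (b [^] l) a (- (of_int l * t))"
    using c bl by (intro phase_commute_sym) auto
  then have "phase_commute (b [^] l) (a [^] k) (of_int k * - (of_int l * t))"
    using bl assms(1) by (intro phase_commute_int_pow_right) auto
  then have "phase_commute (a [^] k) (b [^] l) (- (of_int k * - (of_int l * t)))"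
    using bl Units_int_pow(1)[OF assms(1)] by (intro phase_commute_sym) auto
  then show ?thesis by (simp add: mult.assoc)
qed

end

section \<open>Monomials of a nondegenerate noncommutative torus\<close>

locale nc_torus_gns = gns A \<tau> L \<Lambda> for A (structure) and \<tau> L \<Lambda> +
  fixes m :: nat and \<Theta> U
  assumes nc_torus: "nc_torus m \<Theta> A U" and skew: "skew_symmetric m \<Theta>"
    and nondegenerate: "nondegenerate m \<Theta>"
begin

abbreviation lattice :: "int Matrix.vec set" where "lattice \<equiv> carrier_vec m"

abbreviation mon where "mon \<equiv> nc_monomial A U"

text \<open>The body of \<open>nc_monomial\<close> over an arbitrary list of coordinates, which
  makes induction on the list possible.\<close>

definition word :: "nat list \<Rightarrow> int Matrix.vec \<Rightarrow> 'a" where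
  "word js x = foldr (\<lambda>j y. (U j [^] vec_index x j) \<otimes> y) js \<one>"

lemma word_simps [simp]: "word [] x = \<one>" "word (j # js) x = (U j [^] vec_index x j) \<otimes> word js x"
  by (simp_all add: word_def)

lemma mon_eq_word: "x \<in> lattice \<Longrightarrow> mon x = word [0..<m] x"
  by (simp add: nc_monomial_def word_def)

lemma U_unitary: "j < m \<Longrightarrow> unitary (U j)"
  using nc_torus by (auto simp: nc_torus_def nc_torus_relations_def unitary_def)

lemma U_commute: "i < m \<Longrightarrow> j < m \<Longrightarrow> phase_commute (U i) (U j) (\<Theta> $$ (j, i))"
  using nc_torus unfolding nc_torus_def nc_torus_relations_def phase_commute_def phase_def by blast

lemma U_generate: "cstar_generated A (U ` {..<m})"
  using nc_torus by (simp add: nc_torus_def)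

lemma word_unitary: "set js \<subseteq> {..<m} \<Longrightarrow> unitary (word js x)"
  by (induction js) (auto simp: unitary_one intro!: unitary_mult unitary_int_pow U_unitary)

lemma mon_unitary: "x \<in> lattice \<Longrightarrow> unitary (mon x)"
  by (simp add: mon_eq_word word_unitary atLeast0LessThan)

lemma mon_closed [simp]: "x \<in> lattice \<Longrightarrow> mon x \<in> carrier A"
  by (rule unitary_closed[OF mon_unitary])

lemma U_pow_word_commute:
  assumes "i < m" "set js \<subseteq> {..<m}"
  shows "phase_commute (U i [^] k) (word js x) (\<Sum>j\<leftarrow>js. of_int k * of_int (vec_index x j) * \<Theta> $$ (j, i))"
  using assms(2)
proof (induction js)
  case Nil
  then show ?case using assms(1) by (simp add: phase_commute_one unitary_closed unitary_int_pow U_unitary)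
next
  case (Cons j js)
  then show ?case
    using assms(1)
    by (simp, intro phase_commute_mult_right phase_commute_int_pow)
      (auto intro: unitary_closed unitary_int_pow U_unitary word_unitary U_commute unitary_Units)
qed

lemma word_commute:
  assumes "set is \<subseteq> {..<m}" "set js \<subseteq> {..<m}"
  shows "phase_commute (word is y) (word js x)
    (\<Sum>i\<leftarrow>is. \<Sum>j\<leftarrow>js. of_int (vec_index y i) * of_int (vec_index x j) * \<Theta> $$ (j, i))"
  using assms(1)
proof (induction "is")
  case Nil
  then show ?case using assms(2) by (simp add: phase_commute_one unitary_closed word_unitary)
next
  case (Cons i "is")
  then show ?case
    using assms(2)
    by (simp, intro phase_commute_mult_left U_pow_word_commute)
      (auto intro: unitary_closed unitary_int_pow U_unitary word_unitary)
qed

text \<open>The exponents of the single commutations add up to exactly the form whose nondegeneracy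
  is assumed.\<close>

lemma mon_commute:
  assumes "x \<in> lattice" "y \<in> lattice"
  shows "phase_commute (mon y) (mon x)
    (scalar_prod (map_vec real_of_int x) (mult_mat_vec \<Theta> (map_vec real_of_int y)))"
proof -
  have \<Theta>: "\<Theta> \<in> carrier_mat m m" using skew by (simp add: skew_symmetric_def)
  have "scalar_prod (map_vec real_of_int x) (mult_mat_vec \<Theta> (map_vec real_of_int y)) =
      (\<Sum>j\<in>{0..<m}. \<Sum>i\<in>{0..<m}. of_int (vec_index y i) * of_int (vec_index x j) * \<Theta> $$ (j, i))"
    using assms \<Theta> by (simp add: scalar_prod_def sum_distrib_left mult_ac)
  also have "\<dots> = (\<Sum>i\<leftarrow>[0..<m]. \<Sum>j\<leftarrow>[0..<m]. of_int (vec_index y i) * of_int (vec_index x j) * \<Theta> $$ (j, i))"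
    by (subst sum.swap) (simp add: interv_sum_list_conv_sum_set_nat)
  finally show ?thesis
    using word_commute[of "[0..<m]" "[0..<m]" y x] assms by (simp add: mon_eq_word atLeast0LessThan)
qed

text \<open>The circle orbit of a monomial. These sets multiply and invert like the lattice, so
  phases need not be computed.\<close>

definition mults where "mults x = {c \<odot> mon x |c. cmod c = 1}"

lemma mon_in_mults: "x \<in> lattice \<Longrightarrow> mon x \<in> mults x"
  unfolding mults_def by (auto intro!: exI[of _ 1])

lemma multsE:
  assumes "a \<in> mults x"
  obtains c where "cmod c = 1" "a = c \<odot> mon x"
  using assms by (auto simp: mults_def)

lemma mults_unitary: "x \<in> lattice \<Longrightarrow> a \<in> mults x \<Longrightarrow> unitary a"
  by (auto elim!: multsE intro!: unitary_smult mon_unitary)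

lemma mults_closed: "x \<in> lattice \<Longrightarrow> a \<in> mults x \<Longrightarrow> a \<in> carrier A"
  by (rule unitary_closed[OF mults_unitary])

lemma mults_smult: "x \<in> lattice \<Longrightarrow> a \<in> mults x \<Longrightarrow> cmod c = 1 \<Longrightarrow> c \<odot> a \<in> mults x"
  by (force simp: mults_def smult_smult norm_mult)

text \<open>Sorting the factors moves a power of \<open>U j\<close> past a word, which costs a phase
  by \<open>U_pow_word_commute\<close>; after that the two powers of \<open>U j\<close> are adjacent
  and merge.\<close>

lemma word_mult:
  assumes "set js \<subseteq> {..<m}" "x \<in> lattice" "y \<in> lattice"
  shows "\<exists>c. cmod c = 1 \<and> word js x \<otimes> word js y = c \<odot> word js (x + y)"
  using assms(1)
proof (induction js)
  case Nil
  then show ?case by (auto intro!: exI[of _ 1])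
next
  case (Cons j js)
  then have j: "j < m" and js: "set js \<subseteq> {..<m}" by auto
  obtain c where c: "cmod c = 1" "word js x \<otimes> word js y = c \<odot> word js (x + y)" using Cons by auto
  let ?a = "U j [^] vec_index x j" and ?b = "U j [^] vec_index y j"
  have cl: "?a \<in> carrier A" "?b \<in> carrier A" "word js v \<in> carrier A" for v
    using j js by (auto intro: unitary_closed unitary_int_pow U_unitary word_unitary)
  obtain t where "phase_commute ?b (word js x) t" using U_pow_word_commute[OF j js] by blast
  then have t: "word js x \<otimes> ?b = phase (- t) \<odot> (?b \<otimes> word js x)"
    using phase_commute_sym cl unfolding phase_commute_def by blast
  have "word (j # js) x \<otimes> word (j # js) y = ?a \<otimes> (word js x \<otimes> ?b) \<otimes> word js y"
    using cl by (simp add: m_assoc)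
  also have "\<dots> = phase (- t) \<odot> ((?a \<otimes> ?b) \<otimes> (word js x \<otimes> word js y))"
    using cl unfolding t by (simp add: m_assoc)
  also have "?a \<otimes> ?b = U j [^] vec_index (x + y) j"
    using Units_int_pow(2)[OF unitary_Units[OF U_unitary[OF j]]] j assms(2,3) by simp
  also have "phase (- t) \<odot> (U j [^] vec_index (x + y) j \<otimes> (word js x \<otimes> word js y)) =
      (phase (- t) * c) \<odot> word (j # js) (x + y)"
    using cl j unfolding c(2)
    by (simp add: smult_smult unitary_closed unitary_int_pow U_unitary)
  finally show ?case using c(1) by (intro exI[of _ "phase (- t) * c"]) (simp add: norm_mult)
qed

lemma mon_mult: "x \<in> lattice \<Longrightarrow> y \<in> lattice \<Longrightarrow> mon x \<otimes> mon y \<in> mults (x + y)"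
  using word_mult[of "[0..<m]" x y] by (auto simp: mults_def mon_eq_word atLeast0LessThan)

lemma mults_mult:
  assumes "x \<in> lattice" "y \<in> lattice" "a \<in> mults x" "b \<in> mults y"
  shows "a \<otimes> b \<in> mults (x + y)"
proof -
  obtain c d where "cmod c = 1" "a = c \<odot> mon x" "cmod d = 1" "b = d \<odot> mon y"
    using assms(3,4) by (auto elim!: multsE)
  then show ?thesis
    using mults_smult[OF _ mon_mult[OF assms(1,2)], of "c * d"] assms(1,2)
    by (simp add: smult_smult norm_mult mult.commute)
qed

lemma mon_zero: "mon (0\<^sub>v m) = \<one>"
proof -
  have "set js \<subseteq> {..<m} \<Longrightarrow> word js (0\<^sub>v m) = \<one>" for js by (induction js) auto
  from this[of "[0..<m]"] show ?thesis by (simp add: mon_eq_word atLeast0LessThan)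
qed

lemma star_mon:
  assumes "x \<in> lattice"
  shows "star A (mon x) \<in> mults (- x)"
proof -
  obtain c where c: "cmod c = 1" "mon x \<otimes> mon (- x) = c \<odot> mon (x + - x)"
    using mon_mult[of x "- x"] assms by (auto elim: multsE)
  moreover have "x + - x = 0\<^sub>v m" using assms by (intro eq_vecI) auto
  ultimately have *: "mon x \<otimes> mon (- x) = c \<odot> \<one>" by (simp add: mon_zero)
  have c1: "cnj c * c = 1" using complex_norm_square[of c] c(1) by (simp add: mult.commute)
  have u: "unitary (mon x)" using assms by (rule mon_unitary)
  have "mon (- x) = (star A (mon x) \<otimes> mon x) \<otimes> mon (- x)"
    using u assms by (simp add: unitary_def)
  also have "\<dots> = c \<odot> star A (mon x)"
    using assms by (simp add: m_assoc *)
  finally have "star A (mon x) = cnj c \<odot> mon (- x)" using assms by (simp add: smult_smult c1)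
  then show ?thesis using c(1) by (auto simp: mults_def)
qed

lemma mults_star:
  assumes "x \<in> lattice" "a \<in> mults x"
  shows "star A a \<in> mults (- x)"
proof -
  obtain c where "cmod c = 1" "a = c \<odot> mon x" using assms(2) by (rule multsE)
  then show ?thesis
    using mults_smult[OF _ star_mon[OF assms(1)], of "cnj c"] assms(1) by simp
qed

lemma mults_int_pow:
  fixes k :: int
  assumes "x \<in> lattice" "a \<in> mults x"
  shows "a [^] k \<in> mults (k \<cdot>\<^sub>v x)"
proof -
  have u: "unitary a" using assms by (rule mults_unitary)
  have nat: "a [^] n \<in> mults (int n \<cdot>\<^sub>v x)" for n :: nat
  proof (induction n)
    case 0
    have "int 0 \<cdot>\<^sub>v x = 0\<^sub>v m" using assms(1) by (intro eq_vecI) auto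
    then show ?case using mon_in_mults[of "0\<^sub>v m"] mon_zero by simp
  next
    case (Suc n)
    have "int (Suc n) \<cdot>\<^sub>v x = int n \<cdot>\<^sub>v x + x" using assms(1) by (intro eq_vecI) (auto simp: algebra_simps)
    then show ?case using mults_mult[OF _ assms(1) Suc assms(2)] assms(1) by simp
  qed
  show ?thesis
  proof (rule int_pow_cases[OF unitary_Units[OF u], where P = "\<lambda>k b. b \<in> mults (k \<cdot>\<^sub>v x)"])
    fix n
    show "a [^] n \<in> mults (int n \<cdot>\<^sub>v x)" by (rule nat)
    have "- (int n \<cdot>\<^sub>v x) = - int n \<cdot>\<^sub>v x" by (intro eq_vecI) auto
    moreover have "inv (a [^] n) = star A (a [^] n)"
      using unitary_int_pow[OF u, of "int n"] by (intro unitary_inv) (simp add: int_pow_int)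
    moreover have "star A (a [^] n) \<in> mults (- (int n \<cdot>\<^sub>v x))"
      using assms(1) by (intro mults_star nat) simp
    ultimately show "inv (a [^] n) \<in> mults (- int n \<cdot>\<^sub>v x)" by simp
  qed
qed

text \<open>The smallest closed subspace \<open>Q0\<close> containing the monomials is a
  C*-subalgebra containing the generators. Closure under products takes two uses of minimality:
  first for right multiplication by a monomial, then for left multiplication by an arbitrary element
  of \<open>Q0\<close>.\<close>

lemma total_mon: "total_set A (nrm A) (mon ` lattice)"
proof -
  define \<Q> where "\<Q> = {Q. closed_subspace A (nrm A) Q \<and> mon ` lattice \<subseteq> Q}"
  define Q0 where "Q0 = \<Inter>\<Q>"
  have ne: "carrier A \<in> \<Q>" using closed_subspace_carrier by (auto simp: \<Q>_def)
  then have Q0: "closed_subspace A (nrm A) Q0"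
    unfolding Q0_def by (intro closed_subspace_Inter) (auto simp: \<Q>_def)
  note Q0' = closed_subspaceD[OF Q0]
  have mon_Q0: "mon x \<in> Q0" if "x \<in> lattice" for x using that by (auto simp: Q0_def \<Q>_def)
  have mults_Q0: "a \<in> Q0" if "x \<in> lattice" "a \<in> mults x" for a x
    using that Q0'(4)[OF mon_Q0[OF that(1)]] by (auto elim!: multsE)
  have min: "Q0 \<subseteq> Q" if "closed_subspace A (nrm A) Q" "mon ` lattice \<subseteq> Q" for Q
    using that by (auto simp: Q0_def \<Q>_def)
  have mult_lin: "lin_map A A (\<lambda>b. a \<otimes> b)" "lin_map A A (\<lambda>b. b \<otimes> a)" if "a \<in> carrier A" for a
    using that by (auto intro!: lin_mapI simp: l_distr r_distr)
  have right: "a \<otimes> mon y \<in> Q0" if "a \<in> Q0" "y \<in> lattice" for a y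
  proof -
    have "closed_subspace A (nrm A) {a \<in> carrier A. a \<otimes> mon y \<in> Q0}"
      using nrm_mult that(2)
      by (intro closed_subspace_vimage[OF normed_module_axioms normed_module_axioms mult_lin(2) _ Q0, of _ "nrm A (mon y)"])
        (auto simp: mult.commute)
    moreover have "mon ` lattice \<subseteq> {a \<in> carrier A. a \<otimes> mon y \<in> Q0}"
      using mults_Q0[OF _ mon_mult] that(2) by auto
    ultimately show ?thesis using min that(1) by blast
  qed
  have mult: "a \<otimes> b \<in> Q0" if "a \<in> Q0" "b \<in> Q0" for a b
  proof -
    have a: "a \<in> carrier A" using that Q0' by auto
    have "closed_subspace A (nrm A) {b \<in> carrier A. a \<otimes> b \<in> Q0}"
      using nrm_mult a
      by (intro closed_subspace_vimage[OF normed_module_axioms normed_module_axioms mult_lin(1) _ Q0]) auto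
    moreover have "mon ` lattice \<subseteq> {b \<in> carrier A. a \<otimes> b \<in> Q0}" using right that(1) by auto
    ultimately show ?thesis using min that(2) by blast
  qed
  have star: "star A a \<in> Q0" if "a \<in> Q0" for a
  proof -
    \<comment> \<open>The adjoint is conjugate-linear, so \<open>closed_subspace_vimage\<close> does
      not apply and closedness is checked from isometry of the adjoint.\<close>
    have "closed_subspace A (nrm A) {a \<in> carrier A. star A a \<in> Q0}"
      unfolding closed_subspace_def mem_Collect_eq
    proof (intro conjI ballI allI impI)
      show "star A \<zero> \<in> Q0" using Q0'(2) star_smult[of \<zero> 0] by simp
      fix v assume v: "v \<in> carrier A" "\<forall>\<epsilon>>0. \<exists>u\<in>{a \<in> carrier A. star A a \<in> Q0}. nrm A (v \<ominus> u) < \<epsilon>"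
      show "star A v \<in> Q0"
      proof (rule Q0'(5))
        fix \<epsilon> :: real assume "\<epsilon> > 0"
        then obtain u where u: "u \<in> carrier A" "star A u \<in> Q0" "nrm A (v \<ominus> u) < \<epsilon>" using v(2) by blast
        have "star A v \<ominus> star A u = star A (v \<ominus> u)" using u v by (simp add: diff_eq_smult)
        then have "nrm A (star A v \<ominus> star A u) < \<epsilon>" using u v by simp
        then show "\<exists>u\<in>Q0. nrm A (star A v \<ominus> u) < \<epsilon>" using u(2) by blast
      qed (use v in simp)
    qed (use Q0' in auto)
    moreover have "mon ` lattice \<subseteq> {a \<in> carrier A. star A a \<in> Q0}"
      using mults_Q0[OF _ star_mon] by auto
    ultimately show ?thesis using min that by blast
  qed
  have one: "\<one> \<in> Q0" using mon_Q0[of "0\<^sub>v m"] by (simp add: mon_zero)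
  have "cstar_subalgebra A Q0"
    using closed_subspace_imp_submodule[OF Q0] closed_subspace_imp_closedin[OF Q0] one star mult
    by (simp add: cstar_subalgebra_def cdist_def)
  moreover have "U j \<in> Q0" if j: "j < m" for j
  proof -
    \<comment> \<open>Each generator is itself a monomial, the one with a unit vector as
      exponent.\<close>
    have *: "word js (unit_vec m j) = (if j \<in> set js then U j else \<one>)"
      if "set js \<subseteq> {..<m}" "distinct js" for js
      using that
    proof (induction js)
      case (Cons i js)
      have Uj: "U j \<in> carrier A" using U_unitary[OF j] by (rule unitary_closed)
      have "U j [^] (1::int) = U j" using Uj int_pow_int[of A "U j" 1] by simp
      then show ?case using Cons j Uj by (auto simp: unit_vec_def)
    qed simp
    have "mon (unit_vec m j) = U j" using *[of "[0..<m]"] j by (simp add: mon_eq_word atLeast0LessThan)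
    then show ?thesis using mon_Q0[of "unit_vec m j"] by simp
  qed
  ultimately have "Q0 = carrier A" using U_generate by (auto simp: cstar_generated_def)
  then have "Q = carrier A" if "closed_subspace A (nrm A) Q" "mon ` lattice \<subseteq> Q" for Q
    using min[OF that] closed_subspaceD(1)[OF that(1)] by auto
  then show ?thesis by (auto simp: total_set_def)
qed

text \<open>Conjugation by a monomial preserves the trace but multiplies \<open>mon x\<close> by a
  phase, and by nondegeneracy some conjugation produces a phase different from 1.\<close>

lemma \<tau>_mon:
  assumes "x \<in> lattice" "x \<noteq> 0\<^sub>v m"
  shows "\<tau> (mon x) = 0"
proof -
  obtain y where y: "y \<in> lattice"
    "phase (scalar_prod (map_vec real_of_int x) (mult_mat_vec \<Theta> (map_vec real_of_int y))) \<noteq> 1"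
    using nondegenerate assms unfolding nondegenerate_def phase_def by blast
  define t where "t = scalar_prod (map_vec real_of_int x) (mult_mat_vec \<Theta> (map_vec real_of_int y))"
  have c: "mon y \<otimes> mon x = phase t \<odot> (mon x \<otimes> mon y)"
    using mon_commute[OF assms(1) y(1)] by (simp add: phase_commute_def t_def)
  have u: "unitary (mon y)" using y(1) by (rule mon_unitary)
  have cl: "mon x \<in> carrier A" "mon y \<in> carrier A" using assms y by auto
  have "\<tau> (mon x) = \<tau> (star A (mon y) \<otimes> (mon y \<otimes> mon x))"
    using u cl by (simp add: m_assoc[symmetric] unitary_def)
  also have "\<dots> = phase t * \<tau> (star A (mon y) \<otimes> (mon x \<otimes> mon y))"
    unfolding c using cl by (simp add: \<tau>_smult)
  also have "\<tau> (star A (mon y) \<otimes> (mon x \<otimes> mon y)) = \<tau> ((mon x \<otimes> mon y) \<otimes> star A (mon y))"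
    using cl by (intro \<tau>_commute) auto
  also have "\<dots> = \<tau> (mon x)" using u cl by (simp add: m_assoc unitary_def)
  finally have "(phase t - 1) * \<tau> (mon x) = 0" by (simp add: algebra_simps)
  then show ?thesis using y(2) by (simp add: t_def)
qed

lemma \<tau>_mults: "x \<in> lattice \<Longrightarrow> x \<noteq> 0\<^sub>v m \<Longrightarrow> a \<in> mults x \<Longrightarrow> \<tau> a = 0"
  by (auto elim!: multsE simp: \<tau>_smult \<tau>_mon)

lemma ip_mon:
  assumes "x \<in> lattice" "y \<in> lattice"
  shows "ip L (\<Lambda> (mon x)) (\<Lambda> (mon y)) = (if x = y then 1 else 0)"
proof (cases "x = y")
  case True
  then show ?thesis using mon_unitary[OF assms(1)] assms by (simp add: ip_\<Lambda> unitary_def \<tau>_one)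
next
  case False
  have "- x + y \<noteq> 0\<^sub>v m"
  proof
    assume *: "- x + y = 0\<^sub>v m"
    have "vec_index x i = vec_index y i" if "i < m" for i
      using arg_cong[OF *, of "\<lambda>v. vec_index v i"] assms that by simp
    then show False using False assms by (metis carrier_vecD eq_vecI)
  qed
  moreover have "star A (mon x) \<otimes> mon y \<in> mults (- x + y)"
    using assms by (intro mults_mult star_mon mon_in_mults) auto
  ultimately show ?thesis using False assms \<tau>_mults[of "- x + y"] by (simp add: ip_\<Lambda>)
qed

sublocale B: orthonormal_basis L lattice "\<lambda>x. \<Lambda> (mon x)"
proof unfold_locales
  show "total_set L (hnorm L) ((\<lambda>x. \<Lambda> (mon x)) ` lattice)"
    using total_\<Lambda>[OF total_mon] by (simp add: image_image)
qed (auto simp: ip_mon)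

subsection \<open>Faithfulness of the trace\<close>

definition box :: "nat \<Rightarrow> int Matrix.vec set" where
  "box r = {x \<in> lattice. \<forall>i<m. \<bar>vec_index x i\<bar> \<le> int r}"

lemma box_lattice: "x \<in> box r \<Longrightarrow> x \<in> lattice"
  by (simp add: box_def)

lemma box_finite: "finite (box r)" and box_card: "card (box r) \<le> (2 * r + 1) ^ m"
proof -
  define g where "g x = restrict (vec_index x) {..<m}" for x :: "int Matrix.vec"
  have inj: "inj_on g (box r)"
  proof (rule inj_onI)
    fix x y assume *: "x \<in> box r" "y \<in> box r" "g x = g y"
    have "vec_index x i = vec_index y i" if "i < m" for i
      using fun_cong[OF *(3), of i] that by (simp add: g_def)
    then show "x = y" using *(1,2) by (intro eq_vecI) (auto simp: box_def)
  qed
  have sub: "g ` box r \<subseteq> {..<m} \<rightarrow>\<^sub>E {- int r..int r}"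
  proof (rule image_subsetI)
    fix x assume x: "x \<in> box r"
    have "vec_index x i \<in> {- int r..int r}" if "i < m" for i
      using x that abs_le_iff[of "vec_index x i" "int r"] by (simp add: box_def)
    then show "g x \<in> {..<m} \<rightarrow>\<^sub>E {- int r..int r}" by (simp add: g_def restrict_PiE_iff)
  qed
  have fin: "finite ({..<m} \<rightarrow>\<^sub>E {- int r..int r})" by (intro finite_PiE) auto
  show "finite (box r)" using finite_subset[OF sub fin] inj by (rule finite_imageD)
  have "card (box r) = card (g ` box r)" using inj by (simp add: card_image)
  also have "\<dots> \<le> card ({..<m} \<rightarrow>\<^sub>E {- int r..int r})" by (intro card_mono fin sub)
  also have "\<dots> = (2 * r + 1) ^ m"
  proof -
    have "nat (int r - - int r + 1) = 2 * r + 1" by simp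
    then show ?thesis by (simp add: card_PiE)
  qed
  finally show "card (box r) \<le> (2 * r + 1) ^ m" .
qed

text \<open>Linear combinations of monomials with exponents in \<open>box r\<close>. Generating them
  term by term, repetitions allowed, reduces sums, products and adjoints to inductions in which only
  the radius has to be tracked.\<close>

inductive_set trig_poly for r where
  zero: "\<zero> \<in> trig_poly r"
| add: "p \<in> trig_poly r \<Longrightarrow> x \<in> box r \<Longrightarrow> p \<oplus> c \<odot> mon x \<in> trig_poly r"

lemma trig_poly_closed: "p \<in> trig_poly r \<Longrightarrow> p \<in> carrier A"
  by (induction rule: trig_poly.induct) (auto simp: box_lattice)

lemma trig_poly_mon: "x \<in> box r \<Longrightarrow> c \<odot> mon x \<in> trig_poly r"
  using trig_poly.add[OF trig_poly.zero, of x r c] by (simp add: box_lattice)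

lemma trig_poly_mults: "x \<in> box r \<Longrightarrow> a \<in> mults x \<Longrightarrow> c \<odot> a \<in> trig_poly r"
  by (auto elim!: multsE simp: smult_smult box_lattice intro: trig_poly_mon)

lemma trig_poly_add: "q \<in> trig_poly r \<Longrightarrow> p \<in> trig_poly r \<Longrightarrow> p \<oplus> q \<in> trig_poly r"
proof (induction rule: trig_poly.induct)
  case zero
  then show ?case by (simp add: trig_poly_closed)
next
  case (add q x c)
  have "p \<oplus> (q \<oplus> c \<odot> mon x) = (p \<oplus> q) \<oplus> c \<odot> mon x"
    using add by (simp add: a_assoc trig_poly_closed box_lattice)
  then show ?case using add by (auto intro: trig_poly.add)
qed

lemma trig_poly_smult: "p \<in> trig_poly r \<Longrightarrow> d \<odot> p \<in> trig_poly r"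
proof (induction rule: trig_poly.induct)
  case (add p x c)
  then show ?case
    by (auto simp: smult_add_right smult_smult trig_poly_closed box_lattice intro: trig_poly.add)
qed (simp add: trig_poly.zero)

lemma trig_poly_mono: "p \<in> trig_poly r \<Longrightarrow> r \<le> s \<Longrightarrow> p \<in> trig_poly s"
proof (induction rule: trig_poly.induct)
  case (add p x c)
  then have "x \<in> box s" by (force simp: box_def)
  then show ?case using add by (auto intro: trig_poly.add)
qed (simp add: trig_poly.zero)

text \<open>Radii add under products, so squaring \<open>k\<close> times multiplies the radius only
  by \<open>2 ^ k\<close>; this is the polynomial growth used for faithfulness.\<close>

lemma trig_poly_mult:
  assumes p: "p \<in> trig_poly r" and q: "q \<in> trig_poly s"
  shows "p \<otimes> q \<in> trig_poly (r + s)"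
proof -
  have mon: "p \<otimes> mon y \<in> trig_poly (r + s)" if y: "y \<in> box s" for y
    using p
  proof (induction rule: trig_poly.induct)
    case zero
    then show ?case using y by (simp add: box_lattice trig_poly.zero)
  next
    case (add p x c)
    have xy: "x + y \<in> box (r + s)"
      using add(2) y by (fastforce simp: box_def intro: order_trans[OF abs_triangle_ineq])
    have "(p \<oplus> c \<odot> mon x) \<otimes> mon y = p \<otimes> mon y \<oplus> c \<odot> (mon x \<otimes> mon y)"
      using add y by (simp add: l_distr trig_poly_closed box_lattice)
    moreover have "c \<odot> (mon x \<otimes> mon y) \<in> trig_poly (r + s)"
      using add y by (intro trig_poly_mults[OF xy] mon_mult box_lattice)
    ultimately show ?case using add by (simp add: trig_poly_add)
  qed
  show ?thesis
    using q
  proof (induction rule: trig_poly.induct)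
    case zero
    then show ?case using p by (simp add: trig_poly_closed trig_poly.zero)
  next
    case (add q x c)
    then show ?case using p mon[of x]
      by (simp add: r_distr trig_poly_closed box_lattice trig_poly_add trig_poly_smult)
  qed
qed

lemma trig_poly_star: "p \<in> trig_poly r \<Longrightarrow> star A p \<in> trig_poly r"
proof (induction rule: trig_poly.induct)
  case zero
  have "star A \<zero> = \<zero>" using star_smult[of \<zero> 0] by simp
  then show ?case by (simp add: trig_poly.zero)
next
  case (add p x c)
  then have "- x \<in> box r" by (auto simp: box_def)
  from trig_poly_mults[OF this star_mon, where c = "cnj c"] add show ?case
    by (simp add: trig_poly_closed box_lattice trig_poly_add)
qed

text \<open>Repeated terms at one lattice point are collected, so that the number of terms is
  bounded by the size of the box.\<close>

lemma trig_poly_expand: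
  assumes "p \<in> trig_poly r"
  shows "\<exists>c. p = finsum A (\<lambda>x. c x \<odot> mon x) (box r)"
  using assms
proof (induction rule: trig_poly.induct)
  case zero
  have "finsum A (\<lambda>x. 0 \<odot> mon x) (box r) = finsum A (\<lambda>x. \<zero>) (box r)"
    by (intro finsum_cong') (auto simp: box_lattice)
  then show ?case by (intro exI[of _ "\<lambda>_. 0"]) simp
next
  case (add p x d)
  then obtain c where c: "p = finsum A (\<lambda>x. c x \<odot> mon x) (box r)" by auto
  have "finsum A (\<lambda>y. (c y + (if x = y then d else 0)) \<odot> mon y) (box r) =
      finsum A (\<lambda>y. c y \<odot> mon y \<oplus> (if x = y then d \<odot> mon y else \<zero>)) (box r)"
    by (intro finsum_cong') (auto simp: box_lattice smult_add_left)
  also have "\<dots> = p \<oplus> finsum A (\<lambda>y. if x = y then d \<odot> mon y else \<zero>) (box r)"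
    unfolding c by (intro finsum_addf) (auto simp: box_lattice)
  also have "finsum A (\<lambda>y. if x = y then d \<odot> mon y else \<zero>) (box r) = d \<odot> mon x"
    using add(2) box_finite by (intro add.finprod_singleton) (auto simp: box_lattice)
  finally show ?case by metis
qed

text \<open>Monomials have norm at most 1, so the C*-norm is at most the sum of the moduli of the
  coefficients. Cauchy-Schwarz compares it with the sum of their squares, the GNS norm, at the cost
  of the number of lattice points.\<close>

lemma nrm_trig_poly_le:
  assumes "p \<in> trig_poly r"
  shows "(nrm A p)\<^sup>2 \<le> (2 * real r + 1) ^ m * (hnorm L (\<Lambda> p))\<^sup>2"
proof -
  obtain c where c: "p = finsum A (\<lambda>x. c x \<odot> mon x) (box r)" using trig_poly_expand[OF assms] by blast
  have sub: "box r \<subseteq> lattice" by (auto simp: box_def)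
  have "\<Lambda> p = B.comb c (box r)"
  proof -
    have "\<Lambda> p = finsum L (\<lambda>x. \<Lambda> (c x \<odot> mon x)) (box r)"
      unfolding c
      by (intro lin_map_finsum[OF complex_module_axioms L.complex_module_axioms lin_\<Lambda> box_finite])
        (simp add: box_lattice)
    also have "\<dots> = B.comb c (box r)"
      unfolding B.comb_def by (intro L.finsum_cong') (auto simp: box_lattice \<Lambda>_smult)
    finally show ?thesis .
  qed
  then have \<Lambda>p: "(hnorm L (\<Lambda> p))\<^sup>2 = (\<Sum>x\<in>box r. (cmod (c x))\<^sup>2)"
    using B.hnorm_comb[OF box_finite sub] by simp
  have "nrm A p \<le> (\<Sum>x\<in>box r. cmod (c x))"
  proof -
    have "nrm A p \<le> (\<Sum>x\<in>box r. nrm A (c x \<odot> mon x))"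
      unfolding c by (intro norm_finsum_le box_finite) (auto simp: box_lattice)
    also have "\<dots> \<le> (\<Sum>x\<in>box r. cmod (c x))"
    proof (rule sum_mono)
      fix x assume "x \<in> box r"
      then have "unitary (mon x)" "mon x \<in> carrier A" by (auto simp: box_lattice mon_unitary)
      then show "nrm A (c x \<odot> mon x) \<le> cmod (c x)"
        using nrm_isometry_le[of "mon x"] mult_left_mono[of "nrm A (mon x)" 1 "cmod (c x)"]
        by (simp add: norm_smult unitary_def)
    qed
    finally show ?thesis .
  qed
  then have "(nrm A p)\<^sup>2 \<le> (\<Sum>x\<in>box r. cmod (c x))\<^sup>2"
    using assms by (intro power_mono) (auto simp: trig_poly_closed)
  also have "\<dots> \<le> (\<Sum>x\<in>box r. (cmod (c x))\<^sup>2) * card (box r)" by (rule sum_squared_le_sum_of_squares)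
  also have "\<dots> \<le> (\<Sum>x\<in>box r. (cmod (c x))\<^sup>2) * (2 * real r + 1) ^ m"
  proof (intro mult_left_mono sum_nonneg)
    have "real (card (box r)) \<le> real ((2 * r + 1) ^ m)" using box_card by (simp only: of_nat_le_iff)
    then show "real (card (box r)) \<le> (2 * real r + 1) ^ m" by (simp add: add.commute)
  qed auto
  finally show ?thesis by (simp add: \<Lambda>p mult.commute)
qed

text \<open>Polynomial growth of \<open>\<int>\<^sup>m\<close>: the norm of \<open>p\<close> is the limit of the roots of the norms of the
  powers of \<open>p\<^sup>* p\<close>, whose supports grow only polynomially, so that it is controlled by the GNS norm.\<close>

lemma nrm_trig_poly_le_gns:
  assumes p: "p \<in> trig_poly r" and \<delta>: "0 \<le> \<delta>" "\<And>b. b \<in> carrier A \<Longrightarrow> hnorm L (\<Lambda> (p \<otimes> b)) \<le> \<delta> * hnorm L (\<Lambda> b)"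
  shows "nrm A p \<le> \<delta>"
proof -
  define h where "h = star A p \<otimes> p"
  have pc: "p \<in> carrier A" using p by (rule trig_poly_closed)
  have h: "h \<in> carrier A" "star A h = h" "nrm A h = (nrm A p)\<^sup>2" using pc by (auto simp: h_def nrm_star_mult)
  \<comment> \<open>A bound for left multiplication by \<open>h\<close> on the GNS space. The
    comparison of \<open>nrm A h\<close> with it will read
    \<open>nrm A p * nrm A p \<le> nrm A p * \<delta>\<close>, from which one factor
    cancels.\<close>
  define \<kappa> where "\<kappa> = nrm A p * \<delta>"
  have \<kappa>: "0 \<le> \<kappa>" using pc \<delta> by (simp add: \<kappa>_def)
  have h_poly: "h \<in> trig_poly (2 * r)"
    using trig_poly_mult[OF trig_poly_star[OF p] p] by (simp add: h_def mult_2)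
  have poly: "iter_sq h k \<in> trig_poly (2 ^ k * (2 * r))" for k
  proof (induction k)
    case (Suc k)
    have "2 ^ k * (2 * r) + 2 ^ k * (2 * r) = 2 ^ Suc k * (2 * r)" by simp
    then show ?case using trig_poly_mult[OF Suc Suc] by (simp only: iter_sq_Suc)
  qed (simp add: h_poly)
  have gns: "hnorm L (\<Lambda> (iter_sq h k \<otimes> b)) \<le> \<kappa> ^ 2 ^ k * hnorm L (\<Lambda> b)" if "b \<in> carrier A" for k b
    using that
  proof (induction k arbitrary: b)
    case 0
    have "hnorm L (\<Lambda> (h \<otimes> b)) = hnorm L (\<Lambda> (star A p \<otimes> (p \<otimes> b)))" using 0 pc by (simp add: h_def m_assoc)
    also have "\<dots> \<le> nrm A (star A p) * hnorm L (\<Lambda> (p \<otimes> b))" using 0 pc by (intro hnorm_\<Lambda>_mult_le) auto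
    also have "\<dots> \<le> nrm A (star A p) * (\<delta> * hnorm L (\<Lambda> b))" using 0 pc \<delta> by (intro mult_left_mono) auto
    finally show ?case using pc by (simp add: \<kappa>_def)
  next
    case (Suc k)
    have "hnorm L (\<Lambda> (iter_sq h (Suc k) \<otimes> b)) = hnorm L (\<Lambda> (iter_sq h k \<otimes> (iter_sq h k \<otimes> b)))"
      using Suc.prems h by (simp add: m_assoc)
    also have "\<dots> \<le> \<kappa> ^ 2 ^ k * hnorm L (\<Lambda> (iter_sq h k \<otimes> b))" using Suc.prems h by (intro Suc.IH) auto
    also have "\<dots> \<le> \<kappa> ^ 2 ^ k * (\<kappa> ^ 2 ^ k * hnorm L (\<Lambda> b))"
      using Suc.prems \<kappa> by (intro mult_left_mono Suc.IH) auto
    also have "\<dots> = \<kappa> ^ 2 ^ Suc k * hnorm L (\<Lambda> b)" by (simp add: power_add[symmetric] mult_2 mult.assoc[symmetric])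
    finally show ?case .
  qed
  \<comment> \<open>Squares appear because \<open>nrm_trig_poly_le\<close> compares squared norms.
    The power of \<open>h\<close> with exponent \<open>2 ^ j\<close> has radius
    \<open>2 ^ j * (2 * r)\<close>, and twice this radius plus 1 is the side length
    \<open>4 * real r * 2 ^ j + 1\<close>.\<close>
  have "(nrm A h)\<^sup>2 \<le> \<kappa>\<^sup>2"
  proof (rule le_if_power_le_polynomial[where c = "4 * real r" and C = 1 and m = m])
    fix j
    have "hnorm L (\<Lambda> (iter_sq h j)) \<le> \<kappa> ^ 2 ^ j"
      using gns[of \<one> j] h by (simp add: hnorm_\<Lambda>_one)
    then have le: "(hnorm L (\<Lambda> (iter_sq h j)))\<^sup>2 \<le> (\<kappa> ^ 2 ^ j)\<^sup>2" using h by (intro power_mono) auto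
    have "((nrm A h)\<^sup>2) ^ 2 ^ j = (nrm A (iter_sq h j))\<^sup>2"
      using h by (simp add: nrm_iter_sq power_mult[symmetric] mult.commute)
    also have "\<dots> \<le> (2 * real (2 ^ j * (2 * r)) + 1) ^ m * (hnorm L (\<Lambda> (iter_sq h j)))\<^sup>2"
      by (rule nrm_trig_poly_le[OF poly])
    also have "\<dots> \<le> (2 * real (2 ^ j * (2 * r)) + 1) ^ m * (\<kappa> ^ 2 ^ j)\<^sup>2"
      using le by (intro mult_left_mono) auto
    finally show "((nrm A h)\<^sup>2) ^ 2 ^ j \<le> 1 * (4 * real r * 2 ^ j + 1) ^ m * (\<kappa>\<^sup>2) ^ 2 ^ j"
      by (simp add: power_mult[symmetric] mult_ac)
  qed (use h \<kappa> in auto)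
  then have "nrm A h \<le> \<kappa>" using \<kappa> by (rule power2_le_imp_le)
  then have "nrm A p * nrm A p \<le> nrm A p * \<delta>" using h by (simp add: \<kappa>_def power2_eq_square)
  then show ?thesis using \<delta>(1) norm_nonneg[OF pc] by (cases "nrm A p = 0") auto
qed

text \<open>Let \<open>p\<close> be a trigonometric polynomial close to \<open>a\<close>. Since
  \<open>a\<close> acts as zero, \<open>p\<close> acts like \<open>p - a\<close>, hence with small
  norm, and by \<open>nrm_trig_poly_le_gns\<close> the C*-norm of \<open>p\<close> itself is
  small.\<close>

lemma gns_faithful:
  assumes a: "a \<in> carrier A" and zero: "\<And>b. b \<in> carrier A \<Longrightarrow> \<Lambda> (a \<otimes> b) = \<zero>\<^bsub>L\<^esub>"
  shows "a = \<zero>"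
proof -
  define W where "W = (\<Union>r. trig_poly r)"
  have sub: "submodule W complex_ring A"
  proof (rule submoduleI)
    fix p q assume "p \<in> W" "q \<in> W"
    then obtain r s where "p \<in> trig_poly r" "q \<in> trig_poly s" by (auto simp: W_def)
    then have "p \<in> trig_poly (max r s)" "q \<in> trig_poly (max r s)" by (auto intro: trig_poly_mono)
    then show "p \<oplus> q \<in> W" by (auto simp: W_def intro!: trig_poly_add)
  qed (auto simp: W_def trig_poly_closed trig_poly.zero intro: trig_poly_smult)
  have "mon ` lattice \<subseteq> W"
  proof
    fix a assume "a \<in> mon ` lattice"
    then obtain x where x: "x \<in> lattice" "a = mon x" by auto
    define r where "r = nat (\<Sum>i<m. \<bar>vec_index x i\<bar>)"
    have "\<bar>vec_index x i\<bar> \<le> int r" if "i < m" for i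
      using that member_le_sum[of i "{..<m}" "\<lambda>i. \<bar>vec_index x i\<bar>"] by (simp add: r_def)
    then have "x \<in> box r" using x by (simp add: box_def)
    from trig_poly_mon[OF this, of 1] show "a \<in> W" using x by (auto simp: W_def)
  qed
  from submodule_dense[OF sub total_mon this]
  have dense: "\<exists>p\<in>W. nrm A (a \<ominus> p) < \<epsilon>" if "\<epsilon> > 0" for \<epsilon>
    using closure_of_eq_carrier_iff[OF submoduleD(1)[OF sub]] a that by blast
  have "nrm A a \<le> \<epsilon>" if e: "\<epsilon> > 0" for \<epsilon>
  proof -
    obtain p r where p: "p \<in> trig_poly r" "nrm A (a \<ominus> p) < \<epsilon> / 2"
      using dense[OF half_gt_zero[OF e]] by (auto simp: W_def)
    have pc: "p \<in> carrier A" using p by (simp add: trig_poly_closed)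
    have "nrm A p \<le> \<epsilon> / 2"
    proof (rule nrm_trig_poly_le_gns[OF p(1)])
      fix b assume b: "b \<in> carrier A"
      have "p \<otimes> b = a \<otimes> b \<oplus> (- 1) \<odot> ((a \<ominus> p) \<otimes> b)"
      proof -
        have "(- 1) \<odot> ((a \<ominus> p) \<otimes> b) = \<ominus> ((a \<ominus> p) \<otimes> b)" using a b pc by (simp add: minus_eq_smult)
        moreover have "p \<otimes> b = a \<otimes> b \<oplus> \<ominus> ((a \<ominus> p) \<otimes> b)" using a b pc by algebra
        ultimately show ?thesis by simp
      qed
      then have "\<Lambda> (p \<otimes> b) = (- 1) \<odot>\<^bsub>L\<^esub> \<Lambda> ((a \<ominus> p) \<otimes> b)"
        using a b pc by (simp add: \<Lambda>_add \<Lambda>_smult zero)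
      then have "hnorm L (\<Lambda> (p \<otimes> b)) = hnorm L (\<Lambda> ((a \<ominus> p) \<otimes> b))"
        using a b pc by (simp add: L.hnorm_smult)
      also have "\<dots> \<le> nrm A (a \<ominus> p) * hnorm L (\<Lambda> b)" using a b pc by (intro hnorm_\<Lambda>_mult_le) auto
      also have "\<dots> \<le> \<epsilon> / 2 * hnorm L (\<Lambda> b)" using p b by (intro mult_right_mono) auto
      finally show "hnorm L (\<Lambda> (p \<otimes> b)) \<le> \<epsilon> / 2 * hnorm L (\<Lambda> b)" .
    qed (use e in simp)
    then show ?thesis using norm_le_add_diff[OF a pc] p(2) by simp
  qed
  then have "nrm A a \<le> 0" by (rule field_le_epsilon[of _ 0, simplified])
  then show ?thesis using norm_eq_zero[OF a] norm_nonneg[OF a] by simp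
qed

text \<open>The trace property moves \<open>b\<close> to the other end: the squared norm of
  \<open>\<Lambda> (a \<otimes> b)\<close> equals an inner product with \<open>\<Lambda> a\<close>.
  An element with null GNS vector thus acts as zero.\<close>

lemma \<Lambda>_inj:
  assumes a: "a \<in> carrier A" and zero: "\<Lambda> a = \<zero>\<^bsub>L\<^esub>"
  shows "a = \<zero>"
proof (rule gns_faithful[OF a])
  fix b assume b: "b \<in> carrier A"
  have "complex_of_real ((hnorm L (\<Lambda> (a \<otimes> b)))\<^sup>2) = \<tau> ((star A b \<otimes> (star A a \<otimes> (a \<otimes> b))))"
    using a b by (simp add: hnorm_\<Lambda>_sq m_assoc del: of_real_power)
  also have "\<dots> = \<tau> ((star A a \<otimes> (a \<otimes> b)) \<otimes> star A b)" using a b by (intro \<tau>_commute) auto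
  also have "\<dots> = ip L (\<Lambda> a) (\<Lambda> (a \<otimes> b \<otimes> star A b))" using a b by (simp add: ip_\<Lambda> m_assoc)
  also have "\<dots> = 0" using a b zero by simp
  finally have "hnorm L (\<Lambda> (a \<otimes> b)) = 0" by simp
  then show "\<Lambda> (a \<otimes> b) = \<zero>\<^bsub>L\<^esub>" using a b by (simp add: L.hnorm_eq_zero)
qed

end

section \<open>Hilbert space tensor products\<close>

text \<open>Polarisation: norms determine the real part of the inner product, and replacing
  \<open>v\<close> by \<open>\<i> \<odot> v\<close> gives the imaginary part.\<close>

lemma (in hilbert) isometry_ip:
  assumes "hilbert K" "isometry_op H K j" "u \<in> carrier H" "v \<in> carrier H"
  shows "ip K (j u) (j v) = ip H u v"
proof -
  interpret K: hilbert K by fact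
  have j: "lin_map H K j" "\<And>v. v \<in> carrier H \<Longrightarrow> hnorm K (j v) = hnorm H v"
    using assms(2) by (auto simp: isometry_op_def)
  note j' = lin_mapD[OF j(1)]
  have Re: "Re (ip K (j u) (j v)) = Re (ip H u v)" if "u \<in> carrier H" "v \<in> carrier H" for u v
    using that K.hnorm_sq_add[of "j u" "j v"] hnorm_sq_add[of u v] j(2)[of u] j(2)[of v]
      j(2)[of "u \<oplus> v"] j' by simp
  show ?thesis
    using Re[OF assms(3,4)] Re[OF assms(3), of "\<i> \<odot> v"] assms(3,4) j' by (simp add: complex_eq_iff)
qed

locale hilbert_tensor_product =
  fixes L S H T
  assumes tensor: "hilbert_tensor L S H T"
begin

sublocale L: hilbert L
  using tensor by unfold_locales (simp add: hilbert_tensor_def)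

sublocale S: hilbert S
  using tensor by unfold_locales (simp add: hilbert_tensor_def)

sublocale H: hilbert H
  using tensor by unfold_locales (simp add: hilbert_tensor_def)

lemma lin_T: "v \<in> carrier L \<Longrightarrow> lin_map S H (T v)" "w \<in> carrier S \<Longrightarrow> lin_map L H (\<lambda>v. T v w)"
  and ip_T: "v \<in> carrier L \<Longrightarrow> v' \<in> carrier L \<Longrightarrow> w \<in> carrier S \<Longrightarrow> w' \<in> carrier S \<Longrightarrow>
    ip H (T v w) (T v' w') = ip L v v' * ip S w w'"
  and dense_T: "hdense H (lin_span H {T v w |v w. v \<in> carrier L \<and> w \<in> carrier S})"
  using tensor unfolding hilbert_tensor_def by blast+

lemma T_closed [simp]: "v \<in> carrier L \<Longrightarrow> w \<in> carrier S \<Longrightarrow> T v w \<in> carrier H"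
  using lin_mapD(1)[OF lin_T(1)] .

lemma T_smult_left: "v \<in> carrier L \<Longrightarrow> w \<in> carrier S \<Longrightarrow> T (c \<odot>\<^bsub>L\<^esub> v) w = c \<odot>\<^bsub>H\<^esub> T v w"
  using lin_mapD(3)[OF lin_T(2)] .

lemma T_add_left: "v \<in> carrier L \<Longrightarrow> v' \<in> carrier L \<Longrightarrow> w \<in> carrier S \<Longrightarrow>
    T (v \<oplus>\<^bsub>L\<^esub> v') w = T v w \<oplus>\<^bsub>H\<^esub> T v' w"
  using lin_mapD(2)[OF lin_T(2)] .

lemma T_smult_right: "v \<in> carrier L \<Longrightarrow> w \<in> carrier S \<Longrightarrow> T v (c \<odot>\<^bsub>S\<^esub> w) = c \<odot>\<^bsub>H\<^esub> T v w"
  using lin_mapD(3)[OF lin_T(1)] .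

lemma hnorm_T: "v \<in> carrier L \<Longrightarrow> w \<in> carrier S \<Longrightarrow> hnorm H (T v w) = hnorm L v * hnorm S w"
proof -
  assume vw: "v \<in> carrier L" "w \<in> carrier S"
  have "complex_of_real ((hnorm H (T v w))\<^sup>2) = complex_of_real ((hnorm L v * hnorm S w)\<^sup>2)"
    using vw by (simp add: H.ip_self[symmetric] ip_T L.ip_self S.ip_self power_mult_distrib del: of_real_power)
  then show ?thesis using vw by (simp only: of_real_eq_iff) (simp add: power2_eq_iff_nonneg)
qed

lemma total_T:
  assumes "total_set L (hnorm L) X"
  shows "total_set H (hnorm H) {T v w |v w. v \<in> X \<and> w \<in> carrier S}"
proof (rule H.hdense_total[OF dense_T])
  let ?E = "{T v w |v w. v \<in> carrier L \<and> w \<in> carrier S}"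
  have X: "X \<subseteq> carrier L" using assms by (simp add: total_set_def)
  have "submodule (carrier H) complex_ring H" by (rule H.submoduleI) auto
  moreover have "?E \<subseteq> carrier H" by auto
  ultimately show "lin_span H ?E \<subseteq> carrier H" unfolding lin_span_def by blast
  show "{T v w |v w. v \<in> X \<and> w \<in> carrier S} \<subseteq> carrier H" using X by auto
  fix Q assume Q: "closed_subspace H (hnorm H) Q" "{T v w |v w. v \<in> X \<and> w \<in> carrier S} \<subseteq> Q"
  have "T v w \<in> Q" if v: "v \<in> carrier L" and w: "w \<in> carrier S" for v w
  proof (rule total_set_induct[OF assms _ _ v])
    show "closed_subspace L (hnorm L) {v \<in> carrier L. T v w \<in> Q}"
      using w hnorm_T by (intro closed_subspace_vimage[OF L.normed_module_axioms H.normed_module_axioms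
            lin_T(2) _ Q(1), of _ "hnorm S w"]) (auto simp: mult.commute)
    show "T v w \<in> Q" if "v \<in> X" for v using Q(2) that w by blast
  qed
  then have "?E \<subseteq> Q" by blast
  with H.closed_subspace_imp_submodule[OF Q(1)] show "lin_span H ?E \<subseteq> Q"
    unfolding lin_span_def by blast
qed

text \<open>With orthonormal second factors no cross terms occur, so norm estimates on the first
  factors carry over termwise; \<open>tensor_extension\<close> brings its vectors into this
  form.\<close>

lemma hnorm_finsum_T:
  assumes "orthonormal S E g" "finite E" "\<And>e. e \<in> E \<Longrightarrow> l e \<in> carrier L"
  shows "(hnorm H (finsum H (\<lambda>e. T (l e) (g e)) E))\<^sup>2 = (\<Sum>e\<in>E. (hnorm L (l e))\<^sup>2)"
proof -
  interpret g: orthonormal S E g by fact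
  let ?v = "finsum H (\<lambda>e. T (l e) (g e)) E"
  have v: "?v \<in> carrier H" using assms(3) by (intro H.finsum_closed) auto
  have "complex_of_real ((hnorm H ?v)\<^sup>2) = ip H ?v ?v" using v by (simp add: H.ip_self)
  also have "\<dots> = (\<Sum>e\<in>E. ip H (T (l e) (g e)) ?v)"
    using assms v by (intro H.ip_finsum_left) auto
  also have "\<dots> = (\<Sum>e\<in>E. complex_of_real ((hnorm L (l e))\<^sup>2))"
  proof (rule sum.cong[OF refl])
    fix e assume e: "e \<in> E"
    have "ip H (T (l e) (g e)) ?v = (\<Sum>e'\<in>E. ip H (T (l e) (g e)) (T (l e') (g e')))"
      using assms e by (intro H.ip_finsum_right) auto
    also have "\<dots> = (\<Sum>e'\<in>E. if e = e' then ip L (l e) (l e) else 0)"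
      using assms e by (intro sum.cong) (auto simp: ip_T g.f_ip)
    also have "\<dots> = complex_of_real ((hnorm L (l e))\<^sup>2)"
      using assms e by (simp add: L.ip_self)
    finally show "ip H (T (l e) (g e)) ?v = complex_of_real ((hnorm L (l e))\<^sup>2)" .
  qed
  also have "\<dots> = complex_of_real (\<Sum>e\<in>E. (hnorm L (l e))\<^sup>2)" by simp
  finally show ?thesis by (simp only: of_real_eq_iff)
qed

end

locale gns_tensor = nc_torus_gns A \<tau> L \<Lambda> m \<Theta> U
  for A (structure) and \<tau> L \<Lambda> m \<Theta> U +
  fixes S H T
  assumes hilbert_tensor: "hilbert_tensor L S H T"
    and fin_dim_S: "fin_dim S" and S_nontrivial: "carrier S \<noteq> {\<zero>\<^bsub>S\<^esub>}"
begin

sublocale hilbert_tensor_product L S H T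
  by unfold_locales (rule hilbert_tensor)

lemma ex_S_basis: "\<exists>E. finite E \<and> orthonormal_basis S E (\<lambda>e. e)"
proof -
  have "selfadjoint_end S (\<lambda>e. e)" by (auto simp: selfadjoint_end_def intro: lin_mapI)
  from S.selfadjoint_eigenbasis[OF fin_dim_S this] show ?thesis by blast
qed

lemma total_elementary: "total_set H (hnorm H) {T (\<Lambda> a) \<xi> |a \<xi>. a \<in> carrier A \<and> \<xi> \<in> carrier S}"
proof -
  have "total_set A (nrm A) (carrier A)"
    unfolding total_set_def using closed_subspaceD(1) by blast
  from total_T[OF total_\<Lambda>[OF this]]
  have "total_set H (hnorm H) {T v w |v w. v \<in> \<Lambda> ` carrier A \<and> w \<in> carrier S}" .
  moreover have "{T v w |v w. v \<in> \<Lambda> ` carrier A \<and> w \<in> carrier S} = {T (\<Lambda> a) \<xi> |a \<xi>. a \<in> carrier A \<and> \<xi> \<in> carrier S}"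
    by blast
  ultimately show ?thesis by simp
qed

abbreviation \<delta> where "\<delta> x \<equiv> \<Lambda> (mon x)"

lemma total_\<delta>: "total_set H (hnorm H) {T (\<delta> x) \<xi> |x \<xi>. x \<in> lattice \<and> \<xi> \<in> carrier S}"
proof -
  have "{T v w |v w. v \<in> (\<lambda>x. \<delta> x) ` lattice \<and> w \<in> carrier S} = {T (\<delta> x) \<xi> |x \<xi>. x \<in> lattice \<and> \<xi> \<in> carrier S}"
    by blast
  then show ?thesis using total_T[OF B.total] by simp
qed

lemma bounded_op_eq_on_elementary:
  assumes "hilbert K" "bounded_op H K P" "bounded_op H K Q" "v \<in> carrier H"
    and "\<And>a \<xi>. a \<in> carrier A \<Longrightarrow> \<xi> \<in> carrier S \<Longrightarrow> P (T (\<Lambda> a) \<xi>) = Q (T (\<Lambda> a) \<xi>)"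
  shows "P v = Q v"
  using assms(5) by (intro bounded_op_eq_on_total[OF H.hilbert_axioms assms(1-3) total_elementary _ assms(4)]) auto

text \<open>The tensor product of \<open>\<alpha>\<close> with \<open>j\<close>. Expanding second
  factors in an orthonormal basis \<open>E\<close>, which \<open>j\<close> maps to an orthonormal
  family, the bound \<open>C\<close> survives unchanged. Left multiplication is the case where
  \<open>j\<close> is the identity; the induced operator is the case where \<open>\<alpha>\<close>
  is the GNS map after \<open>\<phi>\<close>.\<close>

lemma tensor_extension:
  assumes K: "hilbert_tensor L2 S2 H2 T2" and \<alpha>: "lin_map A L2 \<alpha>" and j: "isometry_op S S2 j"
    and C: "0 \<le> C" "\<And>a. a \<in> carrier A \<Longrightarrow> hnorm L2 (\<alpha> a) \<le> C * hnorm L (\<Lambda> a)"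
  shows "\<exists>P. P \<in> extensional (carrier H) \<and> bounded_op H H2 P \<and>
    (\<forall>a\<in>carrier A. \<forall>\<xi>\<in>carrier S. P (T (\<Lambda> a) \<xi>) = T2 (\<alpha> a) (j \<xi>)) \<and>
    ((\<forall>a\<in>carrier A. hnorm L2 (\<alpha> a) = hnorm L (\<Lambda> a)) \<longrightarrow> isometry_op H H2 P)"
proof -
  interpret K: hilbert_tensor_product L2 S2 H2 T2 by unfold_locales fact
  note \<alpha>' = lin_mapD[OF \<alpha>]
  have j_lin: "lin_map S S2 j" using j by (simp add: isometry_op_def)
  note j' = lin_mapD[OF j_lin]
  obtain E where E: "finite E" "orthonormal_basis S E (\<lambda>e. e)" using ex_S_basis by blast
  interpret E: orthonormal_basis S E "\<lambda>e. e" by fact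
  have jE: "orthonormal S2 E j"
    by unfold_locales (use j' S.isometry_ip[OF K.S.hilbert_axioms j] E.f_ip in auto)
  have S_expand: "\<xi> = finsum S (\<lambda>e. ip S e \<xi> \<odot>\<^bsub>S\<^esub> e) E" if \<xi>: "\<xi> \<in> carrier S" for \<xi>
  proof -
    have "E.proj E \<xi> = \<xi>" using \<xi> E(1) by (intro E.eqI) (auto simp: E.coeff_comb)
    then show ?thesis by (simp add: E.comb_def)
  qed
  \<comment> \<open>Vectors are encoded by families of algebra elements indexed by \<open>E\<close>.
    No uniqueness of the family is required, since \<open>bounded_extension\<close> accepts a
    relation.\<close>
  define \<Phi> where "\<Phi> b = finsum H (\<lambda>e. T (\<Lambda> (b e)) e) E" for b
  define \<Psi> where "\<Psi> b = finsum H2 (\<lambda>e. T2 (\<alpha> (b e)) (j e)) E" for b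
  have closed: "\<Phi> b \<in> carrier H" "\<Psi> b \<in> carrier H2" if "b \<in> E \<rightarrow> carrier A" for b
    using that \<alpha>' j' unfolding \<Phi>_def \<Psi>_def
    by (auto intro!: H.finsum_closed K.H.finsum_closed simp: Pi_iff)
  have \<Phi>_norm: "(hnorm H (\<Phi> b))\<^sup>2 = (\<Sum>e\<in>E. (hnorm L (\<Lambda> (b e)))\<^sup>2)" if "b \<in> E \<rightarrow> carrier A" for b
    unfolding \<Phi>_def using that by (intro hnorm_finsum_T[OF E.orthonormal_axioms E(1)]) (auto simp: Pi_iff)
  have \<Psi>_norm: "(hnorm H2 (\<Psi> b))\<^sup>2 = (\<Sum>e\<in>E. (hnorm L2 (\<alpha> (b e)))\<^sup>2)" if "b \<in> E \<rightarrow> carrier A" for b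
    unfolding \<Psi>_def using that \<alpha>' by (intro K.hnorm_finsum_T[OF jE E(1)]) (auto simp: Pi_iff)
  define G where "G = (\<lambda>b. (\<Phi> b, \<Psi> b)) ` (E \<rightarrow> carrier A)"
  have elem: "(T (\<Lambda> a) \<xi>, T2 (\<alpha> a) (j \<xi>)) \<in> G" if a: "a \<in> carrier A" and \<xi>: "\<xi> \<in> carrier S" for a \<xi>
  proof -
    define b where "b e = ip S e \<xi> \<odot> a" for e
    have b: "b \<in> E \<rightarrow> carrier A" using a by (simp add: b_def)
    have "T (\<Lambda> a) \<xi> = T (\<Lambda> a) (finsum S (\<lambda>e. ip S e \<xi> \<odot>\<^bsub>S\<^esub> e) E)" using S_expand[OF \<xi>] by simp
    also have "\<dots> = finsum H (\<lambda>e. T (\<Lambda> a) (ip S e \<xi> \<odot>\<^bsub>S\<^esub> e)) E"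
      using a by (intro lin_map_finsum[OF S.complex_module_axioms H.complex_module_axioms lin_T(1) E(1)]) auto
    also have "\<dots> = \<Phi> b"
      unfolding \<Phi>_def using a by (intro H.finsum_cong') (auto simp: b_def \<Lambda>_smult T_smult_left T_smult_right)
    finally have 1: "T (\<Lambda> a) \<xi> = \<Phi> b" .
    have "T2 (\<alpha> a) (j \<xi>) = T2 (\<alpha> a) (j (finsum S (\<lambda>e. ip S e \<xi> \<odot>\<^bsub>S\<^esub> e) E))" using S_expand[OF \<xi>] by simp
    also have "j (finsum S (\<lambda>e. ip S e \<xi> \<odot>\<^bsub>S\<^esub> e) E) = finsum S2 (\<lambda>e. j (ip S e \<xi> \<odot>\<^bsub>S\<^esub> e)) E"
      by (intro lin_map_finsum[OF S.complex_module_axioms K.S.complex_module_axioms j_lin E(1)]) auto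
    also have "T2 (\<alpha> a) \<dots> = finsum H2 (\<lambda>e. T2 (\<alpha> a) (j (ip S e \<xi> \<odot>\<^bsub>S\<^esub> e))) E"
      using a \<alpha>' j' by (intro lin_map_finsum[OF K.S.complex_module_axioms K.H.complex_module_axioms K.lin_T(1) E(1)]) auto
    also have "\<dots> = \<Psi> b"
      unfolding \<Psi>_def using a \<alpha>' j'
      by (intro K.H.finsum_cong') (auto simp: b_def K.T_smult_left K.T_smult_right)
    finally show ?thesis using 1 b by (auto simp: G_def)
  qed
  have "\<exists>P. P \<in> extensional (carrier H) \<and> lin_map H H2 P \<and>
    (\<forall>v\<in>carrier H. hnorm H2 (P v) \<le> C * hnorm H v) \<and> (\<forall>v w. (v, w) \<in> G \<longrightarrow> P v = w) \<and>
    ((\<forall>v w. (v, w) \<in> G \<longrightarrow> hnorm H2 w = hnorm H v) \<longrightarrow> (\<forall>v\<in>carrier H. hnorm H2 (P v) = hnorm H v))"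
  proof (rule bounded_extension[OF H.hilbert_axioms K.H.hilbert_axioms _ _ _ total_elementary _ _ C(1)])
    show "G \<subseteq> carrier H \<times> carrier H2" using closed by (auto simp: G_def)
    show "G \<noteq> {}" using elem[OF zero_closed S.zero_closed] by blast
    show "{T (\<Lambda> a) \<xi> |a \<xi>. a \<in> carrier A \<and> \<xi> \<in> carrier S} \<subseteq> fst ` G" using elem by force
    show "(v \<oplus>\<^bsub>H\<^esub> v', w \<oplus>\<^bsub>H2\<^esub> w') \<in> G" if "(v, w) \<in> G" "(v', w') \<in> G" for v w v' w'
    proof -
      obtain b b' where b: "b \<in> E \<rightarrow> carrier A" "b' \<in> E \<rightarrow> carrier A"
        "v = \<Phi> b" "w = \<Psi> b" "v' = \<Phi> b'" "w' = \<Psi> b'" using \<open>(v, w) \<in> G\<close> \<open>(v', w') \<in> G\<close> by (auto simp: G_def)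
      have bc: "b e \<in> carrier A" "b' e \<in> carrier A" if "e \<in> E" for e using b that by auto
      define d where "d e = b e \<oplus> b' e" for e
      have "v \<oplus>\<^bsub>H\<^esub> v' = finsum H (\<lambda>e. T (\<Lambda> (b e)) e \<oplus>\<^bsub>H\<^esub> T (\<Lambda> (b' e)) e) E"
        unfolding b \<Phi>_def using bc by (intro H.finsum_addf[symmetric]) auto
      also have "\<dots> = \<Phi> d"
        unfolding \<Phi>_def d_def using bc by (intro H.finsum_cong') (auto simp: \<Lambda>_add T_add_left)
      finally have 1: "v \<oplus>\<^bsub>H\<^esub> v' = \<Phi> d" .
      have "w \<oplus>\<^bsub>H2\<^esub> w' = finsum H2 (\<lambda>e. T2 (\<alpha> (b e)) (j e) \<oplus>\<^bsub>H2\<^esub> T2 (\<alpha> (b' e)) (j e)) E"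
        unfolding b \<Psi>_def using bc \<alpha>' j' by (intro K.H.finsum_addf[symmetric]) auto
      also have "\<dots> = \<Psi> d"
        unfolding \<Psi>_def d_def using bc \<alpha>' j' by (intro K.H.finsum_cong') (auto simp: K.T_add_left)
      finally show ?thesis using 1 bc by (auto simp: G_def d_def)
    qed
    show "(c \<odot>\<^bsub>H\<^esub> v, c \<odot>\<^bsub>H2\<^esub> w) \<in> G" if "(v, w) \<in> G" for c v w
    proof -
      obtain b where b: "b \<in> E \<rightarrow> carrier A" "v = \<Phi> b" "w = \<Psi> b" using \<open>(v, w) \<in> G\<close> by (auto simp: G_def)
      have bc: "b e \<in> carrier A" if "e \<in> E" for e using b that by auto
      define d where "d e = c \<odot> b e" for e
      have "lin_map H H (\<lambda>v. c \<odot>\<^bsub>H\<^esub> v)"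
        by (rule lin_mapI) (auto simp: H.smult_add_right H.smult_smult mult.commute)
      from lin_map_finsum[OF H.complex_module_axioms H.complex_module_axioms this E(1), of "\<lambda>e. T (\<Lambda> (b e)) e"]
      have "c \<odot>\<^bsub>H\<^esub> v = finsum H (\<lambda>e. c \<odot>\<^bsub>H\<^esub> T (\<Lambda> (b e)) e) E" using bc by (simp add: b \<Phi>_def)
      also have "\<dots> = \<Phi> d"
        unfolding \<Phi>_def d_def using bc by (intro H.finsum_cong') (auto simp: \<Lambda>_smult T_smult_left)
      finally have 1: "c \<odot>\<^bsub>H\<^esub> v = \<Phi> d" .
      have "lin_map H2 H2 (\<lambda>v. c \<odot>\<^bsub>H2\<^esub> v)"
        by (rule lin_mapI) (auto simp: K.H.smult_add_right K.H.smult_smult mult.commute)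
      from lin_map_finsum[OF K.H.complex_module_axioms K.H.complex_module_axioms this E(1), of "\<lambda>e. T2 (\<alpha> (b e)) (j e)"]
      have "c \<odot>\<^bsub>H2\<^esub> w = finsum H2 (\<lambda>e. c \<odot>\<^bsub>H2\<^esub> T2 (\<alpha> (b e)) (j e)) E"
        using bc \<alpha>' j' by (simp add: b \<Psi>_def)
      also have "\<dots> = \<Psi> d"
        unfolding \<Psi>_def d_def using bc \<alpha>' j' by (intro K.H.finsum_cong') (auto simp: K.T_smult_left)
      finally show ?thesis using 1 bc by (auto simp: G_def d_def)
    qed
    show "hnorm H2 w \<le> C * hnorm H v" if "(v, w) \<in> G" for v w
    proof -
      obtain b where b: "b \<in> E \<rightarrow> carrier A" "v = \<Phi> b" "w = \<Psi> b" using \<open>(v, w) \<in> G\<close> by (auto simp: G_def)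
      have bc: "b e \<in> carrier A" if "e \<in> E" for e using b that by auto
      have "(hnorm H2 w)\<^sup>2 \<le> (\<Sum>e\<in>E. (C * hnorm L (\<Lambda> (b e)))\<^sup>2)"
        unfolding b \<Psi>_norm[OF b(1)] using bc C(2) \<alpha>' by (intro sum_mono power_mono) auto
      also have "\<dots> = (C * hnorm H v)\<^sup>2"
        unfolding b power_mult_distrib \<Phi>_norm[OF b(1)] by (simp add: sum_distrib_left)
      finally show ?thesis
        by (rule power2_le_imp_le) (use C(1) closed[OF b(1)] b in simp)
    qed
  qed
  then obtain P where P: "P \<in> extensional (carrier H)" "lin_map H H2 P"
    "\<And>v. v \<in> carrier H \<Longrightarrow> hnorm H2 (P v) \<le> C * hnorm H v" "\<And>v w. (v, w) \<in> G \<Longrightarrow> P v = w"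
    "(\<forall>v w. (v, w) \<in> G \<longrightarrow> hnorm H2 w = hnorm H v) \<longrightarrow> (\<forall>v\<in>carrier H. hnorm H2 (P v) = hnorm H v)"
    by blast
  show ?thesis
  proof (intro exI[of _ P] conjI impI)
    show "bounded_op H H2 P" using P(2,3) unfolding bounded_op_def by blast
    show "\<forall>a\<in>carrier A. \<forall>\<xi>\<in>carrier S. P (T (\<Lambda> a) \<xi>) = T2 (\<alpha> a) (j \<xi>)" using P(4) elem by blast
    assume iso: "\<forall>a\<in>carrier A. hnorm L2 (\<alpha> a) = hnorm L (\<Lambda> a)"
    have "hnorm H2 w = hnorm H v" if "(v, w) \<in> G" for v w
    proof -
      obtain b where b: "b \<in> E \<rightarrow> carrier A" "v = \<Phi> b" "w = \<Psi> b" using \<open>(v, w) \<in> G\<close> by (auto simp: G_def)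
      have "(\<Sum>e\<in>E. (hnorm L2 (\<alpha> (b e)))\<^sup>2) = (\<Sum>e\<in>E. (hnorm L (\<Lambda> (b e)))\<^sup>2)"
        using iso b(1) by (intro sum.cong) (auto simp: Pi_iff)
      then have "(hnorm H2 w)\<^sup>2 = (hnorm H v)\<^sup>2" using \<Phi>_norm[OF b(1)] \<Psi>_norm[OF b(1)] b by simp
      then show ?thesis using closed[OF b(1)] b by (simp add: power2_eq_iff_nonneg)
    qed
    then show "isometry_op H H2 P" using P(2,5) by (simp add: isometry_op_def)
  qed (rule P(1))
qed

subsection \<open>Left multiplication\<close>

abbreviation rep where "rep \<equiv> left_mult A \<Lambda> S H T"

lemma rep_props:
  assumes a: "a \<in> carrier A"
  shows "rep a \<in> extensional (carrier H) \<and> bounded_op H H (rep a) \<and>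
    (\<forall>b\<in>carrier A. \<forall>\<xi>\<in>carrier S. rep a (T (\<Lambda> b) \<xi>) = T (\<Lambda> (a \<otimes> b)) \<xi>)"
proof -
  let ?P = "\<lambda>P. P \<in> extensional (carrier H) \<and> bounded_op H H P \<and>
    (\<forall>b\<in>carrier A. \<forall>\<xi>\<in>carrier S. P (T (\<Lambda> b) \<xi>) = T (\<Lambda> (a \<otimes> b)) \<xi>)"
  have lin: "lin_map A L (\<lambda>b. \<Lambda> (a \<otimes> b))"
    using a by (intro lin_mapI) (auto simp: r_distr \<Lambda>_add \<Lambda>_smult)
  have iso: "isometry_op S S (\<lambda>\<xi>. \<xi>)" by (auto simp: isometry_op_def intro: lin_mapI)
  have "\<exists>P. ?P P"
    using tensor_extension[OF hilbert_tensor lin iso norm_nonneg[OF a] hnorm_\<Lambda>_mult_le[OF a]] by blast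
  moreover have "P = Q" if "?P P" "?P Q" for P Q
  proof (rule extensionalityI[of _ "carrier H"])
    show "P v = Q v" if v: "v \<in> carrier H" for v
      by (rule bounded_op_eq_on_elementary[OF H.hilbert_axioms _ _ v])
        (use \<open>?P P\<close> \<open>?P Q\<close> in auto)
  qed (use that in auto)
  ultimately have "\<exists>!P. ?P P" by blast
  from theI'[OF this] show ?thesis unfolding left_mult_def .
qed

lemma rep_bounded: "a \<in> carrier A \<Longrightarrow> bounded_op H H (rep a)"
  and rep_T: "a \<in> carrier A \<Longrightarrow> b \<in> carrier A \<Longrightarrow> \<xi> \<in> carrier S \<Longrightarrow> rep a (T (\<Lambda> b) \<xi>) = T (\<Lambda> (a \<otimes> b)) \<xi>"
  using rep_props by auto

lemma rep_lin: "a \<in> carrier A \<Longrightarrow> lin_map H H (rep a)"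
  using rep_bounded by (simp add: bounded_op_def)

lemmas rep_closed [simp] = lin_mapD(1)[OF rep_lin]
  and rep_add_right = lin_mapD(2)[OF rep_lin] and rep_smult_right = lin_mapD(3)[OF rep_lin]

lemma rep_add_left:
  assumes "a \<in> carrier A" "b \<in> carrier A" "v \<in> carrier H"
  shows "rep (a \<oplus> b) v = rep a v \<oplus>\<^bsub>H\<^esub> rep b v"
proof (rule bounded_op_eq_on_elementary[OF H.hilbert_axioms _ _ assms(3)])
  show "bounded_op H H (rep (a \<oplus> b))" using assms by (intro rep_bounded) auto
  show "bounded_op H H (\<lambda>v. rep a v \<oplus>\<^bsub>H\<^esub> rep b v)"
    by (rule bounded_op_add[OF H.hilbert_axioms rep_bounded[OF assms(1)] rep_bounded[OF assms(2)]])
  show "rep (a \<oplus> b) (T (\<Lambda> c) \<xi>) = rep a (T (\<Lambda> c) \<xi>) \<oplus>\<^bsub>H\<^esub> rep b (T (\<Lambda> c) \<xi>)"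
    if "c \<in> carrier A" "\<xi> \<in> carrier S" for c \<xi>
    using assms that by (simp add: rep_T l_distr \<Lambda>_add T_add_left)
qed

lemma rep_smult_left:
  assumes "a \<in> carrier A" "v \<in> carrier H"
  shows "rep (c \<odot> a) v = c \<odot>\<^bsub>H\<^esub> rep a v"
proof (rule bounded_op_eq_on_elementary[OF H.hilbert_axioms _ _ assms(2)])
  show "bounded_op H H (rep (c \<odot> a))" using assms by (intro rep_bounded) auto
  show "bounded_op H H (\<lambda>v. c \<odot>\<^bsub>H\<^esub> rep a v)"
    by (rule bounded_op_smult[OF H.hilbert_axioms rep_bounded[OF assms(1)]])
  show "rep (c \<odot> a) (T (\<Lambda> b) \<xi>) = c \<odot>\<^bsub>H\<^esub> rep a (T (\<Lambda> b) \<xi>)"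
    if "b \<in> carrier A" "\<xi> \<in> carrier S" for b \<xi>
    using assms that by (simp add: rep_T \<Lambda>_smult T_smult_left)
qed

lemma rep_one: "v \<in> carrier H \<Longrightarrow> rep \<one> v = v"
  by (rule bounded_op_eq_on_elementary[OF H.hilbert_axioms rep_bounded bounded_op_id])
    (auto simp: rep_T)

lemma rep_mult:
  assumes "a \<in> carrier A" "b \<in> carrier A" "v \<in> carrier H"
  shows "rep (a \<otimes> b) v = rep a (rep b v)"
proof (rule bounded_op_eq_on_elementary[OF H.hilbert_axioms _ _ assms(3)])
  show "bounded_op H H (rep (a \<otimes> b))" using assms by (intro rep_bounded) auto
  show "bounded_op H H (\<lambda>v. rep a (rep b v))"
    by (rule bounded_op_compose[OF H.hilbert_axioms H.hilbert_axioms rep_bounded[OF assms(2)] rep_bounded[OF assms(1)]])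
  show "rep (a \<otimes> b) (T (\<Lambda> c) \<xi>) = rep a (rep b (T (\<Lambda> c) \<xi>))"
    if "c \<in> carrier A" "\<xi> \<in> carrier S" for c \<xi>
    using assms that by (simp add: rep_T m_assoc)
qed

text \<open>A left multiplication stands on both sides, so that a bare inner product is covered by
  taking the unit; this explains the occurrences of \<open>rep \<one>\<close> in
  \<open>rep_adjoint\<close>.\<close>

lemma closed_subspace_rep_eq:
  assumes "a \<in> carrier A" "b \<in> carrier A" "w \<in> carrier H" "w' \<in> carrier H"
  shows "closed_subspace H (hnorm H) {v \<in> carrier H. ip H w (rep a v) = ip H w' (rep b v)}"
proof -
  have bound: "\<exists>C. \<forall>v\<in>carrier H. cmod (ip H w (rep a v)) \<le> C * hnorm H v"
    if aw: "a \<in> carrier A" "w \<in> carrier H" for a w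
  proof -
    obtain C where C: "\<And>v. v \<in> carrier H \<Longrightarrow> hnorm H (rep a v) \<le> C * hnorm H v"
      using rep_bounded[OF aw(1)] by (auto simp: bounded_op_def)
    have "cmod (ip H w (rep a v)) \<le> (hnorm H w * C) * hnorm H v" if v: "v \<in> carrier H" for v
      using H.cauchy_schwarz[of w "rep a v"] mult_left_mono[OF C[OF v], of "hnorm H w"] aw v
      by (simp add: mult.assoc)
    then show ?thesis by blast
  qed
  obtain C C' where C: "\<And>v. v \<in> carrier H \<Longrightarrow> cmod (ip H w (rep a v)) \<le> C * hnorm H v"
    "\<And>v. v \<in> carrier H \<Longrightarrow> cmod (ip H w' (rep b v)) \<le> C' * hnorm H v"
    using bound[OF assms(1,3)] bound[OF assms(2,4)] by blast
  show ?thesis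
    by (rule H.closed_subspace_equalizer[where C = C and C' = C'])
      (use assms C in \<open>simp_all add: rep_add_right rep_smult_right\<close>)
qed

text \<open>Two density arguments, one for each vector. Both run in the second slot, where the inner
  product is linear, so between them the identity is conjugated.\<close>

lemma rep_adjoint:
  assumes a: "a \<in> carrier A" and v: "v \<in> carrier H" and w: "w \<in> carrier H"
  shows "ip H (rep a v) w = ip H v (rep (star A a) w)"
proof -
  have elem: "ip H (T (\<Lambda> c) \<eta>) (rep a v) = ip H (rep (star A a) (T (\<Lambda> c) \<eta>)) v"
    if c: "c \<in> carrier A" "\<eta> \<in> carrier S" and v: "v \<in> carrier H" for c \<eta> v
  proof -
    have "ip H (T (\<Lambda> c) \<eta>) (rep a v) = ip H (rep (star A a) (T (\<Lambda> c) \<eta>)) (rep \<one> v)"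
    proof (rule total_set_induct[OF total_elementary closed_subspace_rep_eq _ v])
      fix x assume "x \<in> {T (\<Lambda> a) \<xi> |a \<xi>. a \<in> carrier A \<and> \<xi> \<in> carrier S}"
      then obtain b \<xi> where "b \<in> carrier A" "\<xi> \<in> carrier S" "x = T (\<Lambda> b) \<xi>" by blast
      then show "ip H (T (\<Lambda> c) \<eta>) (rep a x) = ip H (rep (star A a) (T (\<Lambda> c) \<eta>)) (rep \<one> x)"
        using a c by (simp add: rep_T ip_T ip_\<Lambda> m_assoc)
    qed (use a c in auto)
    then show ?thesis using v by (simp add: rep_one)
  qed
  have "ip H (rep a v) (rep \<one> w) = ip H v (rep (star A a) w)"
  proof (rule total_set_induct[OF total_elementary closed_subspace_rep_eq _ w])
    fix x assume "x \<in> {T (\<Lambda> a) \<xi> |a \<xi>. a \<in> carrier A \<and> \<xi> \<in> carrier S}"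
    then obtain c \<eta> where c: "c \<in> carrier A" "\<eta> \<in> carrier S" "x = T (\<Lambda> c) \<eta>" by blast
    then have x: "x \<in> carrier H" by simp
    have "ip H (rep a v) x = cnj (ip H x (rep a v))" using a v x by (intro H.ip_commute) auto
    also have "\<dots> = cnj (ip H (rep (star A a) x) v)" using elem[OF c(1,2) v] c(3) by simp
    also have "\<dots> = ip H v (rep (star A a) x)" using a v x by (intro H.ip_commute[symmetric]) auto
    finally show "ip H (rep a v) (rep \<one> x) = ip H v (rep (star A a) x)" using x by (simp add: rep_one)
  qed (use a v in auto)
  then show ?thesis using w by (simp add: rep_one)
qed

text \<open>Tensoring with a fixed nonzero \<open>\<xi>\<close> embeds the GNS space into
  \<open>H\<close>, which reduces the claim to \<open>gns_faithful\<close>.\<close>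

lemma rep_inj:
  assumes ab: "a \<in> carrier A" "b \<in> carrier A" and eq: "\<And>v. v \<in> carrier H \<Longrightarrow> rep a v = rep b v"
  shows "a = b"
proof -
  obtain \<xi> where \<xi>: "\<xi> \<in> carrier S" "\<xi> \<noteq> \<zero>\<^bsub>S\<^esub>" using S_nontrivial S.zero_closed by blast
  have "a \<ominus> b = \<zero>"
  proof (rule gns_faithful)
    fix c assume c: "c \<in> carrier A"
    have "rep (a \<ominus> b) (T (\<Lambda> c) \<xi>) = rep a (T (\<Lambda> c) \<xi>) \<oplus>\<^bsub>H\<^esub> (- 1) \<odot>\<^bsub>H\<^esub> rep b (T (\<Lambda> c) \<xi>)"
      using ab c \<xi> by (simp add: diff_eq_smult rep_add_left rep_smult_left)
    also have "\<dots> = \<zero>\<^bsub>H\<^esub>"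
      using ab c \<xi> eq H.diff_eq_smult[of "rep b (T (\<Lambda> c) \<xi>)" "rep b (T (\<Lambda> c) \<xi>)"] by simp
    finally have "T (\<Lambda> ((a \<ominus> b) \<otimes> c)) \<xi> = \<zero>\<^bsub>H\<^esub>" using ab c \<xi> by (simp add: rep_T)
    then have "hnorm L (\<Lambda> ((a \<ominus> b) \<otimes> c)) * hnorm S \<xi> = 0" using ab c \<xi> by (simp flip: hnorm_T)
    then show "\<Lambda> ((a \<ominus> b) \<otimes> c) = \<zero>\<^bsub>L\<^esub>" using ab c \<xi> by (simp add: L.hnorm_eq_zero S.hnorm_eq_zero)
  qed (use ab in auto)
  then show ?thesis by (rule diff_eq_zeroD[OF ab])
qed

lemma faithful_rep: "faithful_rep A H rep"
  unfolding faithful_rep_def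
  by (intro conjI ballI impI lin_mapI)
    (auto simp: rep_bounded rep_add_left rep_smult_left rep_one rep_mult rep_adjoint intro: rep_inj)

subsection \<open>Fourier coefficients\<close>

abbreviation coeff where "coeff \<equiv> fourier_coeff A U \<Lambda> S H T"

lemma hnorm_\<delta>: "x \<in> lattice \<Longrightarrow> hnorm L (\<delta> x) = 1"
  using ip_mon[of x x] by (simp add: hnorm_def)

text \<open>Riesz representation on \<open>S\<close>, made explicit by a finite orthonormal basis:
  the description in \<open>fourier_coeff\<close> has exactly one solution.\<close>

lemma coeff_props:
  assumes v: "v \<in> carrier H" and x: "x \<in> lattice"
  shows "coeff v x \<in> carrier S \<and> (\<forall>\<xi>\<in>carrier S. ip H (T (\<delta> x) \<xi>) v = ip S \<xi> (coeff v x))"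
proof -
  obtain E where E: "finite E" "orthonormal_basis S E (\<lambda>e. e)" using ex_S_basis by blast
  interpret E: orthonormal_basis S E "\<lambda>e. e" by fact
  define \<eta> where "\<eta> = E.comb (\<lambda>e. ip H (T (\<delta> x) e) v) E"
  have \<eta>: "\<eta> \<in> carrier S" by (simp add: \<eta>_def)
  \<comment> \<open>In this order of the slots both sides are linear in \<open>\<xi>\<close>, so the
    basis vectors suffice.\<close>
  have "ip H v (T (\<delta> x) \<xi>) = ip S \<eta> \<xi>" if \<xi>: "\<xi> \<in> carrier S" for \<xi>
  proof (rule total_set_induct[OF E.total _ _ \<xi>])
    show "closed_subspace S (hnorm S) {\<xi> \<in> carrier S. ip H v (T (\<delta> x) \<xi>) = ip S \<eta> \<xi>}"
    proof (rule S.closed_subspace_equalizer[where C = "hnorm H v" and C' = "hnorm S \<eta>"])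
      show "cmod (ip H v (T (\<delta> x) \<xi>)) \<le> hnorm H v * hnorm S \<xi>" if "\<xi> \<in> carrier S" for \<xi>
        using H.cauchy_schwarz[of v "T (\<delta> x) \<xi>"] that v x by (simp add: hnorm_T hnorm_\<delta>)
    qed (use v x \<eta> S.cauchy_schwarz in \<open>auto simp: lin_mapD(2)[OF lin_T(1)] T_smult_right\<close>)
    fix e assume "e \<in> (\<lambda>e. e) ` E"
    then have e: "e \<in> E" "e \<in> carrier S" by auto
    have "ip S \<eta> e = cnj (ip S e \<eta>)" using e \<eta> by (intro S.ip_commute)
    also have "ip S e \<eta> = ip H (T (\<delta> x) e) v" using e E(1) by (simp add: \<eta>_def E.coeff_comb)
    also have "cnj \<dots> = ip H v (T (\<delta> x) e)" using e v x by (intro H.ip_commute[symmetric]) auto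
    finally show "ip H v (T (\<delta> x) e) = ip S \<eta> e" ..
  qed
  then have "ip H (T (\<delta> x) \<xi>) v = ip S \<xi> \<eta>" if "\<xi> \<in> carrier S" for \<xi>
    using that v x \<eta> H.ip_commute[of v "T (\<delta> x) \<xi>"] S.ip_commute[of \<eta> \<xi>] by simp
  then have "\<exists>\<eta>. \<eta> \<in> carrier S \<and> (\<forall>\<xi>\<in>carrier S. ip H (T (\<delta> x) \<xi>) v = ip S \<xi> \<eta>)" using \<eta> by blast
  moreover have "\<eta> = \<eta>'" if "\<eta> \<in> carrier S \<and> (\<forall>\<xi>\<in>carrier S. ip H (T (\<delta> x) \<xi>) v = ip S \<xi> \<eta>)"
    "\<eta>' \<in> carrier S \<and> (\<forall>\<xi>\<in>carrier S. ip H (T (\<delta> x) \<xi>) v = ip S \<xi> \<eta>')" for \<eta> \<eta>'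
    using that by (intro S.eq_by_ip) auto
  ultimately have "\<exists>!\<eta>. \<eta> \<in> carrier S \<and> (\<forall>\<xi>\<in>carrier S. ip H (T (\<delta> x) \<xi>) v = ip S \<xi> \<eta>)" by blast
  from theI'[OF this] show ?thesis unfolding fourier_coeff_def .
qed

lemma coeff_closed [simp]: "v \<in> carrier H \<Longrightarrow> x \<in> lattice \<Longrightarrow> coeff v x \<in> carrier S"
  and ip_coeff: "v \<in> carrier H \<Longrightarrow> x \<in> lattice \<Longrightarrow> \<xi> \<in> carrier S \<Longrightarrow>
    ip H (T (\<delta> x) \<xi>) v = ip S \<xi> (coeff v x)"
  using coeff_props by auto

lemma coeff_eqI:
  assumes "v \<in> carrier H" "x \<in> lattice" "\<eta> \<in> carrier S"
    "\<And>\<xi>. \<xi> \<in> carrier S \<Longrightarrow> ip H (T (\<delta> x) \<xi>) v = ip S \<xi> \<eta>"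
  shows "coeff v x = \<eta>"
  by (rule S.eq_by_ip) (use assms in \<open>auto simp flip: ip_coeff\<close>)

lemma coeff_add: "u \<in> carrier H \<Longrightarrow> v \<in> carrier H \<Longrightarrow> x \<in> lattice \<Longrightarrow>
    coeff (u \<oplus>\<^bsub>H\<^esub> v) x = coeff u x \<oplus>\<^bsub>S\<^esub> coeff v x"
  by (rule coeff_eqI) (auto simp: ip_coeff)

lemma coeff_smult: "v \<in> carrier H \<Longrightarrow> x \<in> lattice \<Longrightarrow> coeff (c \<odot>\<^bsub>H\<^esub> v) x = c \<odot>\<^bsub>S\<^esub> coeff v x"
  by (rule coeff_eqI) (auto simp: ip_coeff)

lemma coeff_T:
  assumes "x \<in> lattice" "y \<in> lattice" "\<xi> \<in> carrier S"
  shows "coeff (T (\<delta> y) \<xi>) x = (if x = y then \<xi> else \<zero>\<^bsub>S\<^esub>)"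
  by (rule coeff_eqI) (use assms in \<open>auto simp: ip_T ip_mon\<close>)

text \<open>Pair \<open>v\<close> with the elementary tensor of \<open>\<delta> x\<close> and the
  coefficient itself, then apply Cauchy-Schwarz and cancel.\<close>

lemma hnorm_coeff_le:
  assumes "v \<in> carrier H" "x \<in> lattice"
  shows "hnorm S (coeff v x) \<le> hnorm H v"
proof -
  let ?c = "coeff v x"
  have "hnorm S ?c * hnorm S ?c = cmod (ip H (T (\<delta> x) ?c) v)"
    using assms by (simp add: ip_coeff S.ip_self power2_eq_square norm_mult)
  also have "\<dots> \<le> hnorm S ?c * hnorm H v"
    using H.cauchy_schwarz[of "T (\<delta> x) ?c" v] assms by (simp add: hnorm_T hnorm_\<delta>)
  finally have "hnorm S ?c * hnorm S ?c \<le> hnorm S ?c * hnorm H v" .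
  moreover have "0 \<le> hnorm S ?c" "0 \<le> hnorm H v" using assms by auto
  ultimately show ?thesis by (cases "hnorm S ?c = 0") auto
qed

text \<open>The basis of \<open>S\<close> may vary with the lattice point, as eigenbases of the
  \<open>F x\<close> do.\<close>

lemma tensor_basis:
  assumes E: "\<And>x. x \<in> lattice \<Longrightarrow> orthonormal_basis S (E x) (\<lambda>e. e)"
  shows "orthonormal_basis H (Sigma lattice E) (\<lambda>i. T (\<delta> (fst i)) (snd i))"
proof
  have Ec: "e \<in> carrier S" if "x \<in> lattice" "e \<in> E x" for x e
    using orthonormal.f_closed[OF orthonormal_basis.axioms(1)[OF E[OF that(1)]] that(2)] .
  have E_ip: "ip S e e' = (if e = e' then 1 else 0)" if "x \<in> lattice" "e \<in> E x" "e' \<in> E x" for x e e'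
    using orthonormal.f_ip[OF orthonormal_basis.axioms(1)[OF E[OF that(1)]] that(2,3)] .
  fix i assume i: "i \<in> Sigma lattice E"
  then show "T (\<delta> (fst i)) (snd i) \<in> carrier H" using Ec by auto
  fix j assume "j \<in> Sigma lattice E"
  then show "ip H (T (\<delta> (fst i)) (snd i)) (T (\<delta> (fst j)) (snd j)) = (if i = j then 1 else 0)"
    using i Ec E_ip by (auto simp: ip_T ip_mon prod_eq_iff)
next
  have Ec: "e \<in> carrier S" if "x \<in> lattice" "e \<in> E x" for x e
    using orthonormal.f_closed[OF orthonormal_basis.axioms(1)[OF E[OF that(1)]] that(2)] .
  let ?B = "(\<lambda>i. T (\<delta> (fst i)) (snd i)) ` Sigma lattice E"
  show "total_set H (hnorm H) ?B"
    unfolding total_set_def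
  proof (intro conjI allI impI; (elim conjE)?)
    show "?B \<subseteq> carrier H" using Ec by auto
    fix Q assume Q: "closed_subspace H (hnorm H) Q" "?B \<subseteq> Q"
    have "T (\<delta> x) \<xi> \<in> Q" if x: "x \<in> lattice" and \<xi>: "\<xi> \<in> carrier S" for x \<xi>
    proof (rule total_set_induct[OF orthonormal_basis.total[OF E[OF x]] _ _ \<xi>])
      show "closed_subspace S (hnorm S) {\<xi> \<in> carrier S. T (\<delta> x) \<xi> \<in> Q}"
        using x by (intro closed_subspace_vimage[OF S.normed_module_axioms H.normed_module_axioms lin_T(1) _ Q(1), of _ 1])
          (auto simp: hnorm_T hnorm_\<delta>)
      show "T (\<delta> x) e \<in> Q" if "e \<in> (\<lambda>e. e) ` E x" for e
        using Q(2) x that by (auto simp: image_subset_iff)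
    qed
    then have "{T (\<delta> x) \<xi> |x \<xi>. x \<in> lattice \<and> \<xi> \<in> carrier S} \<subseteq> Q" by blast
    then show "Q = carrier H" using total_\<delta> Q(1) by (simp add: total_set_def)
  qed
qed

lemma coeff_ext:
  assumes "u \<in> carrier H" "v \<in> carrier H" "\<And>x. x \<in> lattice \<Longrightarrow> coeff u x = coeff v x"
  shows "u = v"
  by (rule H.eq_by_total[OF total_\<delta> assms(1,2)]) (use assms in \<open>auto simp: ip_coeff\<close>)

lemma parseval_coeff:
  assumes v: "v \<in> carrier H"
  shows "((\<lambda>x. (hnorm S (coeff v x))\<^sup>2) has_sum (hnorm H v)\<^sup>2) lattice"
proof -
  obtain E where E: "finite E" "orthonormal_basis S E (\<lambda>e. e)" using ex_S_basis by blast
  interpret E: orthonormal_basis S E "\<lambda>e. e" by fact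
  interpret F: orthonormal_basis H "lattice \<times> E" "\<lambda>i. T (\<delta> (fst i)) (snd i)"
    using tensor_basis[of "\<lambda>_. E"] E(2) by simp
  show ?thesis
  proof (rule has_sum_SigmaD[OF F.parseval[OF v]])
    fix x assume x: "x \<in> lattice"
    have "((\<lambda>e. (cmod (ip S e (coeff v x)))\<^sup>2) has_sum (hnorm S (coeff v x))\<^sup>2) E"
      using v x by (intro E.parseval) auto
    then show "((\<lambda>e. (cmod (ip H (T (\<delta> (fst (x, e))) (snd (x, e))) v))\<^sup>2) has_sum (hnorm S (coeff v x))\<^sup>2) E"
      by (rule iffD1[OF has_sum_cong, rotated]) (use v x in \<open>simp add: ip_coeff\<close>)
  qed
qed

lemma riesz_fischer_coeff:
  assumes s: "\<And>x. x \<in> lattice \<Longrightarrow> s x \<in> carrier S" and sum: "(\<lambda>x. (hnorm S (s x))\<^sup>2) summable_on lattice"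
  shows "\<exists>v\<in>carrier H. \<forall>x\<in>lattice. coeff v x = s x"
proof -
  obtain E where E: "finite E" "orthonormal_basis S E (\<lambda>e. e)" using ex_S_basis by blast
  interpret E: orthonormal_basis S E "\<lambda>e. e" by fact
  interpret F: orthonormal_basis H "lattice \<times> E" "\<lambda>i. T (\<delta> (fst i)) (snd i)"
    using tensor_basis[of "\<lambda>_. E"] E(2) by simp
  have "(\<lambda>i. (cmod (ip S (snd i) (s (fst i))))\<^sup>2) summable_on (lattice \<times> E)"
  proof (rule summable_on_SigmaI[OF _ sum])
    show "((\<lambda>e. (cmod (ip S (snd (x, e)) (s (fst (x, e)))))\<^sup>2) has_sum (hnorm S (s x))\<^sup>2) E" if "x \<in> lattice" for x
      using E.parseval[OF s[OF that]] by simp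
  qed auto
  from F.riesz_fischer[OF this] obtain v where v: "v \<in> carrier H"
    "\<And>x e. x \<in> lattice \<Longrightarrow> e \<in> E \<Longrightarrow> ip H (T (\<delta> x) e) v = ip S e (s x)" by auto
  have "coeff v x = s x" if x: "x \<in> lattice" for x
    by (rule E.eqI) (use v s x in \<open>auto simp flip: ip_coeff\<close>)
  with v(1) show ?thesis by blast
qed

text \<open>The adjoint of \<open>mon a\<close> acts on the test vector and shifts it back from
  \<open>x + a\<close> to \<open>x\<close>. The scalar appears there as \<open>cnj k\<close> and
  becomes \<open>k\<close> because the first slot is conjugate-linear.\<close>

lemma coeff_rep_mon:
  assumes "a \<in> lattice" "x \<in> lattice" "v \<in> carrier H" "mon a \<otimes> mon x = k \<odot> mon (x + a)" "cmod k = 1"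
  shows "coeff (rep (mon a) v) (x + a) = k \<odot>\<^bsub>S\<^esub> coeff v x"
proof (rule coeff_eqI)
  fix \<xi> assume \<xi>: "\<xi> \<in> carrier S"
  have xa: "x + a \<in> lattice" using assms by simp
  have kk: "cnj k * k = 1" using complex_norm_square[of k] assms(5) by (simp add: mult.commute)
  have u: "unitary (mon a)" using assms(1) by (rule mon_unitary)
  have "mon (x + a) = cnj k \<odot> (mon a \<otimes> mon x)" using assms(4) xa kk by (simp add: smult_smult)
  then have "star A (mon a) \<otimes> mon (x + a) = cnj k \<odot> (star A (mon a) \<otimes> (mon a \<otimes> mon x))"
    using assms(1,2) by simp
  also have "\<dots> = cnj k \<odot> mon x" using u assms(1,2) by (simp add: m_assoc[symmetric] unitary_def)
  finally have *: "star A (mon a) \<otimes> mon (x + a) = cnj k \<odot> mon x" .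
  have "ip H (T (\<delta> (x + a)) \<xi>) (rep (mon a) v) = ip H (rep (star A (mon a)) (T (\<delta> (x + a)) \<xi>)) v"
    using rep_adjoint[of "star A (mon a)" "T (\<delta> (x + a)) \<xi>" v] assms xa \<xi> by simp
  also have "\<dots> = ip H (T (\<Lambda> (cnj k \<odot> mon x)) \<xi>) v"
    using assms xa \<xi> by (simp add: rep_T *)
  also have "\<dots> = ip S \<xi> (k \<odot>\<^bsub>S\<^esub> coeff v x)"
    using assms \<xi> by (simp add: \<Lambda>_smult T_smult_left ip_coeff)
  finally show "ip H (T (\<delta> (x + a)) \<xi>) (rep (mon a) v) = ip S \<xi> (k \<odot>\<^bsub>S\<^esub> coeff v x)" .
qed (use assms in auto)

end

section \<open>The spectral triple of a Fourier multiplier\<close>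

locale multiplier_triple = gns_tensor A \<tau> L \<Lambda> m \<Theta> U S H T
  for A (structure) and \<tau> L \<Lambda> m \<Theta> U S H T +
  fixes F :: "int Matrix.vec \<Rightarrow> _ \<Rightarrow> _"
  assumes F_selfadjoint: "x \<in> carrier_vec m \<Longrightarrow> selfadjoint_end S (F x)"
    and F_spectrum: "0 < R \<Longrightarrow> fin_dim (direct_sum_copies
        {x \<in> carrier_vec m. spec_end S (F x) \<inter> complex_of_real ` {- R..R} \<noteq> {}} S)"
    and F_difference: "a \<in> carrier_vec m \<Longrightarrow> \<exists>C. \<forall>x\<in>carrier_vec m. \<forall>v\<in>carrier S.
        hnorm S (F (x + a) v \<ominus>\<^bsub>S\<^esub> F x v) \<le> C * hnorm S v"
begin

section \<open>The multiplier operator as a diagonal operator\<close>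

abbreviation dirac where "dirac \<equiv> multiplier_op m A U \<Lambda> S H T F"

lemma F_lin: "x \<in> lattice \<Longrightarrow> lin_map S S (F x)"
  using F_selfadjoint by (simp add: selfadjoint_end_def)

lemma F_ip: "x \<in> lattice \<Longrightarrow> v \<in> carrier S \<Longrightarrow> w \<in> carrier S \<Longrightarrow> ip S (F x v) w = ip S v (F x w)"
  using F_selfadjoint by (simp add: selfadjoint_end_def)

lemmas F_closed [simp] = lin_mapD(1)[OF F_lin] and F_smult = lin_mapD(3)[OF F_lin]

text \<open>Domain and value are merged into one description of the graph, in the shape of
  \<open>graph_iff\<close>. Summability provides the value by Riesz-Fischer, Parseval gives
  summability back, and \<open>coeff_ext\<close> makes the value unique.\<close>

lemma dirac_iff:
  "v \<in> op_dom dirac \<and> op_app dirac v = w \<longleftrightarrow>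
    v \<in> carrier H \<and> w \<in> carrier H \<and> (\<forall>x\<in>lattice. coeff w x = F x (coeff v x))"
proof -
  let ?P = "\<lambda>v w. w \<in> carrier H \<and> (\<forall>x\<in>lattice. coeff w x = F x (coeff v x))"
  have unique: "w = w'" if "?P v w" "?P v w'" for v w w' using that by (intro coeff_ext) auto
  have dom: "v \<in> op_dom dirac \<longleftrightarrow> v \<in> carrier H \<and> (\<exists>w. ?P v w)" for v
  proof
    assume "v \<in> op_dom dirac"
    then have "v \<in> carrier H" "(\<lambda>x. (hnorm S (F x (coeff v x)))\<^sup>2) summable_on lattice"
      by (auto simp: multiplier_op_def)
    then show "v \<in> carrier H \<and> (\<exists>w. ?P v w)"
      using riesz_fischer_coeff[of "\<lambda>x. F x (coeff v x)"] by auto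
  next
    assume v: "v \<in> carrier H \<and> (\<exists>w. ?P v w)"
    then obtain w where w: "?P v w" by blast
    have "((\<lambda>x. (hnorm S (F x (coeff v x)))\<^sup>2) has_sum (hnorm H w)\<^sup>2) lattice"
      by (rule iffD1[OF has_sum_cong parseval_coeff]) (use w in auto)
    then show "v \<in> op_dom dirac"
      using v has_sum_imp_summable by (auto simp: multiplier_op_def)
  qed
  have app: "op_app dirac v = w" if "?P v w" for v w
  proof -
    have "(THE w. ?P v w) = w" using that unique by (intro the_equality) auto
    then show ?thesis by (simp add: multiplier_op_def)
  qed
  show ?thesis
  proof
    assume *: "v \<in> op_dom dirac \<and> op_app dirac v = w"
    then obtain w' where "v \<in> carrier H" "?P v w'" using dom by blast
    then show "v \<in> carrier H \<and> ?P v w" using app[of w' v] * by blast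
  next
    assume "v \<in> carrier H \<and> ?P v w"
    then show "v \<in> op_dom dirac \<and> op_app dirac v = w" using app dom by blast
  qed
qed

lemma ex_diagonalization:
  "\<exists>E lam. (\<forall>x\<in>lattice. finite (E x) \<and> orthonormal_basis S (E x) (\<lambda>e. e)) \<and>
    (\<forall>x\<in>lattice. \<forall>e\<in>E x. F x e = complex_of_real (lam x e) \<odot>\<^bsub>S\<^esub> e)"
proof -
  have "\<forall>x\<in>lattice. \<exists>p. finite (fst p) \<and> orthonormal_basis S (fst p) (\<lambda>e. e) \<and>
      (\<forall>e\<in>fst p. F x e = complex_of_real (snd p e) \<odot>\<^bsub>S\<^esub> e)"
    using S.selfadjoint_eigenbasis[OF fin_dim_S F_selfadjoint] by (metis fst_conv snd_conv)
  from bchoice[OF this] obtain p where "\<forall>x\<in>lattice. finite (fst (p x)) \<and> orthonormal_basis S (fst (p x)) (\<lambda>e. e) \<and>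
      (\<forall>e\<in>fst (p x). F x e = complex_of_real (snd (p x) e) \<odot>\<^bsub>S\<^esub> e)" by blast
  then show ?thesis by (intro exI[of _ "\<lambda>x. fst (p x)"] exI[of _ "\<lambda>x. snd (p x)"]) auto
qed

text \<open>The eigenbases are local to this proof, so the consequences of the diagonal form are
  collected in one statement that does not mention them.\<close>

lemma dirac_selfadjoint: "selfadjoint H dirac"
  and dirac_compact_resolvent: "compact_resolvent H dirac"
  and dirac_dom_submodule: "submodule (op_dom dirac) complex_ring H"
  and dirac_dom_dense: "hdense H (op_dom dirac)"
  and dirac_add: "u \<in> op_dom dirac \<Longrightarrow> v \<in> op_dom dirac \<Longrightarrow>
    op_app dirac (u \<oplus>\<^bsub>H\<^esub> v) = op_app dirac u \<oplus>\<^bsub>H\<^esub> op_app dirac v"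
  and dirac_smult: "v \<in> op_dom dirac \<Longrightarrow> op_app dirac (c \<odot>\<^bsub>H\<^esub> v) = c \<odot>\<^bsub>H\<^esub> op_app dirac v"
proof -
  obtain E lam where E: "\<And>x. x \<in> lattice \<Longrightarrow> finite (E x)" "\<And>x. x \<in> lattice \<Longrightarrow> orthonormal_basis S (E x) (\<lambda>e. e)"
    and lam: "\<And>x e. x \<in> lattice \<Longrightarrow> e \<in> E x \<Longrightarrow> F x e = complex_of_real (lam x e) \<odot>\<^bsub>S\<^esub> e"
    using ex_diagonalization by blast
  have Ec: "e \<in> carrier S" if "x \<in> lattice" "e \<in> E x" for x e
    using orthonormal.f_closed[OF orthonormal_basis.axioms(1)[OF E(2)[OF that(1)]] that(2)] .
  let ?X = "Sigma lattice E" and ?f = "\<lambda>i. T (\<delta> (fst i)) (snd i)" and ?lam = "\<lambda>i. lam (fst i) (snd i)"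
  have "diagonal_operator H ?X ?f dirac ?lam"
  proof (intro diagonal_operator.intro tensor_basis[OF E(2)] diagonal_operator_axioms.intro)
    fix v w
    have eig: "ip S e (F x (coeff v x)) = complex_of_real (lam x e) * ip S e (coeff v x)"
      if "v \<in> carrier H" "x \<in> lattice" "e \<in> E x" for x e
      using F_ip[of x e "coeff v x"] lam[OF that(2,3)] Ec[OF that(2,3)] that by simp
    have iff: "coeff w x = F x (coeff v x) \<longleftrightarrow>
        (\<forall>e\<in>E x. ip H (T (\<delta> x) e) w = complex_of_real (lam x e) * ip H (T (\<delta> x) e) v)"
      if vw: "v \<in> carrier H" "w \<in> carrier H" and x: "x \<in> lattice" for x
    proof -
      have "coeff w x = F x (coeff v x) \<longleftrightarrow> (\<forall>e\<in>E x. ip S e (coeff w x) = ip S e (F x (coeff v x)))"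
        using orthonormal_basis.eqI[OF E(2)[OF x], of "coeff w x" "F x (coeff v x)"] vw x by auto
      then show ?thesis using eig[OF vw(1) x] Ec[OF x] vw x by (simp add: ip_coeff)
    qed
    show "v \<in> op_dom dirac \<and> op_app dirac v = w \<longleftrightarrow> v \<in> carrier H \<and> w \<in> carrier H \<and>
        (\<forall>i\<in>?X. ip H (?f i) w = complex_of_real (?lam i) * ip H (?f i) v)"
      unfolding dirac_iff using iff by auto
  qed
  then interpret D: diagonal_operator H ?X ?f dirac ?lam .
  have fin: "finite {i \<in> ?X. \<bar>?lam i\<bar> \<le> R}" for R
  proof -
    \<comment> \<open>\<open>F_spectrum\<close> speaks of positive radii only, while
      \<open>R\<close> is arbitrary.\<close>
    define R' where "R' = max R 1"
    define Y where "Y = {x \<in> lattice. spec_end S (F x) \<inter> complex_of_real ` {- R'..R'} \<noteq> {}}"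
    have Y: "finite Y"
      unfolding Y_def by (rule finite_if_fin_dim_direct_sum[OF S.complex_module_axioms S_nontrivial F_spectrum])
        (simp add: R'_def)
    have "x \<in> Y" if x: "x \<in> lattice" and e: "e \<in> E x" and le: "\<bar>lam x e\<bar> \<le> R" for x e
    proof -
      have "ip S e e = 1"
        using orthonormal.f_ip[OF orthonormal_basis.axioms(1)[OF E(2)[OF x]] e e] by simp
      then have "e \<noteq> \<zero>\<^bsub>S\<^esub>" by auto
      then have "complex_of_real (lam x e) \<in> spec_end S (F x)"
        using S.eigenvalue_in_spec_end[OF F_lin[OF x] Ec[OF x e] _ lam[OF x e]] by simp
      moreover have "lam x e \<in> {- R'..R'}" using le by (auto simp: R'_def)
      ultimately show ?thesis using x by (auto simp: Y_def)
    qed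
    then have "{i \<in> ?X. \<bar>?lam i\<bar> \<le> R} \<subseteq> Sigma Y E" by auto
    moreover have "finite (Sigma Y E)" using Y E(1) by (intro finite_SigmaI) (auto simp: Y_def)
    ultimately show ?thesis by (rule finite_subset)
  qed
  show "selfadjoint H dirac" by (rule D.selfadjoint)
  show "compact_resolvent H dirac" by (rule D.compact_resolvent[OF fin])
  show "submodule (op_dom dirac) complex_ring H" by (rule D.dom_submodule)
  show "hdense H (op_dom dirac)" by (rule D.dom_dense)
  show "u \<in> op_dom dirac \<Longrightarrow> v \<in> op_dom dirac \<Longrightarrow>
    op_app dirac (u \<oplus>\<^bsub>H\<^esub> v) = op_app dirac u \<oplus>\<^bsub>H\<^esub> op_app dirac v" by (rule D.app_add)
  show "v \<in> op_dom dirac \<Longrightarrow> op_app dirac (c \<odot>\<^bsub>H\<^esub> v) = c \<odot>\<^bsub>H\<^esub> op_app dirac v" by (rule D.app_smult)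
qed

section \<open>Elements with bounded commutator\<close>

lemma dirac_dom_closed: "v \<in> op_dom dirac \<Longrightarrow> v \<in> carrier H" "v \<in> op_dom dirac \<Longrightarrow> op_app dirac v \<in> carrier H"
  using dirac_iff by blast+

lemmas dirac_dom_add = H.submoduleD(3)[OF dirac_dom_submodule]
  and dirac_dom_smult = H.submoduleD(4)[OF dirac_dom_submodule]

abbreviation comm where "comm a v \<equiv> op_app dirac (rep a v) \<ominus>\<^bsub>H\<^esub> rep a (op_app dirac v)"

text \<open>Requiring that \<open>a\<close> preserves the whole domain gives a linear space, which is not clear for
  \<^const>\<open>smooth_alg\<close>.\<close>

definition strongly_smooth where
  "strongly_smooth = {a \<in> carrier A. (\<forall>v\<in>op_dom dirac. rep a v \<in> op_dom dirac) \<and>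
     (\<exists>C. \<forall>v\<in>op_dom dirac. hnorm H (comm a v) \<le> C * hnorm H v)}"

lemma comm_closed: "a \<in> strongly_smooth \<Longrightarrow> v \<in> op_dom dirac \<Longrightarrow> comm a v \<in> carrier H"
  by (auto simp: strongly_smooth_def dirac_dom_closed)

lemma strongly_smooth_submodule: "submodule strongly_smooth complex_ring A"
proof (rule submoduleI)
  have zero_rep: "rep \<zero> v = \<zero>\<^bsub>H\<^esub>" if "v \<in> carrier H" for v
    using rep_smult_left[of \<zero> v 0] that by simp
  have zero_dom: "\<zero>\<^bsub>H\<^esub> \<in> op_dom dirac" by (rule H.submoduleD(2)[OF dirac_dom_submodule])
  have "op_app dirac \<zero>\<^bsub>H\<^esub> = \<zero>\<^bsub>H\<^esub>"
    using dirac_smult[OF zero_dom, of 0] dirac_dom_closed[OF zero_dom] by simp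
  then show "\<zero> \<in> strongly_smooth"
    unfolding strongly_smooth_def
    by (auto simp: zero_rep dirac_dom_closed zero_dom intro!: exI[of _ 0])
next
  fix a b assume ab: "a \<in> strongly_smooth" "b \<in> strongly_smooth"
  then have c: "a \<in> carrier A" "b \<in> carrier A"
    and d: "\<And>v. v \<in> op_dom dirac \<Longrightarrow> rep a v \<in> op_dom dirac" "\<And>v. v \<in> op_dom dirac \<Longrightarrow> rep b v \<in> op_dom dirac"
    by (auto simp: strongly_smooth_def)
  obtain C where Ca: "\<And>v. v \<in> op_dom dirac \<Longrightarrow> hnorm H (comm a v) \<le> C * hnorm H v"
    using ab(1) by (auto simp: strongly_smooth_def)
  obtain C' where Cb: "\<And>v. v \<in> op_dom dirac \<Longrightarrow> hnorm H (comm b v) \<le> C' * hnorm H v"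
    using ab(2) by (auto simp: strongly_smooth_def)
  have "hnorm H (comm (a \<oplus> b) v) \<le> (C + C') * hnorm H v" if v: "v \<in> op_dom dirac" for v
  proof -
    have "comm (a \<oplus> b) v = comm a v \<oplus>\<^bsub>H\<^esub> comm b v"
      using v c d dirac_dom_closed[OF v] dirac_dom_closed[OF d(1)[OF v]] dirac_dom_closed[OF d(2)[OF v]]
      by (simp add: rep_add_left dirac_add H.add_diff_add)
    then show ?thesis
      using H.hnorm_triangle[OF comm_closed[OF ab(1) v] comm_closed[OF ab(2) v]] Ca[OF v] Cb[OF v]
      by (simp add: distrib_right)
  qed
  moreover have "rep (a \<oplus> b) v \<in> op_dom dirac" if v: "v \<in> op_dom dirac" for v
    using rep_add_left[OF c dirac_dom_closed(1)[OF v]] dirac_dom_add[OF d(1)[OF v] d(2)[OF v]] by simp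
  ultimately show "a \<oplus> b \<in> strongly_smooth" using c unfolding strongly_smooth_def by blast
next
  fix c a assume a: "a \<in> strongly_smooth"
  then have ac: "a \<in> carrier A" and d: "\<And>v. v \<in> op_dom dirac \<Longrightarrow> rep a v \<in> op_dom dirac"
    by (auto simp: strongly_smooth_def)
  obtain C where C: "\<And>v. v \<in> op_dom dirac \<Longrightarrow> hnorm H (comm a v) \<le> C * hnorm H v"
    using a by (auto simp: strongly_smooth_def)
  have "hnorm H (comm (c \<odot> a) v) \<le> (cmod c * C) * hnorm H v" if v: "v \<in> op_dom dirac" for v
  proof -
    have "comm (c \<odot> a) v = c \<odot>\<^bsub>H\<^esub> comm a v"
      using v ac d dirac_dom_closed[OF v] dirac_dom_closed[OF d[OF v]]
      by (simp add: rep_smult_left dirac_smult H.smult_diff)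
    then show ?thesis
      using C[OF v] comm_closed[OF a v] by (simp add: H.hnorm_smult mult_left_mono mult.assoc)
  qed
  moreover have "rep (c \<odot> a) v \<in> op_dom dirac" if v: "v \<in> op_dom dirac" for v
    using rep_smult_left[OF ac dirac_dom_closed(1)[OF v]] dirac_dom_smult[OF d[OF v]] by simp
  ultimately show "c \<odot> a \<in> strongly_smooth" using ac unfolding strongly_smooth_def by blast
qed (auto simp: strongly_smooth_def)

text \<open>Here the domain of the commutator is the whole domain of \<open>dirac\<close>, which is
  dense, so its graph extends by \<open>bounded_extension\<close>.\<close>

lemma strongly_smooth_subset: "strongly_smooth \<subseteq> smooth_alg A H rep dirac"
proof
  fix a assume a: "a \<in> strongly_smooth"
  then have ac: "a \<in> carrier A" and d: "\<And>v. v \<in> op_dom dirac \<Longrightarrow> rep a v \<in> op_dom dirac"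
    by (auto simp: strongly_smooth_def)
  obtain C where C: "\<And>v. v \<in> op_dom dirac \<Longrightarrow> hnorm H (comm a v) \<le> C * hnorm H v"
    using a by (auto simp: strongly_smooth_def)
  have cd: "commutator_dom H dirac (rep a) = op_dom dirac" using d by (auto simp: commutator_dom_def)
  define G where "G = (\<lambda>v. (v, comm a v)) ` op_dom dirac"
  have tot: "total_set H (hnorm H) (op_dom dirac)"
    using dirac_dom_closed(1) by (intro H.hdense_total[OF dirac_dom_dense]) auto
  have "\<exists>P. P \<in> extensional (carrier H) \<and> lin_map H H P \<and>
    (\<forall>v\<in>carrier H. hnorm H (P v) \<le> \<bar>C\<bar> * hnorm H v) \<and> (\<forall>v w. (v, w) \<in> G \<longrightarrow> P v = w) \<and>
    ((\<forall>v w. (v, w) \<in> G \<longrightarrow> hnorm H w = hnorm H v) \<longrightarrow> (\<forall>v\<in>carrier H. hnorm H (P v) = hnorm H v))"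
  proof (rule bounded_extension[OF H.hilbert_axioms H.hilbert_axioms _ _ _ tot])
    show "G \<subseteq> carrier H \<times> carrier H" using dirac_dom_closed(1) comm_closed[OF a] by (auto simp: G_def)
    show "op_dom dirac \<subseteq> fst ` G" by (force simp: G_def)
    show "G \<noteq> {}" using H.submoduleD(2)[OF dirac_dom_submodule] by (auto simp: G_def)
    show "(v \<oplus>\<^bsub>H\<^esub> v', w \<oplus>\<^bsub>H\<^esub> w') \<in> G" if "(v, w) \<in> G" "(v', w') \<in> G" for v w v' w'
    proof -
      have v: "v \<in> op_dom dirac" "v' \<in> op_dom dirac" "w = comm a v" "w' = comm a v'" using that by (auto simp: G_def)
      have "comm a (v \<oplus>\<^bsub>H\<^esub> v') = w \<oplus>\<^bsub>H\<^esub> w'"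
        using v ac d dirac_dom_closed[OF v(1)] dirac_dom_closed[OF v(2)]
          dirac_dom_closed[OF d[OF v(1)]] dirac_dom_closed[OF d[OF v(2)]]
        by (simp add: rep_add_right dirac_add H.add_diff_add)
      then show ?thesis using dirac_dom_add[OF v(1,2)] by (auto simp: G_def)
    qed
    show "(c \<odot>\<^bsub>H\<^esub> v, c \<odot>\<^bsub>H\<^esub> w) \<in> G" if "(v, w) \<in> G" for c v w
    proof -
      have v: "v \<in> op_dom dirac" "w = comm a v" using that by (auto simp: G_def)
      have "comm a (c \<odot>\<^bsub>H\<^esub> v) = c \<odot>\<^bsub>H\<^esub> w"
        using v ac d dirac_dom_closed[OF v(1)] dirac_dom_closed[OF d[OF v(1)]]
        by (simp add: rep_smult_right dirac_smult H.smult_diff)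
      then show ?thesis using dirac_dom_smult[OF v(1)] by (auto simp: G_def)
    qed
    show "hnorm H w \<le> \<bar>C\<bar> * hnorm H v" if "(v, w) \<in> G" for v w
    proof -
      have v: "v \<in> op_dom dirac" "w = comm a v" using that by (auto simp: G_def)
      show ?thesis
        using order_trans[OF C[OF v(1)] mult_right_mono[OF abs_ge_self H.hnorm_nonneg[OF dirac_dom_closed(1)[OF v(1)]]]] v(2)
        by simp
    qed
  qed simp
  then obtain P where "lin_map H H P" "\<And>v. v \<in> carrier H \<Longrightarrow> hnorm H (P v) \<le> \<bar>C\<bar> * hnorm H v"
    "\<And>v w. (v, w) \<in> G \<Longrightarrow> P v = w" by blast
  then have "bounded_op H H P" "\<forall>v\<in>op_dom dirac. P v = comm a v"
    unfolding bounded_op_def G_def by blast+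
  then show "a \<in> smooth_alg A H rep dirac"
    using ac dirac_dom_dense by (auto simp: smooth_alg_def cd)
qed

text \<open>Up to a unimodular scalar, the commutator shifts coefficients by \<open>a\<close> and
  multiplies them by \<open>F y - F (y - a)\<close>. \<open>F_difference\<close> bounds this
  uniformly, and the shift permutes the lattice, so sums of squares are preserved.\<close>

lemma mon_strongly_smooth:
  assumes a: "a \<in> lattice"
  shows "mon a \<in> strongly_smooth"
proof -
  obtain C0 where C0: "\<And>x v. x \<in> lattice \<Longrightarrow> v \<in> carrier S \<Longrightarrow>
      hnorm S (F (x + a) v \<ominus>\<^bsub>S\<^esub> F x v) \<le> C0 * hnorm S v"
    using F_difference[OF a] by blast
  define C where "C = \<bar>C0\<bar>"
  have C: "hnorm S (F (x + a) v \<ominus>\<^bsub>S\<^esub> F x v) \<le> C * hnorm S v" if "x \<in> lattice" "v \<in> carrier S" for x v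
    using order_trans[OF C0[OF that] mult_right_mono[OF abs_ge_self S.hnorm_nonneg[OF that(2)]]]
    by (simp add: C_def)
  have "\<exists>k. cmod k = 1 \<and> mon a \<otimes> mon x = k \<odot> mon (x + a)" if x: "x \<in> lattice" for x
  proof -
    have "a + x = x + a" using a x by (intro comm_add_vec) auto
    then show ?thesis using mon_mult[OF a x] by (auto elim: multsE)
  qed
  then obtain k where k: "\<And>x. x \<in> lattice \<Longrightarrow> cmod (k x) = 1"
    "\<And>x. x \<in> lattice \<Longrightarrow> mon a \<otimes> mon x = k x \<odot> mon (x + a)" by metis
  have sub_add: "y - a + a = y" if "y \<in> lattice" for y using a that by (intro eq_vecI) auto
  have bij: "bij_betw (\<lambda>y. y - a) lattice lattice"
  proof (rule bij_betwI[of _ _ _ "\<lambda>x. x + a"])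
    show "x + a - a = x" if "x \<in> lattice" for x using a that by (intro eq_vecI) auto
  qed (use a sub_add in auto)
  have coeff_shift: "coeff (rep (mon a) v) y = k (y - a) \<odot>\<^bsub>S\<^esub> coeff v (y - a)"
    if "v \<in> carrier H" "y \<in> lattice" for v y
    using coeff_rep_mon[OF a _ that(1) k(2) k(1), of "y - a"] sub_add[OF that(2)] a that(2) by simp
  have main: "rep (mon a) v \<in> op_dom dirac \<and> hnorm H (comm (mon a) v) \<le> C * hnorm H v"
    if v: "v \<in> op_dom dirac" for v
  proof -
    define w where "w = op_app dirac v"
    have vw: "v \<in> carrier H" "w \<in> carrier H" "\<And>x. x \<in> lattice \<Longrightarrow> coeff w x = F x (coeff v x)"
      using dirac_iff[of v w] v by (auto simp: w_def)
    \<comment> \<open>The expected coefficients of the commutator applied to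
      \<open>v\<close>.\<close>
    define s where "s y = k (y - a) \<odot>\<^bsub>S\<^esub> (F y (coeff v (y - a)) \<ominus>\<^bsub>S\<^esub> F (y - a) (coeff v (y - a)))" for y
    have s: "s y \<in> carrier S" if "y \<in> lattice" for y using that a vw by (simp add: s_def)
    have s_le: "(hnorm S (s y))\<^sup>2 \<le> C\<^sup>2 * (hnorm S (coeff v (y - a)))\<^sup>2" if y: "y \<in> lattice" for y
    proof -
      have "hnorm S (s y) \<le> C * hnorm S (coeff v (y - a))"
        using C[of "y - a" "coeff v (y - a)"] sub_add[OF y] y a vw k(1)[of "y - a"]
        by (simp add: s_def S.hnorm_smult)
      then have "(hnorm S (s y))\<^sup>2 \<le> (C * hnorm S (coeff v (y - a)))\<^sup>2"
        using s[OF y] by (intro power_mono) auto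
      then show ?thesis by (simp only: power_mult_distrib)
    qed
    have "((\<lambda>y. (hnorm S (coeff v (y - a)))\<^sup>2) has_sum (hnorm H v)\<^sup>2) lattice"
      using has_sum_reindex_bij_betw[OF bij, of "\<lambda>x. (hnorm S (coeff v x))\<^sup>2"] parseval_coeff[OF vw(1)] by simp
    then have sum: "((\<lambda>y. C\<^sup>2 * (hnorm S (coeff v (y - a)))\<^sup>2) has_sum (C\<^sup>2 * (hnorm H v)\<^sup>2)) lattice"
      by (rule has_sum_cmult_right)
    have "(\<lambda>y. (hnorm S (s y))\<^sup>2) summable_on lattice"
      by (rule summable_on_comparison_test[OF has_sum_imp_summable[OF sum]]) (use s_le in auto)
    \<comment> \<open>Having the value of the commutator as a vector first settles the domain
      question: adding \<open>g\<close> to \<open>rep (mon a) w\<close> gives the coefficients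
      demanded by \<open>dirac_iff\<close>, so \<open>rep (mon a) v\<close> lies in the
      domain.\<close>
    from riesz_fischer_coeff[OF s this] obtain g where g: "g \<in> carrier H" "\<And>y. y \<in> lattice \<Longrightarrow> coeff g y = s y" by blast
    have "(hnorm H g)\<^sup>2 \<le> C\<^sup>2 * (hnorm H v)\<^sup>2"
      by (rule has_sum_mono[OF parseval_coeff[OF g(1)] sum]) (use g s_le in auto)
    then have g_le: "hnorm H g \<le> C * hnorm H v"
      using power2_le_imp_le[of "hnorm H g" "C * hnorm H v"] vw(1) by (simp add: C_def power_mult_distrib)
    have "coeff (rep (mon a) w \<oplus>\<^bsub>H\<^esub> g) y = F y (coeff (rep (mon a) v) y)" if y: "y \<in> lattice" for y
    proof -
      have ya: "y - a \<in> lattice" using y a by simp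
      let ?c = "coeff v (y - a)"
      have "coeff (rep (mon a) w \<oplus>\<^bsub>H\<^esub> g) y = k (y - a) \<odot>\<^bsub>S\<^esub> F (y - a) ?c \<oplus>\<^bsub>S\<^esub> s y"
        using y a ya vw g coeff_shift by (simp add: coeff_add)
      also have "\<dots> = k (y - a) \<odot>\<^bsub>S\<^esub> F y ?c"
        using y ya vw by (intro S.eq_by_ip) (auto simp: s_def algebra_simps)
      finally show ?thesis using coeff_shift[OF vw(1) y] y ya vw(1) by (simp add: F_smult)
    qed
    then have "rep (mon a) v \<in> op_dom dirac" "op_app dirac (rep (mon a) v) = rep (mon a) w \<oplus>\<^bsub>H\<^esub> g"
      using dirac_iff[of "rep (mon a) v" "rep (mon a) w \<oplus>\<^bsub>H\<^esub> g"] vw g a by auto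
    moreover have "(rep (mon a) w \<oplus>\<^bsub>H\<^esub> g) \<ominus>\<^bsub>H\<^esub> rep (mon a) w = g"
      using vw g a by (intro H.eq_by_ip) auto
    ultimately show ?thesis using g_le by (simp add: w_def)
  qed
  then show ?thesis using a unfolding strongly_smooth_def by auto
qed

lemma spectral_triple: "spectral_triple A H rep dirac"
  unfolding spectral_triple_def
proof (intro conjI cstar_algebra H.hilbert_space faithful_rep dirac_selfadjoint dirac_compact_resolvent)
  have "MS.mtopology closure_of strongly_smooth = carrier A"
    using mon_strongly_smooth by (intro submodule_dense[OF strongly_smooth_submodule total_mon]) auto
  then have "carrier A \<subseteq> MS.mtopology closure_of smooth_alg A H rep dirac"
    using closure_of_mono[OF strongly_smooth_subset] by metis
  moreover have "MS.mtopology closure_of smooth_alg A H rep dirac \<subseteq> carrier A"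
    using closure_of_subset_topspace[of MS.mtopology] by simp
  ultimately show "cstar_dense A (smooth_alg A H rep dirac)" by (auto simp: cstar_dense_def cdist_def)
qed

end

section \<open>Toric morphisms\<close>

text \<open>Negative powers are the point: inverses of unitaries are adjoints, and these are
  preserved.\<close>

lemma star_hom_int_pow:
  fixes k :: int
  assumes "cstar_algebra A" "cstar_algebra B" "unital_star_hom A B \<phi>" "cstar.unitary A u"
  shows "cstar.unitary B (\<phi> u)" "\<phi> (u [^]\<^bsub>A\<^esub> k) = \<phi> u [^]\<^bsub>B\<^esub> k"
proof -
  interpret A: cstar A by unfold_locales fact
  interpret B: cstar B by unfold_locales fact
  note \<phi> = unital_star_homD[OF assms(3)]
  have unitary: "B.unitary (\<phi> v)" if "A.unitary v" for v
  proof -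
    have v: "v \<in> carrier A" "star A v \<otimes>\<^bsub>A\<^esub> v = \<one>\<^bsub>A\<^esub>" "v \<otimes>\<^bsub>A\<^esub> star A v = \<one>\<^bsub>A\<^esub>"
      using that by (auto simp: A.unitary_def)
    have "star B (\<phi> v) \<otimes>\<^bsub>B\<^esub> \<phi> v = \<one>\<^bsub>B\<^esub>" "\<phi> v \<otimes>\<^bsub>B\<^esub> star B (\<phi> v) = \<one>\<^bsub>B\<^esub>"
      using arg_cong[OF v(2), of \<phi>] arg_cong[OF v(3), of \<phi>] v(1) \<phi> by simp_all
    then show ?thesis using v(1) \<phi> by (simp add: B.unitary_def)
  qed
  show "B.unitary (\<phi> u)" by (rule unitary[OF assms(4)])
  have u: "u \<in> carrier A" "u \<in> Units A" using assms(4) A.unitary_closed A.unitary_Units by auto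
  have un: "A.unitary (u [^]\<^bsub>A\<^esub> n)" for n :: nat
    using A.unitary_int_pow[OF assms(4), of "int n"] by (simp add: int_pow_int)
  have nat: "\<phi> (u [^]\<^bsub>A\<^esub> n) = \<phi> u [^]\<^bsub>B\<^esub> n" for n :: nat
    using u \<phi> by (induction n) auto
  show "\<phi> (u [^]\<^bsub>A\<^esub> k) = \<phi> u [^]\<^bsub>B\<^esub> k"
  proof (rule A.int_pow_cases[OF u(2), where P = "\<lambda>k v. \<phi> v = \<phi> u [^]\<^bsub>B\<^esub> k"])
    fix n
    show "\<phi> (u [^]\<^bsub>A\<^esub> n) = \<phi> u [^]\<^bsub>B\<^esub> int n" by (simp add: nat int_pow_int)
    have "\<phi> (inv\<^bsub>A\<^esub> (u [^]\<^bsub>A\<^esub> n)) = inv\<^bsub>B\<^esub> (\<phi> (u [^]\<^bsub>A\<^esub> n))"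
      using A.unitary_inv[OF un] B.unitary_inv[OF unitary[OF un]] A.unitary_closed[OF un] \<phi>(7) by simp
    also have "\<dots> = \<phi> u [^]\<^bsub>B\<^esub> (- int n)"
      using B.Units_int_pow(3)[OF B.unitary_Units[OF unitary[OF assms(4)]], of "int n"]
      by (simp add: nat int_pow_int)
    finally show "\<phi> (inv\<^bsub>A\<^esub> (u [^]\<^bsub>A\<^esub> n)) = \<phi> u [^]\<^bsub>B\<^esub> - int n" .
  qed
qed

locale toric_morphism =
  X: multiplier_triple A \<tau> L \<Lambda> m \<Theta> U S H T F +
  Y: multiplier_triple A' \<tau>' L' \<Lambda>' m' \<Theta>' U' S' H' T' F'
  for A \<tau> L \<Lambda> m \<Theta> U S H T F A' \<tau>' L' \<Lambda>' m' \<Theta>' U' S' H' T' F' +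
  fixes M z \<phi> J
  assumes toric: "toric_hom m \<Theta> A U m' \<Theta>' A' U' M z \<phi>"
    and J: "isometry_op S S' J"
    and intertwine: "x \<in> carrier_vec m \<Longrightarrow> \<xi> \<in> carrier S \<Longrightarrow> F' (M *\<^sub>v x) (J \<xi>) = J (F x \<xi>)"
begin

section \<open>The homomorphism on monomials, traces and GNS norms\<close>

lemma M_carrier: "M \<in> carrier_mat m' m"
  and z: "j < m \<Longrightarrow> cmod (vec_index z j) = 1"
  and hom: "unital_star_hom A A' \<phi>"
  and \<phi>_U: "j < m \<Longrightarrow> \<phi> (U j) = vec_index z j \<odot>\<^bsub>A'\<^esub> nc_monomial A' U' (col M j)"
  using toric unfolding toric_hom_def by blast+

lemmas \<phi> = unital_star_homD[OF hom]

lemma M_lattice [simp]: "x \<in> X.lattice \<Longrightarrow> M *\<^sub>v x \<in> Y.lattice"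
  using M_carrier by (rule mult_mat_vec_carrier)

lemma \<phi>_contractive: "a \<in> carrier A \<Longrightarrow> nrm A' (\<phi> a) \<le> nrm A a"
  by (rule star_hom_contractive[OF X.cstar_algebra Y.cstar_algebra hom])

lemma \<phi>_mon:
  assumes x: "x \<in> X.lattice"
  shows "\<phi> (X.mon x) \<in> Y.mults (M *\<^sub>v x)"
proof -
  \<comment> \<open>The exponent accumulated column by column along the list; for the full list it
    is \<open>M *\<^sub>v x\<close>.\<close>
  define wv where "wv js = foldr (\<lambda>j v. (vec_index x j \<cdot>\<^sub>v col M j) + v) js (0\<^sub>v m')" for js
  have col: "col M j \<in> Y.lattice" if "j < m" for j using M_carrier that by auto
  have "\<phi> (X.word js x) \<in> Y.mults (wv js) \<and> wv js \<in> Y.lattice \<and>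
      (\<forall>i<m'. vec_index (wv js) i = (\<Sum>j\<leftarrow>js. M $$ (i, j) * vec_index x j))" if "set js \<subseteq> {..<m}" for js
    using that
  proof (induction js)
    case Nil
    then show ?case using Y.mon_in_mults[of "0\<^sub>v m'"] by (simp add: wv_def \<phi> Y.mon_zero)
  next
    case (Cons j js)
    then have j: "j < m" and js: "set js \<subseteq> {..<m}" by auto
    have Uj: "X.unitary (U j)" using j by (rule X.U_unitary)
    have "\<phi> (U j) \<in> Y.mults (col M j)"
      unfolding \<phi>_U[OF j] using z[OF j] by (intro Y.mults_smult col j Y.mon_in_mults)
    then have "\<phi> (U j [^]\<^bsub>A\<^esub> vec_index x j) \<in> Y.mults (vec_index x j \<cdot>\<^sub>v col M j)"
      unfolding star_hom_int_pow(2)[OF X.cstar_algebra Y.cstar_algebra hom Uj]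
      by (intro Y.mults_int_pow col j)
    then have "\<phi> (U j [^]\<^bsub>A\<^esub> vec_index x j) \<otimes>\<^bsub>A'\<^esub> \<phi> (X.word js x) \<in> Y.mults (vec_index x j \<cdot>\<^sub>v col M j + wv js)"
      using Cons.IH[OF js] col[OF j] by (intro Y.mults_mult) auto
    moreover have "\<phi> (X.word (j # js) x) = \<phi> (U j [^]\<^bsub>A\<^esub> vec_index x j) \<otimes>\<^bsub>A'\<^esub> \<phi> (X.word js x)"
      using X.unitary_closed[OF X.unitary_int_pow[OF Uj]] X.unitary_closed[OF X.word_unitary[OF js]]
      by (simp add: \<phi>)
    ultimately show ?case
      using Cons.IH[OF js] col[OF j] M_carrier j by (auto simp: wv_def mult.commute)
  qed
  from this[of "[0..<m]"] have w: "\<phi> (X.word [0..<m] x) \<in> Y.mults (wv [0..<m])" "wv [0..<m] \<in> Y.lattice"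
    "\<And>i. i < m' \<Longrightarrow> vec_index (wv [0..<m]) i = (\<Sum>j\<leftarrow>[0..<m]. M $$ (i, j) * vec_index x j)"
    by (auto simp: atLeast0LessThan)
  have "wv [0..<m] = M *\<^sub>v x"
    using w(2,3) M_carrier x by (intro eq_vecI) (auto simp: scalar_prod_def interv_sum_list_conv_sum_set_nat)
  then show ?thesis using w(1) x by (simp add: X.mon_eq_word)
qed

text \<open>If \<open>M x = 0\<close>, then \<open>\<phi> (U\<^sup>x)\<close> is a scalar, so \<open>U\<^sup>x\<close> commutes with all monomials.\<close>

lemma M_inj:
  assumes x: "x \<in> X.lattice" and zero: "M *\<^sub>v x = 0\<^sub>v m'"
  shows "x = 0\<^sub>v m"
proof (rule ccontr)
  assume "x \<noteq> 0\<^sub>v m"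
  then obtain y where y: "y \<in> X.lattice"
    "phase (scalar_prod (map_vec real_of_int x) (mult_mat_vec \<Theta> (map_vec real_of_int y))) \<noteq> 1"
    using X.nondegenerate x unfolding nondegenerate_def phase_def by blast
  define t where "t = scalar_prod (map_vec real_of_int x) (mult_mat_vec \<Theta> (map_vec real_of_int y))"
  have c: "X.mon y \<otimes>\<^bsub>A\<^esub> X.mon x = phase t \<odot>\<^bsub>A\<^esub> (X.mon x \<otimes>\<^bsub>A\<^esub> X.mon y)"
    using X.mon_commute[OF x y(1)] by (simp add: X.phase_commute_def t_def)
  obtain k where k: "cmod k = 1" "\<phi> (X.mon x) = k \<odot>\<^bsub>A'\<^esub> \<one>\<^bsub>A'\<^esub>"
    using \<phi>_mon[OF x] zero Y.mon_zero by (auto elim: Y.multsE)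
  let ?b = "\<phi> (X.mon y)"
  have b: "?b \<in> carrier A'" using \<phi>(2) y by simp
  have ub: "Y.unitary ?b"
    using \<phi>_mon[OF y(1)] y(1) by (intro Y.mults_unitary[of "M *\<^sub>v y"]) auto
  have "k \<odot>\<^bsub>A'\<^esub> ?b = (phase t * k) \<odot>\<^bsub>A'\<^esub> ?b"
    using arg_cong[OF c, of \<phi>] x y(1) b by (simp add: \<phi> k Y.smult_smult)
  \<comment> \<open>Since \<open>?b\<close> is unitary, its GNS vector is a unit vector, and pairing
    with it recovers the two scalars.\<close>
  then have "ip L' (\<Lambda>' ?b) (\<Lambda>' (k \<odot>\<^bsub>A'\<^esub> ?b)) = ip L' (\<Lambda>' ?b) (\<Lambda>' ((phase t * k) \<odot>\<^bsub>A'\<^esub> ?b))" by simp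
  moreover have "ip L' (\<Lambda>' ?b) (\<Lambda>' ?b) = 1"
    using ub b by (simp add: Y.ip_\<Lambda> Y.unitary_def Y.\<tau>_one)
  ultimately have "k = phase t * k" using b by (simp add: Y.\<Lambda>_smult)
  then have "phase t = 1" using k(1) by auto
  then show False using y(2) by (simp add: t_def)
qed

lemma M_inj_on:
  assumes "x \<in> X.lattice" "y \<in> X.lattice" "M *\<^sub>v x = M *\<^sub>v y"
  shows "x = y"
proof -
  have "M *\<^sub>v (x - y) = M *\<^sub>v x - M *\<^sub>v y" using M_carrier assms by (intro mult_minus_distrib_mat_vec)
  also have "\<dots> = 0\<^sub>v m'" using assms by (simp add: minus_cancel_vec)
  finally have eq: "x - y = 0\<^sub>v m" using assms by (intro M_inj) auto
  have "vec_index x i = vec_index y i" if "i < m" for i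
  proof -
    have "vec_index (x - y) i = vec_index x i - vec_index y i" using assms that by simp
    moreover have "vec_index (x - y) i = 0" unfolding eq using that by simp
    ultimately show ?thesis by simp
  qed
  then show ?thesis using assms by (intro eq_vecI) auto
qed

text \<open>Both sides are bounded functionals, the left one by contractivity of
  \<open>\<phi>\<close>, so monomials suffice. On a nontrivial monomial both vanish, because
  \<open>M_inj\<close> keeps the exponent of the image nonzero.\<close>

lemma \<tau>_\<phi>:
  assumes a: "a \<in> carrier A"
  shows "\<tau>' (\<phi> a) = \<tau> a"
proof (rule total_set_induct[OF X.total_mon _ _ a])
  show "closed_subspace A (nrm A) {a \<in> carrier A. \<tau>' (\<phi> a) = \<tau> a}"
  proof (rule X.closed_subspace_equalizer[where C = 1 and C' = 1])
    show "cmod (\<tau>' (\<phi> a)) \<le> 1 * nrm A a" if "a \<in> carrier A" for a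
      using Y.\<tau>_le[OF \<phi>(2)[OF that]] \<phi>_contractive[OF that] by simp
  qed (use \<phi> X.\<tau>_le in \<open>simp_all add: X.\<tau>_add X.\<tau>_smult Y.\<tau>_add Y.\<tau>_smult\<close>)
  fix b assume "b \<in> X.mon ` X.lattice"
  then obtain x where x: "x \<in> X.lattice" "b = X.mon x" by auto
  show "\<tau>' (\<phi> b) = \<tau> b"
  proof (cases "x = 0\<^sub>v m")
    case True
    then show ?thesis using x by (simp add: X.mon_zero \<phi> X.\<tau>_one Y.\<tau>_one)
  next
    case False
    then show ?thesis
      using x M_inj[OF x(1)] Y.\<tau>_mults[OF _ _ \<phi>_mon[OF x(1)]] X.\<tau>_mon by auto
  qed
qed

lemma hnorm_\<Lambda>_\<phi>:
  assumes a: "a \<in> carrier A"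
  shows "hnorm L' (\<Lambda>' (\<phi> a)) = hnorm L (\<Lambda> a)"
proof -
  have "complex_of_real ((hnorm L' (\<Lambda>' (\<phi> a)))\<^sup>2) = \<tau>' (\<phi> (star A a \<otimes>\<^bsub>A\<^esub> a))"
    using a \<phi> by (simp add: Y.hnorm_\<Lambda>_sq del: of_real_power)
  also have "\<dots> = complex_of_real ((hnorm L (\<Lambda> a))\<^sup>2)"
    using a by (simp add: \<tau>_\<phi> X.hnorm_\<Lambda>_sq del: of_real_power)
  finally show ?thesis using a \<phi> by (simp only: of_real_eq_iff) (simp add: power2_eq_iff_nonneg)
qed

text \<open>Preserving the trace makes \<open>\<phi>\<close> isometric for the GNS norms, and
  \<open>\<Lambda>_inj\<close> says that these norms separate points.\<close>

lemma \<phi>_inj: "inj_on \<phi> (carrier A)"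
proof (rule inj_onI)
  fix a b assume ab: "a \<in> carrier A" "b \<in> carrier A" "\<phi> a = \<phi> b"
  have "\<phi> (a \<ominus>\<^bsub>A\<^esub> b) = \<zero>\<^bsub>A'\<^esub>"
    using lin_map_diff[OF X.complex_module_axioms Y.complex_module_axioms \<phi>(1) ab(1,2)] ab \<phi>(2) by simp
  then have "hnorm L (\<Lambda> (a \<ominus>\<^bsub>A\<^esub> b)) = hnorm L' (\<Lambda>' \<zero>\<^bsub>A'\<^esub>)"
    using hnorm_\<Lambda>_\<phi>[of "a \<ominus>\<^bsub>A\<^esub> b"] ab by simp
  also have "\<dots> = 0"
    using lin_map_zero[OF Y.complex_module_axioms Y.L.complex_module_axioms Y.lin_\<Lambda>] by simp
  finally have "a \<ominus>\<^bsub>A\<^esub> b = \<zero>\<^bsub>A\<^esub>" using ab by (intro X.\<Lambda>_inj) (auto simp: X.L.hnorm_eq_zero)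
  then show "a = b" by (rule X.diff_eq_zeroD[OF ab(1,2)])
qed

section \<open>The induced isometry and its Fourier coefficients\<close>

abbreviation induced where "induced \<equiv> induced_op A \<Lambda> S H T \<Lambda>' H' T' \<phi> J"

lemma induced_props:
  "induced \<in> extensional (carrier H) \<and> bounded_op H H' induced \<and>
    (\<forall>a\<in>carrier A. \<forall>\<xi>\<in>carrier S. induced (T (\<Lambda> a) \<xi>) = T' (\<Lambda>' (\<phi> a)) (J \<xi>))"
  and induced_isometry: "isometry_op H H' induced"
proof -
  let ?P = "\<lambda>I. I \<in> extensional (carrier H) \<and> bounded_op H H' I \<and>
    (\<forall>a\<in>carrier A. \<forall>\<xi>\<in>carrier S. I (T (\<Lambda> a) \<xi>) = T' (\<Lambda>' (\<phi> a)) (J \<xi>))"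
  have lin: "lin_map A L' (\<lambda>a. \<Lambda>' (\<phi> a))"
    using \<phi> by (intro lin_mapI) (auto simp: Y.\<Lambda>_add Y.\<Lambda>_smult)
  obtain I where I: "?P I" "isometry_op H H' I"
    using X.tensor_extension[OF Y.hilbert_tensor lin J zero_le_one] hnorm_\<Lambda>_\<phi> by auto
  have unique: "P = Q" if "?P P" "?P Q" for P Q
  proof (rule extensionalityI[of _ "carrier H"])
    show "P v = Q v" if v: "v \<in> carrier H" for v
      by (rule X.bounded_op_eq_on_elementary[OF Y.H.hilbert_axioms _ _ v])
        (use \<open>?P P\<close> \<open>?P Q\<close> in auto)
  qed (use that in auto)
  have "induced = I"
    unfolding induced_op_def by (rule the_equality) (use I(1) unique in blast)+
  then show "?P induced" "isometry_op H H' induced" using I by auto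
qed

lemma induced_T: "a \<in> carrier A \<Longrightarrow> \<xi> \<in> carrier S \<Longrightarrow> induced (T (\<Lambda> a) \<xi>) = T' (\<Lambda>' (\<phi> a)) (J \<xi>)"
  and induced_bounded: "bounded_op H H' induced"
  using induced_props by auto

lemma induced_lin: "lin_map H H' induced"
  using induced_bounded by (simp add: bounded_op_def)

lemmas induced_closed [simp] = lin_mapD(1)[OF induced_lin]

lemma J_lin: "lin_map S S' J" and hnorm_J: "\<xi> \<in> carrier S \<Longrightarrow> hnorm S' (J \<xi>) = hnorm S \<xi>"
  using J by (auto simp: isometry_op_def)

lemmas J_closed [simp] = lin_mapD(1)[OF J_lin]
  and J_add = lin_mapD(2)[OF J_lin] and J_smult = lin_mapD(3)[OF J_lin]

lemma induced_rep:
  assumes a: "a \<in> carrier A" and v: "v \<in> carrier H"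
  shows "induced (X.rep a v) = Y.rep (\<phi> a) (induced v)"
proof (rule X.bounded_op_eq_on_elementary[OF Y.H.hilbert_axioms _ _ v])
  show "bounded_op H H' (\<lambda>v. induced (X.rep a v))"
    by (rule bounded_op_compose[OF X.H.hilbert_axioms Y.H.hilbert_axioms X.rep_bounded[OF a] induced_bounded])
  show "bounded_op H H' (\<lambda>v. Y.rep (\<phi> a) (induced v))"
    by (rule bounded_op_compose[OF Y.H.hilbert_axioms Y.H.hilbert_axioms induced_bounded Y.rep_bounded[OF \<phi>(2)[OF a]]])
  show "induced (X.rep a (T (\<Lambda> b) \<xi>)) = Y.rep (\<phi> a) (induced (T (\<Lambda> b) \<xi>))"
    if "b \<in> carrier A" "\<xi> \<in> carrier S" for b \<xi>
    using a that \<phi> by (simp add: X.rep_T Y.rep_T induced_T)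
qed

text \<open>The scalar \<open>k\<close> lets one lemma serve both cases: lattice points in the image
  of \<open>M\<close>, and, with \<open>k = 0\<close>, points outside it.\<close>

lemma closed_subspace_induced_eq:
  assumes u: "u \<in> carrier H'" and \<xi>: "\<xi> \<in> carrier S'" and x: "x \<in> X.lattice"
  shows "closed_subspace H (hnorm H) {v \<in> carrier H. ip H' u (induced v) = k * ip S' \<xi> (J (X.coeff v x))}"
proof (rule X.H.closed_subspace_equalizer[where C = "hnorm H' u" and C' = "cmod k * hnorm S' \<xi>"])
  fix v assume v: "v \<in> carrier H"
  have "hnorm H' (induced v) = hnorm H v" using induced_isometry v by (simp add: isometry_op_def)
  then show "cmod (ip H' u (induced v)) \<le> hnorm H' u * hnorm H v"
    using Y.H.cauchy_schwarz[OF u induced_closed[OF v]] by simp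
  have "cmod (ip S' \<xi> (J (X.coeff v x))) \<le> hnorm S' \<xi> * hnorm S (X.coeff v x)"
    using Y.S.cauchy_schwarz[of \<xi> "J (X.coeff v x)"] \<xi> v x by (simp add: hnorm_J)
  also have "\<dots> \<le> hnorm S' \<xi> * hnorm H v"
    using \<xi> v x by (intro mult_left_mono X.hnorm_coeff_le) auto
  finally show "cmod (k * ip S' \<xi> (J (X.coeff v x))) \<le> cmod k * hnorm S' \<xi> * hnorm H v"
    by (simp add: norm_mult mult.assoc mult_left_mono)
qed (use assms in \<open>auto simp: lin_mapD(2,3)[OF induced_lin] X.coeff_add X.coeff_smult J_add J_smult distrib_left\<close>)

text \<open>It suffices to test on elementary tensors over \<open>X.\<delta> y\<close>. By
  injectivity of \<open>M\<close> both sides vanish for \<open>y\<close> other than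
  \<open>x\<close>, so only the phase \<open>k\<close> belonging to \<open>x\<close> enters.\<close>

lemma coeff_induced:
  assumes v: "v \<in> carrier H" and x: "x \<in> X.lattice"
    and k: "\<phi> (X.mon x) = k \<odot>\<^bsub>A'\<^esub> Y.mon (M *\<^sub>v x)"
  shows "Y.coeff (induced v) (M *\<^sub>v x) = k \<odot>\<^bsub>S'\<^esub> J (X.coeff v x)"
proof (rule Y.coeff_eqI)
  fix \<xi> assume \<xi>: "\<xi> \<in> carrier S'"
  have "ip H' (T' (Y.\<delta> (M *\<^sub>v x)) \<xi>) (induced v) = k * ip S' \<xi> (J (X.coeff v x))"
  proof (rule total_set_induct[OF X.total_\<delta> closed_subspace_induced_eq _ v])
    fix b assume "b \<in> {T (X.\<delta> x) \<xi> |x \<xi>. x \<in> X.lattice \<and> \<xi> \<in> carrier S}"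
    then obtain y \<eta> where y: "y \<in> X.lattice" "\<eta> \<in> carrier S" "b = T (X.\<delta> y) \<eta>" by blast
    \<comment> \<open>If \<open>y\<close> is \<open>x\<close>, the scalar must be the given
      \<open>k\<close> itself; the membership from \<open>\<phi>_mon\<close> alone would provide
      some scalar not known to equal it.\<close>
    obtain l where l: "\<phi> (X.mon y) = l \<odot>\<^bsub>A'\<^esub> Y.mon (M *\<^sub>v y)" "x = y \<longrightarrow> l = k"
      using \<phi>_mon[OF y(1)] k by (cases "x = y") (auto elim: Y.multsE)
    have "M *\<^sub>v x = M *\<^sub>v y \<longleftrightarrow> x = y" using M_inj_on[OF x y(1)] by auto
    moreover have "J \<zero>\<^bsub>S\<^esub> = \<zero>\<^bsub>S'\<^esub>"
      by (rule lin_map_zero[OF X.S.complex_module_axioms Y.S.complex_module_axioms J_lin])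
    ultimately show "ip H' (T' (Y.\<delta> (M *\<^sub>v x)) \<xi>) (induced b) = k * ip S' \<xi> (J (X.coeff b x))"
      using x y \<xi> l
      by (simp add: induced_T l Y.\<Lambda>_smult Y.T_smult_left Y.ip_T Y.ip_mon X.coeff_T)
  qed (use x \<xi> in auto)
  then show "ip H' (T' (Y.\<delta> (M *\<^sub>v x)) \<xi>) (induced v) = ip S' \<xi> (k \<odot>\<^bsub>S'\<^esub> J (X.coeff v x))"
    using v x \<xi> by simp
qed (use v x in auto)

lemma coeff_induced_zero:
  assumes v: "v \<in> carrier H" and y: "y \<in> Y.lattice" "y \<notin> (\<lambda>x. M *\<^sub>v x) ` X.lattice"
  shows "Y.coeff (induced v) y = \<zero>\<^bsub>S'\<^esub>"
proof (rule Y.coeff_eqI)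
  fix \<xi> assume \<xi>: "\<xi> \<in> carrier S'"
  \<comment> \<open>The right side is zero, written in the form of
    \<open>closed_subspace_induced_eq\<close>; the lattice point occurring in it is
    arbitrary.\<close>
  have "ip H' (T' (Y.\<delta> y) \<xi>) (induced v) = 0 * ip S' \<xi> (J (X.coeff v (0\<^sub>v m)))"
  proof (rule total_set_induct[OF X.total_\<delta> closed_subspace_induced_eq _ v])
    fix b assume "b \<in> {T (X.\<delta> x) \<xi> |x \<xi>. x \<in> X.lattice \<and> \<xi> \<in> carrier S}"
    then obtain x \<eta> where x: "x \<in> X.lattice" "\<eta> \<in> carrier S" "b = T (X.\<delta> x) \<eta>" by blast
    obtain l where l: "\<phi> (X.mon x) = l \<odot>\<^bsub>A'\<^esub> Y.mon (M *\<^sub>v x)"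
      using \<phi>_mon[OF x(1)] by (auto elim: Y.multsE)
    have "y \<noteq> M *\<^sub>v x" using y(2) x(1) by blast
    then show "ip H' (T' (Y.\<delta> y) \<xi>) (induced b) = 0 * ip S' \<xi> (J (X.coeff b (0\<^sub>v m)))"
      using x y \<xi> by (simp add: induced_T l Y.\<Lambda>_smult Y.T_smult_left Y.ip_T Y.ip_mon)
  qed (use y \<xi> in auto)
  then show "ip H' (T' (Y.\<delta> y) \<xi>) (induced v) = ip S' \<xi> \<zero>\<^bsub>S'\<^esub>" using \<xi> by simp
qed (use v y in auto)

text \<open>By \<open>dirac_iff\<close> it is enough to compare coefficients. On the image of
  \<open>M\<close> the scalar passes through the linear map \<open>F'\<close> and
  \<open>intertwine\<close> applies; elsewhere both coefficients are zero.\<close>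

lemma induced_dirac:
  assumes v: "v \<in> op_dom X.dirac"
  shows "induced v \<in> op_dom Y.dirac \<and> op_app Y.dirac (induced v) = induced (op_app X.dirac v)"
proof -
  define w where "w = op_app X.dirac v"
  have vw: "v \<in> carrier H" "w \<in> carrier H" "\<And>x. x \<in> X.lattice \<Longrightarrow> X.coeff w x = F x (X.coeff v x)"
    using X.dirac_iff[of v w] v by (auto simp: w_def)
  have "Y.coeff (induced w) y = F' y (Y.coeff (induced v) y)" if y: "y \<in> Y.lattice" for y
  proof (cases "y \<in> (\<lambda>x. M *\<^sub>v x) ` X.lattice")
    case True
    then obtain x where x: "x \<in> X.lattice" "y = M *\<^sub>v x" by auto
    obtain k where k: "\<phi> (X.mon x) = k \<odot>\<^bsub>A'\<^esub> Y.mon (M *\<^sub>v x)"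
      using \<phi>_mon[OF x(1)] by (auto elim: Y.multsE)
    show ?thesis
      using coeff_induced[OF vw(1) x(1) k] coeff_induced[OF vw(2) x(1) k] vw x
      by (simp add: Y.F_smult intertwine)
  next
    case False
    have "F' y \<zero>\<^bsub>S'\<^esub> = \<zero>\<^bsub>S'\<^esub>"
      by (rule lin_map_zero[OF Y.S.complex_module_axioms Y.S.complex_module_axioms Y.F_lin[OF y]])
    then show ?thesis using coeff_induced_zero[OF _ y False] vw by simp
  qed
  then show ?thesis using Y.dirac_iff[of "induced v" "induced w"] vw by (simp add: w_def)
qed

lemma isometric_morphism:
  assumes "\<phi> ` smooth_alg A H X.rep X.dirac \<subseteq> smooth_alg A' H' Y.rep Y.dirac"
  shows "isometric_morphism A H X.rep X.dirac A' H' Y.rep Y.dirac \<phi> induced"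
  unfolding isometric_morphism_def
proof (intro conjI ballI hom \<phi>_inj induced_isometry assms induced_rep)
  show "induced ` op_dom X.dirac \<subseteq> op_dom Y.dirac" using induced_dirac by blast
  show "induced (op_app X.dirac v) = op_app Y.dirac (induced v)" if "v \<in> op_dom X.dirac" for v
    using induced_dirac[OF that] by simp
qed

end

text \<open>The first conjunct certifies that the definite description behind each
  \<open>I n\<close> has its intended solution, that is, that the formula on elementary vectors
  really defines a bounded operator.\<close>

theorem proposition4p7:
  fixes m :: "nat \<Rightarrow> nat"
    and \<Theta> :: "nat \<Rightarrow> real mat"
    and A :: "nat \<Rightarrow> 'a cstar"
    and U :: "nat \<Rightarrow> nat \<Rightarrow> 'a"
    and \<tau> :: "nat \<Rightarrow> 'a \<Rightarrow> complex"
    and M :: "nat \<Rightarrow> int mat"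
    and z :: "nat \<Rightarrow> complex Matrix.vec"
    and \<phi> :: "nat \<Rightarrow> 'a \<Rightarrow> 'a"
    and F :: "nat \<Rightarrow> int Matrix.vec \<Rightarrow> 's \<Rightarrow> 's"
    and S :: "nat \<Rightarrow> 's hilb"
    and J :: "nat \<Rightarrow> 's \<Rightarrow> 's"
    and L :: "nat \<Rightarrow> 'l hilb"
    and \<Lambda> :: "nat \<Rightarrow> 'a \<Rightarrow> 'l"
    and H :: "nat \<Rightarrow> 'h hilb"
    and T :: "nat \<Rightarrow> 'l \<Rightarrow> 's \<Rightarrow> 'h"
    and \<pi> :: "nat \<Rightarrow> 'a \<Rightarrow> 'h \<Rightarrow> 'h"
    and D :: "nat \<Rightarrow> 'h partial_op"
    and I :: "nat \<Rightarrow> 'h \<Rightarrow> 'h"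
  assumes "\<And>n. m n \<ge> 2"
    and "\<And>n. skew_symmetric (m n) (\<Theta> n)"
    and "\<And>n. nondegenerate (m n) (\<Theta> n)"
    and "\<And>n. nc_torus (m n) (\<Theta> n) (A n) (U n)"
    and "\<And>n. tracial_state (A n) (\<tau> n)"
    and "\<And>n. toric_hom (m n) (\<Theta> n) (A n) (U n)
           (m (Suc n)) (\<Theta> (Suc n)) (A (Suc n)) (U (Suc n)) (M n) (z n) (\<phi> n)"
    and "compatible_multipliers m M F S J"
    and "\<And>n. gns_space (A n) (\<tau> n) (L n) (\<Lambda> n)"
    and "\<And>n. hilbert_tensor (L n) (S n) (H n) (T n)"
    and "\<And>n. \<pi> n = left_mult (A n) (\<Lambda> n) (S n) (H n) (T n)"
    and "\<And>n. D n = multiplier_op (m n) (A n) (U n) (\<Lambda> n) (S n) (H n) (T n) (F n)"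
    and "\<And>n. \<phi> n ` smooth_alg (A n) (H n) (\<pi> n) (D n)
           \<subseteq> smooth_alg (A (Suc n)) (H (Suc n)) (\<pi> (Suc n)) (D (Suc n))"
    and "\<And>n. I n = induced_op (A n) (\<Lambda> n) (S n) (H n) (T n)
           (\<Lambda> (Suc n)) (H (Suc n)) (T (Suc n)) (\<phi> n) (J n)"
  shows "(\<forall>n. \<forall>a\<in>carrier (A n). \<forall>\<xi>\<in>carrier (S n).
            I n (T n (\<Lambda> n a) \<xi>) = T (Suc n) (\<Lambda> (Suc n) (\<phi> n a)) (J n \<xi>)) \<and>
         inductive_system A H \<pi> D \<phi> I"
proof -
  have cm: "fin_dim (S n)" "carrier (S n) \<noteq> {\<zero>\<^bsub>S n\<^esub>}" "isometry_op (S n) (S (Suc n)) (J n)"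
    "\<And>x. x \<in> carrier_vec (m n) \<Longrightarrow> selfadjoint_end (S n) (F n x)"
    "\<And>R. 0 < R \<Longrightarrow> fin_dim (direct_sum_copies
        {x \<in> carrier_vec (m n). spec_end (S n) (F n x) \<inter> complex_of_real ` {- R..R} \<noteq> {}} (S n))"
    "\<And>a. a \<in> carrier_vec (m n) \<Longrightarrow> \<exists>C. \<forall>x\<in>carrier_vec (m n). \<forall>v\<in>carrier (S n).
        hnorm (S n) (F n (x + a) v \<ominus>\<^bsub>S n\<^esub> F n x v) \<le> C * hnorm (S n) v"
    "\<And>x v. x \<in> carrier_vec (m n) \<Longrightarrow> v \<in> carrier (S n) \<Longrightarrow>
        F (Suc n) (mult_mat_vec (M n) x) (J n v) = J n (F n x v)" for n
    using assms(7) unfolding compatible_multipliers_def by blast+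
  have cstar: "cstar_algebra (A n)" for n using assms(4)[of n] by (simp add: nc_torus_def)
  have triple: "multiplier_triple (A n) (\<tau> n) (L n) (\<Lambda> n) (m n) (\<Theta> n) (U n) (S n) (H n) (T n) (F n)" for n
    by unfold_locales (use assms cm cstar in auto)
  have pair: "toric_morphism (A n) (\<tau> n) (L n) (\<Lambda> n) (m n) (\<Theta> n) (U n) (S n) (H n) (T n) (F n)
      (A (Suc n)) (\<tau> (Suc n)) (L (Suc n)) (\<Lambda> (Suc n)) (m (Suc n)) (\<Theta> (Suc n)) (U (Suc n))
      (S (Suc n)) (H (Suc n)) (T (Suc n)) (F (Suc n)) (M n) (z n) (\<phi> n) (J n)" for n
    using triple[of n] triple[of "Suc n"] assms(6) cm
    by (intro toric_morphism.intro toric_morphism_axioms.intro)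
  show ?thesis
    unfolding inductive_system_def
  proof (intro conjI allI ballI)
    fix n
    show "spectral_triple (A n) (H n) (\<pi> n) (D n)"
      unfolding assms(10,11) by (rule multiplier_triple.spectral_triple[OF triple])
    show "isometric_morphism (A n) (H n) (\<pi> n) (D n) (A (Suc n)) (H (Suc n)) (\<pi> (Suc n)) (D (Suc n)) (\<phi> n) (I n)"
      using toric_morphism.isometric_morphism[OF pair] assms(12) unfolding assms(10,11,13) by blast
    show "I n (T n (\<Lambda> n a) \<xi>) = T (Suc n) (\<Lambda> (Suc n) (\<phi> n a)) (J n \<xi>)"
      if "a \<in> carrier (A n)" "\<xi> \<in> carrier (S n)" for a \<xi>
      unfolding assms(13) by (rule toric_morphism.induced_T[OF pair that])
  qed
qed

end
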